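(* Let $\alpha\in\mathbb{R}\setminus\pi\mathbb{Z}$. There exists a constant $C_1$ such that for every $1<p<\infty$ and every $f\in L^p(\mathbb{R})$, $$\frac{1}{C_1\bigl(p+(p-1)^{-1}\bigr)^2}\|f\|_{L^p(\mathbb{R})}\le\left\|\Bigl(\sum_{j\in\mathbb{Z}}|\Delta_j^{\#,\alpha}f|^2\Bigr)^{1/2}\right\|_{L^p(\mathbb{R})}\le C_1\bigl(p+(p-1)^{-1}\bigr)^2\|f\|_{L^p(\mathbb{R})}.$$
   Context: $\widehat f$ is the Fourier transform $\widehat f(\xi)=\int_{\mathbb{R}}e^{-2\pi ix\xi}f(x)\,dx$ and $\vee$ its inverse. $M_\alpha f(x)=e^{i\pi x^2\cot\alpha}f(x)$, and $M_\alpha^{-1}$ is multiplication by $e^{-i\pi x^2\cot\alpha}$. For $j\in\mathbb{Z}$ let $I_j=[2^j,2^{j+1})\cup(-2^{j+1},-2^j]$, $\Delta_j^{\#}f=(\widehat f\,\chi_{I_j})^\vee$ (extended to a bounded operator on $L^p(\mathbb{R})$), and $\Delta_j^{\#,\alpha}:=M_\alpha^{-1}\Delta_j^{\#}M_\alpha$. *)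

theory Defs
  imports "HOL-Analysis.Analysis"
begin

text \<open>
  Powers with a positive exponent on \<^typ>\<open>ennreal\<close>; only used with \<open>r > 0\<close>, where
  \<open>\<infinity>\<^sup>r = \<infinity>\<close> and \<open>0\<^sup>r = 0\<close>.
\<close>

definition ennpowr :: "ennreal \<Rightarrow> real \<Rightarrow> ennreal" where
  "ennpowr x r = (if x = top then top else ennreal (enn2real x powr r))"

text \<open>
  The norm takes an extended nonnegative function, so that it is also meaningful (possibly
  infinite) for a square function not yet known to be finite or integrable.
\<close>

definition Lp_norm :: "real \<Rightarrow> (real \<Rightarrow> ennreal) \<Rightarrow> ennreal" where
  "Lp_norm p F = ennpowr (\<integral>\<^sup>+x. ennpowr (F x) p \<partial>lebesgue) (1 / p)"

abbreviation cLp_norm :: "real \<Rightarrow> (real \<Rightarrow> complex) \<Rightarrow> ennreal" where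
  "cLp_norm p f \<equiv> Lp_norm p (\<lambda>x. ennreal (cmod (f x)))"

text \<open>Elements are functions, not classes; identities in \<open>L\<^sup>p\<close> are stated almost everywhere.\<close>

definition Lp :: "real \<Rightarrow> (real \<Rightarrow> complex) set" where
  "Lp p = {f \<in> borel_measurable lebesgue. cLp_norm p f < top}"

definition fourier :: "(real \<Rightarrow> complex) \<Rightarrow> real \<Rightarrow> complex" where
  "fourier f \<xi> = (\<integral>x. exp (- 2 * of_real pi * \<i> * of_real (x * \<xi>)) * f x \<partial>lebesgue)"

definition inv_fourier :: "(real \<Rightarrow> complex) \<Rightarrow> real \<Rightarrow> complex" where
  "inv_fourier g x = (\<integral>\<xi>. exp (2 * of_real pi * \<i> * of_real (x * \<xi>)) * g \<xi> \<partial>lebesgue)"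

definition dyadic_shell :: "int \<Rightarrow> real set" where
  "dyadic_shell j = {2 powi j ..< 2 powi (j + 1)} \<union> {- (2 powi (j + 1)) <.. - (2 powi j)}"

text \<open>
  On \<open>L\<^sup>1\<close> both transforms below are absolutely convergent integrals, since the Fourier transform
  of an integrable function is bounded and the shells are bounded.
\<close>

definition sharp_block_L1 :: "int \<Rightarrow> (real \<Rightarrow> complex) \<Rightarrow> real \<Rightarrow> complex" where
  "sharp_block_L1 j f = inv_fourier (\<lambda>\<xi>. fourier f \<xi> * indicator (dyadic_shell j) \<xi>)"

text \<open>
  \<open>T\<close> is a bounded linear operator on \<open>L\<^sup>p\<close> that agrees with \<open>T0\<close> on the subspace
  \<open>L\<^sup>1 \<inter> L\<^sup>p\<close>. As this subspace is dense for \<open>1 \<le> p < \<infinity>\<close>, such a \<open>T\<close> is unique up to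
  almost everywhere equality of its values.
\<close>

definition is_Lp_extension ::
  "real \<Rightarrow> ((real \<Rightarrow> complex) \<Rightarrow> real \<Rightarrow> complex) \<Rightarrow> ((real \<Rightarrow> complex) \<Rightarrow> real \<Rightarrow> complex) \<Rightarrow> bool" where
  "is_Lp_extension p T0 T \<longleftrightarrow>
     (\<forall>f\<in>Lp p. T f \<in> Lp p) \<and>
     (\<forall>f\<in>Lp p. \<forall>g\<in>Lp p. AE x in lebesgue. T (\<lambda>y. f y + g y) x = T f x + T g x) \<and>
     (\<forall>c. \<forall>f\<in>Lp p. AE x in lebesgue. T (\<lambda>y. c * f y) x = c * T f x) \<and>
     (\<exists>B\<ge>0. \<forall>f\<in>Lp p. cLp_norm p (T f) \<le> ennreal B * cLp_norm p f) \<and>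
     (\<forall>f\<in>Lp 1 \<inter> Lp p. AE x in lebesgue. T f x = T0 f x)"

definition sharp_block :: "real \<Rightarrow> int \<Rightarrow> (real \<Rightarrow> complex) \<Rightarrow> real \<Rightarrow> complex" where
  "sharp_block p j = (SOME T. is_Lp_extension p (sharp_block_L1 j) T)"

definition chirp_mult :: "real \<Rightarrow> (real \<Rightarrow> complex) \<Rightarrow> real \<Rightarrow> complex" where
  "chirp_mult \<alpha> f x = exp (\<i> * of_real (pi * x\<^sup>2 * cot \<alpha>)) * f x"

definition chirp_mult_inv :: "real \<Rightarrow> (real \<Rightarrow> complex) \<Rightarrow> real \<Rightarrow> complex" where
  "chirp_mult_inv \<alpha> f x = exp (- \<i> * of_real (pi * x\<^sup>2 * cot \<alpha>)) * f x"

definition frac_sharp_block ::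
  "real \<Rightarrow> real \<Rightarrow> int \<Rightarrow> (real \<Rightarrow> complex) \<Rightarrow> real \<Rightarrow> complex" where
  "frac_sharp_block p \<alpha> j f = chirp_mult_inv \<alpha> (sharp_block p j (chirp_mult \<alpha> f))"

definition frac_square_function :: "real \<Rightarrow> real \<Rightarrow> (real \<Rightarrow> complex) \<Rightarrow> real \<Rightarrow> ennreal" where
  "frac_square_function p \<alpha> f x =
     ennpowr (\<Sum>\<^sub>\<infinity>j\<in>(UNIV :: int set). ennreal ((cmod (frac_sharp_block p \<alpha> j f x))\<^sup>2)) (1 / 2)"

end

theory Submission
  imports Defs "HOL-Complex_Analysis.Complex_Analysis" "HOL-Probability.Probability"
begin

text \<open>
  The chirp is unimodular, so the estimate is the one for the sharp dyadic blocks \<open>\<Delta>\<^sub>j\<close> themselves, which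
  on \<open>L\<^sup>p\<close> are convolutions with kernels that lie in every \<open>L\<^sup>q\<close>, \<open>q > 1\<close>. Write \<open>\<kappa> = p + 1 / (p - 1)\<close>; this
  quantity is the same for \<open>p\<close> and for the dual exponent.

  Upper bound. A smooth square function built from differences of Gaussian averages at dyadic scales costs
  one factor \<open>\<kappa>\<close>. The averages form a chain of Markov kernels, and the bilinear form
  \<open>\<Sum>\<^sub>k \<epsilon>\<^sub>k (\<langle>f\<^sub>k, g\<^sub>k\<rangle> - \<langle>f\<^sub>k\<^sub>+\<^sub>1, g\<^sub>k\<^sub>+\<^sub>1\<rangle>)\<close> is estimated with Burkholder's zigzag-concave function; Khintchine's
  inequality then removes the signs. The second factor \<open>\<kappa>\<close> comes from the vector-valued Cauchy transform: for
  \<open>1 < p \<le> 2\<close> and \<open>g \<ge> 0\<close> the Cauchy integral \<open>F\<close> of \<open>g\<close> has values in the right half-plane, \<open>\<integral> F\<^sup>p = 0\<close>, and a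
  pointwise inequality of Pichorides type bounds \<open>|F|\<^sup>p\<close>. Khintchine's inequality gives the \<open>\<ell>\<^sup>2\<close>-valued version and
  duality gives \<open>p \<ge> 2\<close>. A sharp cut-off to \<open>[a, b)\<close> is a difference of two modulated Cauchy transforms, and on a
  dyadic shell the reciprocal of the smooth multiplier is a superposition of sharp cut-offs.

  Lower bound. By Plancherel \<open>\<langle>f, g\<rangle> = \<Sum>\<^sub>j \<langle>\<Delta>\<^sub>j f, \<Delta>\<^sub>j g\<rangle>\<close>, so the upper bound for the dual exponent applies to \<open>g\<close>.

  All bilinear estimates are kept in the form \<open>|B(f, g)| \<le> A\<^sup>p \<parallel>f\<parallel>\<^sup>p / p + \<parallel>g\<parallel>\<^sup>q / q\<close>, which is stable under duality
  without taking roots.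
\<close>


section \<open>Bounded functions of bounded support and norming\<close>

text \<open>The exponent 2 shapes the argument: exactly two estimates may cost a factor \<kappa>,
  and everything else must be uniform in p. Khintchine's inequality is only partly uniform: its
  lower half has the constant 2 for all p >= 1, its upper half is free for p <= 2 and grows with p
  afterwards, so large exponents are reached by duality. Replacing the smooth multiplier by the
  sharp one costs a fixed constant, because the reciprocal is one function of \<xi> / 2^j, of
  bounded variation on [1, 2]. The band edges vary with j, but enter only as unimodular modulations,
  which an l^2-valued bound does not see. For Gaussian averages, symmetry and the semigroup law turn
  a difference of inner products along the chain into one pairing of g with a difference of averages
  of f. The quantitative work is done on bounded functions of bounded support, where the pairings
  converge absolutely; the shell kernels decay only like 1/|x|, so general f are reached by
  truncation and Fatou's lemma. The operators of the statement are chosen extensions of an L^1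
  formula, and uniqueness identifies them with the convolutions.\<close>

definition bsupp :: "(real \<Rightarrow> 'a::real_normed_vector) \<Rightarrow> bool" where
  "bsupp f \<longleftrightarrow> f \<in> borel_measurable borel \<and> (\<exists>M R. \<forall>x. norm (f x) \<le> M \<and> (R < \<bar>x\<bar> \<longrightarrow> f x = 0))"

text \<open>The p-th power of the L^p norm, kept without its root so that it matches bilinear bounds
  in Young form. The \<open>ennreal\<close> version makes sense before any integrability is known;
  \<open>pmass_real\<close> is used on \<open>bsupp\<close> functions, where the two agree.\<close>

definition pmass :: "real \<Rightarrow> (real \<Rightarrow> real) \<Rightarrow> ennreal" where
  "pmass p f = (\<integral>\<^sup>+x. ennreal (\<bar>f x\<bar> powr p) \<partial>lborel)"

definition pmass_real :: "real \<Rightarrow> (real \<Rightarrow> real) \<Rightarrow> real" where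
  "pmass_real p f = (\<integral>x. \<bar>f x\<bar> powr p \<partial>lborel)"

lemma bsuppI:
  "f \<in> borel_measurable borel \<Longrightarrow> (\<And>x. norm (f x) \<le> M) \<Longrightarrow> (\<And>x. R < \<bar>x\<bar> \<Longrightarrow> f x = 0) \<Longrightarrow> bsupp f"
  unfolding bsupp_def by blast

lemma bsuppE:
  assumes "bsupp f"
  obtains M R where "M \<ge> 0" "R \<ge> 0" "\<And>x. norm (f x) \<le> M" "\<And>x. R < \<bar>x\<bar> \<Longrightarrow> f x = 0"
proof -
  from assms obtain M R where MR: "\<And>x. norm (f x) \<le> M \<and> (R < \<bar>x\<bar> \<longrightarrow> f x = 0)"
    unfolding bsupp_def by blast
  have "M \<ge> 0" using MR[of 0] norm_ge_zero[of "f 0"] by linarith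
  then show ?thesis using MR by (intro that[of M "max R 0"]) auto
qed

lemma bsupp_measurable [measurable_dest]: "bsupp f \<Longrightarrow> f \<in> borel_measurable borel"
  unfolding bsupp_def by blast

lemma bsupp_integrable:
  fixes f :: "real \<Rightarrow> 'a::{banach, second_countable_topology}"
  assumes "bsupp f"
  shows "integrable lborel f"
proof -
  obtain M R where MR: "M \<ge> 0" "R \<ge> 0" "\<And>x. norm (f x) \<le> M" "\<And>x. R < \<bar>x\<bar> \<Longrightarrow> f x = 0"
    using bsuppE[OF assms] by blast
  have [measurable]: "f \<in> borel_measurable borel" using assms by (rule bsupp_measurable)
  show ?thesis
  proof (rule Bochner_Integration.integrable_bound)
    show "integrable lborel (\<lambda>x. M * indicator {-R..R} x)"
      by (intro integrable_mult_right integrable_real_indicator) (auto simp: emeasure_lborel_Icc_eq)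
    show "AE x in lborel. norm (f x) \<le> norm (M * indicator {-R..R} x)"
      using MR by (intro AE_I2) (auto simp: indicator_def abs_real_def split: if_splits)
  qed simp
qed

lemma bsupp_mult:
  fixes f g :: "real \<Rightarrow> 'a::{real_normed_algebra, second_countable_topology}"
  assumes "bsupp f" "g \<in> borel_measurable borel" "\<And>x. norm (g x) \<le> K"
  shows "bsupp (\<lambda>x. f x * g x)" "bsupp (\<lambda>x. g x * f x)"
proof -
  obtain M R where MR: "M \<ge> 0" "R \<ge> 0" "\<And>x. norm (f x) \<le> M" "\<And>x. R < \<bar>x\<bar> \<Longrightarrow> f x = 0"
    using bsuppE[OF assms(1)] by blast
  have [measurable]: "f \<in> borel_measurable borel" "g \<in> borel_measurable borel"
    using assms bsupp_measurable by auto
  have K: "K \<ge> 0" using assms(3)[of 0] norm_ge_zero order_trans by blast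
  have 1: "norm (f x * g x) \<le> M * K" for x
    using norm_mult_ineq[of "f x" "g x"] mult_mono[OF MR(3)[of x] assms(3)[of x] MR(1)] by simp
  have 2: "norm (g x * f x) \<le> K * M" for x
    using norm_mult_ineq[of "g x" "f x"] mult_mono[OF assms(3)[of x] MR(3)[of x] K] by simp
  show "bsupp (\<lambda>x. f x * g x)" by (rule bsuppI[of _ "M * K" R]) (use 1 MR in auto)
  show "bsupp (\<lambda>x. g x * f x)" by (rule bsuppI[of _ "K * M" R]) (use 2 MR in auto)
qed

lemma bsupp_add: 
  fixes f g :: "real \<Rightarrow> 'a::{real_normed_vector, second_countable_topology}"
  assumes "bsupp f" "bsupp g"
  shows "bsupp (\<lambda>x. f x + g x)"
proof -
  obtain M R where MR: "M \<ge> 0" "R \<ge> 0" "\<And>x. norm (f x) \<le> M" "\<And>x. R < \<bar>x\<bar> \<Longrightarrow> f x = 0"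
    using bsuppE[OF assms(1)] by blast
  obtain M' R' where MR': "M' \<ge> 0" "R' \<ge> 0" "\<And>x. norm (g x) \<le> M'" "\<And>x. R' < \<bar>x\<bar> \<Longrightarrow> g x = 0"
    using bsuppE[OF assms(2)] by blast
  have [measurable]: "f \<in> borel_measurable borel" "g \<in> borel_measurable borel"
    using assms bsupp_measurable by auto
  show ?thesis
    by (rule bsuppI[of _ "M + M'" "max R R'"]) 
       (use MR MR' in \<open>auto intro!: norm_triangle_mono\<close>)
qed

lemma bsupp_sum:
  fixes f :: "'i \<Rightarrow> real \<Rightarrow> 'a::{real_normed_vector, second_countable_topology}"
  assumes "\<And>j. j \<in> J \<Longrightarrow> bsupp (f j)"
  shows "bsupp (\<lambda>x. \<Sum>j\<in>J. f j x)"
  using assms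
proof (induction J rule: infinite_finite_induct)
  case (insert j J)
  then show ?case by (simp add: bsupp_add)
qed (auto intro!: bsuppI[of _ 0 0])

lemma bsupp_norm_powr:
  assumes "bsupp (f :: real \<Rightarrow> real)" "p > 0"
  shows "bsupp (\<lambda>x. \<bar>f x\<bar> powr p)"
proof -
  obtain M R where MR: "M \<ge> 0" "R \<ge> 0" "\<And>x. norm (f x) \<le> M" "\<And>x. R < \<bar>x\<bar> \<Longrightarrow> f x = 0"
    using bsuppE[OF assms(1)] by blast
  have [measurable]: "f \<in> borel_measurable borel" using assms bsupp_measurable by auto
  show ?thesis
    by (rule bsuppI[of _ "M powr p" R]) (use MR assms in \<open>auto intro!: powr_mono2\<close>)
qed

lemma pmass_pmass_real:
  assumes "bsupp f" "p > 0"
  shows "pmass p f = ennreal (pmass_real p f)"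
  unfolding pmass_def pmass_real_def
  by (rule nn_integral_eq_integral[OF bsupp_integrable[OF bsupp_norm_powr[OF assms]]]) simp

lemma pmass_real_nonneg: "pmass_real p f \<ge> 0"
  unfolding pmass_real_def by (rule Bochner_Integration.integral_nonneg) simp

lemma borel_measurable_L2_set [measurable]:
  assumes [measurable]: "\<And>j. j \<in> J \<Longrightarrow> F j \<in> borel_measurable M"
  shows "(\<lambda>x. L2_set (\<lambda>j. F j x) J) \<in> borel_measurable M"
  unfolding L2_set_def by measurable

lemma bsupp_L2:
  assumes "finite J" "\<And>j. j \<in> J \<Longrightarrow> bsupp (g j)"
  shows "bsupp (\<lambda>x. L2_set (\<lambda>j. cmod (g j x)) J)"
proof -
  have "bsupp (\<lambda>x. \<Sum>j\<in>J. cmod (g j x))"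
  proof (rule bsupp_sum)
    fix j assume "j \<in> J"
    with assms have j: "bsupp (g j)" by blast
    from bsuppE[OF j] obtain M R where MR: "\<And>x. cmod (g j x) \<le> M" "\<And>x. R < \<bar>x\<bar> \<Longrightarrow> g j x = 0"
      by metis
    have [measurable]: "g j \<in> borel_measurable borel" using j by (rule bsupp_measurable)
    show "bsupp (\<lambda>x. cmod (g j x))" by (rule bsuppI[of _ M R]) (use MR in auto)
  qed
  from bsuppE[OF this] obtain M R where MR: "\<And>x. norm (\<Sum>j\<in>J. cmod (g j x)) \<le> M" "\<And>x. R < \<bar>x\<bar> \<Longrightarrow> (\<Sum>j\<in>J. cmod (g j x)) = 0"
    by metis
  have [measurable]: "j \<in> J \<Longrightarrow> g j \<in> borel_measurable borel" for j using assms bsupp_measurable by auto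
  have le: "L2_set (\<lambda>j. cmod (g j x)) J \<le> (\<Sum>j\<in>J. cmod (g j x))" for x
    by (rule L2_set_le_sum) simp
  show ?thesis
  proof (rule bsuppI[of _ M R])
    show "norm (L2_set (\<lambda>j. cmod (g j x)) J) \<le> M" for x
      using le[of x] MR(1)[of x] by simp
    show "L2_set (\<lambda>j. cmod (g j x)) J = 0" if "R < \<bar>x\<bar>" for x
      using le[of x] MR(2)[OF that] L2_set_nonneg[of "\<lambda>j. cmod (g j x)" J] by linarith
  qed measurable
qed

lemma pmass_mono:
  assumes "p > 0" "\<And>x. \<bar>f x\<bar> \<le> \<bar>g x\<bar>"
  shows "pmass p f \<le> pmass p g"
  unfolding pmass_def using assms by (intro nn_integral_mono ennreal_leI powr_mono2) auto

lemma pmass_cmult: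
  assumes "p > 0" "f \<in> borel_measurable borel"
  shows "pmass p (\<lambda>x. c * f x) = ennreal (\<bar>c\<bar> powr p) * pmass p f"
  unfolding pmass_def using assms
  by (subst nn_integral_cmult[symmetric]) (auto simp: abs_mult powr_mult ennreal_mult)

lemma pmass_real_cmult:
  "pmass_real p (\<lambda>x. c * f x) = \<bar>c\<bar> powr p * pmass_real p f"
  unfolding pmass_real_def by (simp add: abs_mult powr_mult)

text \<open>A crude substitute for Minkowski's inequality, from |a + b| <= 2 max(|a|, |b|). The loss
  is harmless, since it becomes an absolute factor after the p-th root.\<close>

lemma pmass_add:
  assumes "p \<ge> 1" and [measurable]: "f \<in> borel_measurable borel" "g \<in> borel_measurable borel"
  shows "pmass p (\<lambda>x. f x + g x) \<le> ennreal (2 powr p) * (pmass p f + pmass p g)"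
proof -
  have "\<bar>a + b\<bar> powr p \<le> 2 powr p * (\<bar>a\<bar> powr p + \<bar>b\<bar> powr p)" for a b :: real
  proof -
    have "\<bar>a + b\<bar> powr p \<le> (2 * max \<bar>a\<bar> \<bar>b\<bar>) powr p"
      using assms by (intro powr_mono2) auto
    also have "\<dots> = 2 powr p * (max \<bar>a\<bar> \<bar>b\<bar>) powr p" by (simp add: powr_mult)
    also have "\<dots> \<le> 2 powr p * (\<bar>a\<bar> powr p + \<bar>b\<bar> powr p)"
      by (intro mult_left_mono) (auto simp: max_def)
    finally show ?thesis .
  qed
  then have "pmass p (\<lambda>x. f x + g x) \<le> (\<integral>\<^sup>+x. ennreal (2 powr p) * (ennreal (\<bar>f x\<bar> powr p) + ennreal (\<bar>g x\<bar> powr p)) \<partial>lborel)"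
    unfolding pmass_def by (intro nn_integral_mono) (simp flip: ennreal_mult ennreal_plus)
  also have "\<dots> = ennreal (2 powr p) * (pmass p f + pmass p g)"
    unfolding pmass_def by (simp add: nn_integral_cmult nn_integral_add)
  finally show ?thesis .
qed

text \<open>Testing against \<open>F |F|\<^sup>p\<^sup>-\<^sup>2\<close>, cut off to a bounded set, turns a bilinear estimate in the form of
  Young's inequality into an \<open>L\<^sup>p\<close> bound; the exponents absorb without any homogenization.\<close>

lemma norming:
  fixes F :: "'i \<Rightarrow> real \<Rightarrow> complex"
  assumes J: "finite J" and p: "p > 1" "q > 1" "1/p + 1/q = 1"
    and meas: "\<And>j. j \<in> J \<Longrightarrow> F j \<in> borel_measurable borel"
    and H: "\<And>g. (\<And>j. j \<in> J \<Longrightarrow> bsupp (g j)) \<Longrightarrow>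
       Re (\<Sum>j\<in>J. \<integral>x. F j x * cnj (g j x) \<partial>lborel) \<le> a / p + pmass_real q (\<lambda>x. L2_set (\<lambda>j. cmod (g j x)) J) / q"
  shows "pmass p (\<lambda>x. L2_set (\<lambda>j. cmod (F j x)) J) \<le> ennreal a"
proof -
  define N where "N x = L2_set (\<lambda>j. cmod (F j x)) J" for x
  have N0: "N x \<ge> 0" for x unfolding N_def by simp
  have [measurable]: "j \<in> J \<Longrightarrow> F j \<in> borel_measurable borel" for j using meas by auto
  have Nm [measurable]: "N \<in> borel_measurable borel" unfolding N_def by measurable
  \<comment> \<open>Cutting off both position and size makes the test functions bounded with bounded
    support and keeps the quantity to be absorbed finite.\<close>
  define E where "E n = {x. \<bar>x\<bar> \<le> real n \<and> N x \<le> real n}" for n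
  have [measurable]: "E n \<in> sets borel" for n unfolding E_def by measurable
  have FN: "cmod (F j x) \<le> N x" if "j \<in> J" for j x
    unfolding N_def using member_le_L2_set[OF J that, of "\<lambda>j. cmod (F j x)"] by simp
  have bound: "(\<integral>x. indicator (E n) x * N x powr p \<partial>lborel) \<le> a" for n
  proof -
    \<comment> \<open>\<open>w\<close> is the power p - 2 of \<open>N\<close> on the cut-off set.
      For p < 2 the exponent is negative; since \<open>0 powr r = 0\<close>, the weight vanishes at
      the zeros of \<open>N\<close>.\<close>
    define w where "w x = indicator (E n) x * N x powr (p - 2)" for x
    have w0: "w x \<ge> 0" for x unfolding w_def by simp
    have [measurable]: "w \<in> borel_measurable borel" unfolding w_def by measurable
    define g where "g j x = of_real (w x) * F j x" for j x
    have wN: "w x * N x = indicator (E n) x * N x powr (p - 1)" for x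
    proof (cases "N x = 0")
      case False
      then have "N x powr (p - 2) * N x powr 1 = N x powr (p - 1)" using N0[of x]
        by (subst powr_add[symmetric]) simp
      then show ?thesis using N0[of x] by (simp add: w_def)
    qed (use p in simp)
    have wNN: "w x * (N x)\<^sup>2 = indicator (E n) x * N x powr p" for x
    proof (cases "N x = 0")
      case False
      then have "N x powr (p - 1) * N x powr 1 = N x powr p" using N0[of x]
        by (subst powr_add[symmetric]) simp
      moreover have "w x * (N x)\<^sup>2 = (w x * N x) * N x" by (simp add: power2_eq_square)
      ultimately show ?thesis using N0[of x] wN by simp
    qed (use p in simp)
    have wNb: "w x * N x \<le> real n powr (p - 1)" for x
      unfolding wN using p N0[of x] by (auto simp: E_def indicator_def intro!: powr_mono2)
    have gb: "bsupp (g j)" if "j \<in> J" for j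
    proof (rule bsuppI[of _ "real n powr (p - 1)" "real n"])
      show "g j \<in> borel_measurable borel" unfolding g_def using that by measurable
      show "norm (g j x) \<le> real n powr (p - 1)" for x
      proof -
        have "norm (g j x) = w x * cmod (F j x)" unfolding g_def using w0[of x] by (simp add: norm_mult)
        also have "\<dots> \<le> w x * N x" using FN[OF that] w0[of x] by (intro mult_left_mono) auto
        finally show ?thesis using wNb[of x] by simp
      qed
      show "g j x = 0" if "real n < \<bar>x\<bar>" for x
        using that by (simp add: g_def w_def E_def)
    qed
    have L2g: "L2_set (\<lambda>j. cmod (g j x)) J = w x * N x" for x
      unfolding g_def N_def norm_mult norm_of_real abs_of_nonneg[OF w0] 
      by (rule L2_set_right_distrib[symmetric]) (rule w0)
    have Fg: "F j x * cnj (g j x) = of_real (w x * (cmod (F j x))\<^sup>2)" for j x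
      unfolding g_def by (simp add: complex_norm_square[symmetric] mult.left_commute flip: of_real_power)
    have int1: "integrable lborel (\<lambda>x. w x * (cmod (F j x))\<^sup>2)" if j: "j \<in> J" for j
    proof (rule bsupp_integrable, rule bsuppI[of _ "real n powr (p - 1) * real n" "real n"])
      show "(\<lambda>x. w x * (cmod (F j x))\<^sup>2) \<in> borel_measurable borel" using j by measurable
      show "norm (w x * (cmod (F j x))\<^sup>2) \<le> real n powr (p - 1) * real n" for x
      proof (cases "x \<in> E n")
        case True
        have "norm (w x * (cmod (F j x))\<^sup>2) = w x * (cmod (F j x))\<^sup>2" using w0[of x] by simp
        also have "\<dots> \<le> w x * (N x)\<^sup>2" using FN[OF j] w0[of x] by (intro mult_left_mono power_mono) auto
        also have "\<dots> = (w x * N x) * N x" by (simp add: power2_eq_square)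
        also have "\<dots> \<le> real n powr (p - 1) * real n" using wNb[of x] True N0[of x] 
          by (intro mult_mono) (auto simp: E_def)
        finally show ?thesis .
      qed (simp add: w_def)
      show "w x * (cmod (F j x))\<^sup>2 = 0" if "real n < \<bar>x\<bar>" for x
        using that by (simp add: w_def E_def)
    qed
    have "(\<Sum>j\<in>J. \<integral>x. F j x * cnj (g j x) \<partial>lborel) = (\<Sum>j\<in>J. of_real (\<integral>x. w x * (cmod (F j x))\<^sup>2 \<partial>lborel))"
      unfolding Fg integral_complex_of_real ..
    also have "\<dots> = of_real (\<integral>x. (\<Sum>j\<in>J. w x * (cmod (F j x))\<^sup>2) \<partial>lborel)"
      by (subst Bochner_Integration.integral_sum) (auto intro: int1)
    also have "(\<lambda>x. \<Sum>j\<in>J. w x * (cmod (F j x))\<^sup>2) = (\<lambda>x. indicator (E n) x * N x powr p)"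
    proof
      fix x
      have "(N x)\<^sup>2 = (\<Sum>j\<in>J. (cmod (F j x))\<^sup>2)"
        unfolding N_def L2_set_def by (simp add: sum_nonneg)
      then show "(\<Sum>j\<in>J. w x * (cmod (F j x))\<^sup>2) = indicator (E n) x * N x powr p"
        by (simp add: wNN[symmetric] sum_distrib_left)
    qed
    finally have eq: "Re (\<Sum>j\<in>J. \<integral>x. F j x * cnj (g j x) \<partial>lborel) = (\<integral>x. indicator (E n) x * N x powr p \<partial>lborel)"
      by simp
    \<comment> \<open>This identity makes the dual mass of the test function equal to the pairing
      itself, so the term divided by q moves to the left and leaves the factor 1 - 1/q =
      1/p.\<close>
    have pq: "(p - 1) * q = p" using p by (simp add: field_simps)
    have "pmass_real q (\<lambda>x. L2_set (\<lambda>j. cmod (g j x)) J) = (\<integral>x. indicator (E n) x * N x powr p \<partial>lborel)"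
      unfolding pmass_real_def L2g wN 
      by (rule Bochner_Integration.integral_cong) (auto simp: indicator_def powr_powr pq)
    with H[of g, OF gb] eq have "(\<integral>x. indicator (E n) x * N x powr p \<partial>lborel) * (1 - 1/q) \<le> a / p"
      by (simp add: algebra_simps)
    moreover have "1 - 1/q = 1/p" using p by linarith
    ultimately have "(\<integral>x. indicator (E n) x * N x powr p \<partial>lborel) / p \<le> a / p" by simp
    then show ?thesis using p by (simp add: divide_le_cancel)
  qed
  have "pmass p N = (\<integral>\<^sup>+x. (SUP n. ennreal (indicator (E n) x * N x powr p)) \<partial>lborel)"
    unfolding pmass_def
  proof (intro nn_integral_cong)
    fix x
    obtain m :: nat where m: "max \<bar>x\<bar> (N x) \<le> real m" using real_arch_simple by blast
    have "ennreal (\<bar>N x\<bar> powr p) = ennreal (indicator (E m) x * N x powr p)" using m N0[of x] by (simp add: E_def)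
    also have "\<dots> \<le> (SUP n. ennreal (indicator (E n) x * N x powr p))" by (rule SUP_upper) simp
    finally have "ennreal (\<bar>N x\<bar> powr p) \<le> (SUP n. ennreal (indicator (E n) x * N x powr p))" .
    moreover have "(SUP n. ennreal (indicator (E n) x * N x powr p)) \<le> ennreal (\<bar>N x\<bar> powr p)"
      using N0[of x] by (intro SUP_least ennreal_leI) (auto simp: indicator_def)
    ultimately show "ennreal (\<bar>N x\<bar> powr p) = (SUP n. ennreal (indicator (E n) x * N x powr p))" by (rule antisym)
  qed
  also have "\<dots> = (SUP n. \<integral>\<^sup>+x. ennreal (indicator (E n) x * N x powr p) \<partial>lborel)"
  proof (rule nn_integral_monotone_convergence_SUP)
    show "incseq (\<lambda>n x. ennreal (indicator (E n) x * N x powr p))"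
      by (intro incseq_SucI le_funI ennreal_leI) (auto simp: indicator_def E_def)
  qed measurable
  also have "\<dots> \<le> ennreal a"
  proof (rule SUP_least)
    fix n
    have "bsupp (\<lambda>x. indicator (E n) x * N x powr p)"
      by (rule bsuppI[of _ "real n powr p" "real n"]) 
         (use N0 p in \<open>auto simp: E_def indicator_def intro!: powr_mono2\<close>)
    then have "(\<integral>\<^sup>+x. ennreal (indicator (E n) x * N x powr p) \<partial>lborel) = ennreal (\<integral>x. indicator (E n) x * N x powr p \<partial>lborel)"
      by (intro nn_integral_eq_integral bsupp_integrable) auto
    then show "(\<integral>\<^sup>+x. ennreal (indicator (E n) x * N x powr p) \<partial>lborel) \<le> ennreal a"
      using bound[of n] by (simp add: ennreal_leI)
  qed
  finally show ?thesis unfolding N_def .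
qed

section \<open>Khintchine's inequality\<close>

text \<open>A choice of signs is encoded by the set of indices with sign +1, so that the expectation
  over independent fair signs is a finite average over \<open>Pow J\<close>.\<close>

definition sgnset :: "'i set \<Rightarrow> 'i \<Rightarrow> real" where
  "sgnset A j = (if j \<in> A then 1 else - 1)"

definition signavg :: "'i set \<Rightarrow> ('i set \<Rightarrow> real) \<Rightarrow> real" where
  "signavg J X = (\<Sum>A\<in>Pow J. X A) / 2 ^ card J"

lemma sum_Pow_insert:
  assumes "finite J" "j \<notin> J"
  shows "(\<Sum>A\<in>Pow (insert j J). X A) = (\<Sum>A\<in>Pow J. X A + X (insert j A))"
proof -
  have inj: "inj_on (insert j) (Pow J)" using assms by (auto simp: inj_on_def)
  have "(\<Sum>A\<in>Pow (insert j J). X A) = (\<Sum>A\<in>Pow J. X A) + (\<Sum>A\<in>insert j ` Pow J. X A)"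
    unfolding Pow_insert using assms by (intro sum.union_disjoint) auto
  also have "(\<Sum>A\<in>insert j ` Pow J. X A) = (\<Sum>A\<in>Pow J. X (insert j A))"
    using inj by (simp add: sum.reindex)
  finally show ?thesis by (simp add: sum.distrib)
qed

definition rsum :: "'i set \<Rightarrow> ('i \<Rightarrow> complex) \<Rightarrow> 'i set \<Rightarrow> complex" where
  "rsum J a A = (\<Sum>j\<in>J. of_real (sgnset A j) * a j)"

lemma rsum_insert:
  assumes "finite J" "j \<notin> J" "A \<subseteq> J"
  shows "rsum (insert j J) a A = rsum J a A - a j" "rsum (insert j J) a (insert j A) = rsum J a A + a j"
proof -
  have "j \<notin> A" using assms by blast
  then show "rsum (insert j J) a A = rsum J a A - a j"
    using assms by (simp add: rsum_def sgnset_def)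
  have "(\<Sum>i\<in>J. of_real (sgnset (insert j A) i) * a i) = (\<Sum>i\<in>J. of_real (sgnset A i) * a i)"
    using assms by (intro sum.cong) (auto simp: sgnset_def)
  then show "rsum (insert j J) a (insert j A) = rsum J a A + a j"
    using assms by (simp add: rsum_def sgnset_def)
qed

lemma signavg_mono:
  "finite J \<Longrightarrow> (\<And>A. A \<subseteq> J \<Longrightarrow> X A \<le> Y A) \<Longrightarrow> signavg J X \<le> signavg J Y"
  unfolding signavg_def by (intro divide_right_mono sum_mono) auto

lemma signavg_affine:
  assumes "finite J"
  shows "signavg J (\<lambda>A. a + b * X A) = a + b * signavg J X"
  unfolding signavg_def using assms
  by (simp add: sum.distrib card_Pow sum_distrib_left[symmetric] add_divide_distrib)

lemma signavg_add: "signavg J (\<lambda>A. X A + Y A) = signavg J X + signavg J Y"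
  unfolding signavg_def by (simp add: sum.distrib add_divide_distrib)

lemma signavg_insert:
  assumes "finite J" "j \<notin> J"
  shows "signavg (insert j J) X = signavg J (\<lambda>A. (X A + X (insert j A)) / 2)"
  unfolding signavg_def sum_Pow_insert[OF assms] using assms
  by (simp add: sum_divide_distrib[symmetric])

text \<open>Orthogonality of the signs; in the induction, averaging over one sign is the
  parallelogram law.\<close>

lemma signavg_rsum2:
  assumes "finite J"
  shows "signavg J (\<lambda>A. (cmod (rsum J a A))\<^sup>2) = (\<Sum>j\<in>J. (cmod (a j))\<^sup>2)"
  using assms
proof (induction J)
  case empty
  then show ?case by (simp add: signavg_def rsum_def)
next
  case (insert j J)
  have id: "((cmod (u - v))\<^sup>2 + (cmod (u + v))\<^sup>2) / 2 = (cmod v)\<^sup>2 + 1 * (cmod u)\<^sup>2" for u v :: complex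
    by (simp only: cmod_power2 minus_complex.sel plus_complex.sel) (simp add: power2_eq_square algebra_simps)
  have "signavg (insert j J) (\<lambda>A. (cmod (rsum (insert j J) a A))\<^sup>2)
     = signavg J (\<lambda>A. (cmod (a j))\<^sup>2 + 1 * (cmod (rsum J a A))\<^sup>2)"
    unfolding signavg_insert[OF insert(1,2)]
    unfolding signavg_def by (intro arg_cong2[of _ _ _ _ "(/)"] sum.cong refl)
       (simp only: rsum_insert[OF insert(1,2)] Pow_iff id)
  then show ?case using insert by (simp only: signavg_affine[OF insert(1)]) simp
qed

text \<open>Averaging |u - v|^4 and |u + v|^4 leaves |u|^4 + 2 |u|^2 |v|^2 + |v|^4 + 4 (u . v)^2,
  and Cauchy-Schwarz bounds the last term by 4 |u|^2 |v|^2. The constant 3 closes the induction,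
  because t^2 + 6 s t + 3 s^2 <= 3 (s + t)^2.\<close>

lemma signavg_rsum4:
  assumes "finite J"
  shows "signavg J (\<lambda>A. (cmod (rsum J a A))^4) \<le> 3 * (\<Sum>j\<in>J. (cmod (a j))\<^sup>2)\<^sup>2"
  using assms
proof (induction J)
  case empty
  then show ?case by (simp add: signavg_def rsum_def)
next
  case (insert j J)
  have id: "((cmod (u - v))^4 + (cmod (u + v))^4) / 2 \<le> ((cmod v)^4 + (6 * (cmod v)\<^sup>2) * (cmod u)\<^sup>2) + (cmod u)^4" for u v :: complex
  proof -
    have 1: "(cmod (u - v))\<^sup>2 = (cmod u)\<^sup>2 + (cmod v)\<^sup>2 - 2 * (u \<bullet> v)"
            "(cmod (u + v))\<^sup>2 = (cmod u)\<^sup>2 + (cmod v)\<^sup>2 + 2 * (u \<bullet> v)"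
      by (simp_all add: power2_norm_eq_inner inner_add_left inner_add_right inner_diff_left inner_diff_right inner_commute)
    have 2: "(cmod (u - v))^4 = ((cmod u)\<^sup>2 + (cmod v)\<^sup>2 - 2 * (u \<bullet> v))\<^sup>2"
       "(cmod (u + v))^4 = ((cmod u)\<^sup>2 + (cmod v)\<^sup>2 + 2 * (u \<bullet> v))\<^sup>2"
      unfolding 1[symmetric] by simp_all
    have "(u \<bullet> v)\<^sup>2 \<le> (cmod u * cmod v)\<^sup>2"
      using Cauchy_Schwarz_ineq2[of u v] by (intro power2_le_iff_abs_le[THEN iffD2]) auto
    moreover have "((s + t - 2 * w)\<^sup>2 + (s + t + 2 * w)\<^sup>2) / 2 = s\<^sup>2 + t\<^sup>2 + 2 * s * t + 4 * w\<^sup>2" for s t w :: real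
      by (simp add: power2_eq_square algebra_simps)
    ultimately show ?thesis unfolding 2 by (simp add: power_mult_distrib mult.commute)
  qed
  let ?s = "\<Sum>j\<in>J. (cmod (a j))\<^sup>2"
  have "signavg (insert j J) (\<lambda>A. (cmod (rsum (insert j J) a A))^4)
     \<le> signavg J (\<lambda>A. ((cmod (a j))^4 + (6 * (cmod (a j))\<^sup>2) * (cmod (rsum J a A))\<^sup>2) + (cmod (rsum J a A))^4)"
    unfolding signavg_insert[OF insert(1,2)]
    by (intro signavg_mono insert(1)) (simp only: rsum_insert[OF insert(1,2)] id)
  also have "\<dots> = (cmod (a j))^4 + (6 * (cmod (a j))\<^sup>2) * ?s + signavg J (\<lambda>A. (cmod (rsum J a A))^4)"
    unfolding signavg_add[of J _ "\<lambda>A. (cmod (rsum J a A))^4"] signavg_affine[OF insert(1), of "(cmod (a j))^4"] signavg_rsum2[OF insert(1)] ..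
  also have "\<dots> \<le> (cmod (a j))^4 + (6 * (cmod (a j))\<^sup>2) * ?s + 3 * ?s\<^sup>2"
    using insert by simp
  also have "\<dots> \<le> 3 * ((cmod (a j))\<^sup>2 + ?s)\<^sup>2"
    by (simp add: power2_eq_square algebra_simps power4_eq_xxxx)
  finally show ?case using insert by simp
qed

text \<open>The tangent line of y^r at 1, obtained from the weighted arithmetic-geometric mean
  inequality; the concave case is the convex one for the exponent 1/r. Averaged, these lines take
  the place of Jensen's inequality below.\<close>

lemma Bernoulli_powr:
  fixes y r :: real
  assumes "y \<ge> 0"
  shows "r \<ge> 1 \<Longrightarrow> y powr r \<ge> 1 + r * (y - 1)"
    and "0 < r \<Longrightarrow> r \<le> 1 \<Longrightarrow> y powr r \<le> 1 + r * (y - 1)"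
proof -
  have ge: "y powr r \<ge> 1 + r * (y - 1)" if y: "y \<ge> 0" and r: "r \<ge> 1" for y r :: real
  proof -
    have "y powr 1 * 1 powr (1 - 1/r) = y" using y by simp
    have "(y powr r) powr (1/r) * 1 powr (1 - 1/r) \<le> (1/r) * y powr r + (1 - 1/r) * 1"
      using Youngs_inequality_0[of "1/r" "1 - 1/r" "y powr r" 1] r by (cases "y = 0") auto
    then have "y \<le> (1/r) * y powr r + (1 - 1/r)" using y r by (simp add: powr_powr)
    then have "r * y \<le> r * ((1/r) * y powr r + (1 - 1/r))" using r by (intro mult_left_mono) auto
    then have "r * y \<le> y powr r + (r - 1)" using r by (simp add: distrib_left right_diff_distrib)
    then show ?thesis by (simp add: algebra_simps)
  qed
  show "r \<ge> 1 \<Longrightarrow> y powr r \<ge> 1 + r * (y - 1)" using ge assms by blast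
  show "y powr r \<le> 1 + r * (y - 1)" if r: "0 < r" "r \<le> 1"
  proof -
    have "(y powr r) powr (1/r) \<ge> 1 + (1/r) * (y powr r - 1)" using ge[of "y powr r" "1/r"] r by simp
    then have "y \<ge> 1 + (1/r) * (y powr r - 1)" using assms r by (simp add: powr_powr)
    then show ?thesis using r by (simp add: field_simps)
  qed
qed

text \<open>Only the second and fourth moments enter: a polynomial minorant of y gives a first
  moment of at least s/2, and Bernoulli's inequality for 2X/s lifts this to the exponent p. The
  constant 2 is uniform in p, so this step does not add to the power of \<kappa>.\<close>

lemma Khintchine_lower:
  assumes J: "finite J" and p: "p \<ge> 1"
  shows "(L2_set (\<lambda>j. cmod (a j)) J) powr p \<le> 2 powr p * signavg J (\<lambda>A. cmod (rsum J a A) powr p)"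
proof -
  define s where "s = L2_set (\<lambda>j. cmod (a j)) J"
  have s0: "s \<ge> 0" unfolding s_def by simp
  have s2: "(\<Sum>j\<in>J. (cmod (a j))\<^sup>2) = s\<^sup>2" unfolding s_def L2_set_def by (simp add: sum_nonneg)
  show ?thesis
  proof (cases "s = 0")
    case True
    have "0 \<le> signavg J (\<lambda>A. cmod (rsum J a A) powr p)" unfolding signavg_def by (simp add: sum_nonneg)
    then show ?thesis using True p by (simp add: s_def[symmetric])
  next
    case False
    then have s: "s > 0" using s0 by simp
    define X where "X A = cmod (rsum J a A)" for A
    \<comment> \<open>Applied to y = X/s, whose second moment is 1 and whose fourth moment is at
      most 3, the right-hand side has mean at least 1 - 3/6 = 1/2.\<close>
    have key: "y \<ge> y\<^sup>2 - y^4 / 6" if "y \<ge> 0" for y :: real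
    proof -
      have "y^3 - 6 * y + 6 \<ge> 0"
      proof -
        have 1: "y^3 - 6 * y + 6 = (y - 3/2)\<^sup>2 * (y + 3) + (3/4) * (y - 1)"
          by (simp add: power2_eq_square power3_eq_cube field_simps)
        show ?thesis
        proof (cases "y \<ge> 1")
          case True
          then show ?thesis unfolding 1 by (intro add_nonneg_nonneg mult_nonneg_nonneg) auto
        next
          case False
          moreover have "y^3 \<ge> 0" using that by simp
          ultimately show ?thesis by linarith
        qed
      qed
      then have "y * (y^3 - 6 * y + 6) \<ge> 0" using that by simp
      then show ?thesis by (simp add: algebra_simps power2_eq_square power4_eq_xxxx power3_eq_cube)
    qed
    have "1/2 \<le> signavg J (\<lambda>A. (1/s\<^sup>2) * (X A)\<^sup>2 + (0 + (-1/(6 * s^4)) * (X A)^4))"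
    proof -
      have "signavg J (\<lambda>A. (1/s\<^sup>2) * (X A)\<^sup>2 + (0 + (-1/(6 * s^4)) * (X A)^4)) 
        = signavg J (\<lambda>A. 0 + (1/s\<^sup>2) * (X A)\<^sup>2) + signavg J (\<lambda>A. 0 + (-1/(6 * s^4)) * (X A)^4)"
        by (subst signavg_add[symmetric]) simp
      also have "\<dots> = 1 + (-1/(6 * s^4)) * signavg J (\<lambda>A. (X A)^4)"
        unfolding signavg_affine[OF J] X_def signavg_rsum2[OF J] s2 using s by simp
      also have "\<dots> \<ge> 1 + (-1/(6 * s^4)) * (3 * s^4)"
      proof (intro add_left_mono mult_left_mono_neg)
        show "signavg J (\<lambda>A. X A ^ 4) \<le> 3 * s ^ 4"
          using signavg_rsum4[OF J, of a] unfolding X_def s2 by simp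
      qed simp
      finally show ?thesis using s by simp
    qed
    also have "\<dots> \<le> signavg J (\<lambda>A. 0 + (1/s) * X A)"
    proof (intro signavg_mono J)
      fix A
      have "X A / s \<ge> (X A / s)\<^sup>2 - (X A / s)^4/6" by (rule key) (use s in \<open>simp add: X_def\<close>)
      then show "(1/s\<^sup>2) * (X A)\<^sup>2 + (0 + (-1/(6 * s^4)) * (X A)^4) \<le> 0 + (1/s) * X A"
        by (simp add: power_divide)
    qed
    finally have h: "1/2 \<le> signavg J X / s" unfolding signavg_affine[OF J] by simp
    have "1 \<le> (1 - p) + (2 * p / s) * signavg J X"
    proof -
      have "(2 * p / s) * signavg J X = (2 * p) * (signavg J X / s)" by simp
      also have "\<dots> \<ge> (2 * p) * (1/2)" using h p by (intro mult_left_mono) auto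
      finally show ?thesis by simp
    qed
    also have "\<dots> = signavg J (\<lambda>A. (1 - p) + (2 * p / s) * X A)" by (simp only: signavg_affine[OF J])
    also have "\<dots> \<le> signavg J (\<lambda>A. 0 + (2 powr p / s powr p) * (X A powr p))"
    proof (intro signavg_mono J)
      fix A
      have "(2 * X A / s) powr p \<ge> 1 + p * (2 * X A / s - 1)"
        by (rule Bernoulli_powr(1)) (use s p in \<open>auto simp: X_def\<close>)
      then show "1 - p + 2 * p / s * X A \<le> 0 + 2 powr p / s powr p * X A powr p"
        by (simp add: powr_mult powr_divide algebra_simps)
    qed
    also have "\<dots> = 2 powr p / s powr p * signavg J (\<lambda>A. X A powr p)"
      using signavg_affine[OF J, of 0] by (simp only: add_0)
    finally show ?thesis using s unfolding s_def[symmetric] X_def by (simp add: field_simps)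
  qed
qed

text \<open>Concavity of t^(p/2): the tangent line at t = 1 is evaluated at t = (X/s)^2, which has
  mean 1. This is why the direct argument for vector-valued bounds stops at p = 2.\<close>

lemma Khintchine_upper:
  assumes J: "finite J" and p: "0 < p" "p \<le> 2"
  shows "signavg J (\<lambda>A. cmod (rsum J a A) powr p) \<le> (L2_set (\<lambda>j. cmod (a j)) J) powr p"
proof -
  define s where "s = L2_set (\<lambda>j. cmod (a j)) J"
  have s0: "s \<ge> 0" unfolding s_def by simp
  have s2: "(\<Sum>j\<in>J. (cmod (a j))\<^sup>2) = s\<^sup>2" unfolding s_def L2_set_def by (simp add: sum_nonneg)
  show ?thesis
  proof (cases "s = 0")
    case True
    then have "\<And>j. j \<in> J \<Longrightarrow> a j = 0" unfolding s_def using J by (simp add: L2_set_eq_0_iff)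
    then have "rsum J a A = 0" for A unfolding rsum_def by simp
    then show ?thesis by (simp add: signavg_def)
  next
    case False
    then have s: "s > 0" using s0 by simp
    define X where "X A = cmod (rsum J a A)" for A
    have "signavg J (\<lambda>A. 0 + (1 / s powr p) * (X A powr p)) \<le> signavg J (\<lambda>A. (1 - p/2) + ((p/2) / s\<^sup>2) * (X A)\<^sup>2)"
    proof (intro signavg_mono J)
      fix A
      have "((X A / s)\<^sup>2) powr (p/2) \<le> 1 + (p/2) * ((X A / s)\<^sup>2 - 1)"
        by (rule Bernoulli_powr(2)) (use p in auto)
      moreover have "((X A / s)\<^sup>2) powr (p/2) = (X A / s) powr p"
      proof (cases "X A = 0")
        case False
        then have "X A / s > 0" using s by (simp add: X_def)
        then show ?thesis by (simp add: powr_powr flip: powr_numeral)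
      qed (use p in simp)
      ultimately show "0 + (1 / s powr p) * (X A powr p) \<le> (1 - p/2) + ((p/2) / s\<^sup>2) * (X A)\<^sup>2"
        using s by (simp add: powr_divide power_divide X_def algebra_simps)
    qed
    also have "\<dots> = 1" unfolding signavg_affine[OF J] X_def signavg_rsum2[OF J] s2 using s by simp
    finally have "(1 / s powr p) * signavg J (\<lambda>A. X A powr p) \<le> 1" unfolding signavg_affine[OF J] by simp
    then show ?thesis using s unfolding s_def[symmetric] X_def by (simp add: field_simps)
  qed
qed

section \<open>Burkholder's function\<close>

text \<open>Concavity of a function with finitely many kinks: the prescribed slopes are antitone
  everywhere but are derivatives only off \<open>S\<close>. Integrating the slope between s and t
  gives the supporting line.\<close>

lemma supporting_line_of_antimono_deriv:
  fixes \<phi> \<phi>' :: "real \<Rightarrow> real"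
  assumes S: "finite S" and cont: "continuous_on UNIV \<phi>"
    and der: "\<And>t. t \<notin> S \<Longrightarrow> (\<phi> has_real_derivative \<phi>' t) (at t)"
    and mono: "\<And>s t. s \<le> t \<Longrightarrow> \<phi>' t \<le> \<phi>' s"
  shows "\<phi> t \<le> \<phi> s + \<phi>' s * (t - s)"
proof -
  have ftc: "(\<phi>' has_integral (\<phi> b - \<phi> a)) {a..b}" if "a \<le> b" for a b
    by (rule fundamental_theorem_of_calculus_interior_strong[OF S that])
       (use der cont in \<open>auto simp: has_real_derivative_iff_has_vector_derivative[symmetric] intro: continuous_on_subset\<close>)
  have const: "((\<lambda>_. \<phi>' s) has_integral \<phi>' s * (b - a)) {a..b}" if "a \<le> b" for a b :: real
    using has_integral_const_real[of "\<phi>' s" a b] that by (simp add: mult.commute)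
  show ?thesis
  proof (cases "s \<le> t")
    case True
    have "\<phi> t - \<phi> s \<le> \<phi>' s * (t - s)"
      by (rule has_integral_le[OF ftc[OF True] const[OF True]]) (use mono in auto)
    then show ?thesis by simp
  next
    case False
    then have ts: "t \<le> s" by simp
    have "\<phi>' s * (s - t) \<le> \<phi> s - \<phi> t"
      by (rule has_integral_le[OF const[OF ts] ftc[OF ts]]) (use mono in auto)
    then show ?thesis by (simp add: algebra_simps)
  qed
qed

text \<open>Burkholder's function up to a normalising factor depending on p. Two properties are
  used: twice the function majorizes |y|^p - (5 (p - 1))^p |x|^p, and it is concave along lines of
  slope 1 and -1.\<close>

definition burkholder :: "real \<Rightarrow> real \<Rightarrow> real \<Rightarrow> real" where
  "burkholder p x y = (\<bar>y\<bar> - (p - 1) * \<bar>x\<bar>) * (\<bar>x\<bar> + \<bar>y\<bar>) powr (p - 1)"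

text \<open>Crude constants in place of the sharp ones. With c = p - 1: if |y| >= 2 c |x|, the first
  factor is at least |y| / 2 and twice the function alone dominates. Otherwise |y|^p is at most (2 c
  |x|)^p, minus twice the function is at most (3 c |x|)^p, and 2^p + 3^p <= 5^p.\<close>

lemma burkholder_majorizes:
  assumes "p \<ge> 2"
  shows "\<bar>y\<bar> powr p \<le> 2 * burkholder p x y + (5 * (p - 1)) powr p * \<bar>x\<bar> powr p"
proof -
  define c where "c = p - 1"
  have c: "c \<ge> 1" using assms by (simp add: c_def)
  define X Y where "X = \<bar>x\<bar>" and "Y = \<bar>y\<bar>"
  have XY: "X \<ge> 0" "Y \<ge> 0" by (auto simp: X_def Y_def)
  have pw: "z * z powr c = z powr p" if "z \<ge> 0" for z :: real
  proof (cases "z = 0")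
    case False
    then have "z powr 1 * z powr c = z powr p" unfolding powr_add[symmetric] by (simp add: c_def)
    then show ?thesis using that by simp
  qed (use assms in simp)
  have "Y powr p \<le> 2 * ((Y - c * X) * (X + Y) powr c) + (5 * c) powr p * X powr p"
  proof (cases "Y \<ge> 2 * c * X")
    case True
    then have "Y * Y powr c \<le> (2 * (Y - c * X)) * (X + Y) powr c"
      using XY c by (intro mult_mono powr_mono2) auto
    moreover have "(5 * c) powr p * X powr p \<ge> 0" by simp
    moreover have "(2 * (Y - c * X)) * (X + Y) powr c = 2 * ((Y - c * X) * (X + Y) powr c)" by (rule mult.assoc)
    ultimately show ?thesis using pw[OF XY(2)] by linarith
  next
    case False
    then have Y: "Y \<le> 2 * c * X" by simp
    have 1: "Y powr p \<le> (2 * c * X) powr p" using Y XY assms by (intro powr_mono2) auto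
    have Xc: "X \<le> c * X" using c XY by (simp add: mult_le_cancel_right1)
    have "- ((Y - c * X) * (X + Y) powr c) = (c * X - Y) * (X + Y) powr c" by (simp add: algebra_simps)
    also have "\<dots> \<le> (c * X) * (3 * c * X) powr c"
      using XY c Y Xc by (intro mult_mono powr_mono2) auto
    finally have "- (2 * ((Y - c * X) * (X + Y) powr c)) \<le> 2 * ((c * X) * (3 * c * X) powr c)" by linarith
    also have "\<dots> \<le> (3 * c * X) * (3 * c * X) powr c" using XY c by (simp add: mult_right_mono)
    also have "\<dots> = (3 * c * X) powr p" using XY c by (intro pw) auto
    finally have 2: "- (2 * ((Y - c * X) * (X + Y) powr c)) \<le> (3 * c * X) powr p" .
    have "2 powr p + 3 powr p \<le> (5::real) powr p"
    proof -
      have "(2::real) powr p + 3 powr p = 2 * 2 powr c + 3 * 3 powr c" using pw[of 2] pw[of 3] by simp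
      also have "\<dots> \<le> 2 * 5 powr c + 3 * 5 powr c" using c by (intro add_mono mult_left_mono powr_mono2) auto
      also have "\<dots> = 5 powr p" using pw[of 5] by simp
      finally show ?thesis .
    qed
    then have "(2 powr p + 3 powr p) * (c * X) powr p \<le> 5 powr p * (c * X) powr p" by (intro mult_right_mono) auto
    then have "(2 * c * X) powr p + (3 * c * X) powr p \<le> (5 * c) powr p * X powr p"
      using XY c by (simp add: powr_mult algebra_simps)
    then show ?thesis using 1 2 by linarith
  qed
  then show ?thesis by (simp add: burkholder_def X_def Y_def c_def)
qed

text \<open>Along a line \<open>x - y = m\<close> the function \<open>burkholder p\<close> is a function of \<open>s = x + y\<close> given by three
  formulas, according to the signs of \<open>x\<close> and \<open>y\<close>.\<close>

definition burkholder_diag :: "real \<Rightarrow> real \<Rightarrow> real \<Rightarrow> real" where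
  "burkholder_diag p m s = (if s \<ge> m then ((2 - p) * s powr p - p * m * s powr (p - 1)) / 2
     else if s \<ge> - m then ((2 - p) * m - p * s) / 2 * m powr (p - 1)
     else ((2 - p) * (- s) powr p + p * m * (- s) powr (p - 1)) / 2)"

text \<open>At the two break points the value is that of the branch to the right; there only the
  monotonicity of the slopes matters.\<close>

definition burkholder_diag' :: "real \<Rightarrow> real \<Rightarrow> real \<Rightarrow> real" where
  "burkholder_diag' p m s = (if s \<ge> m then - ((p - 2) * p * s powr (p - 1) + p * (p - 1) * m * s powr (p - 2)) / 2
     else if s \<ge> - m then - p / 2 * m powr (p - 1)
     else p / 2 * ((p - 2) * (- s) powr (p - 1) - (p - 1) * m * (- s) powr (p - 2)))"

lemma burkholder_diag:
  assumes "p \<ge> 2" "m \<ge> 0"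
  shows "burkholder p ((s + m) / 2) ((s - m) / 2) = burkholder_diag p m s"
proof -
  have pw: "z * z powr (p - 1) = z powr p" if "z \<ge> 0" for z :: real
  proof (cases "z = 0")
    case False
    then have "z powr 1 * z powr (p - 1) = z powr p" unfolding powr_add[symmetric] by simp
    then show ?thesis using that by simp
  qed (use assms in simp)
  consider "s \<ge> m" | "s < m" "s \<ge> - m" | "s < - m" by linarith
  then show ?thesis
  proof cases
    case 1
    then have a: "\<bar>(s + m) / 2\<bar> = (s + m) / 2" "\<bar>(s - m) / 2\<bar> = (s - m) / 2" using assms by auto
    have b: "(s + m) / 2 + (s - m) / 2 = s" by (simp add: field_simps)
    have "burkholder p ((s + m) / 2) ((s - m) / 2) = ((2 - p) * s - p * m) / 2 * s powr (p - 1)"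
      unfolding burkholder_def a b by (simp add: field_simps)
    also have "\<dots> = ((2 - p) * (s * s powr (p - 1)) - p * m * s powr (p - 1)) / 2" by (simp add: field_simps)
    finally show ?thesis using 1 assms by (simp add: burkholder_diag_def pw)
  next
    case 2
    then have a: "\<bar>(s + m) / 2\<bar> = (s + m) / 2" "\<bar>(s - m) / 2\<bar> = (m - s) / 2" using assms by auto
    have b: "(s + m) / 2 + (m - s) / 2 = m" by (simp add: field_simps)
    show ?thesis using 2 unfolding burkholder_def a b burkholder_diag_def by (simp add: field_simps)
  next
    case 3
    then have a: "\<bar>(s + m) / 2\<bar> = (- s - m) / 2" "\<bar>(s - m) / 2\<bar> = (- s + m) / 2" using assms by auto
    have b: "(- s - m) / 2 + (- s + m) / 2 = - s" by (simp add: field_simps)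
    have "burkholder p ((s + m) / 2) ((s - m) / 2) = ((2 - p) * (- s) + p * m) / 2 * (- s) powr (p - 1)"
      unfolding burkholder_def a b by (simp add: field_simps)
    also have "\<dots> = ((2 - p) * ((- s) * (- s) powr (p - 1)) + p * m * (- s) powr (p - 1)) / 2" by (simp add: field_simps)
    also have "(- s) * (- s) powr (p - 1) = (- s) powr p" by (rule pw) (use 3 assms in auto)
    finally show ?thesis using 3 assms by (simp add: burkholder_diag_def)
  qed
qed

lemma burkholder_diag_deriv:
  assumes "p \<ge> 2" "m \<ge> 0" "s \<notin> {-m, m}"
  shows "(burkholder_diag p m has_real_derivative burkholder_diag' p m s) (at s)"
proof -
  consider "s > m" | "s < m" "s > - m" | "s < - m" using assms by fastforce
  then show ?thesis
  proof cases
    case 1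
    have "((\<lambda>s. ((2 - p) * s powr p - p * m * s powr (p - 1)) / 2) has_real_derivative burkholder_diag' p m s) (at s)"
      using 1 assms by (auto intro!: derivative_eq_intros simp: burkholder_diag'_def field_simps)
    moreover have "eventually (\<lambda>t. t \<in> {m<..}) (nhds s)" using 1 by (intro eventually_nhds_in_open) auto
    then have "eventually (\<lambda>t. burkholder_diag p m t = ((2 - p) * t powr p - p * m * t powr (p - 1)) / 2) (nhds s)"
      by eventually_elim (simp add: burkholder_diag_def)
    ultimately show ?thesis by (subst DERIV_cong_ev[OF refl _ refl]) auto
  next
    case 2
    have "((\<lambda>s. ((2 - p) * m - p * s) / 2 * m powr (p - 1)) has_real_derivative burkholder_diag' p m s) (at s)"
      using 2 assms by (auto intro!: derivative_eq_intros simp: burkholder_diag'_def field_simps)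
    moreover have "eventually (\<lambda>t. t \<in> {-m<..<m}) (nhds s)" using 2 by (intro eventually_nhds_in_open) auto
    then have "eventually (\<lambda>t. burkholder_diag p m t = ((2 - p) * m - p * t) / 2 * m powr (p - 1)) (nhds s)"
      by eventually_elim (simp add: burkholder_diag_def)
    ultimately show ?thesis by (subst DERIV_cong_ev[OF refl _ refl]) auto
  next
    case 3
    have "((\<lambda>s. ((2 - p) * (- s) powr p + p * m * (- s) powr (p - 1)) / 2) has_real_derivative burkholder_diag' p m s) (at s)"
      using 3 assms by (auto intro!: derivative_eq_intros simp: burkholder_diag'_def field_simps)
    moreover have "eventually (\<lambda>t. t \<in> {..<-m}) (nhds s)" using 3 by (intro eventually_nhds_in_open) auto
    then have "eventually (\<lambda>t. burkholder_diag p m t = ((2 - p) * (- t) powr p + p * m * (- t) powr (p - 1)) / 2) (nhds s)"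
      by eventually_elim (use assms in \<open>auto simp: burkholder_diag_def\<close>)
    ultimately show ?thesis by (subst DERIV_cong_ev[OF refl _ refl]) auto
  qed
qed

lemma burkholder_diag_cont:
  assumes "p \<ge> 2" "m \<ge> 0"
  shows "continuous_on UNIV (burkholder_diag p m)"
proof -
  have "burkholder_diag p m = (\<lambda>s. (\<bar>(s - m) / 2\<bar> - (p - 1) * \<bar>(s + m) / 2\<bar>) * (\<bar>(s + m) / 2\<bar> + \<bar>(s - m) / 2\<bar>) powr (p - 1))"
    using burkholder_diag[OF assms] unfolding burkholder_def by (intro ext) simp
  then show ?thesis using assms by (auto intro!: continuous_intros continuous_on_powr')
qed

text \<open>Each branch is antitone and no break point jumps upwards. Let m > 0. At s = -m, where x
  = 0, the slopes match; at s = m, where y = 0, the outer slope is 2p - 3 times the negative inner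
  slope, hence not larger exactly when p >= 2.\<close>

lemma burkholder_diag'_antimono:
  assumes p: "p \<ge> 2" and m: "m \<ge> 0" and st: "s \<le> t"
  shows "burkholder_diag' p m t \<le> burkholder_diag' p m s"
proof -
  have pw: "z * z powr (p - 2) = z powr (p - 1)" if "z > 0" for z :: real
  proof -
    have "z powr 1 * z powr (p - 2) = z powr (p - 1)" unfolding powr_add[symmetric] by simp
    then show ?thesis using that by simp
  qed
  define A where "A s = - ((p - 2) * p * s powr (p - 1) + p * (p - 1) * m * s powr (p - 2)) / 2" for s
  define C where "C r = p / 2 * ((p - 2) * r powr (p - 1) - (p - 1) * m * r powr (p - 2))" for r
  define M where "M = - p / 2 * m powr (p - 1)"
  have A: "A t \<le> A s" if "m \<le> s" "s \<le> t" for s t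
  proof -
    have "(p - 2) * p * s powr (p - 1) + p * (p - 1) * m * s powr (p - 2) 
        \<le> (p - 2) * p * t powr (p - 1) + p * (p - 1) * m * t powr (p - 2)"
      using p m that by (intro add_mono mult_left_mono powr_mono2) auto
    then show ?thesis unfolding A_def by simp
  qed
  have Am: "A m \<le> M"
  proof (cases "m = 0")
    case False
    then have m': "m > 0" using m by simp
    have "m powr (p - 1) * p \<le> m powr (p - 1) * ((p - 2) * p + p * (p - 1))" 
      using p by (intro mult_left_mono) (auto simp: algebra_simps mult_left_mono)
    then show ?thesis unfolding A_def M_def pw[OF m', symmetric] by (simp add: algebra_simps)
  qed (use p in \<open>simp add: A_def M_def\<close>)
  \<comment> \<open>In r = -s the derivative is a nonnegative multiple of r - m, and the left branch
    has r >= m.\<close>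
  have C: "C r \<le> C r'" if "m \<le> r" "0 < r" "r \<le> r'" for r r'
  proof (rule DERIV_nonneg_imp_nondecreasing[OF that(3)])
    fix x assume x: "r \<le> x" "x \<le> r'"
    have xp: "x powr (p - 2) = x * x powr (p - 3)"
    proof -
      have "x powr 1 * x powr (p - 3) = x powr (p - 2)" unfolding powr_add[symmetric] by simp
      then show ?thesis using x that by simp
    qed
    have "(C has_real_derivative p / 2 * ((p - 2) * ((p - 1) * x powr (p - 2)) - (p - 1) * m * ((p - 2) * x powr (p - 3)))) (at x)"
      unfolding C_def using x that by (auto intro!: derivative_eq_intros)
    moreover have "p / 2 * ((p - 2) * ((p - 1) * x powr (p - 2)) - (p - 1) * m * ((p - 2) * x powr (p - 3)))
       = p / 2 * (p - 2) * (p - 1) * (x - m) * x powr (p - 3)" unfolding xp by (simp add: algebra_simps)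
    moreover have "\<dots> \<ge> 0" using p x that by (intro mult_nonneg_nonneg) auto
    ultimately show "\<exists>y. (C has_real_derivative y) (at x) \<and> 0 \<le> y" by metis
  qed
  have CM: "M \<le> C r" if "m \<le> r" "0 < r" for r
  proof (cases "m = 0")
    case True
    then show ?thesis using p by (simp add: M_def C_def)
  next
    case False
    then have m': "m > 0" using m by simp
    have "M = C m" unfolding M_def C_def pw[OF m', symmetric] by (simp add: algebra_simps)
    then show ?thesis using C[of m r] that m' by simp
  qed
  have eq: "burkholder_diag' p m u = (if u \<ge> m then A u else if u \<ge> - m then M else C (- u))" for u
    unfolding burkholder_diag'_def A_def M_def C_def by simp
  show ?thesis unfolding eq using A[of s t] A[of m t] Am CM[of "-s"] C[of "-t" "-s"] m st by auto
qed

lemma burkholder_minus: "burkholder p (- x) y = burkholder p x y" "burkholder p x (- y) = burkholder p x y"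
  unfolding burkholder_def by simp_all

text \<open>Zigzag concavity in the form that can be averaged: a linear function of d that touches
  at d = 0 and majorizes. Evenness in x and in y reduces both slopes and both sides of the diagonal
  to the lines x - y = m with m >= 0.\<close>

lemma burkholder_diagonal_concave:
  assumes p: "p \<ge> 2" and e: "\<bar>e\<bar> = (1::real)"
  shows "\<exists>\<sigma>. \<forall>d. burkholder p (x + d) (y + e * d) \<le> burkholder p x y + \<sigma> * d"
proof -
  have 1: "\<exists>\<sigma>. \<forall>d. burkholder p (x + d) (y + d) \<le> burkholder p x y + \<sigma> * d" if "x \<ge> y" for x y
  proof -
    define m where "m = x - y"
    define s where "s = x + y"
    have m: "m \<ge> 0" using that by (simp add: m_def)
    have B: "burkholder p (x + d) (y + d) = burkholder_diag p m (s + 2 * d)" for d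
    proof -
      have "x + d = ((s + 2 * d) + m) / 2" "y + d = ((s + 2 * d) - m) / 2"
        by (simp_all add: m_def s_def field_simps)
      then show ?thesis using burkholder_diag[OF p m, of "s + 2 * d"] by (simp only:)
    qed
    have "burkholder_diag p m (s + 2 * d) \<le> burkholder_diag p m s + burkholder_diag' p m s * (s + 2 * d - s)" for d
      by (rule supporting_line_of_antimono_deriv[of "{-m, m}"])
         (use burkholder_diag_cont[OF p m] burkholder_diag_deriv[OF p m] burkholder_diag'_antimono[OF p m] in auto)
    moreover have "burkholder p x y = burkholder_diag p m s" using B[of 0] by simp
    ultimately show ?thesis unfolding B by (intro exI[of _ "2 * burkholder_diag' p m s"]) (simp add: algebra_simps)
  qed
  have 2: "\<exists>\<sigma>. \<forall>d. burkholder p (x + d) (y + d) \<le> burkholder p x y + \<sigma> * d" for x y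
  proof (cases "x \<ge> y")
    case False
    have "\<exists>\<sigma>. \<forall>d. burkholder p (- x + d) (- y + d) \<le> burkholder p (-x) (-y) + \<sigma> * d" by (rule 1) (use False in simp)
    then obtain \<sigma> where \<sigma>: "\<And>d. burkholder p (- x + d) (- y + d) \<le> burkholder p (-x) (-y) + \<sigma> * d" by blast
    have "burkholder p (x + d) (y + d) \<le> burkholder p x y + (- \<sigma>) * d" for d
      using \<sigma>[of "-d"] burkholder_minus(1)[of p "x + d"] burkholder_minus(2)[of p "- (x + d)" "y + d"] burkholder_minus[of p] by simp
    then show ?thesis by blast
  qed (use 1 in blast)
  consider "e = 1" | "e = -1" using e by (auto simp: abs_if split: if_splits)
  then show ?thesis
  proof cases
    case 2
    obtain \<sigma> where \<sigma>: "\<And>d. burkholder p (x + d) (- y + d) \<le> burkholder p x (-y) + \<sigma> * d" using \<open>\<And>x y. \<exists>\<sigma>. \<forall>d. burkholder p (x + d) (y + d) \<le> burkholder p x y + \<sigma> * d\<close>[of x "-y"] by auto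
    have "burkholder p (x + d) (y + e * d) \<le> burkholder p x y + \<sigma> * d" for d
      using \<sigma>[of d] 2 burkholder_minus(2)[of p "x + d" "y - d"] burkholder_minus(2)[of p x y] by simp
    then show ?thesis by blast
  qed (use 2 in simp)
qed

section \<open>Convolution and probability kernels\<close>

definition conv :: "(real \<Rightarrow> 'a::{real_normed_field, banach, second_countable_topology}) \<Rightarrow> (real \<Rightarrow> 'a) \<Rightarrow> real \<Rightarrow> 'a" where
  "conv k f x = (\<integral>y. k (x - y) * f y \<partial>lborel)"

lemma lborel_integral_shift:
  fixes f :: "real \<Rightarrow> 'a::{banach, second_countable_topology}"
  shows "(\<integral>y. f (x - y) \<partial>lborel) = (\<integral>y. f y \<partial>lborel)"
  using lborel_integral_real_affine[of "-1" f x] by (simp add: algebra_simps)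

lemma lborel_integrable_shift:
  fixes f :: "real \<Rightarrow> 'a::{banach, second_countable_topology}"
  shows "integrable lborel (\<lambda>y. f (x - y)) \<longleftrightarrow> integrable lborel f"
  using lborel_integrable_real_affine_iff[of "-1" f x] by (simp add: algebra_simps)

lemma lborel_nn_integral_shift:
  fixes f :: "real \<Rightarrow> ennreal"
  assumes "f \<in> borel_measurable borel"
  shows "(\<integral>\<^sup>+y. f (x - y) \<partial>lborel) = (\<integral>\<^sup>+y. f y \<partial>lborel)"
  using nn_integral_real_affine[of f "-1" x] assms by (simp add: algebra_simps)

lemma borel_measurable_conv [measurable]:
  assumes [measurable]: "k \<in> borel_measurable borel" "f \<in> borel_measurable borel"
  shows "conv k f \<in> borel_measurable borel"
  unfolding conv_def by measurable

lemma integrable_pairI: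
  fixes F :: "real \<Rightarrow> real \<Rightarrow> 'a::{banach, second_countable_topology}"
  assumes [measurable]: "case_prod F \<in> borel_measurable (lborel \<Otimes>\<^sub>M lborel)"
    and le: "\<And>x y. norm (F x y) \<le> G x y" and fin: "(\<integral>\<^sup>+x. \<integral>\<^sup>+y. ennreal (G x y) \<partial>lborel \<partial>lborel) < \<infinity>"
  shows "integrable (lborel \<Otimes>\<^sub>M lborel) (case_prod F)"
proof (rule integrableI_bounded)
  have "(\<integral>\<^sup>+z. ennreal (norm (case_prod F z)) \<partial>(lborel \<Otimes>\<^sub>M lborel)) = (\<integral>\<^sup>+x. \<integral>\<^sup>+y. ennreal (norm (F x y)) \<partial>lborel \<partial>lborel)"
    by (subst lborel.nn_integral_fst[symmetric]) auto
  also have "\<dots> \<le> (\<integral>\<^sup>+x. \<integral>\<^sup>+y. ennreal (G x y) \<partial>lborel \<partial>lborel)"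
    by (intro nn_integral_mono ennreal_leI le)
  finally show "(\<integral>\<^sup>+z. ennreal (norm (case_prod F z)) \<partial>(lborel \<Otimes>\<^sub>M lborel)) < \<infinity>"
    using fin by (rule le_less_trans)
qed fact

lemma integrable_prod_pair:
  fixes a b :: "real \<Rightarrow> 'a::{real_normed_field, banach, second_countable_topology}"
  assumes [measurable]: "case_prod w \<in> borel_measurable (lborel \<Otimes>\<^sub>M lborel)" 
    and ab: "integrable lborel a" "integrable lborel b" and w: "\<And>x y. norm (w x y) \<le> K"
  shows "integrable (lborel \<Otimes>\<^sub>M lborel) (\<lambda>(x,y). w x y * (a x * b y))"
proof (rule integrable_pairI[where G = "\<lambda>x y. K * (norm (a x) * norm (b y))"])
  have K: "K \<ge> 0" using w[of 0 0] norm_ge_zero order_trans by blast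
  have [measurable]: "a \<in> borel_measurable borel" "b \<in> borel_measurable borel" using ab by (auto dest: borel_measurable_integrable)
  show "(\<lambda>(x, y). w x y * (a x * b y)) \<in> borel_measurable (lborel \<Otimes>\<^sub>M lborel)" by measurable
  show "norm (w x y * (a x * b y)) \<le> K * (norm (a x) * norm (b y))" for x y
    unfolding norm_mult by (intro mult_right_mono w) auto
  have fin: "(\<integral>\<^sup>+x. ennreal (norm (u x)) \<partial>lborel) < \<infinity>" if "integrable lborel u" for u :: "real \<Rightarrow> 'a"
    using that by (simp add: integrable_iff_bounded)
  have "(\<integral>\<^sup>+x. \<integral>\<^sup>+y. ennreal (K * (norm (a x) * norm (b y))) \<partial>lborel \<partial>lborel) 
    = ennreal K * ((\<integral>\<^sup>+x. ennreal (norm (a x)) \<partial>lborel) * (\<integral>\<^sup>+y. ennreal (norm (b y)) \<partial>lborel))"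
    using K by (simp add: ennreal_mult nn_integral_cmult nn_integral_multc)
  also have "\<dots> < \<infinity>" using fin[OF ab(1)] fin[OF ab(2)] by (simp add: ennreal_mult_less_top)
  finally show "(\<integral>\<^sup>+x. \<integral>\<^sup>+y. ennreal (K * (norm (a x) * norm (b y))) \<partial>lborel \<partial>lborel) < \<infinity>" .
qed

lemma integrable_conv_pair:
  fixes k f :: "real \<Rightarrow> 'a::{real_normed_field, banach, second_countable_topology}"
  assumes "integrable lborel k" "integrable lborel f"
    and [measurable]: "g \<in> borel_measurable borel" and g: "\<And>x. norm (g x) \<le> K"
  shows "integrable (lborel \<Otimes>\<^sub>M lborel) (\<lambda>(x,y). k (x - y) * f y * g x)"
proof (rule integrable_pairI[where G = "\<lambda>x y. K * (norm (k (x - y)) * norm (f y))"])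
  have K: "K \<ge> 0" using g[of 0] norm_ge_zero order_trans by blast
  have [measurable]: "k \<in> borel_measurable borel" "f \<in> borel_measurable borel" using assms by (auto dest: borel_measurable_integrable)
  show "(\<lambda>(x, y). k (x - y) * f y * g x) \<in> borel_measurable (lborel \<Otimes>\<^sub>M lborel)" by measurable
  show "norm (k (x - y) * f y * g x) \<le> K * (norm (k (x - y)) * norm (f y))" for x y
    unfolding norm_mult using mult_right_mono[OF g[of x], of "norm (k (x - y)) * norm (f y)"] by (simp add: mult.commute)
  have fin: "(\<integral>\<^sup>+x. ennreal (norm (u x)) \<partial>lborel) < \<infinity>" if "integrable lborel u" for u :: "real \<Rightarrow> 'a"
    using that by (simp add: integrable_iff_bounded)
  have "(\<integral>\<^sup>+x. \<integral>\<^sup>+y. ennreal (K * (norm (k (x - y)) * norm (f y))) \<partial>lborel \<partial>lborel)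
     = (\<integral>\<^sup>+y. \<integral>\<^sup>+x. ennreal (K * (norm (k (x - y)) * norm (f y))) \<partial>lborel \<partial>lborel)"
    by (subst lborel_pair.Fubini') auto
  also have "\<dots> = (\<integral>\<^sup>+y. ennreal K * ((\<integral>\<^sup>+x. ennreal (norm (k (x - y))) \<partial>lborel) * ennreal (norm (f y))) \<partial>lborel)"
    using K by (simp add: ennreal_mult nn_integral_cmult nn_integral_multc)
  also have "\<dots> = (\<integral>\<^sup>+y. ennreal K * ((\<integral>\<^sup>+x. ennreal (norm (k x)) \<partial>lborel) * ennreal (norm (f y))) \<partial>lborel)"
  proof -
    have "(\<integral>\<^sup>+x. ennreal (norm (k (x - y))) \<partial>lborel) = (\<integral>\<^sup>+x. ennreal (norm (k x)) \<partial>lborel)" for y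
      using nn_integral_real_affine[of "\<lambda>x. ennreal (norm (k x))" 1 "-y"] by simp
    then show ?thesis by simp
  qed
  also have "\<dots> = ennreal K * ((\<integral>\<^sup>+x. ennreal (norm (k x)) \<partial>lborel) * (\<integral>\<^sup>+y. ennreal (norm (f y)) \<partial>lborel))"
    by (simp add: nn_integral_cmult)
  also have "\<dots> < \<infinity>" using fin[OF assms(1)] fin[OF assms(2)] by (simp add: ennreal_mult_less_top)
  finally show "(\<integral>\<^sup>+x. \<integral>\<^sup>+y. ennreal (K * (norm (k (x - y)) * norm (f y))) \<partial>lborel \<partial>lborel) < \<infinity>" .
qed

lemma conv_integrable_mult:
  fixes k f :: "real \<Rightarrow> 'a::{real_normed_field, banach, second_countable_topology}"
  assumes "integrable lborel k" "integrable lborel f"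
    and "g \<in> borel_measurable borel" and "\<And>x. norm (g x) \<le> K"
  shows "integrable lborel (\<lambda>x. conv k f x * g x)"
    and "(\<integral>x. conv k f x * g x \<partial>lborel) = (\<integral>y. f y * (\<integral>x. k (x - y) * g x \<partial>lborel) \<partial>lborel)"
proof -
  have *: "integrable (lborel \<Otimes>\<^sub>M lborel) (\<lambda>(x,y). k (x - y) * f y * g x)"
    by (rule integrable_conv_pair[OF assms])
  have "integrable lborel (\<lambda>x. \<integral>y. k (x - y) * f y * g x \<partial>lborel)"
    by (rule lborel_pair.integrable_fst[OF *])
  then show "integrable lborel (\<lambda>x. conv k f x * g x)" unfolding conv_def by simp
  have "(\<integral>x. conv k f x * g x \<partial>lborel) = (\<integral>x. \<integral>y. k (x - y) * f y * g x \<partial>lborel \<partial>lborel)"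
    unfolding conv_def by simp
  also have "\<dots> = (\<integral>y. \<integral>x. k (x - y) * f y * g x \<partial>lborel \<partial>lborel)"
    by (rule lborel_pair.Fubini_integral[symmetric, OF *])
  also have "\<dots> = (\<integral>y. \<integral>x. f y * (k (x - y) * g x) \<partial>lborel \<partial>lborel)"
    by (simp add: mult_ac)
  finally show "(\<integral>x. conv k f x * g x \<partial>lborel) = (\<integral>y. f y * (\<integral>x. k (x - y) * g x \<partial>lborel) \<partial>lborel)" by simp
qed

lemma conv_integrable:
  assumes "integrable lborel k" "integrable lborel f"
  shows "integrable lborel (conv k f)"
  using conv_integrable_mult(1)[OF assms, of "\<lambda>_. 1" 1] by simp

lemma conv_bounded_integrable:
  fixes k f :: "real \<Rightarrow> 'a::{real_normed_field, banach, second_countable_topology}"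
  assumes "integrable lborel f" and [measurable]: "k \<in> borel_measurable borel" and "\<And>x. norm (k x) \<le> K"
  shows "integrable lborel (\<lambda>y. k (x - y) * f y)" "norm (conv k f x) \<le> K * (\<integral>y. norm (f y) \<partial>lborel)"
proof -
  have [measurable]: "f \<in> borel_measurable borel" using assms by (auto dest: borel_measurable_integrable)
  have K: "K \<ge> 0" using assms(3)[of 0] norm_ge_zero order_trans by blast
  have i: "integrable lborel (\<lambda>y. K * norm (f y))" using assms by simp
  have b: "norm (k (x - y) * f y) \<le> K * norm (f y)" for y
    unfolding norm_mult by (intro mult_right_mono assms) simp
  show 1: "integrable lborel (\<lambda>y. k (x - y) * f y)"
    by (rule Bochner_Integration.integrable_bound[OF i]) (use b K in auto)
  have "norm (conv k f x) \<le> (\<integral>y. norm (k (x - y) * f y) \<partial>lborel)" unfolding conv_def by (rule integral_norm_bound)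
  also have "\<dots> \<le> (\<integral>y. K * norm (f y) \<partial>lborel)"
    by (rule integral_mono) (use 1 i b in auto)
  finally show "norm (conv k f x) \<le> K * (\<integral>y. norm (f y) \<partial>lborel)" by simp
qed

lemma conv_integrable_bounded:
  fixes k f :: "real \<Rightarrow> 'a::{real_normed_field, banach, second_countable_topology}"
  assumes "integrable lborel k" and [measurable]: "f \<in> borel_measurable borel" and "\<And>x. norm (f x) \<le> K"
  shows "integrable lborel (\<lambda>y. k (x - y) * f y)" "norm (conv k f x) \<le> K * (\<integral>y. norm (k y) \<partial>lborel)"
proof -
  have [measurable]: "k \<in> borel_measurable borel" using assms by (auto dest: borel_measurable_integrable)
  have K: "K \<ge> 0" using assms(3)[of 0] norm_ge_zero order_trans by blast
  have k: "integrable lborel (\<lambda>y. k (x - y))" using assms by (subst lborel_integrable_shift)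
  then have i: "integrable lborel (\<lambda>y. norm (k (x - y)) * K)" by simp
  have b: "norm (k (x - y) * f y) \<le> norm (k (x - y)) * K" for y
    unfolding norm_mult by (intro mult_left_mono assms) simp
  show 1: "integrable lborel (\<lambda>y. k (x - y) * f y)"
    by (rule Bochner_Integration.integrable_bound[OF i]) (use b K in auto)
  have "norm (conv k f x) \<le> (\<integral>y. norm (k (x - y) * f y) \<partial>lborel)" unfolding conv_def by (rule integral_norm_bound)
  also have "\<dots> \<le> (\<integral>y. norm (k (x - y)) * K \<partial>lborel)"
    by (rule integral_mono) (use 1 i b in auto)
  also have "\<dots> = K * (\<integral>y. norm (k y) \<partial>lborel)" by (simp add: lborel_integral_shift[of "\<lambda>y. norm (k y)"])
  finally show "norm (conv k f x) \<le> K * (\<integral>y. norm (k y) \<partial>lborel)" .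
qed

text \<open>The real functions in both L^1 and L^\<infinity>. Unlike bounded support, this is
  preserved by convolution with a probability density, and it is closed under products.\<close>

definition bintegrable :: "(real \<Rightarrow> real) \<Rightarrow> bool" where
  "bintegrable u \<longleftrightarrow> integrable lborel u \<and> (\<exists>K. \<forall>x. \<bar>u x\<bar> \<le> K)"

definition pkernel :: "(real \<Rightarrow> real) \<Rightarrow> bool" where
  "pkernel k \<longleftrightarrow> integrable lborel k \<and> (\<forall>x. k x \<ge> 0) \<and> (\<integral>x. k x \<partial>lborel) = 1"

lemma bintegrableE:
  assumes "bintegrable u"
  obtains K where "integrable lborel u" "u \<in> borel_measurable borel" "K \<ge> 0" "\<And>x. norm (u x) \<le> K"
proof -
  from assms obtain K where K: "integrable lborel u" "\<And>x. \<bar>u x\<bar> \<le> K" unfolding bintegrable_def by blast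
  show ?thesis
  proof (rule that[OF K(1) _ _ K(2)[folded real_norm_def]])
    show "u \<in> borel_measurable borel" using K(1) by (auto dest: borel_measurable_integrable)
    show "K \<ge> 0" using K(2)[of 0] by linarith
  qed
qed

lemma bsupp_bintegrable: "bsupp u \<Longrightarrow> bintegrable u"
  unfolding bintegrable_def using bsupp_integrable[of u] by (metis bsuppE real_norm_def)

lemma bintegrable_mult:
  assumes "bintegrable u" "bintegrable v"
  shows "bintegrable (\<lambda>x. u x * v x)"
proof -
  obtain K L where K: "integrable lborel u" "u \<in> borel_measurable borel" "K \<ge> 0" "\<And>x. norm (u x) \<le> K"
    and L: "integrable lborel v" "v \<in> borel_measurable borel" "L \<ge> 0" "\<And>x. norm (v x) \<le> L"
    using assms by (metis bintegrableE)
  have [measurable]: "u \<in> borel_measurable borel" "v \<in> borel_measurable borel" by fact+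
  have i: "integrable lborel (\<lambda>x. K * v x)" using L by simp
  have "integrable lborel (\<lambda>x. u x * v x)"
    by (rule Bochner_Integration.integrable_bound[OF i]) (use K in \<open>auto simp: abs_mult intro!: mult_right_mono\<close>)
  moreover have "\<bar>u x * v x\<bar> \<le> K * L" for x
    unfolding abs_mult using K(3,4) L(4) by (intro mult_mono) auto
  ultimately show ?thesis unfolding bintegrable_def by blast
qed

lemma bintegrable_add: assumes "bintegrable u" "bintegrable v" shows "bintegrable (\<lambda>x. u x + v x)"
proof -
  obtain K L where K: "integrable lborel u" "u \<in> borel_measurable borel" "K \<ge> 0" "\<And>x. norm (u x) \<le> K"
    and L: "integrable lborel v" "v \<in> borel_measurable borel" "L \<ge> 0" "\<And>x. norm (v x) \<le> L"
    using assms by (metis bintegrableE)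
  have "\<bar>u x + v x\<bar> \<le> K + L" for x using K(4)[of x] L(4)[of x] by simp
  then show ?thesis unfolding bintegrable_def using K L by auto
qed

lemma bintegrable_cmult: assumes "bintegrable u" shows "bintegrable (\<lambda>x. c * u x)"
proof -
  obtain K where K: "integrable lborel u" "K \<ge> 0" "\<And>x. norm (u x) \<le> K"
    using assms by (metis bintegrableE)
  have "\<bar>c * u x\<bar> \<le> \<bar>c\<bar> * K" for x unfolding abs_mult using K(3)[of x] by (intro mult_left_mono) auto
  then show ?thesis unfolding bintegrable_def using K by auto
qed

lemma bintegrable_conv: assumes "pkernel k" "bintegrable u" shows "bintegrable (conv k u)" "(\<integral>x. conv k u x \<partial>lborel) = (\<integral>x. u x \<partial>lborel)"
proof -
  obtain K where K: "integrable lborel u" "u \<in> borel_measurable borel" "K \<ge> 0" "\<And>x. norm (u x) \<le> K"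
    using assms by (metis bintegrableE)
  have k: "integrable lborel k" "(\<integral>x. k x \<partial>lborel) = 1" using assms unfolding pkernel_def by auto
  show "bintegrable (conv k u)"
    unfolding bintegrable_def using conv_integrable[OF k(1) K(1)] conv_integrable_bounded(2)[OF k(1) K(2,4)] by auto
  have "(\<integral>x. conv k u x * 1 \<partial>lborel) = (\<integral>y. u y * (\<integral>x. k (x - y) * 1 \<partial>lborel) \<partial>lborel)"
    by (rule conv_integrable_mult(2)[OF k(1) K(1), of _ 1]) auto
  moreover have "(\<integral>x. k (x - y) \<partial>lborel) = 1" for y
    using lborel_integral_real_affine[of 1 k "-y"] k by simp
  ultimately show "(\<integral>x. conv k u x \<partial>lborel) = (\<integral>x. u x \<partial>lborel)" by simp
qed

section \<open>Martingale transforms along a chain of kernels\<close>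

fun chain :: "(nat \<Rightarrow> real \<Rightarrow> real) \<Rightarrow> (real \<Rightarrow> real) \<Rightarrow> nat \<Rightarrow> real \<Rightarrow> real" where
  "chain \<kappa> f 0 = f"
| "chain \<kappa> f (Suc k) = conv (\<kappa> k) (chain \<kappa> f k)"

text \<open>The conditional expectation of Y g, where Y is the transform by e of the martingale
  formed by the averages of f, and the process runs down from level k to level 0. Conditioning on
  one step from x to z contributes e_k (f_k(z) - f_{k+1}(x)) g_k(z); averaging the part with
  f_{k+1}(x) over z gives the product at x. Only kernels occur, no probability space.\<close>

fun chainh :: "(nat \<Rightarrow> real \<Rightarrow> real) \<Rightarrow> (nat \<Rightarrow> real) \<Rightarrow> (real \<Rightarrow> real) \<Rightarrow> (real \<Rightarrow> real) \<Rightarrow> nat \<Rightarrow> real \<Rightarrow> real" where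
  "chainh \<kappa> e f g 0 = (\<lambda>x. 0)"
| "chainh \<kappa> e f g (Suc k) = (\<lambda>x. conv (\<kappa> k) (\<lambda>y. chainh \<kappa> e f g k y + e k * (chain \<kappa> f k y * chain \<kappa> g k y)) x
      + (- e k) * (chain \<kappa> f (Suc k) x * chain \<kappa> g (Suc k) x))"

lemma bintegrable_chain: 
  assumes "\<And>k. pkernel (\<kappa> k)" "bintegrable f"
  shows "bintegrable (chain \<kappa> f k)" "(\<integral>x. chain \<kappa> f k x \<partial>lborel) = (\<integral>x. f x \<partial>lborel)"
  by (induction k) (use assms bintegrable_conv in auto)

lemma bintegrable_chainh:
  assumes \<kappa>: "\<And>k. pkernel (\<kappa> k)" and "bintegrable f" "bintegrable g"
  shows "bintegrable (chainh \<kappa> e f g k)"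
proof (induction k)
  case 0
  show ?case by (auto simp: bintegrable_def)
next
  case (Suc k)
  then show ?case unfolding chainh.simps
    by (intro bintegrable_add bintegrable_conv bintegrable_cmult bintegrable_mult bintegrable_chain assms)
qed

text \<open>Each kernel preserves the Lebesgue integral, so integrating the recursion leaves one
  difference of inner products per step.\<close>

lemma integral_chainh:
  assumes \<kappa>: "\<And>k. pkernel (\<kappa> k)" and "bintegrable f" "bintegrable g"
  shows "(\<integral>x. chainh \<kappa> e f g n x \<partial>lborel) = 
    (\<Sum>k<n. e k * ((\<integral>x. chain \<kappa> f k x * chain \<kappa> g k x \<partial>lborel) - (\<integral>x. chain \<kappa> f (Suc k) x * chain \<kappa> g (Suc k) x \<partial>lborel)))"
proof (induction n)
  case (Suc n)
  have i: "integrable lborel u" if "bintegrable u" for u using that by (simp add: bintegrable_def)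
  have fg: "bintegrable (\<lambda>x. e n * (chain \<kappa> f n x * chain \<kappa> g n x))" "bintegrable (\<lambda>x. (- e n) * (chain \<kappa> f (Suc n) x * chain \<kappa> g (Suc n) x))"
    by (intro bintegrable_cmult bintegrable_mult bintegrable_chain assms)+
  have h: "bintegrable (chainh \<kappa> e f g n)" by (intro bintegrable_chainh assms)
  have "(\<integral>x. chainh \<kappa> e f g (Suc n) x \<partial>lborel) = (\<integral>x. chainh \<kappa> e f g n x + e n * (chain \<kappa> f n x * chain \<kappa> g n x) \<partial>lborel)
     + (\<integral>x. (- e n) * (chain \<kappa> f (Suc n) x * chain \<kappa> g (Suc n) x) \<partial>lborel)"
    unfolding chainh.simps
    by (subst Bochner_Integration.integral_add[OF i[OF bintegrable_conv(1)[OF \<kappa> bintegrable_add[OF h fg(1)]]] i[OF fg(2)]])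
       (simp only: bintegrable_conv(2)[OF \<kappa> bintegrable_add[OF h fg(1)]])
  also have "(\<integral>x. chainh \<kappa> e f g n x + e n * (chain \<kappa> f n x * chain \<kappa> g n x) \<partial>lborel) = 
     (\<integral>x. chainh \<kappa> e f g n x \<partial>lborel) + (\<integral>x. e n * (chain \<kappa> f n x * chain \<kappa> g n x) \<partial>lborel)"
    by (rule Bochner_Integration.integral_add) (intro i h fg)+
  finally show ?case using Suc by (simp add: algebra_simps del: chain.simps chainh.simps)
qed simp

text \<open>Dynamic programming with Burkholder's function: the left-hand side is the expectation of
  \<open>(y + Y) g\<close> for the martingale transform \<open>Y\<close>, started at \<open>x\<close> with \<open>k\<close> steps to go.\<close>

lemma chainh_le:
  assumes \<kappa>: "\<And>k. pkernel (\<kappa> k)" and f: "bintegrable f" and g: "bintegrable g" 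
    and p: "p \<ge> 2" "q > 1" "1/p + 1/q = 1" and e: "\<And>k. \<bar>e k\<bar> = 1"
    and fp: "bintegrable (\<lambda>x. \<bar>f x\<bar> powr p)" and gq: "bintegrable (\<lambda>x. \<bar>g x\<bar> powr q)"
  defines "K \<equiv> (5 * (p - 1)) powr p"
  shows "y * chain \<kappa> g k x + chainh \<kappa> e f g k x \<le> 2 / p * burkholder p (chain \<kappa> f k x) y 
     + (K / p * chain \<kappa> (\<lambda>x. \<bar>f x\<bar> powr p) k x + 1 / q * chain \<kappa> (\<lambda>x. \<bar>g x\<bar> powr q) k x)"
proof (induction k arbitrary: x y)
  case 0
  \<comment> \<open>With no steps left, Young's inequality splits the product and the majorization
    replaces |y|^p by Burkholder's function.\<close>
  have "y * g x \<le> \<bar>y\<bar> * \<bar>g x\<bar>" using abs_ge_self[of "y * g x"] by (simp add: abs_mult)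
  also have "\<dots> \<le> \<bar>y\<bar> powr p / p + \<bar>g x\<bar> powr q / q"
    using p by (intro Youngs_inequality) auto
  also have "\<bar>y\<bar> powr p / p \<le> (2 * burkholder p (f x) y + K * \<bar>f x\<bar> powr p) / p"
    unfolding K_def using burkholder_majorizes[OF p(1), of y "f x"] p by (intro divide_right_mono) auto
  finally show ?case by (simp add: add_divide_distrib)
next
  case (Suc k)
  let ?f = "chain \<kappa> f k" and ?g = "chain \<kappa> g k" and ?h = "chainh \<kappa> e f g k"
  let ?fp = "chain \<kappa> (\<lambda>x. \<bar>f x\<bar> powr p) k" and ?gq = "chain \<kappa> (\<lambda>x. \<bar>g x\<bar> powr q) k"
  define a where "a = chain \<kappa> f (Suc k) x"
  \<comment> \<open>The supporting line is taken at the average a itself. As a is the mean of f_k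
    under the kernel, the term with \<sigma> integrates to zero.\<close>
  obtain \<sigma> where \<sigma>: "\<And>d. burkholder p (a + d) (y + e k * d) \<le> burkholder p a y + \<sigma> * d"
    using burkholder_diagonal_concave[OF p(1) e[of k], of a y] by blast
  have kk: "\<kappa> k u \<ge> 0" "integrable lborel (\<kappa> k)" "(\<integral>x. \<kappa> k x \<partial>lborel) = 1" for u using \<kappa>[of k] unfolding pkernel_def by auto
  define w where "w y = \<kappa> k (x - y)" for y
  have wint: "integrable lborel w" "(\<integral>y. w y \<partial>lborel) = 1"
    unfolding w_def using kk lborel_integrable_shift[of "\<kappa> k" x] lborel_integral_shift[of "\<kappa> k" x] by auto
  have wi: "integrable lborel (\<lambda>z. w z * u z)" if "bintegrable u" for u
    using that unfolding w_def by (elim bintegrableE) (rule conv_integrable_bounded(1)[OF kk(2)])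
  have wc: "(\<integral>z. w z * u z \<partial>lborel) = conv (\<kappa> k) u x" for u unfolding w_def conv_def by simp
  note B = bintegrable_chain(1)[OF \<kappa> f] bintegrable_chain(1)[OF \<kappa> g] bintegrable_chainh[OF \<kappa> f g] bintegrable_chain(1)[OF \<kappa> fp] bintegrable_chain(1)[OF \<kappa> gq]
  have hfg: "bintegrable (\<lambda>z. ?h z + e k * (?f z * ?g z))" by (intro bintegrable_add bintegrable_cmult bintegrable_mult B)
  \<comment> \<open>The induction hypothesis at z, with y moved by e_k (f_k(z) - a) so that the pair
    stays on a line of slope e_k; it is combined with the supporting line and weighted by the
    transition density \<open>w\<close>.\<close>
  have L: "(y - e k * a) * (w z * ?g z) + w z * (?h z + e k * (?f z * ?g z))
     \<le> (2 / p * (burkholder p a y - \<sigma> * a)) * w z + (2 / p * \<sigma>) * (w z * ?f z) + (K / p * (w z * ?fp z) + 1 / q * (w z * ?gq z))" for z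
  proof -
    have "(y + e k * (?f z - a)) * ?g z + ?h z \<le> 2 / p * burkholder p (?f z) (y + e k * (?f z - a)) + (K / p * ?fp z + 1 / q * ?gq z)"
      by (rule Suc)
    also have "burkholder p (?f z) (y + e k * (?f z - a)) \<le> burkholder p a y + \<sigma> * (?f z - a)"
      using \<sigma>[of "?f z - a"] by simp
    then have "2 / p * burkholder p (?f z) (y + e k * (?f z - a)) \<le> 2 / p * (burkholder p a y + \<sigma> * (?f z - a))"
      using p by (intro mult_left_mono) auto
    finally have "w z * ((y + e k * (?f z - a)) * ?g z + ?h z) \<le> w z * (2 / p * (burkholder p a y + \<sigma> * (?f z - a)) + (K / p * ?fp z + 1 / q * ?gq z))"
      using kk(1) unfolding w_def by (intro mult_left_mono) auto
    then show ?thesis by (simp add: algebra_simps)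
  qed
  have "(\<integral>z. (y - e k * a) * (w z * ?g z) + w z * (?h z + e k * (?f z * ?g z)) \<partial>lborel)
     \<le> (\<integral>z. (2 / p * (burkholder p a y - \<sigma> * a)) * w z + (2 / p * \<sigma>) * (w z * ?f z) + (K / p * (w z * ?fp z) + 1 / q * (w z * ?gq z)) \<partial>lborel)"
    by (rule integral_mono[OF _ _ L])
       (intro Bochner_Integration.integrable_add integrable_mult_right wi hfg B wint(1))+
  also have "(\<integral>z. (y - e k * a) * (w z * ?g z) + w z * (?h z + e k * (?f z * ?g z)) \<partial>lborel)
     = (y - e k * a) * conv (\<kappa> k) ?g x + conv (\<kappa> k) (\<lambda>z. ?h z + e k * (?f z * ?g z)) x"
    by (subst Bochner_Integration.integral_add) 
       (simp_all only: integral_mult_right_zero wc wi hfg B integrable_mult_right)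
  also have "(\<integral>z. (2 / p * (burkholder p a y - \<sigma> * a)) * w z + (2 / p * \<sigma>) * (w z * ?f z) + (K / p * (w z * ?fp z) + 1 / q * (w z * ?gq z)) \<partial>lborel)
     = (2 / p * (burkholder p a y - \<sigma> * a)) * 1 + (2 / p * \<sigma>) * conv (\<kappa> k) ?f x + (K / p * conv (\<kappa> k) ?fp x + 1 / q * conv (\<kappa> k) ?gq x)"
    apply (subst Bochner_Integration.integral_add)
    subgoal by (intro Bochner_Integration.integrable_add integrable_mult_right wi B wint(1))
    subgoal by (intro Bochner_Integration.integrable_add integrable_mult_right wi B wint(1))
    apply (subst Bochner_Integration.integral_add)
    subgoal by (intro Bochner_Integration.integrable_add integrable_mult_right wi B wint(1))
    subgoal by (intro Bochner_Integration.integrable_add integrable_mult_right wi B wint(1))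
    apply (subst Bochner_Integration.integral_add)
    subgoal by (intro Bochner_Integration.integrable_add integrable_mult_right wi B wint(1))
    subgoal by (intro Bochner_Integration.integrable_add integrable_mult_right wi B wint(1))
    by (simp only: integral_mult_right_zero wc wint)
  finally show ?case unfolding a_def by (simp add: algebra_simps)
qed

definition chain_form :: "(nat \<Rightarrow> real \<Rightarrow> real) \<Rightarrow> (nat \<Rightarrow> real) \<Rightarrow> nat \<Rightarrow> (real \<Rightarrow> real) \<Rightarrow> (real \<Rightarrow> real) \<Rightarrow> real" where
  "chain_form \<kappa> e n f g = (\<Sum>k<n. e k * ((\<integral>x. chain \<kappa> f k x * chain \<kappa> g k x \<partial>lborel) - (\<integral>x. chain \<kappa> f (Suc k) x * chain \<kappa> g (Suc k) x \<partial>lborel)))"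

lemma chain_form_le_ge2:
  assumes \<kappa>: "\<And>k. pkernel (\<kappa> k)" and f: "bsupp f" and g: "bsupp g" 
    and p: "p \<ge> 2" "q > 1" "1/p + 1/q = 1" and e: "\<And>k. \<bar>e k\<bar> = 1"
  shows "chain_form \<kappa> e n f g \<le> (5 * (p - 1)) powr p / p * pmass_real p f + 1 / q * pmass_real q g"
proof -
  define K where "K = (5 * (p - 1)) powr p"
  have b: "bintegrable f" "bintegrable g" using f g by (auto intro: bsupp_bintegrable)
  have fp: "bintegrable (\<lambda>x. \<bar>f x\<bar> powr p)" and gq: "bintegrable (\<lambda>x. \<bar>g x\<bar> powr q)"
    using p by (auto intro!: bsupp_bintegrable bsupp_norm_powr f g)
  have i: "integrable lborel u" if "bintegrable u" for u using that by (simp add: bintegrable_def)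
  have le: "chainh \<kappa> e f g n x \<le> K / p * chain \<kappa> (\<lambda>x. \<bar>f x\<bar> powr p) n x + 1 / q * chain \<kappa> (\<lambda>x. \<bar>g x\<bar> powr q) n x" for x
  proof -
    \<comment> \<open>Starting the transform at y = 0 makes the boundary term nonpositive.\<close>
    have "2 / p * burkholder p (chain \<kappa> f n x) 0 \<le> 0" using p unfolding burkholder_def by (auto intro!: divide_nonpos_pos mult_nonpos_nonneg)
    then show ?thesis using chainh_le[of \<kappa> f g p q e 0 n x] \<kappa> b p e fp gq unfolding K_def by simp
  qed
  have "chain_form \<kappa> e n f g = (\<integral>x. chainh \<kappa> e f g n x \<partial>lborel)"
    unfolding chain_form_def using integral_chainh[OF \<kappa> b] by simp
  also have "\<dots> \<le> (\<integral>x. K / p * chain \<kappa> (\<lambda>x. \<bar>f x\<bar> powr p) n x + 1 / q * chain \<kappa> (\<lambda>x. \<bar>g x\<bar> powr q) n x \<partial>lborel)"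
    by (rule integral_mono[OF _ _ le]) 
       (intro i bintegrable_chainh \<kappa> b bintegrable_add bintegrable_cmult bintegrable_chain fp gq)+
  also have "\<dots> = K / p * pmass_real p f + 1 / q * pmass_real q g"
    by (subst Bochner_Integration.integral_add)
       (simp_all only: integral_mult_right_zero integrable_mult_right i bintegrable_chain[OF \<kappa> fp] bintegrable_chain[OF \<kappa> gq] pmass_real_def)
  finally show ?thesis unfolding K_def .
qed

lemma conv_cmult: "conv k (\<lambda>x. c * f x) = (\<lambda>x. c * conv k f x)"
  unfolding conv_def by (intro ext) (simp add: mult.left_commute)

lemma chain_cmult: "chain \<kappa> (\<lambda>x. c * f x) k = (\<lambda>x. c * chain \<kappa> f k x)"
  by (induction k) (simp_all add: conv_cmult)

lemma chain_form_swap: "chain_form \<kappa> e n f g = chain_form \<kappa> e n g f"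
  unfolding chain_form_def by (simp add: mult.commute)

lemma chain_form_scale: "c \<noteq> 0 \<Longrightarrow> chain_form \<kappa> e n (\<lambda>x. c * f x) (\<lambda>x. g x / c) = chain_form \<kappa> e n f g"
  unfolding chain_form_def using chain_cmult[of \<kappa> c f] chain_cmult[of \<kappa> "1/c" g] by (simp del: chain.simps)

text \<open>Below 2 the form is read with f and g exchanged, and the bound for q >= 2 is applied to
  l g and f / l. The scale l = 1 / (5 (q - 1)) leaves the mass of g with coefficient 1/q and gives f
  the factor (5 (q - 1))^p, where q - 1 = 1 / (p - 1).\<close>

lemma chain_form_le:
  assumes \<kappa>: "\<And>k. pkernel (\<kappa> k)" and f: "bsupp f" and g: "bsupp g" 
    and p: "p > 1" "q > 1" "1/p + 1/q = 1" and e: "\<And>k. \<bar>e k\<bar> = 1"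
  shows "chain_form \<kappa> e n f g \<le> (5 * (p + 1 / (p - 1))) powr p / p * pmass_real p f + pmass_real q g / q"
proof (cases "p \<ge> 2")
  case True
  have "chain_form \<kappa> e n f g \<le> (5 * (p - 1)) powr p / p * pmass_real p f + 1 / q * pmass_real q g"
    using True by (intro chain_form_le_ge2 assms) auto
  also have "(5 * (p - 1)) powr p / p * pmass_real p f \<le> (5 * (p + 1 / (p - 1))) powr p / p * pmass_real p f"
  proof -
    define r where "r = 1 / (p - 1)"
    have "0 \<le> r" using p by (simp add: r_def)
    then have "p - 1 \<le> p + r" by simp
    then have "5 * (p - 1) \<le> 5 * (p + r)" by (rule mult_left_mono) simp
    then have "5 * (p - 1) \<le> 5 * (p + 1 / (p - 1))" by (simp only: r_def)
    then show ?thesis using p pmass_real_nonneg[of p f] by (intro mult_right_mono divide_right_mono powr_mono2) auto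
  qed
  finally show ?thesis by simp
next
  case False
  have q1: "q - 1 = 1 / (p - 1)" using p by (simp add: field_simps)
  have "1 / (p - 1) \<ge> 1" using False p by (simp add: le_divide_eq)
  then have q2: "q \<ge> 2" using q1 by simp
  define l where "l = 1 / (5 * (q - 1))"
  have l: "l > 0" using p by (simp add: l_def)
  have bg: "bsupp (\<lambda>x. l * g x)" "bsupp (\<lambda>x. f x / l)"
    using bsupp_mult(2)[OF g, of "\<lambda>_. l"  "l"] bsupp_mult(1)[OF f, of "\<lambda>_. 1/l" "1/l"] l by auto
  have "chain_form \<kappa> e n f g = chain_form \<kappa> e n (\<lambda>x. l * g x) (\<lambda>x. f x / l)"
    using l chain_form_scale[of l] chain_form_swap[of \<kappa> e n f g] by simp
  also have "\<dots> \<le> (5 * (q - 1)) powr q / q * pmass_real q (\<lambda>x. l * g x) + 1 / p * pmass_real p (\<lambda>x. f x / l)"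
    using p by (intro chain_form_le_ge2 \<kappa> e bg q2) auto
  also have "\<dots> = (5 * (q - 1)) powr q * l powr q / q * pmass_real q g + (1/l) powr p / p * pmass_real p f"
    using pmass_real_cmult[of q l g] pmass_real_cmult[of p "1/l" f] l by simp
  also have "(5 * (q - 1)) powr q * l powr q = 1"
    using p by (simp add: l_def powr_mult[symmetric])
  also have "(1/l) powr p / p * pmass_real p f \<le> (5 * (p + 1 / (p - 1))) powr p / p * pmass_real p f"
    using p pmass_real_nonneg q1 by (intro mult_right_mono divide_right_mono powr_mono2) (auto simp: l_def)
  finally show ?thesis by simp
qed

section \<open>The Cauchy transform\<close>

lemma pichorides_ineq:
  fixes p \<theta> :: real
  assumes p: "1 < p" "p \<le> 2" and \<theta>: "\<bar>\<theta>\<bar> \<le> pi / 2"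
  shows "1 + 2 / \<bar>cos (p * pi / 2)\<bar> * cos (p * \<theta>) \<le> (2 * pi / \<bar>cos (p * pi / 2)\<bar> * cos \<theta>) powr p"
proof -
  define b where "b = \<bar>cos (p * pi / 2)\<bar>"
  define t where "t = \<bar>\<theta>\<bar>"
  have t: "0 \<le> t" "t \<le> pi / 2" using \<theta> by (auto simp: t_def)
  have ct: "cos (p * \<theta>) = cos (p * t)" "cos \<theta> = cos t" by (auto simp: t_def abs_if)
  have pp: "pi / 2 < p * pi / 2" "p * pi / 2 \<le> pi" using p by auto
  \<comment> \<open>For 1 < p <= 2 the angle p pi / 2 lies in (pi/2, pi]. At |\<theta>| = pi/2 the
    left-hand side of the claim is therefore 1 - 2 = -1, which leaves room for the linear estimates
    below.\<close>
  have neg: "cos (p * pi / 2) < 0"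
    using cos_gt_zero_pi[of "p * pi / 2 - pi"] pp by (simp add: cos_diff)
  have b: "b > 0" "cos (p * pi / 2) = - b" using neg by (auto simp: b_def)
  \<comment> \<open>The cosine is 1-Lipschitz; with the value -b at the end point this controls cos
    (p t) linearly in pi/2 - t.\<close>
  have 1: "\<bar>cos (p * t) - cos (p * pi / 2)\<bar> \<le> \<bar>p * t - p * pi / 2\<bar>"
  proof -
    have "norm (cos (p * t) - cos (p * pi / 2)) \<le> 1 * norm (p * t - p * pi / 2)"
      by (rule field_differentiable_bound[of UNIV cos "\<lambda>x. - sin x"]) 
         (auto intro!: derivative_eq_intros simp: abs_sin_le_one)
    then show ?thesis by simp
  qed
  have pt: "p * t \<le> p * (pi / 2)" using t p by (intro mult_left_mono) auto
  have "cos (p * t) \<le> - b + (p * pi / 2 - p * t)"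
    using 1 pt b by (simp add: abs_le_iff)
  also have "p * pi / 2 - p * t = p * (pi / 2 - t)" by (simp add: algebra_simps)
  also have "\<dots> \<le> 2 * (pi / 2 - t)" using t p by (intro mult_right_mono) auto
  \<comment> \<open>Jordan's inequality 2u / pi <= sin u, from concavity of the sine on
    [0, pi/2].\<close>
  also have "2 * (pi / 2 - t) \<le> pi * cos t"
  proof -
    have "2 / pi * (pi / 2 - t) \<le> sin (pi / 2 - t)"
    proof -
      have conv: "concave_on {0..pi/2} (sin :: real \<Rightarrow> real)"
        unfolding concave_on_def
        by (rule convex_on_realI[where f' = "\<lambda>x. - cos x"])
           (auto intro!: derivative_eq_intros cos_monotone_0_pi_le)
      define u where "u = 2 / pi * (pi / 2 - t)"
      have u: "0 \<le> u" "u \<le> 1" using t by (auto simp: u_def field_simps)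
      have "sin ((1 - u) *\<^sub>R 0 + u *\<^sub>R (pi / 2)) \<ge> (1 - u) * sin 0 + u * sin (pi / 2)"
        using concave_onD[OF conv u, of 0 "pi/2"] by simp
      moreover have "u * (pi / 2) = pi / 2 - t" by (simp add: u_def field_simps)
      ultimately have "u \<le> sin (pi / 2 - t)" by (simp only: real_scaleR_def) simp
      then show ?thesis unfolding u_def .
    qed
    then show ?thesis using sin_cos_eq[of "pi/2 - t"] by (simp add: field_simps)
  qed
  finally have c: "cos (p * t) \<le> - b + pi * cos t" by simp
  define T where "T = 2 * pi / b * cos t"
  have T0: "T \<ge> 0" unfolding T_def using b t by (intro mult_nonneg_nonneg cos_ge_zero) auto
  have "1 + 2 / b * cos (p * t) \<le> 1 + 2 / b * (- b + pi * cos t)"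
    using c b by (intro add_left_mono mult_left_mono) auto
  also have "\<dots> = T - 1" using b by (simp add: T_def field_simps)
  \<comment> \<open>The factor 2 in 2 / b is what produces T - 1 here: it is at most T^p for T >= 1
    and negative for T < 1.\<close>
  also have "T - 1 \<le> T powr p"
  proof (cases "T \<ge> 1")
    case True
    then have "T powr 1 \<le> T powr p" using p by (intro powr_mono) auto
    then show ?thesis using True by simp
  next
    case False
    then have "T - 1 \<le> 0" by simp
    then show ?thesis by (rule order_trans) simp
  qed
  finally show ?thesis unfolding ct T_def b_def by simp
qed

text \<open>The absolute value equals sin ((p - 1) pi / 2), which Jordan's inequality bounds below.
  This is the origin of the factor 1 / (p - 1).\<close>

lemma abs_cos_ge:
  fixes p :: real
  assumes p: "1 < p" "p \<le> 2"
  shows "p - 1 \<le> \<bar>cos (p * pi / 2)\<bar>"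
proof -
  have conv: "concave_on {0..pi/2} (sin :: real \<Rightarrow> real)"
    unfolding concave_on_def
    by (rule convex_on_realI[where f' = "\<lambda>x. - cos x"])
       (auto intro!: derivative_eq_intros cos_monotone_0_pi_le)
  have "sin ((1 - (p - 1)) *\<^sub>R 0 + (p - 1) *\<^sub>R (pi / 2)) \<ge> (1 - (p - 1)) * sin 0 + (p - 1) * sin (pi / 2)"
    using concave_onD[OF conv, of "p - 1" 0 "pi/2"] p by simp
  then have "p - 1 \<le> sin ((p - 1) * (pi / 2))" by simp
  moreover have "cos (p * pi / 2) = - sin ((p - 1) * (pi / 2))"
  proof -
    have "p * pi / 2 = (p - 1) * (pi / 2) + pi / 2" by (simp add: field_simps)
    moreover have "cos ((p - 1) * (pi / 2) + pi / 2) = - sin ((p - 1) * (pi / 2))"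
      unfolding cos_add cos_pi_half sin_pi_half by simp
    ultimately show ?thesis by (simp only:)
  qed
  ultimately show ?thesis by simp
qed

text \<open>The trigonometric inequality multiplied by |z|^p, in polar form. The coefficient of Re
  z^p may blow up as p tends to 1, because that term will integrate to zero.\<close>

lemma re_powr_ineq:
  fixes z :: complex
  assumes p: "1 < p" "p \<le> 2" and z: "Re z > 0"
  shows "cmod z powr p + 2 / \<bar>cos (p * pi / 2)\<bar> * Re (z powr of_real p) \<le> (2 * pi / (p - 1)) powr p * (Re z) powr p"
proof -
  define b where "b = \<bar>cos (p * pi / 2)\<bar>"
  have b: "p - 1 \<le> b" "b > 0" using abs_cos_ge[OF p] p by (auto simp: b_def)
  have z0: "z \<noteq> 0" using z by auto
  define r where "r = cmod z"
  have r: "r > 0" using z0 by (simp add: r_def)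
  have arg: "\<bar>Arg z\<bar> \<le> pi / 2" using Re_Ln_pos_lt[OF z0] z Arg_eq_Im_Ln[OF z0] by simp
  have zr: "z = of_real r * exp (\<i> * of_real (Arg z))"
    using Arg_eq[OF z0] by (simp add: r_def)
  have Rez: "Re z = r * cos (Arg z)" using arg_cong[OF zr, of Re] by (simp add: Re_exp)
  have "z powr of_real p = exp (of_real p * Ln z)" using z0 by (simp add: powr_def)
  also have "Re \<dots> = r powr p * cos (p * Arg z)"
    using z0 r by (simp add: Re_exp Arg_eq_Im_Ln powr_def r_def)
  finally have Rp: "Re (z powr of_real p) = r powr p * cos (p * Arg z)" .
  have cg: "cos (Arg z) \<ge> 0" using z r Rez by (simp add: zero_less_mult_iff)
  have "r powr p * (1 + 2 / b * cos (p * Arg z)) \<le> r powr p * (2 * pi / b * cos (Arg z)) powr p"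
    unfolding b_def by (intro mult_left_mono pichorides_ineq p arg) auto
  also have "(2 * pi / b * cos (Arg z)) powr p \<le> (2 * pi / (p - 1) * cos (Arg z)) powr p"
    using p b cg by (intro powr_mono2 mult_right_mono divide_left_mono) auto
  also have "r powr p * (2 * pi / (p - 1) * cos (Arg z)) powr p = (2 * pi / (p - 1)) powr p * (Re z) powr p"
    unfolding Rez by (simp only: powr_mult mult_ac)
  finally show ?thesis using r unfolding Rp b_def r_def[symmetric] by (simp add: algebra_simps mult_left_mono)
qed

text \<open>The inverse Fourier transform of the damped half-line symbol exp (-2 pi d \<xi>) on
  \<xi> > 0. As d tends to 0, a difference of two modulates becomes the kernel of a frequency
  band.\<close>

definition cauchy_kernel :: "real \<Rightarrow> real \<Rightarrow> complex" where
  "cauchy_kernel d x = \<i> / (2 * of_real pi * Complex x d)"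

lemma Complex_cont: "continuous_on UNIV (\<lambda>x. Complex x d)"
  unfolding Complex_eq by (intro continuous_intros)

lemma cauchy_kernel_measurable [measurable]: "cauchy_kernel d \<in> borel_measurable borel"
proof -
  have [measurable]: "(\<lambda>x. Complex x d) \<in> borel_measurable borel"
    by (intro borel_measurable_continuous_onI Complex_cont)
  show ?thesis unfolding cauchy_kernel_def by measurable
qed

lemma cauchy_kernel_bound: "d > 0 \<Longrightarrow> cmod (cauchy_kernel d x) \<le> 1 / (2 * pi * d)"
  using abs_Im_le_cmod[of "Complex x d"]
  unfolding cauchy_kernel_def by (auto simp: norm_divide norm_mult intro!: divide_left_mono mult_left_mono mult_pos_pos)

text \<open>This symmetry expresses that the symbol is real; it makes the convolution self-adjoint,
  which the duality argument uses.\<close>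

lemma cauchy_kernel_adjoint: "cnj (cauchy_kernel d (- x)) = cauchy_kernel d x"
proof -
  have "cnj (Complex (-x) d) = - Complex x d" by (simp add: complex_eq_iff)
  then show ?thesis unfolding cauchy_kernel_def by simp
qed

text \<open>The Cauchy integral \<open>F\<close> of a density \<open>g \<ge> 0\<close> has positive real part, so \<open>F\<^sup>p\<close> is holomorphic and
  has integral zero along horizontal lines.\<close>

definition cauchy_int :: "(real \<Rightarrow> real) \<Rightarrow> complex \<Rightarrow> complex" where
  "cauchy_int g z = (\<integral>y. of_real (g y) * (\<i> / (of_real pi * (z - of_real y))) \<partial>lborel)"

lemma cauchy_int_conv: "cauchy_int g (Complex x d) = 2 * conv (cauchy_kernel d) (\<lambda>y. of_real (g y)) x"
proof -
  have "Complex (x - y) d = Complex x d - of_real y" for y by (simp add: complex_eq_iff)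
  from this[symmetric] have "of_real (g y) * (\<i> / (of_real pi * (Complex x d - of_real y))) = 2 * (cauchy_kernel d (x - y) * of_real (g y))" for y
    unfolding cauchy_kernel_def by simp
  then show ?thesis unfolding cauchy_int_def conv_def by simp
qed

lemma cauchy_int_kernel_bound:
  assumes "Im z > 0"
  shows "z \<noteq> of_real y" "Im z \<le> cmod (z - of_real y)"
  using abs_Im_le_cmod[of "z - of_real y"] assms by (auto simp: complex_eq_iff)

lemma cauchy_int_integrable:
  assumes g: "bsupp g" and z: "Im z > 0"
  shows "integrable lborel (\<lambda>y. of_real (g y) * (\<i> / (of_real pi * (z - of_real y))))"
proof -
  have gm [measurable]: "g \<in> borel_measurable borel" using g by (rule bsupp_measurable)
  have i: "integrable lborel (\<lambda>y. norm (g y) * (1 / (pi * Im z)))" using bsupp_integrable[OF g] by simp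
  show ?thesis
  proof (rule Bochner_Integration.integrable_bound[OF i])
    show "AE y in lborel. norm (of_real (g y) * (\<i> / (of_real pi * (z - of_real y)))) \<le> norm (norm (g y) * (1 / (pi * Im z)))"
    proof (rule AE_I2)
      fix y
      have "1 / (pi * cmod (z - of_real y)) \<le> 1 / (pi * Im z)"
        using cauchy_int_kernel_bound[OF z, of y] z by (intro divide_left_mono mult_left_mono mult_pos_pos) auto
      then show "norm (of_real (g y) * (\<i> / (of_real pi * (z - of_real y)))) \<le> norm (norm (g y) * (1 / (pi * Im z)))"
        using z by (simp add: norm_mult norm_divide abs_mult mult_left_mono del: times_divide_eq_right mult_1_right)
    qed
  qed measurable
qed

lemma cauchy_int_holomorphic:
  assumes g: "bsupp g"
  shows "cauchy_int g holomorphic_on {z. Im z > 0}"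
proof -
  have gm [measurable]: "g \<in> borel_measurable borel" using g by (rule bsupp_measurable)
  have "\<exists>D. (cauchy_int g has_field_derivative D) (at z)" if z: "Im z > 0" for z
  proof -
    \<comment> \<open>Half the height above the real axis, so that z + h with |h| < e stays above
      height e and all denominators are bounded below.\<close>
    define e where "e = Im z / 2"
    have e: "e > 0" "Im z = 2 * e" using z by (auto simp: e_def)
    define k where "k w y = \<i> / (of_real pi * (w - complex_of_real y))" for w y
    define D where "D = (\<integral>y. of_real (g y) * (- \<i> / (of_real pi * (z - of_real y)^2)) \<partial>lborel)"
    have [measurable]: "k w \<in> borel_measurable borel" for w unfolding k_def by measurable
    have ge: "cmod (z - of_real y) \<ge> e" for y using cauchy_int_kernel_bound[OF z, of y] e by simp
    have ige: "1 / cmod (z - of_real y) \<le> 1 / e" for y 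
      using ge[of y] e by (intro divide_left_mono mult_pos_pos) (auto intro: less_le_trans)
    have ki: "integrable lborel (\<lambda>y. of_real (g y) * k w y)" if "Im w > 0" for w
      using cauchy_int_integrable[OF g that] unfolding k_def .
    have Di: "integrable lborel (\<lambda>y. of_real (g y) * (- \<i> / (of_real pi * (z - of_real y)^2)))"
    proof (rule Bochner_Integration.integrable_bound)
      show "integrable lborel (\<lambda>y. norm (g y) * (1 / (pi * e^2)))" using bsupp_integrable[OF g] by simp
      show "AE y in lborel. norm (of_real (g y) * (- \<i> / (of_real pi * (z - of_real y)^2))) \<le> norm (norm (g y) * (1 / (pi * e^2)))"
      proof (rule AE_I2)
        fix y
        have "1 / (pi * (cmod (z - of_real y))^2) \<le> 1 / (pi * e^2)"
          using ge[of y] e by (intro divide_left_mono mult_left_mono mult_pos_pos power_mono) (auto intro: less_le_trans zero_less_power)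
        then show "norm (of_real (g y) * (- \<i> / (of_real pi * (z - of_real y)^2))) \<le> norm (norm (g y) * (1 / (pi * e^2)))"
          by (simp add: norm_mult norm_divide norm_power abs_mult mult_left_mono del: times_divide_eq_right mult_1_right)
      qed
    qed measurable
    define C where "C = (\<integral>y. norm (g y) \<partial>lborel) / (pi * e^3)"
    \<comment> \<open>With a = z - y, the error of the difference quotient of the kernel is exactly
      i h / (pi a^2 (a + h)), so it is O(|h|) uniformly in y.\<close>
    have bd: "cmod ((cauchy_int g (z + h) - cauchy_int g z) / h - D) \<le> cmod h * C" if h: "h \<noteq> 0" "cmod h < e" for h
    proof -
      have Imh: "Im (z + h) > e" using abs_Im_le_cmod[of h] h e by simp
      then have Imh0: "Im (z + h) > 0" using e by simp
      have ptw: "cmod ((of_real (g y) * k (z + h) y - of_real (g y) * k z y) / h - of_real (g y) * (- \<i> / (of_real pi * (z - of_real y)^2)))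
           \<le> norm (g y) * (cmod h / (pi * e^3))" for y
      proof -
        define a where "a = z - of_real y"
        have a: "a \<noteq> 0" "cmod a \<ge> e" using ge[of y] e by (auto simp: a_def)
        have ah: "a + h \<noteq> 0" "cmod (a + h) \<ge> e" 
          using cauchy_int_kernel_bound[OF Imh0, of y] Imh e by (auto simp: a_def algebra_simps)
        have "(k (z + h) y - k z y) / h - (- \<i> / (of_real pi * (z - of_real y)^2)) = \<i> * h / (of_real pi * (a^2 * (a + h)))"
        proof -
          have "k (z + h) y = \<i> / (of_real pi * (a + h))" "k z y = \<i> / (of_real pi * a)" by (simp_all add: k_def a_def algebra_simps)
          then show ?thesis unfolding a_def[symmetric] using a ah h by (simp add: divide_simps power2_eq_square) (simp add: algebra_simps)
        qed
        then have eq: "(of_real (g y) * k (z + h) y - of_real (g y) * k z y) / h - of_real (g y) * (- \<i> / (of_real pi * (z - of_real y)^2))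
            = of_real (g y) * (\<i> * h / (of_real pi * (a^2 * (a + h))))"
          by (metis (no_types, lifting) right_diff_distrib times_divide_eq_right)
        have "e^3 \<le> (cmod a)^2 * cmod (a + h)"
          unfolding power3_eq_cube power2_eq_square using a ah e by (intro mult_mono) auto
        then have "cmod h / (pi * ((cmod a)^2 * cmod (a + h))) \<le> cmod h / (pi * e^3)"
          using e a ah by (intro divide_left_mono mult_left_mono mult_pos_pos) auto
        then show ?thesis unfolding eq by (simp add: norm_mult norm_divide norm_power mult_left_mono del: times_divide_eq_right)
      qed
      have "(cauchy_int g (z + h) - cauchy_int g z) / h - D = (\<integral>y. (of_real (g y) * k (z + h) y - of_real (g y) * k z y) / h - of_real (g y) * (- \<i> / (of_real pi * (z - of_real y)^2)) \<partial>lborel)"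
        unfolding D_def cauchy_int_def k_def[symmetric] using ki[OF z] ki[OF Imh0] Di by simp
      also have "cmod \<dots> \<le> (\<integral>y. norm (g y) * (cmod h / (pi * e^3)) \<partial>lborel)"
      proof (rule Bochner_Integration.integral_norm_bound_integral)
        show "integrable lborel (\<lambda>y. (of_real (g y) * k (z + h) y - of_real (g y) * k z y) / h - of_real (g y) * (- \<i> / (of_real pi * (z - of_real y)^2)))"
          using ki[OF z] ki[OF Imh0] Di by simp
        show "integrable lborel (\<lambda>y. norm (g y) * (cmod h / (pi * e^3)))" using bsupp_integrable[OF g] by simp
      qed (rule ptw)
      finally show ?thesis by (simp add: C_def field_simps)
    qed
    have "((\<lambda>h. (cauchy_int g (z + h) - cauchy_int g z) / h) \<longlongrightarrow> D) (at 0)"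
    proof (rule Lim_transform[of "\<lambda>_. D"])
      have "((\<lambda>h. cmod h * C) \<longlongrightarrow> 0) (at (0::complex))" by (auto intro!: tendsto_eq_intros)
      then show "((\<lambda>h. (cauchy_int g (z + h) - cauchy_int g z) / h - D) \<longlongrightarrow> 0) (at 0)"
        by (rule Lim_null_comparison[rotated])
           (use bd e in \<open>auto simp: eventually_at intro!: exI[of _ e]\<close>)
    qed simp
    then have "(cauchy_int g has_field_derivative D) (at z)" unfolding DERIV_def .
    then show ?thesis by blast
  qed
  then show ?thesis unfolding holomorphic_on_def field_differentiable_def
    using has_field_derivative_at_within by blast
qed

text \<open>Jensen's inequality for the density \<open>k\<close>, by integrating the tangent line of
  t^p at the mean m; the division by m is why m = 0 is a separate case.\<close>

lemma conv_Jensen: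
  assumes k: "pkernel k" and g: "bsupp g" and g0: "\<And>x. g x \<ge> 0" and p: "p > 1"
  shows "(conv k g x) powr p \<le> conv k (\<lambda>y. g y powr p) x" 
proof -
  define m where "m = conv k g x"
  have ki: "integrable lborel k" "\<And>x. k x \<ge> 0" "(\<integral>x. k x \<partial>lborel) = 1" using k by (auto simp: pkernel_def)
  have m0: "m \<ge> 0" unfolding m_def conv_def using ki g0 by (intro Bochner_Integration.integral_nonneg mult_nonneg_nonneg) auto
  define w where "w y = k (x - y)" for y
  have wint: "integrable lborel w" "(\<integral>y. w y \<partial>lborel) = 1"
    unfolding w_def using ki lborel_integrable_shift[of k x] lborel_integral_shift[of k x] by auto
  have wi: "integrable lborel (\<lambda>z. w z * u z)" if "bintegrable u" for u
    using that unfolding w_def by (elim bintegrableE) (rule conv_integrable_bounded(1)[OF ki(1)])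
  have wc: "(\<integral>z. w z * u z \<partial>lborel) = conv k u x" for u unfolding w_def conv_def by simp
  have bg: "bintegrable g" "bintegrable (\<lambda>y. g y powr p)"
    using g bsupp_norm_powr[OF g, of p] p g0 by (auto intro!: bsupp_bintegrable)
  show ?thesis
  proof (cases "m = 0")
    case True
    have "conv k (\<lambda>y. g y powr p) x \<ge> 0" unfolding conv_def using ki 
      by (intro Bochner_Integration.integral_nonneg mult_nonneg_nonneg) auto
    then show ?thesis using True p by (simp add: m_def[symmetric])
  next
    case False
    then have m: "m > 0" using m0 by simp
    have ptw: "(m powr p * (1 - p)) * w y + (m powr p * p / m) * (w y * g y) \<le> w y * (g y powr p)" for y
    proof -
      have "1 + p * (g y / m - 1) \<le> (g y / m) powr p" using g0[of y] m p by (intro Bernoulli_powr(1)) auto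
      also have "\<dots> = g y powr p / m powr p" by (rule powr_divide)
      finally have "m powr p * (1 + p * (g y / m - 1)) \<le> m powr p * (g y powr p / m powr p)" by (intro mult_left_mono) auto
      then have "m powr p * (1 + p * (g y / m - 1)) \<le> g y powr p" using m by simp
      then have "w y * (m powr p * (1 + p * (g y / m - 1))) \<le> w y * (g y powr p)" unfolding w_def using ki by (intro mult_left_mono) auto
      then show ?thesis by (simp add: algebra_simps)
    qed
    have "(\<integral>y. (m powr p * (1 - p)) * w y + (m powr p * p / m) * (w y * g y) \<partial>lborel) \<le> (\<integral>y. w y * (g y powr p) \<partial>lborel)"
      by (rule integral_mono[OF _ _ ptw]) (intro Bochner_Integration.integrable_add integrable_mult_right wi bg wint(1))+
    also have "(\<integral>y. (m powr p * (1 - p)) * w y + (m powr p * p / m) * (w y * g y) \<partial>lborel) = (m powr p * (1 - p)) * 1 + (m powr p * p / m) * m"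
      by (subst Bochner_Integration.integral_add) (simp_all only: integrable_mult_right wi bg wint integral_mult_right_zero wc m_def)
    finally show ?thesis using m unfolding wc m_def[symmetric] by (simp add: algebra_simps)
  qed
qed

lemma pmass_conv_pkernel:
  assumes k: "pkernel k" and g: "bsupp g" and g0: "\<And>x. g x \<ge> 0" and p: "p > 1"
  shows "pmass p (conv k g) \<le> ennreal (pmass_real p g)"
proof -
  have ki: "\<And>x. k x \<ge> 0" using k by (auto simp: pkernel_def)
  have c0: "conv k g x \<ge> 0" for x unfolding conv_def using ki g0 by (intro Bochner_Integration.integral_nonneg mult_nonneg_nonneg) auto
  have bg: "bintegrable (\<lambda>y. g y powr p)" using bsupp_norm_powr[OF g, of p] p g0 by (auto intro!: bsupp_bintegrable)
  have c1: "conv k (\<lambda>y. g y powr p) x \<ge> 0" for x unfolding conv_def using ki by (intro Bochner_Integration.integral_nonneg mult_nonneg_nonneg) auto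
  have "pmass p (conv k g) \<le> (\<integral>\<^sup>+x. ennreal (conv k (\<lambda>y. g y powr p) x) \<partial>lborel)"
    unfolding pmass_def using conv_Jensen[OF k g g0 p] c0 by (intro nn_integral_mono ennreal_leI) simp
  also have "\<dots> = ennreal (\<integral>x. conv k (\<lambda>y. g y powr p) x \<partial>lborel)"
    using bintegrable_conv(1)[OF k bg] c1 by (intro nn_integral_eq_integral) (auto simp: bintegrable_def)
  also have "\<dots> = ennreal (pmass_real p g)"
    unfolding pmass_real_def using bintegrable_conv(2)[OF k bg] g0 by simp
  finally show ?thesis .
qed

section \<open>Poisson averages as the real part of the Cauchy integral\<close>

definition poisson :: "real \<Rightarrow> real \<Rightarrow> real" where
  "poisson d x = d / (pi * (x\<^sup>2 + d\<^sup>2))"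

lemma pkernel_poisson:
  assumes d: "d > 0"
  shows "pkernel (poisson d)"
proof -
  have i: "integrable lborel (\<lambda>x. inverse (1 + x^2) :: real)"
    using integrable_inverse_1_plus_square by (simp add: set_integrable_def)
  have v: "(\<integral>x. inverse (1 + x^2) \<partial>lborel) = pi"
    using LBINT_inverse_1_plus_square by (simp add: interval_lebesgue_integral_def set_lebesgue_integral_def)
  have eq: "poisson d (0 + d * x) = 1 / (pi * d) * inverse (1 + x^2)" for x
  proof -
    have "(0 + d * x)\<^sup>2 + d\<^sup>2 = d * (d * (1 + x^2))" by (simp add: power2_eq_square algebra_simps)
    then show ?thesis using d by (simp add: poisson_def inverse_eq_divide)
  qed
  have "integrable lborel (\<lambda>x. poisson d (0 + d * x))" unfolding eq using i by simp
  then have 1: "integrable lborel (poisson d)" using lborel_integrable_real_affine_iff[of d "poisson d" 0] d by simp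
  have "(\<integral>x. poisson d x \<partial>lborel) = \<bar>d\<bar> *\<^sub>R (\<integral>x. poisson d (0 + d * x) \<partial>lborel)"
    using d by (intro lborel_integral_real_affine) auto
  also have "\<dots> = 1" unfolding eq using v d by simp
  finally show ?thesis using 1 d by (simp add: pkernel_def poisson_def)
qed

lemma Re_cauchy_int:
  assumes g: "bsupp g" and d: "d > 0"
  shows "Re (cauchy_int g (Complex x d)) = conv (poisson d) g x"
proof -
  have "Re (cauchy_int g (Complex x d)) = (\<integral>y. Re (of_real (g y) * (\<i> / (of_real pi * (Complex x d - of_real y)))) \<partial>lborel)"
    unfolding cauchy_int_def by (intro integral_Re[symmetric] cauchy_int_integrable[OF g]) (use d in simp)
  also have "\<dots> = conv (poisson d) g x" unfolding conv_def
  proof (intro Bochner_Integration.integral_cong refl)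
    fix y
    have "Complex x d - of_real y = Complex (x - y) d" by (simp add: complex_eq_iff)
    then have "Re (\<i> / (of_real pi * (Complex x d - of_real y))) = poisson d (x - y)"
      using d by (simp add: poisson_def Re_divide power2_eq_square power_mult_distrib divide_simps) 
         (simp add: algebra_simps)
    then show "Re (of_real (g y) * (\<i> / (of_real pi * (Complex x d - of_real y)))) = poisson d (x - y) * g y"
      by (simp del: times_divide_eq_right add: mult.commute)
  qed
  finally show ?thesis .
qed

text \<open>Strict positivity keeps the values off the branch cut of the power. The Poisson density
  is positive everywhere, so its average against g vanishes only if g is zero almost
  everywhere.\<close>

lemma Re_cauchy_int_pos:
  assumes g: "bsupp g" and g0: "\<And>x. g x \<ge> 0" and ne: "(\<integral>x. g x \<partial>lborel) \<noteq> 0" and z: "Im z > 0"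
  shows "Re (cauchy_int g z) > 0"
proof -
  define d where "d = Im z"
  have d: "d > 0" using z by (simp add: d_def)
  have zz: "z = Complex (Re z) d" by (simp add: d_def)
  have pos: "poisson d u > 0" for u unfolding poisson_def using d by (intro divide_pos_pos mult_pos_pos add_nonneg_pos) auto
  have i: "integrable lborel (\<lambda>y. poisson d (Re z - y) * g y)"
    using bintegrableE[OF bsupp_bintegrable[OF g]] conv_integrable_bounded(1)[of "poisson d" g] pkernel_poisson[OF d] unfolding pkernel_def by metis
  have ge: "conv (poisson d) g (Re z) \<ge> 0" unfolding conv_def
    using pos g0 by (intro Bochner_Integration.integral_nonneg mult_nonneg_nonneg) (auto intro: less_imp_le)
  have "conv (poisson d) g (Re z) \<noteq> 0"
  proof
    assume "conv (poisson d) g (Re z) = 0"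
    then have "AE y in lborel. poisson d (Re z - y) * g y = 0"
      using i pos g0 unfolding conv_def by (subst (asm) integral_nonneg_eq_0_iff_AE) (auto intro!: AE_I2 mult_nonneg_nonneg intro: less_imp_le)
    then have "AE y in lborel. g y = 0"
      by eventually_elim (metis pos less_irrefl mult_eq_0_iff)
    then have "(\<integral>x. g x \<partial>lborel) = 0" by (rule integral_eq_zero_AE)
    then show False using ne by simp
  qed
  then show ?thesis using ge Re_cauchy_int[OF g d, of "Re z"] zz by simp
qed

text \<open>For |z| >= 2R + 1 the distance from z to the support is at least |z| / 2. As p > 1, the
  p-th power then decays faster than the length of a half-circle grows.\<close>

lemma cauchy_int_decay:
  assumes g: "bsupp g" 
  obtains R0 C where "R0 > 0" "C \<ge> 0" "\<And>z. cmod z \<ge> R0 \<Longrightarrow> cmod (cauchy_int g z) \<le> C / cmod z"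
proof -
  obtain M R where MR: "M \<ge> 0" "R \<ge> 0" "\<And>x. norm (g x) \<le> M" "\<And>x. R < \<bar>x\<bar> \<Longrightarrow> g x = 0"
    using bsuppE[OF g] by blast
  define C where "C = 2 / pi * (\<integral>y. norm (g y) \<partial>lborel)"
  show ?thesis
  proof (rule that[of "2 * R + 1" C])
    show "C \<ge> 0" unfolding C_def by simp
    fix z assume z: "cmod z \<ge> 2 * R + 1"
    then have z0: "cmod z > 0" using MR(2) by linarith
    have [measurable]: "g \<in> borel_measurable borel" using g by (rule bsupp_measurable)
    have ptw: "cmod (of_real (g y) * (\<i> / (of_real pi * (z - of_real y)))) \<le> 2 / (pi * cmod z) * norm (g y)" for y
    proof (cases "\<bar>y\<bar> \<le> R")
      case True
      have "cmod z \<le> cmod (z - of_real y) + \<bar>y\<bar>" using norm_triangle_ineq[of "z - of_real y" "of_real y"] by simp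
      then have "cmod z / 2 \<le> cmod (z - of_real y)" using True z by simp
      then have "1 / (pi * cmod (z - of_real y)) \<le> 1 / (pi * (cmod z / 2))"
        using z0 by (intro divide_left_mono mult_left_mono mult_pos_pos) auto
      then have "norm (g y) * (1 / (pi * cmod (z - of_real y))) \<le> norm (g y) * (1 / (pi * (cmod z / 2)))" by (intro mult_left_mono) auto
      then show ?thesis by (simp add: norm_mult norm_divide mult_ac)
    qed (use MR(4)[of y] in simp)
    have ig: "integrable lborel (\<lambda>y. 2 / (pi * cmod z) * norm (g y))" using bsupp_integrable[OF g] by simp
    have "integrable lborel (\<lambda>y. of_real (g y) * (\<i> / (of_real pi * (z - of_real y))))"
      by (rule Bochner_Integration.integrable_bound[OF ig]) (use ptw order_trans[OF _ abs_ge_self] in auto)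
    then have "cmod (cauchy_int g z) \<le> (\<integral>y. 2 / (pi * cmod z) * norm (g y) \<partial>lborel)"
      unfolding cauchy_int_def using ig ptw by (intro Bochner_Integration.integral_norm_bound_integral) auto
    then show "cmod (cauchy_int g z) \<le> C / cmod z" by (simp add: C_def field_simps)
  qed (use MR in auto)
qed

text \<open>The integral over the line is asserted only as a limit over symmetric intervals, so
  integrability of the power need not be known yet. Cauchy's theorem replaces the segment by a
  half-circle of length pi R, on which the integrand is O(R^(-p)).\<close>

lemma cauchy_int_powr_integral:
  assumes g: "bsupp g" and g0: "\<And>x. g x \<ge> 0" and ne: "(\<integral>x. g x \<partial>lborel) \<noteq> 0" and d: "d > 0" and p: "p > 1"
  shows "\<exists>I. (I \<longlongrightarrow> 0) at_top \<and> (\<forall>R>0. ((\<lambda>x. cauchy_int g (Complex x d) powr of_real p) has_integral I R) {-R..R})"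
proof -
  \<comment> \<open>The vertical shift by d is built into \<open>G\<close>, so the segment lies on
    the real axis, well inside the half-plane \<open>S\<close> of holomorphy.\<close>
  define G where "G w = cauchy_int g (w + \<i> * of_real d) powr of_real p" for w
  define S where "S = {w. Im w > - d}"
  have S: "open S" "convex S" unfolding S_def by (auto simp: open_halfspace_Im_gt convex_halfspace_Im_gt)
  have GS: "G holomorphic_on S"
    unfolding G_def
  proof (rule holomorphic_on_powr)
    have "(cauchy_int g \<circ> (\<lambda>w. w + \<i> * of_real d)) holomorphic_on S"
      by (rule holomorphic_on_compose_gen[OF _ cauchy_int_holomorphic[OF g]]) (auto intro!: holomorphic_intros simp: S_def)
    then show "(\<lambda>w. cauchy_int g (w + \<i> * of_real d)) holomorphic_on S" by (simp add: o_def)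
    show "cauchy_int g (x + \<i> * of_real d) \<notin> \<real>\<^sub>\<le>\<^sub>0" if "x \<in> S" for x
      using Re_cauchy_int_pos[OF g g0 ne, of "x + \<i> * of_real d"] that by (auto simp: S_def complex_nonpos_Reals_iff)
  qed simp
  obtain R0 C where C: "R0 > 0" "C \<ge> 0" "\<And>z. cmod z \<ge> R0 \<Longrightarrow> cmod (cauchy_int g z) \<le> C / cmod z"
    using cauchy_int_decay[OF g] by blast
  have "\<exists>I. ((\<lambda>x. cauchy_int g (Complex x d) powr of_real p) has_integral I) {-R..R} \<and> (R \<ge> 2 * d + 2 * R0 \<longrightarrow> cmod I \<le> (2 * C / R) powr p * R * pi)" if R: "R > 0" for R
  proof -
    let ?l = "linepath (of_real (-R)) (of_real R)" and ?c = "part_circlepath 0 R 0 pi"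
    have pc: "path_image ?c \<subseteq> {w. cmod w = R \<and> Im w \<ge> 0}"
      using R by (auto simp: path_image_part_circlepath' closed_segment_eq_real_ivl exp_Euler norm_mult sin_ge_zero Im_exp image_iff)
    have cS: "path_image ?c \<subseteq> S" using pc d by (auto simp: S_def)
    have lS: "path_image ?l \<subseteq> S" unfolding path_image_linepath using d by (intro closed_segment_subset S(2)) (auto simp: S_def)
    have ends: "pathfinish ?l = pathstart ?c" "pathfinish ?c = pathstart ?l" 
      by (auto simp: exp_pi_i)
    have lI: "G contour_integrable_on ?l" by (rule contour_integrable_holomorphic_simple[OF GS S(1) _ lS]) simp
    have cI: "G contour_integrable_on ?c" by (rule contour_integrable_holomorphic_simple[OF GS S(1) _ cS]) simp
    have "(G has_contour_integral 0) (?l +++ ?c)"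
      by (rule Cauchy_theorem_convex_simple[OF GS S(2)]) (use ends cS lS path_image_join_subset[of ?l ?c] in \<open>auto intro!: valid_path_join\<close>)
    then have sum0: "contour_integral ?l G + contour_integral ?c G = 0"
      using contour_integral_join[OF lI cI] contour_integral_unique by fastforce
    define I where "I = contour_integral ?l G"
    have "(G has_contour_integral I) ?l" unfolding I_def by (rule has_contour_integral_integral[OF lI])
    then have "((\<lambda>x. G (of_real x)) has_integral I) {-R..R}"
      using has_contour_integral_linepath_Reals_iff[of "of_real (-R)" "of_real R" G I] R by simp
    moreover have "of_real x + \<i> * of_real d = Complex x d" for x by (simp add: complex_eq_iff)
    ultimately have 1: "((\<lambda>x. cauchy_int g (Complex x d) powr of_real p) has_integral I) {-R..R}" unfolding G_def by simp
    have 2: "cmod I \<le> (2 * C / R) powr p * R * pi" if RR: "R \<ge> 2 * d + 2 * R0"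
    proof -
      have "cmod (contour_integral ?c G) \<le> (2 * C / R) powr p * R * (pi - 0)"
      proof (rule has_contour_integral_bound_part_circlepath[OF has_contour_integral_integral[OF cI]])
        fix w assume "w \<in> path_image ?c"
        then have w: "cmod w = R" "w \<in> S" using pc cS by auto
        define z where "z = w + \<i> * of_real d"
        have "cmod w \<le> cmod z + d" using norm_triangle_ineq4[of z "\<i> * of_real d"] d by (simp add: z_def norm_mult)
        then have z: "cmod z \<ge> R / 2" "cmod z \<ge> R0" using RR w d C(1) by auto
        have "cmod (cauchy_int g z) \<le> C / cmod z" using C(3) z by simp
        also have "\<dots> \<le> C / (R / 2)" using z R C(2) by (intro divide_left_mono mult_pos_pos) auto
        finally have "cmod (cauchy_int g z) \<le> 2 * C / R" by (simp add: mult.commute)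
        moreover have "cauchy_int g z \<noteq> 0" using Re_cauchy_int_pos[OF g g0 ne, of z] w(2) by (auto simp: z_def S_def)
        then have "cmod (G w) = cmod (cauchy_int g z) powr p" unfolding G_def z_def[symmetric] by (simp add: norm_powr_real_powr')
        ultimately show "cmod (G w) \<le> (2 * C / R) powr p" using p by (auto intro!: powr_mono2)
      qed (use R in auto)
      moreover have "I = - contour_integral ?c G" using sum0 unfolding I_def by (simp add: eq_neg_iff_add_eq_0)
      ultimately show ?thesis by simp
    qed
    show ?thesis using 1 2 by blast
  qed
  then obtain I where I: "\<And>R. R > 0 \<Longrightarrow> ((\<lambda>x. cauchy_int g (Complex x d) powr of_real p) has_integral I R) {-R..R}"
     "\<And>R. R > 0 \<Longrightarrow> R \<ge> 2 * d + 2 * R0 \<Longrightarrow> cmod (I R) \<le> (2 * C / R) powr p * R * pi" by metis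
  have "(I \<longlongrightarrow> 0) at_top"
  proof (rule Lim_null_comparison)
    show "\<forall>\<^sub>F R in at_top. cmod (I R) \<le> (2 * C) powr p * pi * R powr (1 - p)"
      using eventually_ge_at_top[of "2 * d + 2 * R0"]
    proof eventually_elim
      case (elim R)
      then have R: "R > 0" using d C(1) by linarith
      have "R powr (1 - p) = R / R powr p" using R by (simp add: powr_diff)
      then show ?case using I(2)[OF R elim] R by (simp add: powr_divide mult_ac)
    qed
    have "((\<lambda>R. R powr (1 - p)) \<longlongrightarrow> 0) at_top" using p by (intro tendsto_neg_powr filterlim_ident) auto
    then show "((\<lambda>R. (2 * C) powr p * pi * R powr (1 - p)) \<longlongrightarrow> 0) at_top" by (auto intro: tendsto_mult_right_zero)
  qed
  then show ?thesis using I(1) by blast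
qed

text \<open>A bridge between the gauge integral, in which the contour argument delivers its result,
  and the Lebesgue integrals that define the masses.\<close>

lemma nn_integral_Icc_continuous:
  fixes v :: "real \<Rightarrow> real"
  assumes "continuous_on UNIV v" "\<And>x. v x \<ge> 0"
  shows "(\<integral>\<^sup>+x. ennreal (indicator {a..b} x * v x) \<partial>lborel) = ennreal (integral {a..b} v)"
proof -
  have "set_integrable lborel {a..b} v"
    by (rule borel_integrable_atLeastAtMost') (use assms continuous_on_subset in blast)
  then have i: "integrable lborel (\<lambda>x. indicator {a..b} x * v x)" and e: "(\<integral>x. indicator {a..b} x * v x \<partial>lborel) = integral {a..b} v"
    using set_borel_integral_eq_integral(2)[of "{a..b}" v] by (auto simp: set_integrable_def set_lebesgue_integral_def)
  show ?thesis unfolding e[symmetric] using assms by (intro nn_integral_eq_integral i) auto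
qed

text \<open>The pointwise inequality is integrated over [-R, R]: the integral of Re F^p tends to
  zero, and Re F is a Poisson average of g, whose mass Jensen bounds by that of g. The Cauchy kernel
  yields F / 2, which turns 2 pi / (p - 1) into pi / (p - 1).\<close>

lemma cauchy_kernel_nonneg:
  assumes g: "bsupp g" and g0: "\<And>x. g x \<ge> 0" and d: "d > 0" and p: "1 < p" "p \<le> 2"
  shows "pmass p (\<lambda>x. cmod (conv (cauchy_kernel d) (\<lambda>y. of_real (g y)) x)) \<le> ennreal ((pi / (p - 1)) powr p * pmass_real p g)"
proof (cases "(\<integral>x. g x \<partial>lborel) = 0")
  case True
  have "AE y in lborel. g y = 0"
    using True g0 bsupp_integrable[OF g] by (subst (asm) integral_nonneg_eq_0_iff_AE) auto
  then have "conv (cauchy_kernel d) (\<lambda>y. of_real (g y)) x = 0" for x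
    unfolding conv_def by (intro integral_eq_zero_AE) (auto elim: eventually_mono)
  then show ?thesis using p by (simp add: pmass_def)
next
  case False
  define F where "F x = cauchy_int g (Complex x d)" for x
  define A where "A = (2 * pi / (p - 1)) powr p"
  define B where "B = 2 / \<bar>cos (p * pi / 2)\<bar>"
  have B0: "B \<ge> 0" by (simp add: B_def)
  have Fpos: "Re (F x) > 0" for x unfolding F_def by (rule Re_cauchy_int_pos[OF g g0 False]) (use d in simp)
  have Fc: "continuous_on UNIV F"
  proof -
    have "continuous_on {z. Im z > 0} (cauchy_int g)" by (rule holomorphic_on_imp_continuous_on[OF cauchy_int_holomorphic[OF g]])
    then have "continuous_on UNIV (\<lambda>x. cauchy_int g (Complex x d))"
      by (rule continuous_on_compose2[OF _ Complex_cont]) (use d in auto)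
    then show ?thesis unfolding F_def .
  qed
  have F0: "F x \<noteq> 0" for x using Fpos[of x] by auto
  have c1: "continuous_on UNIV (\<lambda>x. cmod (F x) powr p)"
    using Fc F0 by (intro continuous_on_powr continuous_intros) auto
  have c2: "continuous_on UNIV (\<lambda>x. Re (F x) powr p)"
    using Fc Fpos by (intro continuous_on_powr continuous_intros) (auto simp: less_imp_neq[symmetric])
  obtain I where I: "(I \<longlongrightarrow> 0) at_top" "\<And>R. R > 0 \<Longrightarrow> ((\<lambda>x. F x powr of_real p) has_integral I R) {-R..R}"
    using cauchy_int_powr_integral[OF g g0 False d p(1)] unfolding F_def by blast
  have int: "v integrable_on {a..b}" if "continuous_on UNIV v" for v :: "real \<Rightarrow> real" and a b
    by (rule integrable_continuous_real[OF continuous_on_subset[OF that]]) simp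
  have u: "integral {-R..R} (\<lambda>x. Re (F x) powr p) \<le> pmass_real p g" for R
  proof -
    have "ennreal (integral {-R..R} (\<lambda>x. Re (F x) powr p)) = (\<integral>\<^sup>+x. ennreal (indicator {-R..R} x * Re (F x) powr p) \<partial>lborel)"
      by (rule nn_integral_Icc_continuous[OF c2, symmetric]) simp
    also have "\<dots> \<le> pmass p (conv (poisson d) g)" unfolding pmass_def F_def
      by (intro nn_integral_mono ennreal_leI) (use Re_cauchy_int[OF g d] Fpos in \<open>auto simp: indicator_def F_def abs_of_pos\<close>)
    also have "\<dots> \<le> ennreal (pmass_real p g)" by (rule pmass_conv_pkernel[OF pkernel_poisson[OF d] g g0 p(1)])
    finally show ?thesis using pmass_real_nonneg by (simp add: ennreal_le_iff)
  qed
  have main: "integral {-R..R} (\<lambda>x. cmod (F x) powr p) \<le> A * pmass_real p g + B * cmod (I R)" if R: "R > 0" for R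
  proof -
    have hr: "((\<lambda>x. Re (F x powr of_real p)) has_integral Re (I R)) {-R..R}"
      using has_integral_linear[OF I(2)[OF R] bounded_linear_Re] by (simp add: o_def)
    have "integral {-R..R} (\<lambda>x. cmod (F x) powr p) + B * Re (I R) \<le> A * integral {-R..R} (\<lambda>x. Re (F x) powr p)"
    proof (rule has_integral_le)
      show "((\<lambda>x. cmod (F x) powr p + B * Re (F x powr of_real p)) has_integral (integral {-R..R} (\<lambda>x. cmod (F x) powr p) + B * Re (I R))) {-R..R}"
        by (intro has_integral_add integrable_integral int c1 has_integral_mult_right hr)
      show "((\<lambda>x. A * Re (F x) powr p) has_integral (A * integral {-R..R} (\<lambda>x. Re (F x) powr p))) {-R..R}"
        by (intro integrable_integral int c2 has_integral_mult_right)
      show "cmod (F x) powr p + B * Re (F x powr of_real p) \<le> A * Re (F x) powr p" for x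
        unfolding A_def B_def by (rule re_powr_ineq[OF p Fpos])
    qed
    moreover have "A * integral {-R..R} (\<lambda>x. Re (F x) powr p) \<le> A * pmass_real p g"
      by (intro mult_left_mono u) (simp add: A_def)
    moreover have "- (B * Re (I R)) \<le> B * cmod (I R)"
      using abs_Re_le_cmod[of "I R"] B0 mult_left_mono[of "- Re (I R)" "cmod (I R)" B] by (simp add: abs_le_iff)
    ultimately show ?thesis by linarith
  qed
  \<comment> \<open>The window [-T, T] stays fixed while R grows, which removes the error term
    containing \<open>I R\<close>.\<close>
  have T: "integral {-T..T} (\<lambda>x. cmod (F x) powr p) \<le> A * pmass_real p g" if T: "T > 0" for T
  proof (rule tendsto_lowerbound)
    show "((\<lambda>R. A * pmass_real p g + B * cmod (I R)) \<longlongrightarrow> A * pmass_real p g) at_top"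
      using I(1) by (auto intro!: tendsto_eq_intros tendsto_norm_zero)
    show "\<forall>\<^sub>F R in at_top. integral {-T..T} (\<lambda>x. cmod (F x) powr p) \<le> A * pmass_real p g + B * cmod (I R)"
      using eventually_ge_at_top[of T]
    proof eventually_elim
      case (elim R)
      have "integral {-T..T} (\<lambda>x. cmod (F x) powr p) \<le> integral {-R..R} (\<lambda>x. cmod (F x) powr p)"
        using elim by (intro integral_subset_le int c1) auto
      also have "\<dots> \<le> A * pmass_real p g + B * cmod (I R)" using elim T by (intro main) simp
      finally show ?case .
    qed
  qed simp
  have [measurable]: "F \<in> borel_measurable borel" using Fc by (rule borel_measurable_continuous_onI)
  have "pmass p (\<lambda>x. cmod (F x)) = (\<integral>\<^sup>+x. (SUP n::nat. ennreal (indicator {-real n..real n} x * cmod (F x) powr p)) \<partial>lborel)"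
    unfolding pmass_def
  proof (intro nn_integral_cong antisym)
    fix x
    obtain m :: nat where m: "\<bar>x\<bar> \<le> real m" using real_arch_simple by blast
    then have "ennreal (\<bar>cmod (F x)\<bar> powr p) = ennreal (indicator {-real m..real m} x * cmod (F x) powr p)" by (simp add: abs_le_iff)
    also have "\<dots> \<le> (SUP n::nat. ennreal (indicator {-real n..real n} x * cmod (F x) powr p))" by (rule SUP_upper) simp
    finally show "ennreal (\<bar>cmod (F x)\<bar> powr p) \<le> (SUP n::nat. ennreal (indicator {-real n..real n} x * cmod (F x) powr p))" .
    show "(SUP n::nat. ennreal (indicator {-real n..real n} x * cmod (F x) powr p)) \<le> ennreal (\<bar>cmod (F x)\<bar> powr p)"
      by (intro SUP_least ennreal_leI) (auto simp: indicator_def)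
  qed
  also have "\<dots> = (SUP n::nat. \<integral>\<^sup>+x. ennreal (indicator {-real n..real n} x * cmod (F x) powr p) \<partial>lborel)"
    by (rule nn_integral_monotone_convergence_SUP)
       (auto intro!: incseq_SucI le_funI ennreal_leI simp: indicator_def)
  also have "\<dots> \<le> ennreal (A * pmass_real p g)"
  proof (rule SUP_least)
    fix n :: nat
    have "(\<integral>\<^sup>+x. ennreal (indicator {-real n..real n} x * cmod (F x) powr p) \<partial>lborel) 
       \<le> (\<integral>\<^sup>+x. ennreal (indicator {-real (Suc n)..real (Suc n)} x * cmod (F x) powr p) \<partial>lborel)"
      by (intro nn_integral_mono ennreal_leI) (auto simp: indicator_def)
    also have "\<dots> = ennreal (integral {-real (Suc n)..real (Suc n)} (\<lambda>x. cmod (F x) powr p))"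
      by (rule nn_integral_Icc_continuous[OF c1]) simp
    also have "\<dots> \<le> ennreal (A * pmass_real p g)" by (intro ennreal_leI T) simp
    finally show "(\<integral>\<^sup>+x. ennreal (indicator {-real n..real n} x * cmod (F x) powr p) \<partial>lborel) \<le> ennreal (A * pmass_real p g)" .
  qed
  finally have N: "pmass p (\<lambda>x. cmod (F x)) \<le> ennreal (A * pmass_real p g)" .
  have half: "cmod (conv (cauchy_kernel d) (\<lambda>y. of_real (g y)) x) = (1/2) * cmod (F x)" for x
    unfolding F_def cauchy_int_conv by (simp add: norm_mult)
  have "pmass p (\<lambda>x. cmod (conv (cauchy_kernel d) (\<lambda>y. of_real (g y)) x)) = ennreal ((1/2) powr p) * pmass p (\<lambda>x. cmod (F x))"
    unfolding half using pmass_cmult[of p "\<lambda>x. cmod (F x)" "1/2"] p by simp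
  also have "\<dots> \<le> ennreal ((1/2) powr p) * ennreal (A * pmass_real p g)" by (intro mult_left_mono N) simp
  also have "\<dots> = ennreal ((1/2) powr p * (A * pmass_real p g))" by (rule ennreal_mult[symmetric]) (auto simp: A_def pmass_real_nonneg)
  also have "(1/2) powr p * (A * pmass_real p g) = (pi / (p - 1)) powr p * pmass_real p g"
  proof -
    have "(1/2) powr p * A = ((1/2) * (2 * pi / (p - 1))) powr p" unfolding A_def by (rule powr_mult[symmetric])
    then show ?thesis by simp
  qed
  finally show ?thesis .
qed

section \<open>From nonnegative densities to complex and vector-valued functions\<close>

lemma pmass_real_mono:
  assumes "bsupp g" "f \<in> borel_measurable borel" "p > 0" "\<And>x. \<bar>f x\<bar> \<le> \<bar>g x\<bar>"
  shows "pmass_real p f \<le> pmass_real p g"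
proof -
  have ig: "integrable lborel (\<lambda>x. \<bar>g x\<bar> powr p)" by (intro bsupp_integrable bsupp_norm_powr assms)
  have [measurable]: "f \<in> borel_measurable borel" by fact
  have le: "\<bar>f x\<bar> powr p \<le> \<bar>g x\<bar> powr p" for x using assms by (intro powr_mono2) auto
  have "integrable lborel (\<lambda>x. \<bar>f x\<bar> powr p)"
    by (rule Bochner_Integration.integrable_bound[OF ig]) (use le in auto)
  then show ?thesis unfolding pmass_real_def by (intro integral_mono ig le)
qed

lemma bsupp_cmod: "bsupp (g :: real \<Rightarrow> complex) \<Longrightarrow> bsupp (\<lambda>x. cmod (g x))"
  using bsupp_L2[of "{()}" "\<lambda>_. g"] by simp

lemma conv_cauchy_kernel_integrable:
  assumes "bsupp g" "d > 0"
  shows "integrable lborel (\<lambda>y. cauchy_kernel d (x - y) * g y)"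
  by (rule conv_bounded_integrable(1)[OF bsupp_integrable[OF assms(1)] cauchy_kernel_measurable cauchy_kernel_bound[OF assms(2)]])

text \<open>Positive and negative parts of the real and imaginary parts give four densities. Two
  nested uses of \<open>pmass_add\<close> cost 4^p, and the four terms a factor 4 <= 4^p, whence
  16.\<close>

lemma cauchy_kernel_scalar:
  fixes g :: "real \<Rightarrow> complex"
  assumes g: "bsupp g" and d: "d > 0" and p: "1 < p" "p \<le> 2"
  shows "pmass p (\<lambda>x. cmod (conv (cauchy_kernel d) g x)) \<le> ennreal ((16 * pi / (p - 1)) powr p * pmass_real p (\<lambda>x. cmod (g x)))"
proof -
  have gm [measurable]: "g \<in> borel_measurable borel" using g by (rule bsupp_measurable)
  define N where "N = pmass_real p (\<lambda>x. cmod (g x))"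
  define K where "K = (pi / (p - 1)) powr p * N"
  have K0: "K \<ge> 0" unfolding K_def N_def by (simp add: pmass_real_nonneg)
  define h where "h i x = (if i = 0 then max 0 (Re (g x)) else if i = 1 then max 0 (- Re (g x)) else if i = 2 then max 0 (Im (g x)) else max 0 (- Im (g x)))" for i :: nat and x
  have hm [measurable]: "h i \<in> borel_measurable borel" for i unfolding h_def by measurable
  have hle: "\<bar>h i x\<bar> \<le> cmod (g x)" "h i x \<ge> 0" for i x
    using abs_Re_le_cmod[of "g x"] abs_Im_le_cmod[of "g x"] by (auto simp: h_def max_def)
  obtain M R where MR: "\<And>x. norm (g x) \<le> M" "\<And>x. R < \<bar>x\<bar> \<Longrightarrow> g x = 0" using bsuppE[OF g] by metis
  have hb: "bsupp (h i)" for i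
  proof (rule bsuppI[of _ M R])
    show "norm (h i x) \<le> M" for x using order_trans[OF hle(1) MR(1)] by simp
    show "h i x = 0" if "R < \<bar>x\<bar>" for x using MR(2)[OF that] by (simp add: h_def)
  qed measurable
  define H where "H i = conv (cauchy_kernel d) (\<lambda>y. of_real (h i y))" for i
  have Hm [measurable]: "H i \<in> borel_measurable borel" for i unfolding H_def by measurable
  have HK: "pmass p (\<lambda>x. cmod (H i x)) \<le> ennreal K" for i
  proof -
    have "pmass p (\<lambda>x. cmod (H i x)) \<le> ennreal ((pi / (p - 1)) powr p * pmass_real p (h i))"
      unfolding H_def by (rule cauchy_kernel_nonneg[OF hb hle(2) d p])
    also have "\<dots> \<le> ennreal K" unfolding K_def N_def using p hle(1)
      by (intro ennreal_leI mult_left_mono pmass_real_mono bsupp_cmod g) auto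
    finally show ?thesis .
  qed
  have hi: "integrable lborel (\<lambda>y. cauchy_kernel d (x - y) * complex_of_real (h i y))" for i x
    by (rule conv_bounded_integrable(1)[OF _ cauchy_kernel_measurable cauchy_kernel_bound[OF d]]) (use bsupp_integrable[OF hb] in simp)
  have gdec: "g y = (of_real (h 0 y) - of_real (h 1 y)) + \<i> * (of_real (h 2 y) - of_real (h 3 y))" for y
    by (auto simp: h_def complex_eq_iff max_def)
  have "conv (cauchy_kernel d) g x = (H 0 x - H 1 x) + \<i> * (H 2 x - H 3 x)" for x
  proof -
    have "conv (cauchy_kernel d) g x = (\<integral>y. (cauchy_kernel d (x - y) * of_real (h 0 y) - cauchy_kernel d (x - y) * of_real (h 1 y)) + \<i> * (cauchy_kernel d (x - y) * of_real (h 2 y) - cauchy_kernel d (x - y) * of_real (h 3 y)) \<partial>lborel)"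
      unfolding conv_def by (subst gdec) (simp add: algebra_simps)
    then show ?thesis using hi[of x] unfolding H_def conv_def by simp
  qed
  then have le: "cmod (conv (cauchy_kernel d) g x) \<le> (cmod (H 0 x) + cmod (H 1 x)) + (cmod (H 2 x) + cmod (H 3 x))" for x
  proof -
    have "cmod ((H 0 x - H 1 x) + \<i> * (H 2 x - H 3 x)) \<le> cmod (H 0 x - H 1 x) + cmod (\<i> * (H 2 x - H 3 x))"
      by (rule norm_triangle_ineq)
    also have "cmod (\<i> * (H 2 x - H 3 x)) = cmod (H 2 x - H 3 x)" by (simp add: norm_mult)
    also have "cmod (H 0 x - H 1 x) + cmod (H 2 x - H 3 x) \<le> (cmod (H 0 x) + cmod (H 1 x)) + (cmod (H 2 x) + cmod (H 3 x))"
      by (intro add_mono norm_triangle_ineq4)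
    finally show ?thesis using \<open>\<And>x. conv (cauchy_kernel d) g x = (H 0 x - H 1 x) + \<i> * (H 2 x - H 3 x)\<close>[of x] by simp
  qed
  have "pmass p (\<lambda>x. cmod (conv (cauchy_kernel d) g x)) \<le> pmass p (\<lambda>x. (cmod (H 0 x) + cmod (H 1 x)) + (cmod (H 2 x) + cmod (H 3 x)))"
    using p le by (intro pmass_mono) auto
  also have "\<dots> \<le> ennreal (2 powr p) * (pmass p (\<lambda>x. cmod (H 0 x) + cmod (H 1 x)) + pmass p (\<lambda>x. cmod (H 2 x) + cmod (H 3 x)))"
    using p by (intro pmass_add) auto
  also have "\<dots> \<le> ennreal (2 powr p) * (ennreal (2 powr p) * (ennreal K + ennreal K) + ennreal (2 powr p) * (ennreal K + ennreal K))"
    using p HK by (intro mult_left_mono add_mono order_trans[OF pmass_add] HK) auto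
  also have "\<dots> = ennreal (2 powr p * (2 powr p * (K + K) + 2 powr p * (K + K)))"
    by (simp only: ennreal_mult ennreal_plus add_nonneg_nonneg mult_nonneg_nonneg powr_ge_zero K0)
  also have "\<dots> \<le> ennreal ((16 * pi / (p - 1)) powr p * N)"
  proof (rule ennreal_leI)
    have "(4::real) \<le> 4 powr p" using powr_mono[of 1 p 4] p by simp
    have "2 powr p * (2 powr p * (K + K) + 2 powr p * (K + K)) = (2 powr p * 2 powr p) * (4 * K)" by (simp add: algebra_simps)
    also have "2 powr p * 2 powr p = (4::real) powr p" by (simp flip: powr_mult)
    also have "4 powr p * (4 * K) \<le> 4 powr p * (4 powr p * K)" using K0 \<open>4 \<le> 4 powr p\<close> by (intro mult_left_mono mult_right_mono) auto
    also have "\<dots> = (4 powr p * 4 powr p * (pi / (p - 1)) powr p) * N" by (simp add: K_def)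
    also have "4 powr p * 4 powr p * (pi / (p - 1)) powr p = (4 * 4 * (pi / (p - 1))) powr p" by (simp only: powr_mult)
    finally show "2 powr p * (2 powr p * (K + K) + 2 powr p * (K + K)) \<le> (16 * pi / (p - 1)) powr p * N" by simp
  qed
  finally show ?thesis unfolding N_def .
qed

lemma conv_sum:
  assumes "finite J" "\<And>j. j \<in> J \<Longrightarrow> integrable lborel (\<lambda>y. k (x - y) * g j y)"
  shows "conv k (\<lambda>y. \<Sum>j\<in>J. c j * g j y) x = (\<Sum>j\<in>J. c j * conv k (g j) x)"
proof -
  have "conv k (\<lambda>y. \<Sum>j\<in>J. c j * g j y) x = (\<integral>y. (\<Sum>j\<in>J. c j * (k (x - y) * g j y)) \<partial>lborel)"
    unfolding conv_def by (simp add: sum_distrib_left mult_ac)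
  also have "\<dots> = (\<Sum>j\<in>J. \<integral>y. c j * (k (x - y) * g j y) \<partial>lborel)"
    using assms by (intro Bochner_Integration.integral_sum) auto
  finally show ?thesis unfolding conv_def by simp
qed

text \<open>The lower Khintchine inequality integrated in x: control of every signed sum gives
  control of the square function.\<close>

lemma pmass_L2_le_signavg:
  assumes J: "finite J" and p: "p \<ge> 1" and [measurable]: "\<And>j. j \<in> J \<Longrightarrow> F j \<in> borel_measurable borel"
  and N: "\<And>A. A \<subseteq> J \<Longrightarrow> pmass p (\<lambda>x. cmod (rsum J (\<lambda>j. F j x) A)) \<le> ennreal (N A)" and N0: "\<And>A. N A \<ge> 0"
  shows "pmass p (\<lambda>x. L2_set (\<lambda>j. cmod (F j x)) J) \<le> ennreal (2 powr p * signavg J N)"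
proof -
  have [measurable]: "(\<lambda>x. rsum J (\<lambda>j. F j x) A) \<in> borel_measurable borel" for A unfolding rsum_def by measurable
  define c where "c = 2 powr p / 2 ^ card J"
  have c0: "c \<ge> 0" by (simp add: c_def)
  have "pmass p (\<lambda>x. L2_set (\<lambda>j. cmod (F j x)) J) \<le> (\<integral>\<^sup>+x. (\<Sum>A\<in>Pow J. ennreal c * ennreal (\<bar>cmod (rsum J (\<lambda>j. F j x) A)\<bar> powr p)) \<partial>lborel)"
    unfolding pmass_def
  proof (rule nn_integral_mono)
    fix x
    have "(L2_set (\<lambda>j. cmod (F j x)) J) powr p \<le> 2 powr p * signavg J (\<lambda>A. cmod (rsum J (\<lambda>j. F j x) A) powr p)"
      by (rule Khintchine_lower[OF J p])
    also have "\<dots> = (\<Sum>A\<in>Pow J. c * cmod (rsum J (\<lambda>j. F j x) A) powr p)"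
      by (simp add: signavg_def c_def sum_distrib_left sum_divide_distrib)
    finally have "ennreal ((L2_set (\<lambda>j. cmod (F j x)) J) powr p) \<le> ennreal (\<Sum>A\<in>Pow J. c * cmod (rsum J (\<lambda>j. F j x) A) powr p)"
      by (rule ennreal_leI)
    also have "\<dots> = (\<Sum>A\<in>Pow J. ennreal c * ennreal (\<bar>cmod (rsum J (\<lambda>j. F j x) A)\<bar> powr p))"
      using c0 by (subst sum_ennreal[symmetric]) (auto simp: ennreal_mult)
    finally show "ennreal (\<bar>L2_set (\<lambda>j. cmod (F j x)) J\<bar> powr p) \<le> (\<Sum>A\<in>Pow J. ennreal c * ennreal (\<bar>cmod (rsum J (\<lambda>j. F j x) A)\<bar> powr p))"
      by simp
  qed
  also have "\<dots> = (\<Sum>A\<in>Pow J. ennreal c * pmass p (\<lambda>x. cmod (rsum J (\<lambda>j. F j x) A)))"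
    unfolding pmass_def by (subst nn_integral_sum) (auto simp: nn_integral_cmult)
  also have "\<dots> \<le> (\<Sum>A\<in>Pow J. ennreal c * ennreal (N A))"
    by (intro sum_mono mult_left_mono N) auto
  also have "\<dots> = ennreal (\<Sum>A\<in>Pow J. c * N A)"
    using c0 N0 by (subst sum_ennreal[symmetric]) (auto simp: ennreal_mult)
  also have "(\<Sum>A\<in>Pow J. c * N A) = 2 powr p * signavg J N"
    by (simp add: signavg_def c_def sum_distrib_left sum_divide_distrib)
  finally show ?thesis .
qed

text \<open>By linearity a signed sum of outputs is the output of a signed sum of inputs, to which
  the scalar bound applies. Khintchine's lower inequality is used on the outputs, at the cost of a
  factor 2, and the upper one, available for p <= 2, on the inputs.\<close>

lemma cauchy_kernel_vector_le2:
  fixes g :: "'i \<Rightarrow> real \<Rightarrow> complex"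
  assumes J: "finite J" and g: "\<And>j. j \<in> J \<Longrightarrow> bsupp (g j)" and d: "d > 0" and p: "1 < p" "p \<le> 2"
  shows "pmass p (\<lambda>x. L2_set (\<lambda>j. cmod (conv (cauchy_kernel d) (g j) x)) J) \<le> ennreal ((32 * pi / (p - 1)) powr p * pmass_real p (\<lambda>x. L2_set (\<lambda>j. cmod (g j x)) J))"
proof -
  define c where "c = (16 * pi / (p - 1)) powr p"
  have rg: "bsupp (\<lambda>x. rsum J (\<lambda>j. g j x) A)" for A
    unfolding rsum_def by (intro bsupp_sum bsupp_mult(2)[where K = 1] g) (auto simp: sgnset_def)
  have "pmass p (\<lambda>x. L2_set (\<lambda>j. cmod (conv (cauchy_kernel d) (g j) x)) J) \<le> ennreal (2 powr p * signavg J (\<lambda>A. c * pmass_real p (\<lambda>x. cmod (rsum J (\<lambda>j. g j x) A))))"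
  proof (rule pmass_L2_le_signavg[OF J])
    show "p \<ge> 1" using p by simp
    show "conv (cauchy_kernel d) (g j) \<in> borel_measurable borel" if "j \<in> J" for j using bsupp_measurable[OF g[OF that]] by measurable
    show "0 \<le> c * pmass_real p (\<lambda>x. cmod (rsum J (\<lambda>j. g j x) A))" for A by (simp add: c_def pmass_real_nonneg)
    fix A assume "A \<subseteq> J"
    have "rsum J (\<lambda>j. conv (cauchy_kernel d) (g j) x) A = conv (cauchy_kernel d) (\<lambda>x. rsum J (\<lambda>j. g j x) A) x" for x
      unfolding rsum_def by (rule conv_sum[symmetric, OF J conv_cauchy_kernel_integrable[OF g d]])
    then show "pmass p (\<lambda>x. cmod (rsum J (\<lambda>j. conv (cauchy_kernel d) (g j) x) A)) \<le> ennreal (c * pmass_real p (\<lambda>x. cmod (rsum J (\<lambda>j. g j x) A)))"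
      unfolding c_def using cauchy_kernel_scalar[OF rg d p] by simp
  qed
  also have "\<dots> \<le> ennreal (2 powr p * (c * pmass_real p (\<lambda>x. L2_set (\<lambda>j. cmod (g j x)) J)))"
  proof (intro ennreal_leI mult_left_mono)
    have i: "integrable lborel (\<lambda>x. \<bar>cmod (rsum J (\<lambda>j. g j x) A)\<bar> powr p)" for A
      using p by (intro bsupp_integrable bsupp_norm_powr bsupp_cmod rg) auto
    have i2: "integrable lborel (\<lambda>x. \<bar>L2_set (\<lambda>j. cmod (g j x)) J\<bar> powr p)"
      using p by (intro bsupp_integrable bsupp_norm_powr bsupp_L2 g J) auto
    have "signavg J (\<lambda>A. 0 + c * pmass_real p (\<lambda>x. cmod (rsum J (\<lambda>j. g j x) A))) = c * signavg J (\<lambda>A. pmass_real p (\<lambda>x. cmod (rsum J (\<lambda>j. g j x) A)))"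
      by (subst signavg_affine[OF J]) simp
    also have "signavg J (\<lambda>A. pmass_real p (\<lambda>x. cmod (rsum J (\<lambda>j. g j x) A))) = (\<integral>x. signavg J (\<lambda>A. \<bar>cmod (rsum J (\<lambda>j. g j x) A)\<bar> powr p) \<partial>lborel)"
      unfolding signavg_def pmass_real_def using i by simp
    also have "\<dots> \<le> pmass_real p (\<lambda>x. L2_set (\<lambda>j. cmod (g j x)) J)"
      unfolding pmass_real_def
    proof (rule integral_mono[OF _ i2])
      show "integrable lborel (\<lambda>x. signavg J (\<lambda>A. \<bar>cmod (rsum J (\<lambda>j. g j x) A)\<bar> powr p))"
        unfolding signavg_def using i by simp
      show "signavg J (\<lambda>A. \<bar>cmod (rsum J (\<lambda>j. g j x) A)\<bar> powr p) \<le> \<bar>L2_set (\<lambda>j. cmod (g j x)) J\<bar> powr p" for x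
        using Khintchine_upper[OF J, of p "\<lambda>j. g j x"] p by simp
    qed
    finally show "signavg J (\<lambda>A. c * pmass_real p (\<lambda>x. cmod (rsum J (\<lambda>j. g j x) A))) \<le> c * pmass_real p (\<lambda>x. L2_set (\<lambda>j. cmod (g j x)) J)"
      by (simp add: c_def mult_left_mono)
  qed simp
  also have "2 powr p * (c * pmass_real p (\<lambda>x. L2_set (\<lambda>j. cmod (g j x)) J)) = (32 * pi / (p - 1)) powr p * pmass_real p (\<lambda>x. L2_set (\<lambda>j. cmod (g j x)) J)"
  proof -
    have "2 powr p * c = (2 * (16 * pi / (p - 1))) powr p" unfolding c_def by (rule powr_mult[symmetric])
    then show ?thesis by simp
  qed
  finally show ?thesis .
qed

section \<open>Vector-valued bounds and frequency bands\<close>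

lemma borel_measurable_cnj [measurable (raw)]:
  "f \<in> borel_measurable M \<Longrightarrow> (\<lambda>x. cnj (f x)) \<in> borel_measurable M"
  by (rule measurable_compose[OF _ borel_measurable_continuous_onI]) (auto intro: continuous_intros)

text \<open>Hoelder's inequality in Young form with a free scale l between the two sides. At each
  use l is the operator bound on the dual side, so that this bound cancels and the second term
  becomes a plain mass divided by q.\<close>

lemma re_pair_young:
  fixes F G :: "'i \<Rightarrow> real \<Rightarrow> complex"
  assumes J: "finite J" and p: "p > 1" "q > 1" "1/p + 1/q = 1" and l: "l > 0"
    and int: "\<And>j. j \<in> J \<Longrightarrow> integrable lborel (\<lambda>x. F j x * cnj (G j x))"
    and [measurable]: "\<And>j. j \<in> J \<Longrightarrow> F j \<in> borel_measurable borel" "\<And>j. j \<in> J \<Longrightarrow> G j \<in> borel_measurable borel"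
    and a: "pmass p (\<lambda>x. L2_set (\<lambda>j. cmod (F j x)) J) \<le> ennreal a" "a \<ge> 0"
    and b: "pmass q (\<lambda>x. L2_set (\<lambda>j. cmod (G j x)) J) \<le> ennreal b" "b \<ge> 0"
  shows "Re (\<Sum>j\<in>J. \<integral>x. F j x * cnj (G j x) \<partial>lborel) \<le> l powr p * a / p + b / (l powr q * q)"
proof -
  define v where "v x = (\<Sum>j\<in>J. cmod (F j x) * cmod (G j x))" for x
  have vi: "integrable lborel v" unfolding v_def
    using int[THEN integrable_norm] by (intro Bochner_Integration.integrable_sum) (simp add: norm_mult)
  let ?f = "\<lambda>x. L2_set (\<lambda>j. cmod (F j x)) J" and ?g = "\<lambda>x. L2_set (\<lambda>j. cmod (G j x)) J"
  have v0: "v x \<ge> 0" for x unfolding v_def by (intro sum_nonneg) auto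
  have ptw: "v x \<le> (l powr p / p) * ?f x powr p + (1 / (l powr q * q)) * ?g x powr q" for x
  proof -
    have "v x \<le> ?f x * ?g x" unfolding v_def using L2_set_mult_ineq[of "\<lambda>j. cmod (F j x)" "\<lambda>j. cmod (G j x)" J] by simp
    also have "\<dots> = (l * ?f x) * (?g x / l)" using l by simp
    also have "\<dots> \<le> (l * ?f x) powr p / p + (?g x / l) powr q / q" using p l by (intro Youngs_inequality) auto
    finally show ?thesis by (simp add: powr_mult powr_divide)
  qed
  have "Re (\<Sum>j\<in>J. \<integral>x. F j x * cnj (G j x) \<partial>lborel) \<le> cmod (\<Sum>j\<in>J. \<integral>x. F j x * cnj (G j x) \<partial>lborel)"
    by (rule complex_Re_le_cmod)
  also have "\<dots> \<le> (\<Sum>j\<in>J. \<integral>x. cmod (F j x * cnj (G j x)) \<partial>lborel)"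
    by (intro sum_norm_le integral_norm_bound)
  also have "\<dots> = (\<integral>x. v x \<partial>lborel)" unfolding v_def
    using int[THEN integrable_norm] by (subst Bochner_Integration.integral_sum) (simp_all add: norm_mult)
  finally have 1: "Re (\<Sum>j\<in>J. \<integral>x. F j x * cnj (G j x) \<partial>lborel) \<le> (\<integral>x. v x \<partial>lborel)" .
  have "ennreal (\<integral>x. v x \<partial>lborel) = (\<integral>\<^sup>+x. ennreal (v x) \<partial>lborel)"
    by (rule nn_integral_eq_integral[symmetric, OF vi]) (use v0 in auto)
  also have "\<dots> \<le> (\<integral>\<^sup>+x. ennreal (l powr p / p) * ennreal (?f x powr p) + ennreal (1 / (l powr q * q)) * ennreal (?g x powr q) \<partial>lborel)"
  proof (rule nn_integral_mono)
    fix x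
    have "ennreal (v x) \<le> ennreal ((l powr p / p) * ?f x powr p + (1 / (l powr q * q)) * ?g x powr q)" by (intro ennreal_leI ptw)
    also have "\<dots> = ennreal (l powr p / p) * ennreal (?f x powr p) + ennreal (1 / (l powr q * q)) * ennreal (?g x powr q)"
      using p by (subst ennreal_plus) (auto simp: ennreal_mult[symmetric])
    finally show "ennreal (v x) \<le> ennreal (l powr p / p) * ennreal (?f x powr p) + ennreal (1 / (l powr q * q)) * ennreal (?g x powr q)" .
  qed
  also have "\<dots> = ennreal (l powr p / p) * pmass p ?f + ennreal (1 / (l powr q * q)) * pmass q ?g"
    unfolding pmass_def by (subst nn_integral_add) (auto simp: nn_integral_cmult)
  also have "\<dots> \<le> ennreal (l powr p / p) * ennreal a + ennreal (1 / (l powr q * q)) * ennreal b"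
    by (intro add_mono mult_left_mono a b) auto
  also have "\<dots> = ennreal (l powr p * a / p + b / (l powr q * q))"
    using a b p by (subst ennreal_plus) (auto simp: ennreal_mult[symmetric])
  finally have "(\<integral>x. v x \<partial>lborel) \<le> l powr p * a / p + b / (l powr q * q)"
    using a b p by (subst (asm) ennreal_le_iff) auto
  with 1 show ?thesis by linarith
qed

lemma conv_adjoint_bounded:
  fixes k f g :: "real \<Rightarrow> 'a::{real_normed_field, banach, second_countable_topology}"
  assumes [measurable]: "k \<in> borel_measurable borel" and k: "\<And>x. norm (k x) \<le> K"
    and fg: "integrable lborel f" "integrable lborel g"
  shows "(\<integral>x. conv k f x * g x \<partial>lborel) = (\<integral>y. f y * (\<integral>x. k (x - y) * g x \<partial>lborel) \<partial>lborel)"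
proof -
  have *: "integrable (lborel \<Otimes>\<^sub>M lborel) (\<lambda>(x,y). k (x - y) * (g x * f y))"
    by (rule integrable_prod_pair[where K = K]) (use k fg in auto)
  have "(\<integral>x. conv k f x * g x \<partial>lborel) = (\<integral>x. \<integral>y. k (x - y) * (g x * f y) \<partial>lborel \<partial>lborel)"
    unfolding conv_def by (subst integral_mult_left_zero[symmetric]) (simp add: mult_ac)
  also have "\<dots> = (\<integral>y. \<integral>x. k (x - y) * (g x * f y) \<partial>lborel \<partial>lborel)"
    by (rule lborel_pair.Fubini_integral[symmetric, OF *])
  also have "\<dots> = (\<integral>y. \<integral>x. f y * (k (x - y) * g x) \<partial>lborel \<partial>lborel)"
    by (simp add: mult_ac)
  finally show ?thesis by simp
qed

lemma conv_selfadjoint: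
  fixes f g :: "real \<Rightarrow> complex"
  assumes k: "k \<in> borel_measurable borel" "\<And>x. norm (k x) \<le> K" and adj: "\<And>x. cnj (k (- x)) = k x"
    and fg: "integrable lborel f" "integrable lborel g"
  shows "(\<integral>x. conv k f x * cnj (g x) \<partial>lborel) = (\<integral>x. f x * cnj (conv k g x) \<partial>lborel)"
proof -
  have "(\<integral>x. conv k f x * cnj (g x) \<partial>lborel) = (\<integral>y. f y * (\<integral>x. k (x - y) * cnj (g x) \<partial>lborel) \<partial>lborel)"
    by (rule conv_adjoint_bounded[OF k]) (use fg in auto)
  also have "(\<lambda>y. \<integral>x. k (x - y) * cnj (g x) \<partial>lborel) = (\<lambda>y. cnj (conv k g y))"
  proof
    fix y
    have "cnj (k (y - x)) = k (x - y)" for x using adj[of "x - y"] by simp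
    then have "(\<lambda>x. k (x - y) * cnj (g x)) = (\<lambda>x. cnj (k (y - x) * g x))" by simp
    then show "(\<integral>x. k (x - y) * cnj (g x) \<partial>lborel) = cnj (conv k g y)" unfolding conv_def by (simp only: Bochner_Integration.integral_cnj)
  qed
  finally show ?thesis .
qed

text \<open>For p > 2 the self-adjoint kernel is moved to the test functions, where the bound for q
  < 2 applies; 1 / (q - 1) = p - 1 makes the resulting constant linear in p.\<close>

lemma cauchy_kernel_vector:
  fixes g :: "'i \<Rightarrow> real \<Rightarrow> complex"
  assumes J: "finite J" and g: "\<And>j. j \<in> J \<Longrightarrow> bsupp (g j)" and d: "d > 0" and p: "1 < p"
  shows "pmass p (\<lambda>x. L2_set (\<lambda>j. cmod (conv (cauchy_kernel d) (g j) x)) J) \<le> ennreal ((32 * pi * (p + 1 / (p - 1))) powr p * pmass_real p (\<lambda>x. L2_set (\<lambda>j. cmod (g j x)) J))"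
proof (cases "p \<le> 2")
  case True
  have "pmass p (\<lambda>x. L2_set (\<lambda>j. cmod (conv (cauchy_kernel d) (g j) x)) J) \<le> ennreal ((32 * pi / (p - 1)) powr p * pmass_real p (\<lambda>x. L2_set (\<lambda>j. cmod (g j x)) J))"
    by (rule cauchy_kernel_vector_le2[OF J g d p True])
  also have "\<dots> \<le> ennreal ((32 * pi * (p + 1 / (p - 1))) powr p * pmass_real p (\<lambda>x. L2_set (\<lambda>j. cmod (g j x)) J))"
  proof (intro ennreal_leI mult_right_mono pmass_real_nonneg powr_mono2)
    have "32 * pi * (1 / (p - 1)) \<le> 32 * pi * (p + 1 / (p - 1))" using p by (intro mult_left_mono) auto
    then show "32 * pi / (p - 1) \<le> 32 * pi * (p + 1 / (p - 1))" by simp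
  qed (use p in auto)
  finally show ?thesis .
next
  case False
  define q where "q = p / (p - 1)"
  have q: "q > 1" "q \<le> 2" "1/p + 1/q = 1" "1 / (q - 1) = p - 1" using False by (auto simp: q_def field_simps)
  define l where "l = 32 * pi / (q - 1)"
  have l: "l > 0" using q by (simp add: l_def)
  define N where "N = pmass_real p (\<lambda>x. L2_set (\<lambda>j. cmod (g j x)) J)"
  have "pmass p (\<lambda>x. L2_set (\<lambda>j. cmod (conv (cauchy_kernel d) (g j) x)) J) \<le> ennreal (l powr p * N)"
  proof (rule norming[OF J p q(1,3)])
    show "conv (cauchy_kernel d) (g j) \<in> borel_measurable borel" if "j \<in> J" for j using bsupp_measurable[OF g[OF that]] by measurable
    fix h :: "'i \<Rightarrow> real \<Rightarrow> complex" assume h: "\<And>j. j \<in> J \<Longrightarrow> bsupp (h j)"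
    have hm: "conv (cauchy_kernel d) (h j) \<in> borel_measurable borel" if "j \<in> J" for j using bsupp_measurable[OF h[OF that]] by measurable
    have "(\<Sum>j\<in>J. \<integral>x. conv (cauchy_kernel d) (g j) x * cnj (h j x) \<partial>lborel) = (\<Sum>j\<in>J. \<integral>x. g j x * cnj (conv (cauchy_kernel d) (h j) x) \<partial>lborel)"
      by (intro sum.cong refl conv_selfadjoint[OF cauchy_kernel_measurable cauchy_kernel_bound[OF d] cauchy_kernel_adjoint] bsupp_integrable g h)
    moreover have "Re (\<Sum>j\<in>J. \<integral>x. g j x * cnj (conv (cauchy_kernel d) (h j) x) \<partial>lborel) \<le> 
       l powr p * N / p + (l powr q * pmass_real q (\<lambda>x. L2_set (\<lambda>j. cmod (h j x)) J)) / (l powr q * q)"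
    proof (rule re_pair_young[OF J p q(1,3) l])
      show "integrable lborel (\<lambda>x. g j x * cnj (conv (cauchy_kernel d) (h j) x))" if j: "j \<in> J" for j
        using hm[OF j] conv_bounded_integrable(2)[OF bsupp_integrable[OF h[OF j]] cauchy_kernel_measurable cauchy_kernel_bound[OF d]]
        by (intro bsupp_integrable bsupp_mult(1)[OF g[OF j]]) auto
      show "pmass p (\<lambda>x. L2_set (\<lambda>j. cmod (g j x)) J) \<le> ennreal N"
        unfolding N_def using p by (subst pmass_pmass_real) (auto intro!: bsupp_L2 J g)
      show "pmass q (\<lambda>x. L2_set (\<lambda>j. cmod (conv (cauchy_kernel d) (h j) x)) J) \<le> ennreal (l powr q * pmass_real q (\<lambda>x. L2_set (\<lambda>j. cmod (h j x)) J))"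
        unfolding l_def by (rule cauchy_kernel_vector_le2[OF J h d q(1,2)])
    qed (use hm bsupp_measurable[OF g] pmass_real_nonneg in \<open>auto simp: N_def\<close>)
    ultimately show "Re (\<Sum>j\<in>J. \<integral>x. conv (cauchy_kernel d) (g j) x * cnj (h j x) \<partial>lborel) \<le> l powr p * N / p + pmass_real q (\<lambda>x. L2_set (\<lambda>j. cmod (h j x)) J) / q"
      using l by simp
  qed
  also have "\<dots> \<le> ennreal ((32 * pi * (p + 1 / (p - 1))) powr p * N)"
  proof (intro ennreal_leI mult_right_mono powr_mono2)
    define r where "r = 1 / (p - 1)"
    have "r \<ge> 0" using p by (simp add: r_def)
    then have "32 * pi * (1 / (q - 1)) \<le> 32 * pi * (p + r)" unfolding q(4) by (intro mult_left_mono) auto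
    then show "l \<le> 32 * pi * (p + 1 / (p - 1))" by (simp add: l_def r_def)
  qed (use p l pmass_real_nonneg in \<open>auto simp: N_def\<close>)
  finally show ?thesis unfolding N_def .
qed

lemma pmass_Fatou:
  assumes [measurable]: "\<And>n. F n \<in> borel_measurable borel" and lim: "\<And>x. (\<lambda>n. F n x) \<longlonglongrightarrow> f x" and p: "p > 0"
    and le: "\<And>n. pmass p (F n) \<le> c"
  shows "pmass p f \<le> c"
proof -
  have "pmass p f = (\<integral>\<^sup>+x. liminf (\<lambda>n. ennreal (\<bar>F n x\<bar> powr p)) \<partial>lborel)"
    unfolding pmass_def
  proof (intro nn_integral_cong lim_imp_Liminf[symmetric] tendsto_ennrealI)
    fix x
    show "(\<lambda>n. \<bar>F n x\<bar> powr p) \<longlonglongrightarrow> \<bar>f x\<bar> powr p"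
      using lim[of x] p by (intro tendsto_powr2 tendsto_rabs) (auto simp: tendsto_const)
  qed simp
  also have "\<dots> \<le> liminf (\<lambda>n. pmass p (F n))" unfolding pmass_def by (intro nn_integral_liminf) measurable
  also have "\<dots> \<le> c" by (intro Liminf_le) (use le in auto)
  finally show ?thesis .
qed

section \<open>Characters and sharp frequency bands\<close>

definition uchar :: "real \<Rightarrow> complex" where "uchar t = cis (2 * pi * t)"

lemma uchar_simps [simp]: "cmod (uchar t) = 1" "uchar 0 = 1" "cnj (uchar t) = uchar (- t)" "uchar t \<noteq> 0"
  by (simp_all add: uchar_def cis_cnj)

lemma uchar_add: "uchar (s + t) = uchar s * uchar t" by (simp add: uchar_def cis_mult distrib_left)
lemma uchar_diff: "uchar (s - t) = uchar s * uchar (- t)" using uchar_add[of s "-t"] by simp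
lemma continuous_uchar [continuous_intros]: "continuous_on S f \<Longrightarrow> continuous_on S (\<lambda>x. uchar (f x))"
  unfolding uchar_def by (intro continuous_intros)
lemma uchar_measurable [measurable]: "uchar \<in> borel_measurable borel"
  by (intro borel_measurable_continuous_onI continuous_uchar continuous_on_id)

definition band :: "real \<Rightarrow> real \<Rightarrow> real \<Rightarrow> complex" where
  "band a b x = (\<integral>\<xi>. indicator {a..<b} \<xi> * uchar (x * \<xi>) \<partial>lborel)"

lemma band_measurable [measurable]: "band a b \<in> borel_measurable borel"
  unfolding band_def by measurable

lemma bsupp_indicator_Ico: "bsupp (indicator {a..<b::real} :: real \<Rightarrow> 'a::real_normed_algebra_1)"
  by (rule bsuppI[of _ 1 "max \<bar>a\<bar> \<bar>b\<bar>"]) (auto simp: indicator_def)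

lemma band_bound: "cmod (band a b x) \<le> \<bar>b - a\<bar>"
proof -
  have "cmod (band a b x) \<le> (\<integral>\<xi>. cmod (indicator {a..<b} \<xi> * uchar (x * \<xi>)) \<partial>lborel)"
    unfolding band_def by (rule integral_norm_bound)
  also have "\<dots> = (\<integral>\<xi>. indicator {a..<b} \<xi> \<partial>lborel)" by (intro Bochner_Integration.integral_cong) (auto simp: indicator_def)
  also have "\<dots> \<le> \<bar>b - a\<bar>" by (cases "a \<le> b") auto
  finally show ?thesis .
qed

lemma band_explicit:
  assumes "a \<le> b" "x \<noteq> 0"
  shows "band a b x = (uchar (b * x) - uchar (a * x)) / (2 * of_real pi * \<i> * of_real x)"
proof -
  have der: "((\<lambda>\<xi>. uchar (x * \<xi>) / (2 * of_real pi * \<i> * of_real x)) has_vector_derivative uchar (x * \<xi>)) (at \<xi> within {a..b})" for \<xi>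
  proof -
    have "((\<lambda>\<xi>. exp (\<i> * of_real (2 * pi * (x * \<xi>))) / (2 * of_real pi * \<i> * of_real x)) has_vector_derivative exp (\<i> * of_real (2 * pi * (x * \<xi>)))) (at \<xi> within {a..b})"
    proof -
      have "((\<lambda>z. exp (\<i> * (2 * of_real pi * (of_real x * z))) / (2 * of_real pi * \<i> * of_real x)) has_field_derivative exp (\<i> * (2 * of_real pi * (of_real x * of_real \<xi>)))) (at (of_real \<xi>))"
        using assms by (auto intro!: derivative_eq_intros)
      from has_vector_derivative_real_field[OF this, of "{a..b}"] show ?thesis by simp
    qed
    then show ?thesis unfolding uchar_def cis_conv_exp .
  qed
  have "((\<lambda>\<xi>. uchar (x * \<xi>)) has_integral (uchar (x * b) / (2 * of_real pi * \<i> * of_real x) - uchar (x * a) / (2 * of_real pi * \<i> * of_real x))) {a..b}"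
    by (rule fundamental_theorem_of_calculus[OF assms(1) der])
  then have i: "integral {a..b} (\<lambda>\<xi>. uchar (x * \<xi>)) = (uchar (x * b) - uchar (x * a)) / (2 * of_real pi * \<i> * of_real x)"
    by (simp add: integral_unique diff_divide_distrib)
  have "set_integrable lborel {a..b} (\<lambda>\<xi>. uchar (x * \<xi>))"
    by (intro borel_integrable_atLeastAtMost' continuous_intros)
  from set_borel_integral_eq_integral(2)[OF this] 
  have "(\<integral>\<xi>. indicator {a..b} \<xi> *\<^sub>R uchar (x * \<xi>) \<partial>lborel) = (uchar (x * b) - uchar (x * a)) / (2 * of_real pi * \<i> * of_real x)"
    unfolding i set_lebesgue_integral_def .
  moreover have "band a b x = (\<integral>\<xi>. indicator {a..b} \<xi> *\<^sub>R uchar (x * \<xi>) \<partial>lborel)"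
    unfolding band_def
  proof (rule integral_cong_AE)
    have "AE \<xi> in lborel. \<xi> \<noteq> b" by (rule AE_lborel_singleton)
    then show "AE \<xi> in lborel. indicator {a..<b} \<xi> * uchar (x * \<xi>) = indicator {a..b} \<xi> *\<^sub>R uchar (x * \<xi>)"
      by eventually_elim (auto simp: indicator_def)
  qed measurable
  ultimately show ?thesis by (simp add: mult.commute)
qed

lemma uchar_lipschitz: "cmod (uchar s - uchar t) \<le> 2 * pi * \<bar>s - t\<bar>"
proof -
  have "cmod (uchar s - uchar t) = cmod (cis (2 * pi * s) - cis (2 * pi * t))" by (simp add: uchar_def)
  also have "\<dots> \<le> \<bar>2 * pi * s - 2 * pi * t\<bar>"
  proof -
    have "cmod (exp (\<i> * of_real u) - exp (\<i> * of_real v)) \<le> 1 * cmod (of_real u - of_real v)" for u v :: real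
      by (rule field_differentiable_bound[of "\<real>" "\<lambda>z. exp (\<i> * z)" "\<lambda>z. \<i> * exp (\<i> * z)"])
         (auto intro!: derivative_eq_intros convex_Reals simp: norm_mult elim!: Reals_cases)
    then show ?thesis unfolding cis_conv_exp by (metis mult_1 norm_of_real of_real_diff)
  qed
  also have "\<dots> = 2 * pi * \<bar>s - t\<bar>" by (simp add: abs_mult flip: right_diff_distrib)
  finally show ?thesis .
qed

lemma conv_modulate:
  "conv (\<lambda>t. uchar (a * t) * k t) g x = uchar (a * x) * conv k (\<lambda>y. uchar (- (a * y)) * g y) x"
proof -
  have *: "uchar (a * (x - y)) * k (x - y) * g y = uchar (a * x) * (k (x - y) * (uchar (- (a * y)) * g y))" for y
    using uchar_add[of "a * x" "- (a * y)"] by (simp add: right_diff_distrib)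
  show ?thesis unfolding conv_def * integral_mult_right_zero ..
qed

lemma bsupp_modulate: "bsupp (g :: real \<Rightarrow> complex) \<Longrightarrow> bsupp (\<lambda>y. uchar (- (a * y)) * g y)"
  by (rule bsupp_mult(2)[where K = 1]) auto

text \<open>The singularity that the Cauchy kernel develops at x = 0 cancels in the difference. The
  bound is uniform in d, as dominated convergence requires.\<close>

lemma cauchy_kernel_band_diff:
  assumes ab: "a \<le> b" and d: "d > 0"
  shows "cmod (uchar (a * x) * cauchy_kernel d x - uchar (b * x) * cauchy_kernel d x) \<le> b - a"
proof -
  have "cmod (uchar (a * x) - uchar (b * x)) \<le> 2 * pi * \<bar>a * x - b * x\<bar>" by (rule uchar_lipschitz)
  also have "\<bar>a * x - b * x\<bar> = (b - a) * \<bar>x\<bar>" using ab by (simp add: abs_mult flip: left_diff_distrib)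
  finally have 1: "cmod (uchar (a * x) - uchar (b * x)) \<le> 2 * pi * ((b - a) * \<bar>x\<bar>)" .
  have pos: "cmod (Complex x d) > 0" using d by (auto simp: complex_eq_iff)
  have c: "cmod (cauchy_kernel d x) = 1 / (2 * pi * cmod (Complex x d))" unfolding cauchy_kernel_def by (simp add: norm_divide norm_mult)
  have "cmod (uchar (a * x) * cauchy_kernel d x - uchar (b * x) * cauchy_kernel d x) = cmod (uchar (a * x) - uchar (b * x)) * cmod (cauchy_kernel d x)"
    by (simp add: norm_mult flip: left_diff_distrib)
  also have "\<dots> \<le> (2 * pi * ((b - a) * \<bar>x\<bar>)) * (1 / (2 * pi * cmod (Complex x d)))"
    unfolding c by (intro mult_right_mono 1) auto
  also have "\<dots> = (b - a) * (\<bar>x\<bar> / cmod (Complex x d))" by simp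
  also have "\<dots> \<le> (b - a) * 1" using abs_Re_le_cmod[of "Complex x d"] pos ab by (intro mult_left_mono) auto
  finally show ?thesis by simp
qed

lemma cauchy_kernel_band_lim:
  assumes ab: "a \<le> b" and x: "x \<noteq> 0" and dl: "dl \<longlonglongrightarrow> 0"
  shows "(\<lambda>n. uchar (a * x) * cauchy_kernel (dl n) x - uchar (b * x) * cauchy_kernel (dl n) x) \<longlonglongrightarrow> band a b x"
proof -
  have "(\<lambda>n. uchar (a * x) * cauchy_kernel (dl n) x - uchar (b * x) * cauchy_kernel (dl n) x) \<longlonglongrightarrow> uchar (a * x) * (\<i> / (2 * of_real pi * of_real x)) - uchar (b * x) * (\<i> / (2 * of_real pi * of_real x))"
  proof -
    have "(\<lambda>n. Complex x (dl n)) \<longlonglongrightarrow> Complex x 0" using dl by (intro tendsto_intros)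
    then have "(\<lambda>n. cauchy_kernel (dl n) x) \<longlonglongrightarrow> \<i> / (2 * of_real pi * Complex x 0)" unfolding cauchy_kernel_def using x
      by (intro tendsto_divide tendsto_mult tendsto_const) (auto simp: complex_eq_iff)
    moreover have "Complex x 0 = of_real x" by (simp add: complex_eq_iff)
    ultimately show ?thesis by (intro tendsto_intros) auto
  qed
  moreover have "uchar (a * x) * (\<i> / (2 * of_real pi * of_real x)) - uchar (b * x) * (\<i> / (2 * of_real pi * of_real x)) = band a b x"
    unfolding band_explicit[OF ab x] using x by (simp add: field_simps)
  ultimately show ?thesis by simp
qed

text \<open>Modulating before and after a Cauchy transform moves the edge of its frequency
  half-line; the half-lines starting at a and at b differ by the band.\<close>

lemma band_conv_lim:
  assumes ab: "a \<le> b" and g: "integrable lborel g" and dl: "dl \<longlonglongrightarrow> 0" "\<And>n. dl n > 0"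
  shows "(\<lambda>n. uchar (a * x) * conv (cauchy_kernel (dl n)) (\<lambda>y. uchar (- (a * y)) * g y) x - uchar (b * x) * conv (cauchy_kernel (dl n)) (\<lambda>y. uchar (- (b * y)) * g y) x) \<longlonglongrightarrow> conv (band a b) g x"
proof -
  have gm [measurable]: "g \<in> borel_measurable borel" using g by auto
  define K where "K n t = uchar (a * t) * cauchy_kernel (dl n) t - uchar (b * t) * cauchy_kernel (dl n) t" for n t
  have [measurable]: "K n \<in> borel_measurable borel" for n unfolding K_def by measurable
  have "(\<lambda>n. \<integral>y. K n (x - y) * g y \<partial>lborel) \<longlonglongrightarrow> (\<integral>y. band a b (x - y) * g y \<partial>lborel)"
  proof (rule integral_dominated_convergence)
    show "integrable lborel (\<lambda>y. (b - a) * cmod (g y))" using g by simp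
    show "AE y in lborel. (\<lambda>n. K n (x - y) * g y) \<longlonglongrightarrow> band a b (x - y) * g y"
    proof -
      have "AE y in lborel. y \<noteq> x" by (rule AE_lborel_singleton)
      then show ?thesis
      proof eventually_elim
        case (elim y)
        then show ?case unfolding K_def using cauchy_kernel_band_lim[OF ab _ dl(1), of "x - y"] by (intro tendsto_mult tendsto_const) auto
      qed
    qed
    show "AE y in lborel. cmod (K n (x - y) * g y) \<le> (b - a) * cmod (g y)" for n
      unfolding K_def norm_mult by (intro AE_I2 mult_right_mono cauchy_kernel_band_diff ab dl(2)) auto
  qed measurable
  moreover have "(\<integral>y. K n (x - y) * g y \<partial>lborel) = uchar (a * x) * conv (cauchy_kernel (dl n)) (\<lambda>y. uchar (- (a * y)) * g y) x - uchar (b * x) * conv (cauchy_kernel (dl n)) (\<lambda>y. uchar (- (b * y)) * g y) x" for n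
  proof -
    have bd: "cmod (uchar (c * t) * cauchy_kernel (dl n) t) \<le> 1 / (2 * pi * dl n)" for c t
      using cauchy_kernel_bound[OF dl(2)] by (simp add: norm_mult)
    have i: "integrable lborel (\<lambda>y. uchar (c * (x - y)) * cauchy_kernel (dl n) (x - y) * g y)" for c
      by (rule conv_bounded_integrable(1)[OF g _ bd]) measurable
    have "(\<integral>y. K n (x - y) * g y \<partial>lborel) = conv (\<lambda>t. uchar (a * t) * cauchy_kernel (dl n) t) g x - conv (\<lambda>t. uchar (b * t) * cauchy_kernel (dl n) t) g x"
      unfolding K_def conv_def using i[of a] i[of b] by (simp add: left_diff_distrib)
    then show ?thesis unfolding conv_modulate .
  qed
  ultimately show ?thesis unfolding conv_def by simp
qed

text \<open>The edges may depend on j: every modulation is unimodular and acts on its own component,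
  so the vector-valued Cauchy bound holds unchanged for both terms. Their difference costs 2 * 2,
  which turns 32 into 128, and Fatou's lemma removes d.\<close>

lemma band_vector:
  fixes g :: "'i \<Rightarrow> real \<Rightarrow> complex"
  assumes J: "finite J" and g: "\<And>j. j \<in> J \<Longrightarrow> bsupp (g j)" and ab: "\<And>j. j \<in> J \<Longrightarrow> a j \<le> b j" and p: "1 < p"
  shows "pmass p (\<lambda>x. L2_set (\<lambda>j. cmod (conv (band (a j) (b j)) (g j) x)) J) \<le> ennreal ((128 * pi * (p + 1 / (p - 1))) powr p * pmass_real p (\<lambda>x. L2_set (\<lambda>j. cmod (g j x)) J))"
proof -
  define N where "N = pmass_real p (\<lambda>x. L2_set (\<lambda>j. cmod (g j x)) J)"
  define l where "l = 32 * pi * (p + 1 / (p - 1))"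
  define dl where "dl n = 1 / real (Suc n)" for n
  have dl: "dl \<longlonglongrightarrow> 0" "\<And>n. dl n > 0" using LIMSEQ_inverse_real_of_nat by (auto simp: dl_def[abs_def] inverse_eq_divide)
  define U where "U c n j x = uchar (c j * x) * conv (cauchy_kernel (dl n)) (\<lambda>y. uchar (- (c j * y)) * g j y) x" for c :: "'i \<Rightarrow> real" and n j x
  have gm [measurable]: "j \<in> J \<Longrightarrow> g j \<in> borel_measurable borel" for j using bsupp_measurable[OF g] by auto
  have Um [measurable]: "U c n j \<in> borel_measurable borel" if "j \<in> J" for c n j unfolding U_def using that by measurable
  have UN: "pmass p (\<lambda>x. L2_set (\<lambda>j. cmod (U c n j x)) J) \<le> ennreal (l powr p * N)" for c n
    unfolding U_def N_def l_def using cauchy_kernel_vector[OF J, of "\<lambda>j y. uchar (- (c j * y)) * g j y" "dl n" p] bsupp_modulate[OF g] dl(2) p by (simp add: norm_mult)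
  show ?thesis
  proof (rule pmass_Fatou)
    fix n
    show "(\<lambda>x. L2_set (\<lambda>j. cmod (U a n j x - U b n j x)) J) \<in> borel_measurable borel" by measurable
    have "pmass p (\<lambda>x. L2_set (\<lambda>j. cmod (U a n j x - U b n j x)) J) \<le> pmass p (\<lambda>x. L2_set (\<lambda>j. cmod (U a n j x)) J + L2_set (\<lambda>j. cmod (U b n j x)) J)"
    proof (rule pmass_mono)
      fix x
      have "L2_set (\<lambda>j. cmod (U a n j x - U b n j x)) J \<le> L2_set (\<lambda>j. cmod (U a n j x) + cmod (U b n j x)) J"
        by (intro L2_set_mono norm_triangle_ineq4) auto
      also have "\<dots> \<le> L2_set (\<lambda>j. cmod (U a n j x)) J + L2_set (\<lambda>j. cmod (U b n j x)) J" by (rule L2_set_triangle_ineq)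
      finally show "\<bar>L2_set (\<lambda>j. cmod (U a n j x - U b n j x)) J\<bar> \<le> \<bar>L2_set (\<lambda>j. cmod (U a n j x)) J + L2_set (\<lambda>j. cmod (U b n j x)) J\<bar>"
        by (simp add: add_nonneg_nonneg)
    qed (use p in simp)
    also have "\<dots> \<le> ennreal (2 powr p) * (pmass p (\<lambda>x. L2_set (\<lambda>j. cmod (U a n j x)) J) + pmass p (\<lambda>x. L2_set (\<lambda>j. cmod (U b n j x)) J))"
      by (rule pmass_add) (use p in simp, measurable)
    also have "\<dots> \<le> ennreal (2 powr p) * (ennreal (l powr p * N) + ennreal (l powr p * N))"
      by (intro mult_left_mono add_mono UN) auto
    also have "\<dots> = ennreal (2 powr p * (l powr p * N + l powr p * N))"
    proof -
      have "N \<ge> 0" by (simp add: N_def pmass_real_nonneg)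
      then show ?thesis by (simp only: ennreal_plus ennreal_mult add_nonneg_nonneg mult_nonneg_nonneg powr_ge_zero)
    qed
    also have "2 powr p * (l powr p * N + l powr p * N) = (2 powr p * 2) * (l powr p * N)" by simp
    also have "\<dots> \<le> (2 powr p * 2 powr p) * (l powr p * N)"
    proof -
      have "(2::real) \<le> 2 powr p" using powr_mono[of 1 p 2] p by simp
      then show ?thesis using pmass_real_nonneg by (intro mult_right_mono mult_left_mono) (auto simp: N_def)
    qed
    also have "(2 powr p * 2 powr p) * (l powr p * N) = (2 powr p * 2 powr p * l powr p) * N" by simp
    also have "2 powr p * 2 powr p * l powr p = (2 * 2 * l) powr p" by (simp only: powr_mult)
    also have "2 * 2 * l = 128 * pi * (p + 1 / (p - 1))" by (simp add: l_def)
    finally show "pmass p (\<lambda>x. L2_set (\<lambda>j. cmod (U a n j x - U b n j x)) J) \<le> ennreal ((128 * pi * (p + 1 / (p - 1))) powr p * pmass_real p (\<lambda>x. L2_set (\<lambda>j. cmod (g j x)) J))"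
      unfolding N_def by (simp add: ennreal_leI)
  next
    fix x
    have "(\<lambda>n. \<Sum>j\<in>J. (cmod (U a n j x - U b n j x))\<^sup>2) \<longlonglongrightarrow> (\<Sum>j\<in>J. (cmod (conv (band (a j) (b j)) (g j) x))\<^sup>2)"
      unfolding U_def by (intro tendsto_sum tendsto_power tendsto_norm band_conv_lim dl ab bsupp_integrable g)
    then show "(\<lambda>n. L2_set (\<lambda>j. cmod (U a n j x - U b n j x)) J) \<longlonglongrightarrow> L2_set (\<lambda>j. cmod (conv (band (a j) (b j)) (g j) x)) J"
      unfolding L2_set_def by (intro tendsto_real_sqrt)
  qed (use p in auto)
qed

section \<open>The Fourier transform of integrable functions\<close>

definition ft :: "(real \<Rightarrow> complex) \<Rightarrow> real \<Rightarrow> complex" where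
  "ft f \<xi> = (\<integral>x. uchar (- (x * \<xi>)) * f x \<partial>lborel)"

lemma ft_measurable [measurable]:
  assumes [measurable]: "f \<in> borel_measurable borel"
  shows "ft f \<in> borel_measurable borel"
  unfolding ft_def by measurable

lemma ft_bound: "cmod (ft f \<xi>) \<le> (\<integral>x. cmod (f x) \<partial>lborel)"
  unfolding ft_def using integral_norm_bound[of lborel "\<lambda>x. uchar (- (x * \<xi>)) * f x"] by (simp add: norm_mult)

lemma ft_integrable:
  assumes "integrable lborel f"
  shows "integrable lborel (\<lambda>x. uchar (- (x * \<xi>)) * f x)"
  by (rule Bochner_Integration.integrable_bound[OF assms]) (use assms in \<open>auto simp: norm_mult\<close>)

lemma ft_conv:
  assumes "integrable lborel k" "integrable lborel f"
  shows "ft (conv k f) \<xi> = ft k \<xi> * ft f \<xi>"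
proof -
  have "ft (conv k f) \<xi> = (\<integral>x. conv k f x * uchar (- (x * \<xi>)) \<partial>lborel)" unfolding ft_def by (simp add: mult.commute)
  also have "\<dots> = (\<integral>y. f y * (\<integral>x. k (x - y) * uchar (- (x * \<xi>)) \<partial>lborel) \<partial>lborel)"
    by (rule conv_integrable_mult(2)[OF assms, where K = 1]) auto
  also have "\<dots> = (\<integral>y. ft k \<xi> * (uchar (- (y * \<xi>)) * f y) \<partial>lborel)"
  proof (rule Bochner_Integration.integral_cong[OF refl])
    fix y
    have "(\<integral>x. k (x - y) * uchar (- (x * \<xi>)) \<partial>lborel) = (\<integral>x. k x * uchar (- ((x + y) * \<xi>)) \<partial>lborel)"
      using lborel_integral_real_affine[of 1 "\<lambda>x. k (x - y) * uchar (- (x * \<xi>))" y] by (simp add: add.commute)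
    also have "\<dots> = (\<integral>x. uchar (- (y * \<xi>)) * (uchar (- (x * \<xi>)) * k x) \<partial>lborel)"
    proof (rule Bochner_Integration.integral_cong[OF refl])
      fix x
      have "uchar (- ((x + y) * \<xi>)) = uchar (- (y * \<xi>)) * uchar (- (x * \<xi>))" using uchar_add[of "- (y * \<xi>)" "- (x * \<xi>)"] by (simp add: algebra_simps)
      then show "k x * uchar (- ((x + y) * \<xi>)) = uchar (- (y * \<xi>)) * (uchar (- (x * \<xi>)) * k x)" by simp
    qed
    also have "\<dots> = uchar (- (y * \<xi>)) * ft k \<xi>" by (simp add: ft_def)
    finally show "f y * (\<integral>x. k (x - y) * uchar (- (x * \<xi>)) \<partial>lborel) = ft k \<xi> * (uchar (- (y * \<xi>)) * f y)" by simp
  qed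
  also have "\<dots> = ft k \<xi> * ft f \<xi>" by (simp add: ft_def)
  finally show ?thesis .
qed

definition fourier_kernel :: "(real \<Rightarrow> complex) \<Rightarrow> real \<Rightarrow> complex" where
  "fourier_kernel a x = (\<integral>\<xi>. a \<xi> * uchar (x * \<xi>) \<partial>lborel)"

lemma conv_fourier_kernel:
  assumes a: "integrable lborel a" and f: "integrable lborel f"
  shows "conv (fourier_kernel a) f x = (\<integral>\<xi>. a \<xi> * (uchar (x * \<xi>) * ft f \<xi>) \<partial>lborel)"
proof -
  have [measurable]: "f \<in> borel_measurable borel" "a \<in> borel_measurable borel" using f a by auto
  have *: "integrable (lborel \<Otimes>\<^sub>M lborel) (\<lambda>(\<xi>,y). uchar ((x - y) * \<xi>) * (a \<xi> * f y))"
    by (rule integrable_prod_pair[where K = 1]) (use a f in auto)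
  have "conv (fourier_kernel a) f x = (\<integral>y. \<integral>\<xi>. uchar ((x - y) * \<xi>) * (a \<xi> * f y) \<partial>lborel \<partial>lborel)"
    unfolding conv_def fourier_kernel_def by (subst integral_mult_left_zero[symmetric]) (simp add: mult_ac)
  also have "\<dots> = (\<integral>\<xi>. \<integral>y. uchar ((x - y) * \<xi>) * (a \<xi> * f y) \<partial>lborel \<partial>lborel)"
    by (rule lborel_pair.Fubini_integral[OF *])
  also have "\<dots> = (\<integral>\<xi>. \<integral>y. (a \<xi> * uchar (x * \<xi>)) * (uchar (- (y * \<xi>)) * f y) \<partial>lborel \<partial>lborel)"
  proof -
    have "uchar ((x - y) * \<xi>) = uchar (x * \<xi>) * uchar (- (y * \<xi>))" for y \<xi> using uchar_diff[of "x * \<xi>" "y * \<xi>"] by (simp add: left_diff_distrib)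
    then show ?thesis by (simp add: mult_ac)
  qed
  also have "\<dots> = (\<integral>\<xi>. a \<xi> * (uchar (x * \<xi>) * ft f \<xi>) \<partial>lborel)"
    unfolding ft_def integral_mult_right_zero by (simp add: mult.assoc)
  finally show ?thesis .
qed

lemma integrable_mult_ft:
  assumes a: "integrable lborel a" and f: "integrable lborel f"
  shows "integrable lborel (\<lambda>\<xi>. a \<xi> * ft f \<xi>)"
proof (rule Bochner_Integration.integrable_bound)
  have [measurable]: "f \<in> borel_measurable borel" "a \<in> borel_measurable borel" using f a by auto
  show "integrable lborel (\<lambda>\<xi>. cmod (a \<xi>) * (\<integral>x. cmod (f x) \<partial>lborel))" using a by simp
  show "(\<lambda>\<xi>. a \<xi> * ft f \<xi>) \<in> borel_measurable lborel" by measurable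
  show "AE \<xi> in lborel. norm (a \<xi> * ft f \<xi>) \<le> norm (cmod (a \<xi>) * (\<integral>x. cmod (f x) \<partial>lborel))"
    using ft_bound[of f] by (auto simp: norm_mult intro!: mult_left_mono)
qed

text \<open>For an integrable symbol this is only Fubini's theorem, so bands and shells can be
  treated on the Fourier side before Plancherel's identity is available.\<close>

lemma conv_fourier_kernel_pairing:
  assumes a: "integrable lborel a" and f: "integrable lborel f" and g: "integrable lborel g"
  shows "(\<integral>x. conv (fourier_kernel a) f x * cnj (g x) \<partial>lborel) = (\<integral>\<xi>. a \<xi> * (ft f \<xi> * cnj (ft g \<xi>)) \<partial>lborel)"
proof -
  have [measurable]: "f \<in> borel_measurable borel" "g \<in> borel_measurable borel" "a \<in> borel_measurable borel" using f g a by auto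
  have i: "integrable lborel (\<lambda>\<xi>. a \<xi> * ft f \<xi>)" by (rule integrable_mult_ft[OF a f])
  have *: "integrable (lborel \<Otimes>\<^sub>M lborel) (\<lambda>(\<xi>,x). uchar (x * \<xi>) * ((a \<xi> * ft f \<xi>) * cnj (g x)))"
    by (rule integrable_prod_pair[where K = 1]) (use i g in auto)
  have "(\<integral>x. conv (fourier_kernel a) f x * cnj (g x) \<partial>lborel) = (\<integral>x. \<integral>\<xi>. uchar (x * \<xi>) * ((a \<xi> * ft f \<xi>) * cnj (g x)) \<partial>lborel \<partial>lborel)"
    unfolding conv_fourier_kernel[OF a f] by (subst integral_mult_left_zero[symmetric]) (simp add: mult_ac)
  also have "\<dots> = (\<integral>\<xi>. \<integral>x. uchar (x * \<xi>) * ((a \<xi> * ft f \<xi>) * cnj (g x)) \<partial>lborel \<partial>lborel)"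
    by (rule lborel_pair.Fubini_integral[OF *])
  also have "\<dots> = (\<integral>\<xi>. (a \<xi> * ft f \<xi>) * (\<integral>x. cnj (uchar (- (x * \<xi>)) * g x) \<partial>lborel) \<partial>lborel)"
    unfolding integral_mult_right_zero[symmetric] by (simp add: mult_ac)
  also have "\<dots> = (\<integral>\<xi>. a \<xi> * (ft f \<xi> * cnj (ft g \<xi>)) \<partial>lborel)"
    unfolding ft_def by (simp only: Bochner_Integration.integral_cnj mult.assoc)
  finally show ?thesis .
qed

lemma band_fourier_kernel: "band a b = fourier_kernel (indicator {a..<b})"
  unfolding band_def fourier_kernel_def ..

lemmas conv_band_pairing = conv_fourier_kernel_pairing[OF bsupp_integrable[OF bsupp_indicator_Ico], folded band_fourier_kernel]

section \<open>The Gaussian square function\<close>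

lemma pkernel_normal: "\<sigma> > 0 \<Longrightarrow> pkernel (normal_density 0 \<sigma>)"
  unfolding pkernel_def by auto

lemma normal_density_even: "normal_density 0 \<sigma> (- x) = normal_density 0 \<sigma> x"
  by (simp add: normal_density_def)

lemma normal_density_le: "\<sigma> > 0 \<Longrightarrow> norm (normal_density 0 \<sigma> x) \<le> 1 / sqrt (2 * pi * \<sigma>\<^sup>2)"
  using mult_left_mono[of "exp (- (x - 0)\<^sup>2 / (2 * \<sigma>\<^sup>2))" 1 "1 / sqrt (2 * pi * \<sigma>\<^sup>2)"]
  by (simp add: normal_density_def)

lemma conv_normal_normal:
  assumes s: "\<sigma> > 0" "\<tau> > 0"
  shows "conv (normal_density 0 \<sigma>) (normal_density 0 \<tau>) = normal_density 0 (sqrt (\<sigma>\<^sup>2 + \<tau>\<^sup>2))"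
proof
  fix x
  have i: "integrable lborel (\<lambda>y. normal_density 0 \<sigma> (x - y) * normal_density 0 \<tau> y)"
    by (rule conv_bounded_integrable(1)[OF _ _ normal_density_le[OF s(1)]]) (use s in auto)
  have "ennreal (conv (normal_density 0 \<sigma>) (normal_density 0 \<tau>) x) = (\<integral>\<^sup>+y. ennreal (normal_density 0 \<sigma> (x - y) * normal_density 0 \<tau> y) \<partial>lborel)"
    unfolding conv_def by (rule nn_integral_eq_integral[symmetric, OF i]) auto
  also have "\<dots> = ennreal (normal_density 0 (sqrt (\<sigma>\<^sup>2 + \<tau>\<^sup>2)) x)"
    using fun_cong[OF conv_normal_density_zero_mean[OF s], of x] .
  finally show "conv (normal_density 0 \<sigma>) (normal_density 0 \<tau>) x = normal_density 0 (sqrt (\<sigma>\<^sup>2 + \<tau>\<^sup>2)) x"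
    by (subst (asm) ennreal_inj) (auto simp: conv_def intro!: Bochner_Integration.integral_nonneg)
qed

lemma conv_assoc:
  fixes k1 k2 f :: "real \<Rightarrow> 'a::{real_normed_field, banach, second_countable_topology}"
  assumes [measurable]: "k1 \<in> borel_measurable borel" and K: "\<And>x. norm (k1 x) \<le> K" and k2: "integrable lborel k2" and f: "integrable lborel f"
  shows "conv k1 (conv k2 f) x = conv (conv k1 k2) f x"
proof -
  have "conv k1 (conv k2 f) x = (\<integral>z. conv k2 f z * k1 (x - z) \<partial>lborel)" unfolding conv_def[of k1] by (simp add: mult.commute)
  also have "\<dots> = (\<integral>y. f y * (\<integral>z. k2 (z - y) * k1 (x - z) \<partial>lborel) \<partial>lborel)"
    by (rule conv_integrable_mult(2)[OF k2 f _ K]) measurable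
  also have "\<dots> = (\<integral>y. conv k1 k2 (x - y) * f y \<partial>lborel)"
  proof (rule Bochner_Integration.integral_cong[OF refl])
    fix y
    have "(\<integral>z. k2 (z - y) * k1 (x - z) \<partial>lborel) = (\<integral>t. k1 (x - y - t) * k2 t \<partial>lborel)"
      using lborel_integral_real_affine[of 1 "\<lambda>z. k2 (z - y) * k1 (x - z)" y] by (simp add: algebra_simps)
    then show "f y * (\<integral>z. k2 (z - y) * k1 (x - z) \<partial>lborel) = conv k1 k2 (x - y) * f y" by (simp add: conv_def mult.commute)
  qed
  finally show ?thesis by (simp add: conv_def)
qed

text \<open>After the first step the deviations double, because (2^m \<tau>)^2 + 3 (2^m \<tau>)^2 =
  (2^(m+1) \<tau>)^2. For k >= 1 the k-th average is thus the Gaussian one of deviation 2^(k-1)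
  \<tau>.\<close>

definition gausschain :: "real \<Rightarrow> nat \<Rightarrow> real \<Rightarrow> real" where
  "gausschain \<tau> k = (case k of 0 \<Rightarrow> normal_density 0 \<tau> | Suc m \<Rightarrow> normal_density 0 (sqrt 3 * 2 ^ m * \<tau>))"

lemma pkernel_gausschain: "\<tau> > 0 \<Longrightarrow> pkernel (gausschain \<tau> k)"
  unfolding gausschain_def by (auto split: nat.splits intro!: pkernel_normal)

lemma chain_gauss:
  assumes t: "\<tau> > 0" and f: "bsupp f"
  shows "chain (gausschain \<tau>) f (Suc k) = conv (normal_density 0 (2 ^ k * \<tau>)) f"
proof (induction k)
  case 0
  then show ?case by (simp add: gausschain_def)
next
  case (Suc k)
  let ?a = "sqrt 3 * 2 ^ k * \<tau>" and ?b = "2 ^ k * \<tau>"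
  have ab: "?a > 0" "?b > 0" using t by auto
  have "chain (gausschain \<tau>) f (Suc (Suc k)) = conv (gausschain \<tau> (Suc k)) (chain (gausschain \<tau>) f (Suc k))"
    by (rule chain.simps(2))
  also have "\<dots> = conv (normal_density 0 ?a) (conv (normal_density 0 ?b) f)"
    unfolding Suc by (simp add: gausschain_def)
  also have "\<dots> = conv (conv (normal_density 0 ?a) (normal_density 0 ?b)) f"
    by (rule ext, rule conv_assoc[OF _ normal_density_le[OF ab(1)]]) (use ab bsupp_integrable[OF f] in auto)
  also have "conv (normal_density 0 ?a) (normal_density 0 ?b) = normal_density 0 (sqrt (?a\<^sup>2 + ?b\<^sup>2))"
    by (rule conv_normal_normal[OF ab])
  also have "?a\<^sup>2 + ?b\<^sup>2 = (2 ^ Suc k * \<tau>)\<^sup>2" by (simp add: power_mult_distrib)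
  also have "sqrt ((2 ^ Suc k * \<tau>)\<^sup>2) = 2 ^ Suc k * \<tau>" using t by simp
  finally show ?case .
qed

text \<open>Symmetry moves one Gaussian across the pairing and the semigroup law composes the two.
  This converts an inner product of averages into the pairing of a single average of f with
  g.\<close>

lemma normal_pairing:
  assumes s: "\<sigma> > 0" and f: "bsupp f" and g: "bsupp g"
  shows "(\<integral>x. conv (normal_density 0 \<sigma>) f x * conv (normal_density 0 \<sigma>) g x \<partial>lborel) = (\<integral>x. conv (normal_density 0 (sqrt 2 * \<sigma>)) f x * g x \<partial>lborel)"
proof -
  let ?n = "normal_density 0 \<sigma>"
  have b: "bintegrable (conv ?n f)" by (rule bintegrable_conv(1)[OF pkernel_normal[OF s] bsupp_bintegrable[OF f]])
  have "(\<integral>x. conv ?n g x * conv ?n f x \<partial>lborel) = (\<integral>y. g y * (\<integral>x. ?n (x - y) * conv ?n f x \<partial>lborel) \<partial>lborel)"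
    by (rule conv_adjoint_bounded[OF _ normal_density_le[OF s] bsupp_integrable[OF g]]) (use b in \<open>auto simp: bintegrable_def\<close>)
  also have "\<dots> = (\<integral>y. conv ?n (conv ?n f) y * g y \<partial>lborel)"
  proof (rule Bochner_Integration.integral_cong[OF refl])
    fix y
    have "?n (x - y) = ?n (y - x)" for x using normal_density_even[of \<sigma> "y - x"] by simp
    then show "g y * (\<integral>x. ?n (x - y) * conv ?n f x \<partial>lborel) = conv ?n (conv ?n f) y * g y"
      by (simp add: conv_def[of _ "conv ?n f"] mult.commute)
  qed
  also have "conv ?n (conv ?n f) = conv (conv ?n ?n) f"
    by (rule ext, rule conv_assoc[OF _ normal_density_le[OF s]]) (use s bsupp_integrable[OF f] in auto)
  also have "conv ?n ?n = normal_density 0 (sqrt 2 * \<sigma>)"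
    using conv_normal_normal[OF s s] s by (simp add: real_sqrt_mult)
  finally show ?thesis by (simp add: mult.commute)
qed

text \<open>Index 0 compares with f itself, where the chain starts. The indices used for the smooth
  blocks are positive, and there it is a difference of two Gaussian averages whose deviations have
  ratio 2.\<close>

definition gstep :: "real \<Rightarrow> nat \<Rightarrow> (real \<Rightarrow> real) \<Rightarrow> real \<Rightarrow> real" where
  "gstep \<rho> k f x = (if k = 0 then f x else conv (normal_density 0 (\<rho> * 2 ^ k)) f x) - conv (normal_density 0 (\<rho> * 2 ^ Suc k)) f x"

lemma gstep_pairing:
  assumes r: "\<rho> > 0" and f: "bsupp f" and g: "bsupp g"
  defines "\<tau> \<equiv> sqrt 2 * \<rho>"
  shows "(\<integral>x. chain (gausschain \<tau>) f k x * chain (gausschain \<tau>) g k x \<partial>lborel) - (\<integral>x. chain (gausschain \<tau>) f (Suc k) x * chain (gausschain \<tau>) g (Suc k) x \<partial>lborel)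
     = (\<integral>x. gstep \<rho> k f x * g x \<partial>lborel)" "integrable lborel (\<lambda>x. gstep \<rho> k f x * g x)"
proof -
  have t: "\<tau> > 0" using r by (simp add: \<tau>_def)
  \<comment> \<open>The factor sqrt 2 of the pairing identity and the one in \<tau> combine to the 2
    that shifts the exponent by one.\<close>
  have eq: "sqrt 2 * (2 ^ m * \<tau>) = \<rho> * 2 ^ Suc m" for m by (simp add: \<tau>_def)
  have S: "(\<integral>x. chain (gausschain \<tau>) f (Suc m) x * chain (gausschain \<tau>) g (Suc m) x \<partial>lborel) = (\<integral>x. conv (normal_density 0 (\<rho> * 2 ^ Suc m)) f x * g x \<partial>lborel)" for m
    unfolding chain_gauss[OF t f] chain_gauss[OF t g] eq[symmetric] by (rule normal_pairing[OF _ f g]) (use t in simp)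
  have i: "integrable lborel (\<lambda>x. conv (normal_density 0 (\<rho> * 2 ^ m)) f x * g x)" for m
    using bintegrable_mult[OF bintegrable_conv(1)[OF pkernel_normal bsupp_bintegrable[OF f]] bsupp_bintegrable[OF g], of "\<rho> * 2 ^ m"] r by (simp add: bintegrable_def)
  have i0: "integrable lborel (\<lambda>x. f x * g x)" using bintegrable_mult[OF bsupp_bintegrable[OF f] bsupp_bintegrable[OF g]] by (simp add: bintegrable_def)
  show "integrable lborel (\<lambda>x. gstep \<rho> k f x * g x)"
    unfolding gstep_def left_diff_distrib using i[of k] i[of "Suc k"] i0 by (cases "k = 0") (auto simp del: power_Suc)
  show "(\<integral>x. chain (gausschain \<tau>) f k x * chain (gausschain \<tau>) g k x \<partial>lborel) - (\<integral>x. chain (gausschain \<tau>) f (Suc k) x * chain (gausschain \<tau>) g (Suc k) x \<partial>lborel)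
     = (\<integral>x. gstep \<rho> k f x * g x \<partial>lborel)"
  proof (cases k)
    case 0
    then show ?thesis using i[of 1] i0 unfolding S gstep_def left_diff_distrib by simp
  next
    case (Suc m)
    show ?thesis unfolding Suc S using i[of "Suc m"] i[of "Suc (Suc m)"] unfolding gstep_def left_diff_distrib by (simp del: power_Suc)
  qed
qed

lemma gstep_measurable [measurable]:
  assumes [measurable]: "f \<in> borel_measurable borel"
  shows "gstep \<rho> k f \<in> borel_measurable borel"
  unfolding gstep_def by (cases "k = 0") simp_all

text \<open>Norming with a one-point index set turns the bound for the chain form with signs
  \<open>sgnset A\<close> into an L^p bound for each signed sum, uniformly in A. The lower
  Khintchine inequality then gives the square function, and 10 = 2 * 5.\<close>

lemma gstep_square_real:
  assumes r: "\<rho> > 0" and f: "bsupp f" and p: "p > 1"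
  shows "pmass p (\<lambda>x. L2_set (\<lambda>k. cmod (of_real (gstep \<rho> k f x))) {..<n}) \<le> ennreal ((10 * (p + 1 / (p - 1))) powr p * pmass_real p f)"
proof -
  define q where "q = p / (p - 1)"
  have q: "q > 1" "1/p + 1/q = 1" using p by (auto simp: q_def field_simps)
  define \<tau> where "\<tau> = sqrt 2 * \<rho>"
  have t: "\<tau> > 0" using r by (simp add: \<tau>_def)
  define C where "C = (5 * (p + 1 / (p - 1))) powr p * pmass_real p f"
  have fm [measurable]: "f \<in> borel_measurable borel" using f by (rule bsupp_measurable)
  define R where "R A x = rsum {..<n} (\<lambda>k. of_real (gstep \<rho> k f x)) A" for A x
  have Rm [measurable]: "R A \<in> borel_measurable borel" for A unfolding R_def rsum_def by measurable
  have N: "pmass p (\<lambda>x. cmod (R A x)) \<le> ennreal C" for A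
  proof -
    have "pmass p (\<lambda>x. L2_set (\<lambda>j. cmod (R A x)) {()}) \<le> ennreal C"
    proof (rule norming[OF _ p q])
      fix g :: "unit \<Rightarrow> real \<Rightarrow> complex" assume "\<And>j. j \<in> {()} \<Longrightarrow> bsupp (g j)"
      then have g: "bsupp (g ())" by simp
      have gm [measurable]: "g () \<in> borel_measurable borel" using g by (rule bsupp_measurable)
      \<comment> \<open>The steps of f are real, so only the real part of the test function
        contributes to the real part of the pairing.\<close>
      define u where "u x = Re (g () x)" for x
      obtain M R' where MR: "\<And>x. cmod (g () x) \<le> M" "\<And>x. R' < \<bar>x\<bar> \<Longrightarrow> g () x = 0" using bsuppE[OF g] by metis
      have u: "bsupp u" unfolding u_def
        by (rule bsuppI[of _ M R']) (use MR order_trans[OF abs_Re_le_cmod] in auto)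
      have gi: "integrable lborel (\<lambda>x. of_real (gstep \<rho> k f x) * cnj (g () x))" for k
      proof (rule Bochner_Integration.integrable_bound)
        show "integrable lborel (\<lambda>x. gstep \<rho> k f x * cmod (g () x))" by (rule gstep_pairing(2)[OF r f bsupp_cmod[OF g]])
      qed (auto simp: norm_mult abs_mult)
      have "Re (\<Sum>j\<in>{()}. \<integral>x. R A x * cnj (g j x) \<partial>lborel) = Re (\<integral>x. (\<Sum>k<n. of_real (sgnset A k) * (of_real (gstep \<rho> k f x) * cnj (g () x))) \<partial>lborel)"
        unfolding R_def rsum_def by (simp add: sum_distrib_right mult.assoc)
      also have "\<dots> = (\<Sum>k<n. sgnset A k * Re (\<integral>x. of_real (gstep \<rho> k f x) * cnj (g () x) \<partial>lborel))"
        using gi by (subst Bochner_Integration.integral_sum) auto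
      also have "\<dots> = (\<Sum>k<n. sgnset A k * (\<integral>x. gstep \<rho> k f x * u x \<partial>lborel))"
        by (intro sum.cong refl arg_cong2[of _ _ _ _ "(*)"], subst integral_Re[symmetric, OF gi]) (simp add: u_def)
      also have "\<dots> = chain_form (gausschain \<tau>) (sgnset A) n f u"
        unfolding chain_form_def \<tau>_def gstep_pairing(1)[OF r f u] ..
      also have "\<dots> \<le> (5 * (p + 1 / (p - 1))) powr p / p * pmass_real p f + pmass_real q u / q"
        by (rule chain_form_le[OF pkernel_gausschain[OF t] f u p q]) (simp add: sgnset_def)
      also have "pmass_real q u / q \<le> pmass_real q (\<lambda>x. cmod (g () x)) / q"
        using q abs_Re_le_cmod bsupp_measurable[OF u] by (intro divide_right_mono pmass_real_mono bsupp_cmod g) (auto simp: u_def)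
      finally show "Re (\<Sum>j\<in>{()}. \<integral>x. R A x * cnj (g j x) \<partial>lborel) \<le> C / p + pmass_real q (\<lambda>x. L2_set (\<lambda>j. cmod (g j x)) {()}) / q"
        by (simp add: C_def)
    qed auto
    then show ?thesis by simp
  qed
  have "pmass p (\<lambda>x. L2_set (\<lambda>k. cmod (of_real (gstep \<rho> k f x))) {..<n}) \<le> ennreal (2 powr p * signavg {..<n} (\<lambda>_. C))"
    by (rule pmass_L2_le_signavg) (use p N pmass_real_nonneg in \<open>auto simp: R_def C_def\<close>)
  also have "signavg {..<n} (\<lambda>_. C) = C" using signavg_affine[of "{..<n}" C 0 "\<lambda>_. 0"] by simp
  also have "2 powr p * C = (2 * (5 * (p + 1 / (p - 1)))) powr p * pmass_real p f" unfolding C_def by (simp only: powr_mult mult.assoc)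
  also have "2 * (5 * (p + 1 / (p - 1))) = 10 * (p + 1 / (p - 1))" by simp
  finally show ?thesis .
qed

section \<open>Smooth dyadic blocks\<close>

definition gauss_kernel :: "real \<Rightarrow> real \<Rightarrow> complex" where "gauss_kernel s x = of_real (normal_density 0 s x)"

text \<open>Normalised so that the Gaussian of this deviation has Fourier transform exp (-(\<xi> /
  2^j)^2).\<close>

definition blockscale :: "int \<Rightarrow> real" where "blockscale j = 2 powi (- j) / (sqrt 2 * pi)"

definition smooth_block :: "int \<Rightarrow> (real \<Rightarrow> complex) \<Rightarrow> real \<Rightarrow> complex" where
  "smooth_block j f x = conv (gauss_kernel (blockscale j)) f x - conv (gauss_kernel (2 * blockscale j)) f x"

lemma gauss_kernel_integrable: "s > 0 \<Longrightarrow> integrable lborel (gauss_kernel s)"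
  unfolding gauss_kernel_def by simp

lemma conv_gauss_kernel:
  assumes f: "bsupp f" and s: "s > 0"
  shows "conv (gauss_kernel s) f x = of_real (conv (normal_density 0 s) (\<lambda>y. Re (f y)) x) + \<i> * of_real (conv (normal_density 0 s) (\<lambda>y. Im (f y)) x)"
proof -
  have i: "integrable lborel (\<lambda>y. gauss_kernel s (x - y) * f y)"
  proof (rule conv_bounded_integrable(1)[OF bsupp_integrable[OF f]])
    show "cmod (gauss_kernel s x) \<le> 1 / sqrt (2 * pi * s\<^sup>2)" for x using normal_density_le[OF s, of x] by (simp add: gauss_kernel_def)
  qed (simp add: gauss_kernel_def)
  have "Re (conv (gauss_kernel s) f x) = conv (normal_density 0 s) (\<lambda>y. Re (f y)) x" "Im (conv (gauss_kernel s) f x) = conv (normal_density 0 s) (\<lambda>y. Im (f y)) x"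
    unfolding conv_def using integral_Re[OF i] integral_Im[OF i] by (simp_all add: gauss_kernel_def)
  then show ?thesis by (simp add: complex_eq_iff)
qed

lemma bsupp_Re_Im:
  assumes f: "bsupp f"
  shows "bsupp (\<lambda>y. Re (f y))" "bsupp (\<lambda>y. Im (f y))"
proof -
  have [measurable]: "f \<in> borel_measurable borel" using f by (rule bsupp_measurable)
  obtain M R where MR: "\<And>x. cmod (f x) \<le> M" "\<And>x. R < \<bar>x\<bar> \<Longrightarrow> f x = 0" using bsuppE[OF f] by metis
  show "bsupp (\<lambda>y. Re (f y))" "bsupp (\<lambda>y. Im (f y))"
    by (rule bsuppI[of _ M R], use MR order_trans[OF abs_Re_le_cmod] order_trans[OF abs_Im_le_cmod] in auto)+
qed

lemma L2_set_reindex_subset: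
  assumes "finite B" "inj_on h J" "h ` J \<subseteq> B" "\<And>x. F x \<ge> 0"
  shows "L2_set (\<lambda>j. F (h j)) J \<le> L2_set F B"
proof -
  have "(\<Sum>j\<in>J. (F (h j))\<^sup>2) = (\<Sum>k\<in>h ` J. (F k)\<^sup>2)" using assms by (simp add: sum.reindex)
  also have "\<dots> \<le> (\<Sum>k\<in>B. (F k)\<^sup>2)" using assms by (intro sum_mono2) auto
  finally show ?thesis unfolding L2_set_def by simp
qed

text \<open>A finite set of blocks is embedded into one chain that starts below its finest scale.
  Real and imaginary parts are treated separately and recombined, and 40 = 2 * 2 * 10.\<close>

lemma smooth_block_square:
  assumes J: "finite J" and f: "bsupp f" and p: "p > 1"
  shows "pmass p (\<lambda>x. L2_set (\<lambda>j. cmod (smooth_block j f x)) J) \<le> ennreal ((40 * (p + 1 / (p - 1))) powr p * pmass_real p (\<lambda>x. cmod (f x)))"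
proof -
  obtain M :: nat where M: "\<And>j. j \<in> J \<Longrightarrow> \<bar>j\<bar> \<le> int M"
  proof -
    have "bdd_above ((\<lambda>j. nat \<bar>j\<bar>) ` J)" using J by simp
    then obtain M where "\<And>j. j \<in> J \<Longrightarrow> nat \<bar>j\<bar> \<le> M" unfolding bdd_above_def by auto
    then show ?thesis by (intro that[of M]) (simp add: nat_le_iff)
  qed
  define \<rho> where "\<rho> = 2 powi (- (int M + 1)) / (sqrt 2 * pi)"
  have r: "\<rho> > 0" by (simp add: \<rho>_def)
  \<comment> \<open>Larger j means a finer scale, while the chain runs from fine to coarse, hence
    the reversal. The shift by M + 1 keeps every index at least 1, away from the special step
    0.\<close>
  define h where "h j = nat (int M + 1 - j)" for j
  have h: "h j \<noteq> 0" "\<rho> * 2 ^ h j = blockscale j" "h j < 2 * M + 2" if "j \<in> J" for j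
  proof -
    have hj: "int (h j) = int M + 1 - j" "h j > 0" using M[OF that] by (auto simp: h_def)
    show "h j \<noteq> 0" using hj by simp
    have "(2::real) powi (- (int M + 1)) * 2 ^ h j = 2 powi (- (int M + 1)) * 2 powi (int (h j))" by simp
    also have "\<dots> = 2 powi (- (int M + 1) + int (h j))" by (rule power_int_add[symmetric]) simp
    also have "- (int M + 1) + int (h j) = - j" using hj by simp
    finally show "\<rho> * 2 ^ h j = blockscale j" by (simp add: \<rho>_def blockscale_def)
    show "h j < 2 * M + 2" using M[OF that] by (auto simp: h_def)
  qed
  have inj: "inj_on h J" using M by (force simp: inj_on_def h_def)
  let ?B = "{..<2 * M + 2}"
  define u v where "u y = Re (f y)" and "v y = Im (f y)" for y
  have uv: "bsupp u" "bsupp v" unfolding u_def v_def by (rule bsupp_Re_Im[OF f])+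
  have [measurable]: "u \<in> borel_measurable borel" "v \<in> borel_measurable borel" "f \<in> borel_measurable borel" using uv f bsupp_measurable by auto
  have bs: "blockscale j > 0" for j by (simp add: blockscale_def)
  have eq: "smooth_block j f x = of_real (gstep \<rho> (h j) u x) + \<i> * of_real (gstep \<rho> (h j) v x)" if "j \<in> J" for j x
  proof -
    have 2: "\<rho> * 2 ^ Suc (h j) = 2 * blockscale j" using h(2)[OF that] by simp
    show ?thesis unfolding gstep_def h(2)[OF that] 2 smooth_block_def conv_gauss_kernel[OF f bs] conv_gauss_kernel[OF f mult_pos_pos[OF zero_less_numeral bs]] u_def v_def
      using h(1)[OF that] by (simp add: algebra_simps)
  qed
  let ?U = "\<lambda>x. L2_set (\<lambda>k. cmod (of_real (gstep \<rho> k u x))) ?B" and ?V = "\<lambda>x. L2_set (\<lambda>k. cmod (of_real (gstep \<rho> k v x))) ?B"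
  have le: "L2_set (\<lambda>j. cmod (smooth_block j f x)) J \<le> ?U x + ?V x" for x
  proof -
    have "L2_set (\<lambda>j. cmod (smooth_block j f x)) J \<le> L2_set (\<lambda>j. cmod (of_real (gstep \<rho> (h j) u x)) + cmod (of_real (gstep \<rho> (h j) v x))) J"
      by (intro L2_set_mono) (auto simp: eq norm_mult intro!: order_trans[OF norm_triangle_ineq])
    also have "\<dots> \<le> L2_set (\<lambda>j. cmod (of_real (gstep \<rho> (h j) u x))) J + L2_set (\<lambda>j. cmod (of_real (gstep \<rho> (h j) v x))) J"
      by (rule L2_set_triangle_ineq)
    also have "\<dots> \<le> ?U x + ?V x"
      by (intro add_mono L2_set_reindex_subset inj) (use h in auto)
    finally show ?thesis .
  qed
  define C where "C = (10 * (p + 1 / (p - 1))) powr p * pmass_real p (\<lambda>x. cmod (f x))"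
  have C0: "C \<ge> 0" unfolding C_def by (simp add: pmass_real_nonneg)
  have WC: "pmass p (\<lambda>x. L2_set (\<lambda>k. cmod (of_real (gstep \<rho> k w x))) ?B) \<le> ennreal C" 
    if w: "bsupp w" "\<And>y. \<bar>w y\<bar> \<le> cmod (f y)" for w
  proof -
    have "pmass_real p w \<le> pmass_real p (\<lambda>x. cmod (f x))"
      using p w(2) by (intro pmass_real_mono bsupp_cmod f bsupp_measurable[OF w(1)]) auto
    then have "(10 * (p + 1 / (p - 1))) powr p * pmass_real p w \<le> C" unfolding C_def by (intro mult_left_mono) auto
    then show ?thesis by (intro order_trans[OF gstep_square_real[OF r w(1) p]] ennreal_leI)
  qed
  have UC: "pmass p ?U \<le> ennreal C" "pmass p ?V \<le> ennreal C"
    by (rule WC, fact uv, simp add: u_def v_def abs_Re_le_cmod abs_Im_le_cmod)+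
  have "pmass p (\<lambda>x. L2_set (\<lambda>j. cmod (smooth_block j f x)) J) \<le> pmass p (\<lambda>x. ?U x + ?V x)"
    using p le by (intro pmass_mono) (auto intro: order_trans abs_ge_self)
  also have "\<dots> \<le> ennreal (2 powr p) * (pmass p ?U + pmass p ?V)"
    using p by (intro pmass_add) auto
  also have "\<dots> \<le> ennreal (2 powr p) * (ennreal C + ennreal C)" by (intro mult_left_mono add_mono UC) auto
  also have "\<dots> = ennreal (2 powr p * (C + C))" using C0 by (simp only: ennreal_plus ennreal_mult add_nonneg_nonneg powr_ge_zero)
  also have "\<dots> \<le> ennreal ((40 * (p + 1 / (p - 1))) powr p * pmass_real p (\<lambda>x. cmod (f x)))"
  proof (rule ennreal_leI)
    have "(2::real) \<le> 2 powr p" using powr_mono[of 1 p 2] p by simp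
    have "2 powr p * (C + C) = 2 powr p * (2 * C)" by simp
    also have "\<dots> \<le> 2 powr p * (2 powr p * C)" using \<open>2 \<le> 2 powr p\<close> C0 by (intro mult_left_mono mult_right_mono) auto
    also have "\<dots> = (2 * (2 * (10 * (p + 1 / (p - 1))))) powr p * pmass_real p (\<lambda>x. cmod (f x))" unfolding C_def by (simp only: powr_mult mult.assoc)
    also have "2 * (2 * (10 * (p + 1 / (p - 1)))) = 40 * (p + 1 / (p - 1))" by simp
    finally show "2 powr p * (C + C) \<le> (40 * (p + 1 / (p - 1))) powr p * pmass_real p (\<lambda>x. cmod (f x))" .
  qed
  finally show ?thesis .
qed

text \<open>After rescaling, this is the characteristic function of the standard normal distribution
  at t = -2 pi s \<xi>.\<close>

lemma ft_normal:
  assumes s: "s > 0"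
  shows "ft (gauss_kernel s) \<xi> = of_real (exp (- (2 * pi\<^sup>2 * s\<^sup>2 * \<xi>\<^sup>2)))"
proof -
  define t where "t = - (2 * pi * s * \<xi>)"
  have "char std_normal_distribution t = of_real (exp (- (t^2) / 2))" by (simp add: char_std_normal_distribution)
  then have 1: "(\<integral>x. std_normal_density x *\<^sub>R iexp (t * x) \<partial>lborel) = of_real (exp (- (t^2) / 2))"
    unfolding char_def by (subst (asm) integral_density) auto
  have "ft (gauss_kernel s) \<xi> = \<bar>s\<bar> *\<^sub>R (\<integral>x. uchar (- ((0 + s * x) * \<xi>)) * gauss_kernel s (0 + s * x) \<partial>lborel)"
    unfolding ft_def using s by (intro lborel_integral_real_affine) auto
  also have "\<dots> = (\<integral>x. \<bar>s\<bar> *\<^sub>R (uchar (- ((0 + s * x) * \<xi>)) * gauss_kernel s (0 + s * x)) \<partial>lborel)" by simp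
  also have "\<dots> = (\<integral>x. std_normal_density x *\<^sub>R iexp (t * x) \<partial>lborel)"
  proof (rule Bochner_Integration.integral_cong[OF refl])
    fix x
    have "s * normal_density 0 s (s * x) = std_normal_density x"
      using s by (simp add: normal_density_def real_sqrt_mult power_mult_distrib)
    moreover have "uchar (- ((0 + s * x) * \<xi>)) = iexp (t * x)" by (simp add: uchar_def cis_conv_exp t_def mult_ac)
    ultimately show "\<bar>s\<bar> *\<^sub>R (uchar (- ((0 + s * x) * \<xi>)) * gauss_kernel s (0 + s * x)) = std_normal_density x *\<^sub>R iexp (t * x)"
      using s by (simp add: gauss_kernel_def scaleR_conv_of_real flip: of_real_mult)
  qed
  also have "\<dots> = of_real (exp (- (2 * pi\<^sup>2 * s\<^sup>2 * \<xi>\<^sup>2)))" unfolding 1 by (simp add: t_def power_mult_distrib)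
  finally show ?thesis .
qed

text \<open>The symbol of the smooth block j, as a function of \<xi> / 2^j. Its positivity for t > 0
  allows it to be divided out on [1, 2].\<close>

definition mult_m :: "real \<Rightarrow> real" where "mult_m t = exp (- t\<^sup>2) - exp (- 4 * t\<^sup>2)"

lemma ft_smooth_block:
  assumes f: "bsupp f"
  shows "ft (smooth_block j f) \<xi> = of_real (mult_m (\<xi> / 2 powi j)) * ft f \<xi>" "integrable lborel (smooth_block j f)"
proof -
  have bs: "blockscale j > 0" "2 * blockscale j > 0" by (simp_all add: blockscale_def)
  have fi: "integrable lborel f" by (rule bsupp_integrable[OF f])
  have i: "integrable lborel (conv (gauss_kernel (blockscale j)) f)" "integrable lborel (conv (gauss_kernel (2 * blockscale j)) f)"
    by (intro conv_integrable gauss_kernel_integrable bs fi)+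
  then show "integrable lborel (smooth_block j f)" unfolding smooth_block_def by simp
  have "ft (smooth_block j f) \<xi> = ft (conv (gauss_kernel (blockscale j)) f) \<xi> - ft (conv (gauss_kernel (2 * blockscale j)) f) \<xi>"
    unfolding ft_def smooth_block_def using ft_integrable[OF i(1), of \<xi>] ft_integrable[OF i(2), of \<xi>] by (simp add: right_diff_distrib)
  also have "\<dots> = (ft (gauss_kernel (blockscale j)) \<xi> - ft (gauss_kernel (2 * blockscale j)) \<xi>) * ft f \<xi>"
    by (simp add: ft_conv gauss_kernel_integrable bs fi left_diff_distrib)
  also have "ft (gauss_kernel (blockscale j)) \<xi> - ft (gauss_kernel (2 * blockscale j)) \<xi> = of_real (mult_m (\<xi> / 2 powi j))"
    unfolding ft_normal[OF bs(1)] ft_normal[OF bs(2)]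
    by (simp add: mult_m_def blockscale_def power_mult_distrib power_divide power_int_minus field_simps)
  finally show "ft (smooth_block j f) \<xi> = of_real (mult_m (\<xi> / 2 powi j)) * ft f \<xi>" .
qed

section \<open>The upper bound for the sharp square function\<close>

definition inv_symbol :: "real \<Rightarrow> real" where "inv_symbol t = 1 / mult_m t"
definition inv_symbol' :: "real \<Rightarrow> real" where
  "inv_symbol' t = (2 * t * exp (- t\<^sup>2) - 8 * t * exp (- 4 * t\<^sup>2)) / (mult_m t)\<^sup>2"

text \<open>The end value plus the total variation of the reciprocal symbol on [1, 2], that is, the
  total mass of the superposition of sharp cut-offs representing it. It depends neither on p nor on
  j.\<close>

definition inv_symbol_var :: real where
  "inv_symbol_var = \<bar>inv_symbol 2\<bar> + (\<integral>s. indicator {1..2} s * \<bar>inv_symbol' s\<bar> \<partial>lborel)"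

lemma mult_m_pos: "t > 0 \<Longrightarrow> mult_m t > 0"
  by (simp add: mult_m_def)

lemma inv_symbol_deriv: "t > 0 \<Longrightarrow> (inv_symbol has_real_derivative inv_symbol' t) (at t)"
  unfolding inv_symbol_def inv_symbol'_def using mult_m_pos[of t]
  by (auto simp: mult_m_def power2_eq_square intro!: derivative_eq_intros)

lemma inv_symbol'_cont: "continuous_on {1..2} inv_symbol'"
  unfolding inv_symbol'_def using mult_m_pos by (intro continuous_intros) (auto simp: mult_m_def intro!: continuous_intros)

lemma inv_symbol'_measurable [measurable]: "inv_symbol' \<in> borel_measurable borel"
  unfolding inv_symbol'_def mult_m_def by measurable

lemma inv_symbol'_integrable: "integrable lborel (\<lambda>s. indicator {1..2} s * inv_symbol' s)"
  using borel_integrable_atLeastAtMost'[OF inv_symbol'_cont] by (simp add: set_integrable_def)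

text \<open>The fundamental theorem of calculus from t to 2, arranged so that t enters only through
  the cut-off t < s.\<close>

lemma inv_symbol_repr:
  assumes t: "1 \<le> t" "t < 2"
  shows "inv_symbol t = inv_symbol 2 - (\<integral>s. indicator {1..2} s * inv_symbol' s * (if t < s then 1 else 0) \<partial>lborel)"
proof -
  have "(inv_symbol' has_integral (inv_symbol 2 - inv_symbol t)) {t..2}"
    using t by (intro fundamental_theorem_of_calculus) 
      (auto simp: has_real_derivative_iff_has_vector_derivative[symmetric] intro!: has_field_derivative_at_within inv_symbol_deriv)
  moreover have si: "set_integrable lborel {t..2} inv_symbol'"
    by (intro borel_integrable_atLeastAtMost' continuous_on_subset[OF inv_symbol'_cont]) (use t in auto)
  ultimately have "(\<integral>s. indicator {t..2} s * inv_symbol' s \<partial>lborel) = inv_symbol 2 - inv_symbol t"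
    using set_borel_integral_eq_integral(2)[OF si] by (simp add: set_lebesgue_integral_def integral_unique)
  moreover have "(\<integral>s. indicator {1..2} s * inv_symbol' s * (if t < s then 1 else 0) \<partial>lborel) = (\<integral>s. indicator {t..2} s * inv_symbol' s \<partial>lborel)"
  proof (rule integral_cong_AE)
    have "AE s in lborel. s \<noteq> t" by (rule AE_lborel_singleton)
    then show "AE s in lborel. indicator {1..2} s * inv_symbol' s * (if t < s then 1 else 0) = indicator {t..2} s * inv_symbol' s"
      by eventually_elim (use t in \<open>auto simp: indicator_def\<close>)
  qed measurable
  ultimately show ?thesis by simp
qed

lemma band_adjoint: "cnj (band a b (- x)) = band a b x"
proof -
  have "(\<integral>\<xi>. cnj (indicator {a..<b} \<xi> * uchar (- x * \<xi>)) \<partial>lborel) = (\<integral>\<xi>. indicator {a..<b} \<xi> * uchar (x * \<xi>) \<partial>lborel)"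
    by (intro Bochner_Integration.integral_cong) (auto simp: indicator_def)
  then show ?thesis unfolding band_def Bochner_Integration.integral_cnj .
qed

text \<open>The pairing of the smooth blocks, restricted to the lower part [2^j, s 2^j) of the
  positive half-shells, with the g_j, written on the Fourier side. The relative edge s is the same
  for all j, since it is the parameter of the superposition.\<close>

definition subband_form :: "(int \<Rightarrow> real \<Rightarrow> complex) \<Rightarrow> int set \<Rightarrow> (real \<Rightarrow> complex) \<Rightarrow> real \<Rightarrow> complex" where
  "subband_form g J f s = (\<Sum>j\<in>J. \<integral>\<xi>. indicator {2 powi j..<s * 2 powi j} \<xi> * (ft (smooth_block j f) \<xi> * cnj (ft (g j) \<xi>)) \<partial>lborel)"

text \<open>From q - 1 = 1 / (p - 1): both sides equal p + q - 1. Constants obtained for the dual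
  exponent can therefore be read as constants for p.\<close>

lemma kappa_dual:
  fixes p q :: real
  assumes "p > 1" "1/p + 1/q = 1" "q > 1"
  shows "q + 1 / (q - 1) = p + 1 / (p - 1)"
proof -
  have "q = p / (p - 1)" using assms by (simp add: field_simps)
  then have "q - 1 = 1 / (p - 1)" using assms by (simp add: field_simps)
  moreover have "q = 1 + 1 / (p - 1)" using calculation by simp
  ultimately show ?thesis using assms by simp
qed

text \<open>The band operators are moved to the g_j, which have the bounded support that
  \<open>band_vector\<close> asks for; the smooth blocks in general do not. The two factors \<kappa>
  meet here: 128 pi \<kappa> from the bands for q, 40 \<kappa> from the smooth square function for
  p, and 128 * 40 = 5120.\<close>

lemma subband_form_bound:
  assumes J: "finite J" and f: "bsupp f" and g: "\<And>j. j \<in> J \<Longrightarrow> bsupp (g j)" and s: "1 \<le> s"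
    and p: "p > 1" "q > 1" "1/p + 1/q = 1"
  shows "Re (subband_form g J f s) \<le> (5120 * pi * (p + 1 / (p - 1))\<^sup>2) powr p * pmass_real p (\<lambda>x. cmod (f x)) / p + pmass_real q (\<lambda>x. L2_set (\<lambda>j. cmod (g j x)) J) / q"
proof -
  define \<kappa> where "\<kappa> = p + 1 / (p - 1)"
  have k: "\<kappa> > 0" using p by (simp add: \<kappa>_def add_pos_pos)
  define l where "l = 128 * pi * \<kappa>"
  have l: "l > 0" using k by (simp add: l_def)
  let ?B = "\<lambda>j. band (2 powi j) (s * 2 powi j)"
  have si: "integrable lborel (smooth_block j f)" for j by (rule ft_smooth_block(2)[OF f])
  have sm: "smooth_block j f \<in> borel_measurable borel" for j using si[of j] by auto
  have gm: "j \<in> J \<Longrightarrow> g j \<in> borel_measurable borel" for j using bsupp_measurable[OF g] by auto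
  have bm: "conv (?B j) (g j) \<in> borel_measurable borel" if "j \<in> J" for j using gm[OF that] by measurable
  have "subband_form g J f s = (\<Sum>j\<in>J. \<integral>x. smooth_block j f x * cnj (conv (?B j) (g j) x) \<partial>lborel)"
    unfolding subband_form_def
  proof (rule sum.cong[OF refl])
    fix j assume j: "j \<in> J"
    have gi: "integrable lborel (g j)" by (rule bsupp_integrable[OF g[OF j]])
    show "(\<integral>\<xi>. indicator {2 powi j..<s * 2 powi j} \<xi> * (ft (smooth_block j f) \<xi> * cnj (ft (g j) \<xi>)) \<partial>lborel) = (\<integral>x. smooth_block j f x * cnj (conv (?B j) (g j) x) \<partial>lborel)"
      unfolding conv_band_pairing[OF si gi, symmetric]
      by (rule conv_selfadjoint[OF band_measurable band_bound band_adjoint si gi])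
  qed
  also have "Re \<dots> \<le> l powr p * ((40 * \<kappa>) powr p * pmass_real p (\<lambda>x. cmod (f x))) / p + (l powr q * pmass_real q (\<lambda>x. L2_set (\<lambda>j. cmod (g j x)) J)) / (l powr q * q)"
  proof (rule re_pair_young[OF J p l])
    fix j assume j: "j \<in> J"
    show "integrable lborel (\<lambda>x. smooth_block j f x * cnj (conv (?B j) (g j) x))"
    proof (rule Bochner_Integration.integrable_bound)
      let ?K = "\<bar>s * 2 powi j - 2 powi j\<bar> * (\<integral>y. norm (g j y) \<partial>lborel)"
      show "integrable lborel (\<lambda>x. ?K * cmod (smooth_block j f x))" using si by simp
      show "(\<lambda>x. smooth_block j f x * cnj (conv (?B j) (g j) x)) \<in> borel_measurable lborel" using sm bm[OF j] by simp
      show "AE x in lborel. cmod (smooth_block j f x * cnj (conv (?B j) (g j) x)) \<le> norm (?K * cmod (smooth_block j f x))"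
      proof (rule AE_I2)
        fix x
        have "cmod (conv (?B j) (g j) x) \<le> ?K" by (rule conv_bounded_integrable(2)[OF bsupp_integrable[OF g[OF j]] band_measurable band_bound])
        then have "cmod (smooth_block j f x) * cmod (conv (?B j) (g j) x) \<le> cmod (smooth_block j f x) * ?K" by (intro mult_left_mono) auto
        also have "\<dots> \<le> norm (?K * cmod (smooth_block j f x))" by (simp add: abs_mult mult.commute)
        finally show "cmod (smooth_block j f x * cnj (conv (?B j) (g j) x)) \<le> norm (?K * cmod (smooth_block j f x))" by (simp add: norm_mult)
      qed
    qed
    show "conv (?B j) (g j) \<in> borel_measurable borel" by (rule bm[OF j])
  next
    show "pmass p (\<lambda>x. L2_set (\<lambda>j. cmod (smooth_block j f x)) J) \<le> ennreal ((40 * \<kappa>) powr p * pmass_real p (\<lambda>x. cmod (f x)))"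
      unfolding \<kappa>_def by (rule smooth_block_square[OF J f p(1)])
    have "pmass q (\<lambda>x. L2_set (\<lambda>j. cmod (conv (?B j) (g j) x)) J) \<le> ennreal ((128 * pi * (q + 1 / (q - 1))) powr q * pmass_real q (\<lambda>x. L2_set (\<lambda>j. cmod (g j x)) J))"
      by (rule band_vector[OF J g _ p(2)]) (use s in auto)
    then show "pmass q (\<lambda>x. L2_set (\<lambda>j. cmod (conv (?B j) (g j) x)) J) \<le> ennreal (l powr q * pmass_real q (\<lambda>x. L2_set (\<lambda>j. cmod (g j x)) J))"
      unfolding kappa_dual[OF p(1,3,2)] l_def \<kappa>_def .
  qed (use sm pmass_real_nonneg in auto)
  also have "l powr p * ((40 * \<kappa>) powr p * pmass_real p (\<lambda>x. cmod (f x))) = (l powr p * (40 * \<kappa>) powr p) * pmass_real p (\<lambda>x. cmod (f x))" by simp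
  also have "l powr p * (40 * \<kappa>) powr p = (l * (40 * \<kappa>)) powr p" by (rule powr_mult[symmetric])
  also have "l * (40 * \<kappa>) = 5120 * pi * \<kappa>\<^sup>2" by (simp add: l_def power2_eq_square)
  finally show ?thesis using l unfolding \<kappa>_def by simp
qed

lemma ft_uminus: "ft (\<lambda>x. - f x) \<xi> = - ft f \<xi>"
  unfolding ft_def by simp

text \<open>The other sign follows by replacing every g_j by its negative.\<close>

lemma subband_form_abs_bound:
  assumes J: "finite J" and f: "bsupp f" and g: "\<And>j. j \<in> J \<Longrightarrow> bsupp (g j)" and s: "1 \<le> s"
    and p: "p > 1" "q > 1" "1/p + 1/q = 1"
  shows "\<bar>Re (subband_form g J f s)\<bar> \<le> (5120 * pi * (p + 1 / (p - 1))\<^sup>2) powr p * pmass_real p (\<lambda>x. cmod (f x)) / p + pmass_real q (\<lambda>x. L2_set (\<lambda>j. cmod (g j x)) J) / q"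
proof -
  have "subband_form (\<lambda>j x. - g j x) J f s = - subband_form g J f s"
    unfolding subband_form_def by (simp add: ft_uminus sum_negf)
  moreover have "bsupp (\<lambda>x. - g j x)" if "j \<in> J" for j
    using bsupp_mult(1)[OF g[OF that], of "\<lambda>_. -1" 1] by simp
  ultimately show ?thesis using subband_form_bound[OF J f g s p] subband_form_bound[OF J f, of "\<lambda>j x. - g j x", OF _ s p] by (simp add: abs_le_iff)
qed

text \<open>On the positive half-shell the transform of f is the reciprocal symbol times that of the
  smooth block. Inserting the superposition and exchanging the integrals expresses the sharp pairing
  through subband pairings.\<close>

lemma half_repr:
  assumes f: "bsupp f" and g: "bsupp g"
  shows "(\<integral>\<xi>. indicator {2 powi j..<2 * 2 powi j} \<xi> * (ft f \<xi> * cnj (ft g \<xi>)) \<partial>lborel)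
    = inv_symbol 2 * (\<integral>\<xi>. indicator {2 powi j..<2 * 2 powi j} \<xi> * (ft (smooth_block j f) \<xi> * cnj (ft g \<xi>)) \<partial>lborel)
      - (\<integral>s. of_real (indicator {1..2} s * inv_symbol' s) * (\<integral>\<xi>. indicator {2 powi j..<s * 2 powi j} \<xi> * (ft (smooth_block j f) \<xi> * cnj (ft g \<xi>)) \<partial>lborel) \<partial>lborel)"
    "integrable lborel (\<lambda>s. of_real (indicator {1..2} s * inv_symbol' s) * (\<integral>\<xi>. indicator {2 powi j..<s * 2 powi j} \<xi> * (ft (smooth_block j f) \<xi> * cnj (ft g \<xi>)) \<partial>lborel))"
proof -
  let ?T = "2 powi j :: real"
  have T: "?T > 0" by simp
  have si: "integrable lborel (smooth_block j f)" by (rule ft_smooth_block(2)[OF f])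
  have [measurable]: "smooth_block j f \<in> borel_measurable borel" "f \<in> borel_measurable borel" "g \<in> borel_measurable borel"
    using si bsupp_measurable[OF f] bsupp_measurable[OF g] by auto
  define \<Psi> where "\<Psi> \<xi> = indicator {?T..<2 * ?T} \<xi> * (ft (smooth_block j f) \<xi> * cnj (ft g \<xi>))" for \<xi>
  have \<Psi>i: "integrable lborel \<Psi>"
  proof -
    have "cmod (ft (smooth_block j f) \<xi> * cnj (ft g \<xi>)) \<le> (\<integral>x. cmod (smooth_block j f x) \<partial>lborel) * (\<integral>x. cmod (g x) \<partial>lborel)" for \<xi>
      unfolding norm_mult complex_mod_cnj by (intro mult_mono ft_bound) auto
    then show ?thesis unfolding \<Psi>_def by (intro bsupp_integrable bsupp_mult(1)[OF bsupp_indicator_Ico]) measurable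
  qed
  have [measurable]: "\<Psi> \<in> borel_measurable borel" using \<Psi>i by auto
  define u where "u s = complex_of_real (indicator {1..2} s * inv_symbol' s)" for s
  have ui: "integrable lborel u" unfolding u_def by (rule integrable_of_real[OF inv_symbol'_integrable])
  define w where "w s \<xi> = (if \<xi> / ?T < s then 1 else 0 :: complex)" for s \<xi>
  have [measurable]: "case_prod w \<in> borel_measurable (lborel \<Otimes>\<^sub>M lborel)" unfolding w_def by measurable
  have *: "integrable (lborel \<Otimes>\<^sub>M lborel) (\<lambda>(s,\<xi>). w s \<xi> * (u s * \<Psi> \<xi>))"
    by (rule integrable_prod_pair[where K = 1]) (use ui \<Psi>i in \<open>auto simp: w_def\<close>)
  have inner: "(\<integral>\<xi>. w s \<xi> * (u s * \<Psi> \<xi>) \<partial>lborel) = u s * (\<integral>\<xi>. indicator {?T..<s * ?T} \<xi> * (ft (smooth_block j f) \<xi> * cnj (ft g \<xi>)) \<partial>lborel)" for s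
  proof (cases "s \<in> {1..2}")
    case True
    have "w s \<xi> * (u s * \<Psi> \<xi>) = u s * (indicator {?T..<s * ?T} \<xi> * (ft (smooth_block j f) \<xi> * cnj (ft g \<xi>)))" for \<xi>
    proof -
      \<comment> \<open>For s <= 2 the cut-off at s 2^j lies inside the half-shell, so the indicator
        of the latter disappears.\<close>
      have "s * ?T \<le> 2 * ?T" by (rule mult_right_mono) (use True T in auto)
      then have "\<xi> < s * ?T \<Longrightarrow> \<xi> < 2 * ?T" by linarith
      moreover have "\<xi> / ?T < s \<longleftrightarrow> \<xi> < s * ?T" using T by (simp add: divide_less_eq)
      ultimately show ?thesis by (auto simp: w_def \<Psi>_def indicator_def)
    qed
    then show ?thesis by (simp only: integral_mult_right_zero)
  qed (simp add: u_def)
  have "integrable lborel (\<lambda>s. \<integral>\<xi>. w s \<xi> * (u s * \<Psi> \<xi>) \<partial>lborel)" using lborel_pair.integrable_fst[OF *] .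
  then show "integrable lborel (\<lambda>s. of_real (indicator {1..2} s * inv_symbol' s) * (\<integral>\<xi>. indicator {?T..<s * ?T} \<xi> * (ft (smooth_block j f) \<xi> * cnj (ft g \<xi>)) \<partial>lborel))"
    unfolding inner unfolding u_def .
  have snd: "integrable lborel (\<lambda>\<xi>. \<integral>s. w s \<xi> * (u s * \<Psi> \<xi>) \<partial>lborel)" using lborel_pair.integrable_snd[OF *] .
  have ptw: "indicator {?T..<2 * ?T} \<xi> * (ft f \<xi> * cnj (ft g \<xi>)) = inv_symbol 2 * \<Psi> \<xi> - (\<integral>s. w s \<xi> * (u s * \<Psi> \<xi>) \<partial>lborel)" for \<xi>
  proof (cases "\<xi> \<in> {?T..<2 * ?T}")
    case True
    define t where "t = \<xi> / ?T"
    have t: "1 \<le> t" "t < 2" using True T by (auto simp: t_def le_divide_eq divide_less_eq)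
    have "(\<integral>s. w s \<xi> * (u s * \<Psi> \<xi>) \<partial>lborel) = (\<integral>s. w s \<xi> * u s \<partial>lborel) * \<Psi> \<xi>"
      by (simp flip: integral_mult_left_zero mult.assoc)
    also have "(\<integral>s. w s \<xi> * u s \<partial>lborel) = (\<integral>s. complex_of_real (indicator {1..2} s * inv_symbol' s * (if t < s then 1 else 0)) \<partial>lborel)"
      by (intro Bochner_Integration.integral_cong) (auto simp: w_def u_def t_def)
    also have "\<dots> = of_real (inv_symbol 2 - inv_symbol t)" unfolding integral_complex_of_real using inv_symbol_repr[OF t] by simp
    finally have "inv_symbol 2 * \<Psi> \<xi> - (\<integral>s. w s \<xi> * (u s * \<Psi> \<xi>) \<partial>lborel) = of_real (inv_symbol t) * \<Psi> \<xi>" by (simp add: algebra_simps)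
    also have "\<dots> = of_real (inv_symbol t * mult_m t) * (ft f \<xi> * cnj (ft g \<xi>))"
      using True by (simp add: \<Psi>_def ft_smooth_block(1)[OF f] t_def)
    also have "inv_symbol t * mult_m t = 1" using mult_m_pos[of t] t by (simp add: inv_symbol_def)
    finally show ?thesis using True by simp
  qed (simp add: \<Psi>_def)
  have "(\<integral>\<xi>. indicator {?T..<2 * ?T} \<xi> * (ft f \<xi> * cnj (ft g \<xi>)) \<partial>lborel) = inv_symbol 2 * (\<integral>\<xi>. \<Psi> \<xi> \<partial>lborel) - (\<integral>\<xi>. \<integral>s. w s \<xi> * (u s * \<Psi> \<xi>) \<partial>lborel \<partial>lborel)"
    unfolding ptw using \<Psi>i snd by simp
  also have "(\<integral>\<xi>. \<integral>s. w s \<xi> * (u s * \<Psi> \<xi>) \<partial>lborel \<partial>lborel) = (\<integral>s. \<integral>\<xi>. w s \<xi> * (u s * \<Psi> \<xi>) \<partial>lborel \<partial>lborel)"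
    by (rule lborel_pair.Fubini_integral[OF *])
  finally show "(\<integral>\<xi>. indicator {?T..<2 * ?T} \<xi> * (ft f \<xi> * cnj (ft g \<xi>)) \<partial>lborel)
    = inv_symbol 2 * (\<integral>\<xi>. indicator {?T..<2 * ?T} \<xi> * (ft (smooth_block j f) \<xi> * cnj (ft g \<xi>)) \<partial>lborel)
      - (\<integral>s. of_real (indicator {1..2} s * inv_symbol' s) * (\<integral>\<xi>. indicator {?T..<s * ?T} \<xi> * (ft (smooth_block j f) \<xi> * cnj (ft g \<xi>)) \<partial>lborel) \<partial>lborel)"
    unfolding inner unfolding u_def \<Psi>_def .
qed

text \<open>A bound on the subband forms that is uniform in s passes to their superposition with the
  total mass as factor. Absolute values of the form are used because the superposition is
  subtracted.\<close>

lemma half_bound: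
  assumes J: "finite J" and f: "bsupp f" and g: "\<And>j. j \<in> J \<Longrightarrow> bsupp (g j)"
    and p: "p > 1" "q > 1" "1/p + 1/q = 1"
  shows "Re (\<Sum>j\<in>J. \<integral>\<xi>. indicator {2 powi j..<2 * 2 powi j} \<xi> * (ft f \<xi> * cnj (ft (g j) \<xi>)) \<partial>lborel)
    \<le> inv_symbol_var * ((5120 * pi * (p + 1 / (p - 1))\<^sup>2) powr p * pmass_real p (\<lambda>x. cmod (f x)) / p + pmass_real q (\<lambda>x. L2_set (\<lambda>j. cmod (g j x)) J) / q)"
proof -
  define K where "K = (5120 * pi * (p + 1 / (p - 1))\<^sup>2) powr p * pmass_real p (\<lambda>x. cmod (f x)) / p + pmass_real q (\<lambda>x. L2_set (\<lambda>j. cmod (g j x)) J) / q"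
  have KB: "\<bar>Re (subband_form g J f s)\<bar> \<le> K" if "1 \<le> s" for s unfolding K_def by (rule subband_form_abs_bound[OF J f g that p])
  define Z where "Z s = complex_of_real (indicator {1..2} s * inv_symbol' s) * subband_form g J f s" for s
  have Zi: "integrable lborel Z" unfolding Z_def subband_form_def sum_distrib_left
    by (intro Bochner_Integration.integrable_sum half_repr(2) f g)
  have eq: "(\<Sum>j\<in>J. \<integral>\<xi>. indicator {2 powi j..<2 * 2 powi j} \<xi> * (ft f \<xi> * cnj (ft (g j) \<xi>)) \<partial>lborel) = inv_symbol 2 * subband_form g J f 2 - (\<integral>s. Z s \<partial>lborel)"
  proof -
    have "(\<Sum>j\<in>J. \<integral>\<xi>. indicator {2 powi j..<2 * 2 powi j} \<xi> * (ft f \<xi> * cnj (ft (g j) \<xi>)) \<partial>lborel) 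
      = (\<Sum>j\<in>J. inv_symbol 2 * (\<integral>\<xi>. indicator {2 powi j..<2 * 2 powi j} \<xi> * (ft (smooth_block j f) \<xi> * cnj (ft (g j) \<xi>)) \<partial>lborel)
      - (\<integral>s. of_real (indicator {1..2} s * inv_symbol' s) * (\<integral>\<xi>. indicator {2 powi j..<s * 2 powi j} \<xi> * (ft (smooth_block j f) \<xi> * cnj (ft (g j) \<xi>)) \<partial>lborel) \<partial>lborel))"
      by (rule sum.cong[OF refl half_repr(1)[OF f g]])
    also have "\<dots> = inv_symbol 2 * subband_form g J f 2 - (\<Sum>j\<in>J. \<integral>s. of_real (indicator {1..2} s * inv_symbol' s) * (\<integral>\<xi>. indicator {2 powi j..<s * 2 powi j} \<xi> * (ft (smooth_block j f) \<xi> * cnj (ft (g j) \<xi>)) \<partial>lborel) \<partial>lborel)"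
      by (simp only: sum_subtractf sum_distrib_left subband_form_def)
    also have "(\<Sum>j\<in>J. \<integral>s. of_real (indicator {1..2} s * inv_symbol' s) * (\<integral>\<xi>. indicator {2 powi j..<s * 2 powi j} \<xi> * (ft (smooth_block j f) \<xi> * cnj (ft (g j) \<xi>)) \<partial>lborel) \<partial>lborel) = (\<integral>s. Z s \<partial>lborel)"
      unfolding Z_def subband_form_def sum_distrib_left
      by (rule Bochner_Integration.integral_sum[symmetric, OF half_repr(2)[OF f g]])
    finally show ?thesis .
  qed
  have Z: "\<bar>Re (Z s)\<bar> \<le> (indicator {1..2} s * \<bar>inv_symbol' s\<bar>) * K" for s
  proof (cases "s \<in> {1..2}")
    case True
    have "\<bar>Re (Z s)\<bar> = \<bar>inv_symbol' s\<bar> * \<bar>Re (subband_form g J f s)\<bar>" using True by (simp add: Z_def abs_mult)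
    also have "\<dots> \<le> \<bar>inv_symbol' s\<bar> * K" using True by (intro mult_left_mono KB) auto
    finally show ?thesis using True by simp
  qed (simp add: Z_def)
  have "integrable lborel (\<lambda>s. \<bar>indicator {1..2} s * inv_symbol' s\<bar>)" using inv_symbol'_integrable by (rule integrable_abs)
  then have ai: "integrable lborel (\<lambda>s. indicator {1..2} s * \<bar>inv_symbol' s\<bar>)" by (simp add: abs_mult)
  have "- Re (\<integral>s. Z s \<partial>lborel) = (\<integral>s. - Re (Z s) \<partial>lborel)" using Zi by simp
  also have "\<dots> \<le> (\<integral>s. (indicator {1..2} s * \<bar>inv_symbol' s\<bar>) * K \<partial>lborel)"
    using Zi ai Z by (intro integral_mono) (auto simp: abs_le_iff)
  finally have 1: "- Re (\<integral>s. Z s \<partial>lborel) \<le> (\<integral>s. indicator {1..2} s * \<bar>inv_symbol' s\<bar> \<partial>lborel) * K" by simp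
  have "inv_symbol 2 * Re (subband_form g J f 2) \<le> \<bar>inv_symbol 2\<bar> * \<bar>Re (subband_form g J f 2)\<bar>"
    using abs_ge_self[of "inv_symbol 2 * Re (subband_form g J f 2)"] by (simp add: abs_mult)
  also have "\<dots> \<le> \<bar>inv_symbol 2\<bar> * K" by (intro mult_left_mono KB) auto
  finally have "Re (inv_symbol 2 * subband_form g J f 2) \<le> \<bar>inv_symbol 2\<bar> * K" by simp
  then show ?thesis unfolding eq K_def[symmetric] inv_symbol_var_def using 1 by (simp add: distrib_right)
qed

section \<open>Kernels of the two-sided shells and their upper bound\<close>

definition shell_kernel :: "int \<Rightarrow> real \<Rightarrow> complex" where
  "shell_kernel j x = band (2 powi j) (2 * 2 powi j) x + band (- (2 * 2 powi j)) (- (2 powi j)) x"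

lemma shell_kernel_measurable [measurable]: "shell_kernel j \<in> borel_measurable borel"
  unfolding shell_kernel_def by measurable

lemma conv_shell_kernel:
  assumes f: "integrable lborel f"
  shows "conv (shell_kernel j) f x = conv (band (2 powi j) (2 * 2 powi j)) f x + conv (band (- (2 * 2 powi j)) (- (2 powi j))) f x"
  unfolding conv_def shell_kernel_def distrib_right
  by (rule Bochner_Integration.integral_add; rule conv_bounded_integrable(1)[OF f band_measurable band_bound])

lemma ft_reflect: "ft (\<lambda>x. f (- x)) \<xi> = ft f (- \<xi>)"
  unfolding ft_def using lborel_integral_shift[of "\<lambda>x. uchar (- (x * \<xi>)) * f (- x)" 0] by simp

lemma pmass_real_reflect: "pmass_real p (\<lambda>x. f (- x)) = pmass_real p f"
  unfolding pmass_real_def using lborel_integral_shift[of "\<lambda>x. \<bar>f x\<bar> powr p" 0] by simp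

lemma bsupp_reflect:
  assumes "bsupp f" shows "bsupp (\<lambda>x. f (- x))"
proof -
  have [measurable]: "f \<in> borel_measurable borel" using assms by (rule bsupp_measurable)
  obtain M R where "\<And>x. norm (f x) \<le> M" "\<And>x. R < \<bar>x\<bar> \<Longrightarrow> f x = 0" using bsuppE[OF assms] by metis
  then show ?thesis by (intro bsuppI[of _ M R]) auto
qed

text \<open>The factor 2 counts the two halves of a shell, \<open>inv_symbol_var\<close> comes from
  the superposition, and 5120 pi from the subband bound.\<close>

definition base_const :: real where "base_const = 2 * inv_symbol_var * (5120 * pi)"

lemma inv_symbol_var_pos: "inv_symbol_var > 0"
proof -
  have "0 < \<bar>inv_symbol 2\<bar>" using mult_m_pos[of 2] by (simp add: inv_symbol_def)
  moreover have "0 \<le> (\<integral>s. indicator {1..2} s * \<bar>inv_symbol' s\<bar> \<partial>lborel)" by (intro Bochner_Integration.integral_nonneg) auto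
  ultimately show ?thesis unfolding inv_symbol_var_def by linarith
qed

text \<open>Reflecting f and all g_j carries the negative half-shell to the positive one up to end
  points and leaves the masses unchanged.\<close>

lemma block_pairing_bound0:
  assumes J: "finite J" and f: "bsupp f" and g: "\<And>j. j \<in> J \<Longrightarrow> bsupp (g j)"
    and p: "p > 1" "q > 1" "1/p + 1/q = 1"
  shows "Re (\<Sum>j\<in>J. \<integral>x. conv (shell_kernel j) f x * cnj (g j x) \<partial>lborel)
    \<le> 2 * inv_symbol_var * ((5120 * pi * (p + 1 / (p - 1))\<^sup>2) powr p * pmass_real p (\<lambda>x. cmod (f x)) / p + pmass_real q (\<lambda>x. L2_set (\<lambda>j. cmod (g j x)) J) / q)"
proof -
  have fi: "integrable lborel f" by (rule bsupp_integrable[OF f])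
  let ?f = "\<lambda>x. f (- x)" and ?g = "\<lambda>j x. g j (- x)"
  have eq: "(\<integral>x. conv (shell_kernel j) f x * cnj (g j x) \<partial>lborel) = 
     (\<integral>\<xi>. indicator {2 powi j..<2 * 2 powi j} \<xi> * (ft f \<xi> * cnj (ft (g j) \<xi>)) \<partial>lborel)
     + (\<integral>\<xi>. indicator {2 powi j..<2 * 2 powi j} \<xi> * (ft ?f \<xi> * cnj (ft (?g j) \<xi>)) \<partial>lborel)" if j: "j \<in> J" for j
  proof -
    have gi: "integrable lborel (g j)" by (rule bsupp_integrable[OF g[OF j]])
    have i: "integrable lborel (\<lambda>x. conv (band a b) f x * cnj (g j x))" for a b
    proof (rule Bochner_Integration.integrable_bound)
      show "integrable lborel (\<lambda>x. (\<bar>b - a\<bar> * (\<integral>y. norm (f y) \<partial>lborel)) * cmod (g j x))" using gi by simp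
      show "(\<lambda>x. conv (band a b) f x * cnj (g j x)) \<in> borel_measurable lborel" using fi gi by simp
      show "AE x in lborel. cmod (conv (band a b) f x * cnj (g j x)) \<le> norm ((\<bar>b - a\<bar> * (\<integral>y. norm (f y) \<partial>lborel)) * cmod (g j x))"
        unfolding norm_mult complex_mod_cnj
        by (intro AE_I2 mult_mono order_trans[OF conv_bounded_integrable(2)[OF fi band_measurable band_bound]]) auto
    qed
    have "(\<integral>x. conv (shell_kernel j) f x * cnj (g j x) \<partial>lborel) = (\<integral>x. conv (band (2 powi j) (2 * 2 powi j)) f x * cnj (g j x) \<partial>lborel)
       + (\<integral>x. conv (band (- (2 * 2 powi j)) (- (2 powi j))) f x * cnj (g j x) \<partial>lborel)"
      unfolding conv_shell_kernel[OF fi] distrib_right by (rule Bochner_Integration.integral_add[OF i i])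
    also have "(\<integral>x. conv (band (- (2 * 2 powi j)) (- (2 powi j))) f x * cnj (g j x) \<partial>lborel)
       = (\<integral>\<xi>. indicator {- (2 * 2 powi j)..<- (2 powi j)} (- \<xi>) * (ft f (- \<xi>) * cnj (ft (g j) (- \<xi>))) \<partial>lborel)"
      unfolding conv_band_pairing[OF fi gi]
      using lborel_integral_shift[of "\<lambda>\<xi>. indicator {- (2 * 2 powi j)..<- (2 powi j)} \<xi> * (ft f \<xi> * cnj (ft (g j) \<xi>))" 0] by simp
    also have "\<dots> = (\<integral>\<xi>. indicator {2 powi j..<2 * 2 powi j} \<xi> * (ft ?f \<xi> * cnj (ft (?g j) \<xi>)) \<partial>lborel)"
      unfolding ft_reflect
    proof (rule integral_cong_AE)
      have [measurable]: "f \<in> borel_measurable borel" "g j \<in> borel_measurable borel" using fi gi by auto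
      show "(\<lambda>\<xi>. indicator {- (2 * 2 powi j)..<- (2 powi j)} (- \<xi>) * (ft f (- \<xi>) * cnj (ft (g j) (- \<xi>)))) \<in> borel_measurable lborel" by measurable
      show "(\<lambda>\<xi>. indicator {2 powi j..<2 * 2 powi j} \<xi> * (ft f (- \<xi>) * cnj (ft (g j) (- \<xi>)))) \<in> borel_measurable lborel" by measurable
      have "AE \<xi> in lborel. \<xi> \<noteq> 2 powi j" "AE \<xi> in lborel. \<xi> \<noteq> 2 * 2 powi j" by (rule AE_lborel_singleton)+
      then show "AE \<xi> in lborel. indicator {- (2 * 2 powi j)..<- (2 powi j)} (- \<xi>) * (ft f (- \<xi>) * cnj (ft (g j) (- \<xi>))) = indicator {2 powi j..<2 * 2 powi j} \<xi> * (ft f (- \<xi>) * cnj (ft (g j) (- \<xi>)))"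
        by eventually_elim (auto simp: indicator_def)
    qed
    finally show ?thesis unfolding conv_band_pairing[OF fi gi] .
  qed
  have "(\<Sum>j\<in>J. \<integral>x. conv (shell_kernel j) f x * cnj (g j x) \<partial>lborel) = 
     (\<Sum>j\<in>J. \<integral>\<xi>. indicator {2 powi j..<2 * 2 powi j} \<xi> * (ft f \<xi> * cnj (ft (g j) \<xi>)) \<partial>lborel)
     + (\<Sum>j\<in>J. \<integral>\<xi>. indicator {2 powi j..<2 * 2 powi j} \<xi> * (ft ?f \<xi> * cnj (ft (?g j) \<xi>)) \<partial>lborel)"
    unfolding sum.distrib[symmetric] by (rule sum.cong[OF refl eq])
  moreover have "pmass_real p (\<lambda>x. cmod (?f x)) = pmass_real p (\<lambda>x. cmod (f x))" by (rule pmass_real_reflect)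
  moreover have "pmass_real q (\<lambda>x. L2_set (\<lambda>j. cmod (?g j x)) J) = pmass_real q (\<lambda>x. L2_set (\<lambda>j. cmod (g j x)) J)" by (rule pmass_real_reflect)
  ultimately show ?thesis
    using half_bound[where g = g, OF J f g p] half_bound[where g = ?g, OF J bsupp_reflect[OF f] bsupp_reflect[OF g] p] by simp
qed

text \<open>The factor V in front of the whole Young form has to be moved to the mass of f alone.
  Scaling f by \<mu> and g by 1 / \<mu> with \<mu>^q = V achieves this, since V \<mu>^p = V^(1 +
  p/q) = V^p.\<close>

lemma block_upper_bsupp:
  assumes J: "finite J" and f: "bsupp f" and p: "p > 1"
  shows "pmass p (\<lambda>x. L2_set (\<lambda>j. cmod (conv (shell_kernel j) f x)) J) \<le> ennreal ((base_const * (p + 1 / (p - 1))\<^sup>2) powr p * pmass_real p (\<lambda>x. cmod (f x)))"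
proof -
  define q where "q = p / (p - 1)"
  have q: "q > 1" "1/p + 1/q = 1" using p by (auto simp: q_def field_simps)
  define \<kappa> where "\<kappa> = p + 1 / (p - 1)"
  define V where "V = 2 * inv_symbol_var"
  have V: "V > 0" using inv_symbol_var_pos by (simp add: V_def)
  define \<mu> where "\<mu> = V powr (1/q)"
  have \<mu>: "\<mu> > 0" using V by (simp add: \<mu>_def)
  have \<mu>q: "\<mu> powr q = V" using V q by (simp add: \<mu>_def powr_powr)
  have V\<mu>: "V * \<mu> powr p = V powr p"
  proof -
    have "1 + p / q = p" using q p by (simp add: field_simps)
    then have "V powr p = V powr 1 * V powr (p / q)" unfolding powr_add[symmetric] by simp
    then show ?thesis using V by (simp add: \<mu>_def powr_powr)
  qed
  show ?thesis
  proof (rule norming[OF J p q])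
    show "conv (shell_kernel j) f \<in> borel_measurable borel" for j using bsupp_measurable[OF f] by measurable
    fix g :: "int \<Rightarrow> real \<Rightarrow> complex" assume g: "\<And>j. j \<in> J \<Longrightarrow> bsupp (g j)"
    let ?f = "\<lambda>x. of_real \<mu> * f x" and ?g = "\<lambda>j x. of_real (1/\<mu>) * g j x"
    have fg: "bsupp ?f" "\<And>j. j \<in> J \<Longrightarrow> bsupp (?g j)"
      by (rule bsupp_mult(2)[OF f _ order_refl], simp) (rule bsupp_mult(2)[OF g _ order_refl], simp_all)
    have "conv (shell_kernel j) ?f x * cnj (?g j x) = conv (shell_kernel j) f x * cnj (g j x)" for j x
      unfolding conv_cmult using \<mu> by simp
    then have "Re (\<Sum>j\<in>J. \<integral>x. conv (shell_kernel j) f x * cnj (g j x) \<partial>lborel) = Re (\<Sum>j\<in>J. \<integral>x. conv (shell_kernel j) ?f x * cnj (?g j x) \<partial>lborel)"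
      by simp
    also have "\<dots> \<le> V * ((5120 * pi * \<kappa>\<^sup>2) powr p * pmass_real p (\<lambda>x. cmod (?f x)) / p + pmass_real q (\<lambda>x. L2_set (\<lambda>j. cmod (?g j x)) J) / q)"
      unfolding V_def \<kappa>_def by (rule block_pairing_bound0[OF J fg p q])
    also have "pmass_real p (\<lambda>x. cmod (?f x)) = \<mu> powr p * pmass_real p (\<lambda>x. cmod (f x))"
      using pmass_real_cmult[of p \<mu> "\<lambda>x. cmod (f x)"] \<mu> by (simp add: norm_mult)
    also have "(\<lambda>x. L2_set (\<lambda>j. cmod (?g j x)) J) = (\<lambda>x. (1/\<mu>) * L2_set (\<lambda>j. cmod (g j x)) J)"
    proof
      fix x
      have "L2_set (\<lambda>j. \<bar>1/\<mu>\<bar> * cmod (g j x)) J = \<bar>1/\<mu>\<bar> * L2_set (\<lambda>j. cmod (g j x)) J"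
        by (rule L2_set_right_distrib[symmetric]) simp
      then show "L2_set (\<lambda>j. cmod (?g j x)) J = (1/\<mu>) * L2_set (\<lambda>j. cmod (g j x)) J"
        using \<mu> by (simp only: norm_mult norm_of_real abs_of_pos divide_pos_pos zero_less_one)
    qed
    also have "pmass_real q (\<lambda>x. (1/\<mu>) * L2_set (\<lambda>j. cmod (g j x)) J) = pmass_real q (\<lambda>x. L2_set (\<lambda>j. cmod (g j x)) J) / V"
      unfolding pmass_real_cmult using \<mu> \<mu>q by (simp add: powr_divide)
    also have "V * ((5120 * pi * \<kappa>\<^sup>2) powr p * (\<mu> powr p * pmass_real p (\<lambda>x. cmod (f x))) / p + pmass_real q (\<lambda>x. L2_set (\<lambda>j. cmod (g j x)) J) / V / q)
       = (V * \<mu> powr p) * (5120 * pi * \<kappa>\<^sup>2) powr p * pmass_real p (\<lambda>x. cmod (f x)) / p + pmass_real q (\<lambda>x. L2_set (\<lambda>j. cmod (g j x)) J) / q"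
      using V by (simp add: distrib_left)
    also have "(V * \<mu> powr p) * (5120 * pi * \<kappa>\<^sup>2) powr p = (base_const * \<kappa>\<^sup>2) powr p"
      unfolding V\<mu> powr_mult[symmetric] by (simp add: base_const_def V_def mult_ac)
    finally show "Re (\<Sum>j\<in>J. \<integral>x. conv (shell_kernel j) f x * cnj (g j x) \<partial>lborel) \<le> ((base_const * (p + 1 / (p - 1))\<^sup>2) powr p * pmass_real p (\<lambda>x. cmod (f x))) / p + pmass_real q (\<lambda>x. L2_set (\<lambda>j. cmod (g j x)) J) / q"
      unfolding \<kappa>_def by simp
  qed
qed

section \<open>Plancherel and completeness of the dyadic shells\<close>

definition gauss_weight :: "real \<Rightarrow> real \<Rightarrow> complex" where
  "gauss_weight s \<xi> = of_real (exp (- (2 * pi\<^sup>2 * s\<^sup>2 * \<xi>\<^sup>2)))"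

lemma gauss_weight_gauss_kernel:
  assumes s: "s > 0"
  shows "gauss_weight s \<xi> = of_real (1 / (sqrt (2 * pi) * s)) * gauss_kernel (1 / (2 * pi * s)) \<xi>"
proof -
  have "sqrt (2 * pi * (1 / (2 * pi * s))\<^sup>2) = sqrt (2 * pi) * (1 / (2 * pi * s))"
    using s by (simp add: real_sqrt_mult)
  also have "\<dots> = 1 / (sqrt (2 * pi) * s)"
    using s real_sqrt_mult_self[of "2 * pi"] by (simp add: field_simps)
  finally have "1 / (sqrt (2 * pi) * s) * normal_density 0 (1 / (2 * pi * s)) \<xi> = exp (- \<xi>\<^sup>2 / (2 * (1 / (2 * pi * s))\<^sup>2))"
    using s by (simp add: normal_density_def)
  also have "- \<xi>\<^sup>2 / (2 * (1 / (2 * pi * s))\<^sup>2) = - (2 * pi\<^sup>2 * s\<^sup>2 * \<xi>\<^sup>2)"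
    using s by (simp add: power_divide power_mult_distrib)
  finally have e: "1 / (sqrt (2 * pi) * s) * normal_density 0 (1 / (2 * pi * s)) \<xi> = exp (- (2 * pi\<^sup>2 * s\<^sup>2 * \<xi>\<^sup>2))" .
  show ?thesis unfolding gauss_weight_def gauss_kernel_def of_real_mult[symmetric] e ..
qed

lemma gauss_weight_integrable:
  assumes s: "s > 0" shows "integrable lborel (gauss_weight s)"
proof -
  have "gauss_weight s = (\<lambda>\<xi>. of_real (1 / (sqrt (2 * pi) * s)) * gauss_kernel (1 / (2 * pi * s)) \<xi>)" by (rule ext, rule gauss_weight_gauss_kernel[OF s])
  moreover have "integrable lborel (gauss_kernel (1 / (2 * pi * s)))" by (rule gauss_kernel_integrable) (use s in simp)
  ultimately show ?thesis by simp
qed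

text \<open>Fourier inversion in the explicit Gaussian case: the weight is itself a multiple of the
  Gaussian of deviation 1 / (2 pi s). It exhibits a Gaussian average as a multiplier with integrable
  symbol.\<close>

lemma gauss_kernel_fourier_kernel:
  assumes s: "s > 0"
  shows "gauss_kernel s = fourier_kernel (gauss_weight s)"
proof
  fix x
  have "fourier_kernel (gauss_weight s) x = of_real (1 / (sqrt (2 * pi) * s)) * (\<integral>\<xi>. uchar (- (\<xi> * (- x))) * gauss_kernel (1 / (2 * pi * s)) \<xi> \<partial>lborel)"
    unfolding fourier_kernel_def gauss_weight_gauss_kernel[OF s] integral_mult_right_zero[symmetric] by (simp add: mult_ac)
  also have "(\<integral>\<xi>. uchar (- (\<xi> * (- x))) * gauss_kernel (1 / (2 * pi * s)) \<xi> \<partial>lborel) = ft (gauss_kernel (1 / (2 * pi * s))) (- x)"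
    unfolding ft_def ..
  also have "\<dots> = of_real (exp (- (2 * pi\<^sup>2 * (1 / (2 * pi * s))\<^sup>2 * (- x)\<^sup>2)))"
    by (rule ft_normal) (use s in simp)
  also have "2 * pi\<^sup>2 * (1 / (2 * pi * s))\<^sup>2 * (- x)\<^sup>2 = x\<^sup>2 / (2 * s\<^sup>2)"
    using s by (simp add: power_divide power_mult_distrib)
  also have "of_real (1 / (sqrt (2 * pi) * s)) * of_real (exp (- (x\<^sup>2 / (2 * s\<^sup>2)))) = gauss_kernel s x"
    using s by (simp add: gauss_kernel_def normal_density_def real_sqrt_mult)
  finally show "gauss_kernel s x = fourier_kernel (gauss_weight s) x" by simp
qed

lemma gauss_kernel_measurable [measurable]: "gauss_kernel s \<in> borel_measurable borel"
  unfolding gauss_kernel_def by measurable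

lemma integral_norm_gauss_kernel: "s > 0 \<Longrightarrow> (\<integral>x. cmod (gauss_kernel s x) \<partial>lborel) = 1"
  by (simp add: gauss_kernel_def)

text \<open>Convergence is claimed only at continuity points, where it is dominated convergence
  after rescaling; this is what brings almost everywhere continuity into Plancherel's
  identity.\<close>

lemma conv_gauss_kernel_tendsto:
  assumes f: "bsupp f" and x: "isCont f x" and s: "s \<longlonglongrightarrow> 0" "\<And>n. s n > 0"
  shows "(\<lambda>n. conv (gauss_kernel (s n)) f x) \<longlonglongrightarrow> f x"
proof -
  have [measurable]: "f \<in> borel_measurable borel" using f by (rule bsupp_measurable)
  obtain M where M: "\<And>x. cmod (f x) \<le> M" using bsuppE[OF f] by metis
  have eq: "conv (gauss_kernel (s n)) f x = (\<integral>t. gauss_kernel 1 t * f (x - s n * t) \<partial>lborel)" for n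
  proof -
    have "conv (gauss_kernel (s n)) f x = \<bar>- s n\<bar> *\<^sub>R (\<integral>t. gauss_kernel (s n) (x - (x + (- s n) * t)) * f (x + (- s n) * t) \<partial>lborel)"
      unfolding conv_def by (rule lborel_integral_real_affine) (use s(2)[of n] in simp)
    also have "\<dots> = (\<integral>t. \<bar>- s n\<bar> *\<^sub>R (gauss_kernel (s n) (x - (x + (- s n) * t)) * f (x + (- s n) * t)) \<partial>lborel)" by simp
    also have "\<dots> = (\<integral>t. gauss_kernel 1 t * f (x - s n * t) \<partial>lborel)"
    proof (rule Bochner_Integration.integral_cong[OF refl])
      fix t
      have "s n * normal_density 0 (s n) (s n * t) = std_normal_density t"
        using s(2)[of n] by (simp add: normal_density_def real_sqrt_mult power_mult_distrib)
      then have "of_real (s n) * gauss_kernel (s n) (s n * t) = gauss_kernel 1 t" unfolding gauss_kernel_def by (simp flip: of_real_mult)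
      then show "\<bar>- s n\<bar> *\<^sub>R (gauss_kernel (s n) (x - (x + (- s n) * t)) * f (x + (- s n) * t)) = gauss_kernel 1 t * f (x - s n * t)"
        using s(2)[of n] by (simp add: scaleR_conv_of_real mult.assoc[symmetric])
    qed
    finally show ?thesis .
  qed
  have "(\<lambda>n. \<integral>t. gauss_kernel 1 t * f (x - s n * t) \<partial>lborel) \<longlonglongrightarrow> (\<integral>t. gauss_kernel 1 t * f x \<partial>lborel)"
  proof (rule integral_dominated_convergence)
    show "integrable lborel (\<lambda>t. cmod (gauss_kernel 1 t) * M)" using gauss_kernel_integrable[of 1] by simp
    show "AE t in lborel. (\<lambda>n. gauss_kernel 1 t * f (x - s n * t)) \<longlonglongrightarrow> gauss_kernel 1 t * f x"
    proof (intro AE_I2 tendsto_mult tendsto_const)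
      fix t
      have "(\<lambda>n. x - s n * t) \<longlonglongrightarrow> x - 0 * t" by (intro tendsto_intros s)
      then show "(\<lambda>n. f (x - s n * t)) \<longlonglongrightarrow> f x" using isCont_tendsto_compose[OF x] by simp
    qed
    show "AE t in lborel. norm (gauss_kernel 1 t * f (x - s n * t)) \<le> cmod (gauss_kernel 1 t) * M" for n
      unfolding norm_mult using M by (intro AE_I2 mult_left_mono) auto
  qed measurable
  also have "(\<integral>t. gauss_kernel 1 t * f x \<partial>lborel) = f x" by (simp add: gauss_kernel_def)
  finally show ?thesis unfolding eq .
qed

text \<open>The Gaussian-weighted integrals of the square equal pairings of Gaussian averages of f
  with f, hence are at most sup |f| times the L^1 norm. Fatou's lemma removes the weight.\<close>

lemma ft_square_integrable:
  assumes f: "bsupp f"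
  shows "integrable lborel (\<lambda>\<xi>. (cmod (ft f \<xi>))\<^sup>2)"
proof -
  have fm [measurable]: "f \<in> borel_measurable borel" using f by (rule bsupp_measurable)
  have fi: "integrable lborel f" by (rule bsupp_integrable[OF f])
  obtain M where M: "\<And>x. cmod (f x) \<le> M" "M \<ge> 0" using bsuppE[OF f] by metis
  define s where "s n = 1 / real (Suc n)" for n
  have s: "s \<longlonglongrightarrow> 0" "\<And>n. s n > 0" using LIMSEQ_inverse_real_of_nat by (auto simp: s_def[abs_def] inverse_eq_divide)
  define K where "K = M * (\<integral>x. cmod (f x) \<partial>lborel)"
  have le: "(\<integral>\<^sup>+\<xi>. ennreal (cmod (gauss_weight (s n) \<xi>) * (cmod (ft f \<xi>))\<^sup>2) \<partial>lborel) \<le> ennreal K" for n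
  proof -
    have e: "gauss_weight (s n) \<xi> * (ft f \<xi> * cnj (ft f \<xi>)) = of_real (cmod (gauss_weight (s n) \<xi>) * (cmod (ft f \<xi>))\<^sup>2)" for \<xi>
      by (simp add: complex_norm_square[symmetric] gauss_weight_def)
    have i: "integrable lborel (\<lambda>\<xi>. cmod (gauss_weight (s n) \<xi>) * (cmod (ft f \<xi>))\<^sup>2)"
    proof (rule Bochner_Integration.integrable_bound)
      let ?A = "(\<integral>x. cmod (f x) \<partial>lborel)\<^sup>2"
      show "integrable lborel (\<lambda>\<xi>. cmod (gauss_weight (s n) \<xi>) * ?A)" using gauss_weight_integrable[OF s(2)[of n]] by simp
      show "(\<lambda>\<xi>. cmod (gauss_weight (s n) \<xi>) * (cmod (ft f \<xi>))\<^sup>2) \<in> borel_measurable lborel" unfolding gauss_weight_def by measurable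
      show "AE \<xi> in lborel. norm (cmod (gauss_weight (s n) \<xi>) * (cmod (ft f \<xi>))\<^sup>2) \<le> norm (cmod (gauss_weight (s n) \<xi>) * ?A)"
        by (auto simp: abs_mult intro!: mult_left_mono power_mono ft_bound)
    qed
    have "(\<integral>\<xi>. cmod (gauss_weight (s n) \<xi>) * (cmod (ft f \<xi>))\<^sup>2 \<partial>lborel) = Re (\<integral>\<xi>. gauss_weight (s n) \<xi> * (ft f \<xi> * cnj (ft f \<xi>)) \<partial>lborel)"
      unfolding e integral_complex_of_real by simp
    also have "\<dots> = Re (\<integral>x. conv (gauss_kernel (s n)) f x * cnj (f x) \<partial>lborel)"
      unfolding gauss_kernel_fourier_kernel[OF s(2)] by (simp add: conv_fourier_kernel_pairing gauss_weight_integrable s fi)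
    also have "\<dots> \<le> cmod (\<integral>x. conv (gauss_kernel (s n)) f x * cnj (f x) \<partial>lborel)" by (rule complex_Re_le_cmod)
    also have "\<dots> \<le> (\<integral>x. cmod (conv (gauss_kernel (s n)) f x * cnj (f x)) \<partial>lborel)" by (rule integral_norm_bound)
    also have "\<dots> \<le> (\<integral>x. M * cmod (f x) \<partial>lborel)"
    proof (rule Bochner_Integration.integral_mono')
      show "integrable lborel (\<lambda>x. M * cmod (f x))" using fi by simp
      have "cmod (conv (gauss_kernel (s n)) f x) \<le> M" for x
        using conv_integrable_bounded(2)[OF gauss_kernel_integrable[OF s(2)] fm M(1), of n x] integral_norm_gauss_kernel[OF s(2)] by simp
      then show "cmod (conv (gauss_kernel (s n)) f x * cnj (f x)) \<le> M * cmod (f x)" for x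
        unfolding norm_mult complex_mod_cnj by (intro mult_right_mono) auto
    qed (use M(2) in auto)
    finally have "(\<integral>\<xi>. cmod (gauss_weight (s n) \<xi>) * (cmod (ft f \<xi>))\<^sup>2 \<partial>lborel) \<le> K" by (simp add: K_def)
    then show ?thesis using i by (subst nn_integral_eq_integral) (auto intro: ennreal_leI)
  qed
  have "(\<integral>\<^sup>+\<xi>. ennreal ((cmod (ft f \<xi>))\<^sup>2) \<partial>lborel) = (\<integral>\<^sup>+\<xi>. liminf (\<lambda>n. ennreal (cmod (gauss_weight (s n) \<xi>) * (cmod (ft f \<xi>))\<^sup>2)) \<partial>lborel)"
  proof (intro nn_integral_cong lim_imp_Liminf[symmetric] tendsto_ennrealI)
    fix \<xi>
    have "(\<lambda>n. cmod (gauss_weight (s n) \<xi>)) \<longlonglongrightarrow> exp (- (2 * pi\<^sup>2 * 0\<^sup>2 * \<xi>\<^sup>2))"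
      unfolding gauss_weight_def norm_of_real abs_exp_cancel by (intro tendsto_intros s)
    then show "(\<lambda>n. cmod (gauss_weight (s n) \<xi>) * (cmod (ft f \<xi>))\<^sup>2) \<longlonglongrightarrow> (cmod (ft f \<xi>))\<^sup>2"
      using tendsto_mult[OF _ tendsto_const] by fastforce
  qed simp
  also have "\<dots> \<le> liminf (\<lambda>n. \<integral>\<^sup>+\<xi>. ennreal (cmod (gauss_weight (s n) \<xi>) * (cmod (ft f \<xi>))\<^sup>2) \<partial>lborel)"
    unfolding gauss_weight_def by (intro nn_integral_liminf) measurable
  also have "\<dots> \<le> ennreal K" by (intro Liminf_le) (use le in auto)
  finally show ?thesis by (intro integrableI_bounded) (auto intro: le_less_trans)
qed

lemma ft_pair_integrable:
  assumes f: "bsupp f" and g: "bsupp g"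
  shows "integrable lborel (\<lambda>\<xi>. cmod (ft f \<xi>) * cmod (ft g \<xi>))" "integrable lborel (\<lambda>\<xi>. ft f \<xi> * cnj (ft g \<xi>))"
proof -
  have [measurable]: "f \<in> borel_measurable borel" "g \<in> borel_measurable borel" using f g by (auto dest: bsupp_measurable)
  have i: "integrable lborel (\<lambda>\<xi>. (cmod (ft f \<xi>))\<^sup>2 + (cmod (ft g \<xi>))\<^sup>2)"
    by (intro Bochner_Integration.integrable_add ft_square_integrable f g)
  have le: "cmod (ft f \<xi>) * cmod (ft g \<xi>) \<le> (cmod (ft f \<xi>))\<^sup>2 + (cmod (ft g \<xi>))\<^sup>2" for \<xi>
  proof -
    have "2 * (cmod (ft f \<xi>) * cmod (ft g \<xi>)) \<le> (cmod (ft f \<xi>))\<^sup>2 + (cmod (ft g \<xi>))\<^sup>2"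
      using sum_squares_bound[of "cmod (ft f \<xi>)" "cmod (ft g \<xi>)"] by simp
    moreover have "0 \<le> cmod (ft f \<xi>) * cmod (ft g \<xi>)" by simp
    ultimately show ?thesis by linarith
  qed
  show "integrable lborel (\<lambda>\<xi>. cmod (ft f \<xi>) * cmod (ft g \<xi>))"
    by (rule Bochner_Integration.integrable_bound[OF i]) (use le in \<open>auto simp: abs_mult\<close>)
  show "integrable lborel (\<lambda>\<xi>. ft f \<xi> * cnj (ft g \<xi>))"
    by (rule Bochner_Integration.integrable_bound[OF i]) (use le in \<open>auto simp: norm_mult\<close>)
qed

text \<open>Gaussian regularisation on both sides with dominated convergence. Almost everywhere
  continuity of one factor covers both uses: transforms cut off to a shell, which jump only at its
  edges, and continuous test functions.\<close>

lemma plancherel: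
  assumes f: "bsupp f" and g: "bsupp g" and c: "AE x in lborel. isCont f x"
  shows "(\<integral>x. f x * cnj (g x) \<partial>lborel) = (\<integral>\<xi>. ft f \<xi> * cnj (ft g \<xi>) \<partial>lborel)"
proof -
  have fm [measurable]: "f \<in> borel_measurable borel" and [measurable]: "g \<in> borel_measurable borel" using f g by (auto dest: bsupp_measurable)
  have fi: "integrable lborel f" and gi: "integrable lborel g" by (auto intro: bsupp_integrable f g)
  obtain M where M: "\<And>x. cmod (f x) \<le> M" "M \<ge> 0" using bsuppE[OF f] by metis
  define s where "s n = 1 / real (Suc n)" for n
  have s: "s \<longlonglongrightarrow> 0" "\<And>n. s n > 0" using LIMSEQ_inverse_real_of_nat by (auto simp: s_def[abs_def] inverse_eq_divide)
  have "(\<lambda>n. \<integral>x. conv (gauss_kernel (s n)) f x * cnj (g x) \<partial>lborel) \<longlonglongrightarrow> (\<integral>x. f x * cnj (g x) \<partial>lborel)"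
  proof (rule integral_dominated_convergence)
    show "integrable lborel (\<lambda>x. M * cmod (g x))" using gi by simp
    show "AE x in lborel. (\<lambda>n. conv (gauss_kernel (s n)) f x * cnj (g x)) \<longlonglongrightarrow> f x * cnj (g x)"
      using c by eventually_elim (intro tendsto_mult tendsto_const conv_gauss_kernel_tendsto f s)
    have "cmod (conv (gauss_kernel (s n)) f x) \<le> M" for n x
      using conv_integrable_bounded(2)[OF gauss_kernel_integrable[OF s(2)] fm M(1), of n x] integral_norm_gauss_kernel[OF s(2)] by simp
    then show "AE x in lborel. norm (conv (gauss_kernel (s n)) f x * cnj (g x)) \<le> M * cmod (g x)" for n
      unfolding norm_mult complex_mod_cnj by (intro AE_I2 mult_right_mono) auto
  qed measurable
  moreover have "(\<lambda>n. \<integral>x. conv (gauss_kernel (s n)) f x * cnj (g x) \<partial>lborel) \<longlonglongrightarrow> (\<integral>\<xi>. ft f \<xi> * cnj (ft g \<xi>) \<partial>lborel)"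
  proof -
    have eq: "(\<integral>x. conv (gauss_kernel (s n)) f x * cnj (g x) \<partial>lborel) = (\<integral>\<xi>. gauss_weight (s n) \<xi> * (ft f \<xi> * cnj (ft g \<xi>)) \<partial>lborel)" for n
      unfolding gauss_kernel_fourier_kernel[OF s(2)] by (rule conv_fourier_kernel_pairing[OF gauss_weight_integrable[OF s(2)] fi gi])
    show ?thesis unfolding eq
    proof (rule integral_dominated_convergence)
      show "integrable lborel (\<lambda>\<xi>. cmod (ft f \<xi>) * cmod (ft g \<xi>))" by (rule ft_pair_integrable(1)[OF f g])
      show "(\<lambda>\<xi>. gauss_weight (s n) \<xi> * (ft f \<xi> * cnj (ft g \<xi>))) \<in> borel_measurable lborel" for n unfolding gauss_weight_def by measurable
      show "AE \<xi> in lborel. (\<lambda>n. gauss_weight (s n) \<xi> * (ft f \<xi> * cnj (ft g \<xi>))) \<longlonglongrightarrow> ft f \<xi> * cnj (ft g \<xi>)"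
      proof (rule AE_I2)
        fix \<xi>
        have "(\<lambda>n. gauss_weight (s n) \<xi>) \<longlonglongrightarrow> of_real (exp (- (2 * pi\<^sup>2 * 0\<^sup>2 * \<xi>\<^sup>2)))"
          unfolding gauss_weight_def by (intro tendsto_intros s)
        from tendsto_mult[OF this tendsto_const] show "(\<lambda>n. gauss_weight (s n) \<xi> * (ft f \<xi> * cnj (ft g \<xi>))) \<longlonglongrightarrow> ft f \<xi> * cnj (ft g \<xi>)" by simp
      qed
      show "AE \<xi> in lborel. norm (gauss_weight (s n) \<xi> * (ft f \<xi> * cnj (ft g \<xi>))) \<le> cmod (ft f \<xi>) * cmod (ft g \<xi>)" for n
      proof (rule AE_I2)
        fix \<xi>
        have "cmod (gauss_weight (s n) \<xi>) \<le> 1" by (simp add: gauss_weight_def)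
        from mult_right_mono[OF this, of "cmod (ft f \<xi>) * cmod (ft g \<xi>)"]
        show "norm (gauss_weight (s n) \<xi> * (ft f \<xi> * cnj (ft g \<xi>))) \<le> cmod (ft f \<xi>) * cmod (ft g \<xi>)" by (simp add: norm_mult)
      qed
    qed measurable
  qed
  ultimately show ?thesis by (rule LIMSEQ_unique)
qed

text \<open>The negative part is closed at the opposite end from \<open>dyadic_shell\<close>, so
  that both pieces have the form used by \<open>band\<close>; the two symbols differ at two points
  only.\<close>

definition shell :: "int \<Rightarrow> real \<Rightarrow> complex" where
  "shell j \<xi> = indicator {2 powi j..<2 * 2 powi j} \<xi> + indicator {- (2 * 2 powi j)..<- (2 powi j)} \<xi>"

lemma shell_bsupp: "bsupp (shell j)"
  unfolding shell_def by (intro bsupp_add bsupp_indicator_Ico)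

lemma shell_cases: "shell j \<xi> = 0 \<or> shell j \<xi> = 1"
proof -
  have "(0::real) < 2 powi j" by simp
  then show ?thesis by (auto simp: shell_def indicator_def)
qed

lemma shell_kernel_fourier_kernel: "shell_kernel j = fourier_kernel (shell j)"
proof
  fix x
  have i: "integrable lborel (\<lambda>\<xi>. indicator {a..<b} \<xi> * uchar (x * \<xi>))" for a b
    by (intro bsupp_integrable bsupp_mult(1)[OF bsupp_indicator_Ico, where K = 1]) auto
  show "shell_kernel j x = fourier_kernel (shell j) x"
    unfolding shell_kernel_def fourier_kernel_def shell_def band_def distrib_right by (rule Bochner_Integration.integral_add[OF i i, symmetric])
qed

lemma continuous_ft:
  assumes f: "integrable lborel f"
  shows "isCont (ft f) \<xi>"
proof -
  have [measurable]: "f \<in> borel_measurable borel" using f by auto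
  show ?thesis unfolding continuous_at_sequentially o_def
  proof (intro allI impI)
    fix u :: "nat \<Rightarrow> real" assume u: "u \<longlonglongrightarrow> \<xi>"
    show "(\<lambda>n. ft f (u n)) \<longlonglongrightarrow> ft f \<xi>" unfolding ft_def
    proof (rule integral_dominated_convergence)
      show "integrable lborel (\<lambda>x. cmod (f x))" using f by simp
      show "AE x in lborel. (\<lambda>n. uchar (- (x * u n)) * f x) \<longlonglongrightarrow> uchar (- (x * \<xi>)) * f x"
      proof (intro AE_I2 tendsto_mult tendsto_const)
        fix x
        have "isCont uchar (- (x * \<xi>))" using continuous_uchar[OF continuous_on_id, of UNIV] by (simp add: continuous_on_eq_continuous_at)
        then show "(\<lambda>n. uchar (- (x * u n))) \<longlonglongrightarrow> uchar (- (x * \<xi>))"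
          by (rule isCont_tendsto_compose) (intro tendsto_intros u)
      qed
    qed (auto simp: norm_mult)
  qed
qed

lemma isCont_shell: "AE \<xi> in lborel. isCont (shell j) \<xi>"
proof -
  let ?S = "{2 powi j, 2 * 2 powi j, - (2 * 2 powi j), - (2 powi j) :: real}"
  have "AE \<xi> in lborel. \<xi> \<noteq> a" for a :: real by (rule AE_lborel_singleton)
  then have "AE \<xi> in lborel. \<xi> \<notin> ?S" by (simp add: AE_conj_iff)
  then show ?thesis
  proof eventually_elim
    case (elim \<xi>)
    have c: "isCont (indicator {a..<b} :: real \<Rightarrow> complex) \<xi>" if "\<xi> \<noteq> a" "\<xi> \<noteq> b" for a b
    proof -
      have "\<xi> \<notin> frontier {a..<b}" using that frontier_subset_closed[of "{a..b}"] 
        by (cases "a < b") (auto simp: frontier_def closure_atLeastLessThan interior_atLeastLessThan)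
      then have "isCont (indicator {a..<b} :: real \<Rightarrow> real) \<xi>" by (simp add: isCont_indicator)
      then have "isCont (\<lambda>x. complex_of_real (indicator {a..<b} x)) \<xi>" by (rule continuous_of_real)
      moreover have "(\<lambda>x. complex_of_real (indicator {a..<b} x)) = indicator {a..<b}" by (auto simp: indicator_def fun_eq_iff)
      ultimately show ?thesis by simp
    qed
    show ?case unfolding shell_def using elim by (intro continuous_add c) auto
  qed
qed

definition cutft :: "int \<Rightarrow> (real \<Rightarrow> complex) \<Rightarrow> real \<Rightarrow> complex" where
  "cutft j f \<xi> = shell j \<xi> * ft f \<xi>"

lemma bsupp_cutft:
  assumes f: "bsupp f" shows "bsupp (cutft j f)"
proof -
  have [measurable]: "f \<in> borel_measurable borel" using f by (rule bsupp_measurable)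
  show ?thesis unfolding cutft_def by (rule bsupp_mult(1)[OF shell_bsupp _ ft_bound]) measurable
qed

text \<open>A sharp block is, up to reflection, the Fourier transform of a bounded function of
  bounded support. Plancherel's identity thus applies with position and frequency exchanged.\<close>

lemma conv_shell_kernel_cutft:
  assumes f: "bsupp f"
  shows "conv (shell_kernel j) f x = ft (cutft j f) (- x)"
  unfolding shell_kernel_fourier_kernel conv_fourier_kernel[OF bsupp_integrable[OF shell_bsupp] bsupp_integrable[OF f]] ft_def[of "cutft j f"] cutft_def
  by (simp add: mult_ac)

text \<open>Plancherel's identity for the cut-off transforms; the symbol is real and idempotent, so
  it appears only once on the right.\<close>

lemma block_pairing:
  assumes f: "bsupp f" and g: "bsupp g"
  shows "(\<integral>x. conv (shell_kernel j) f x * cnj (conv (shell_kernel j) g x) \<partial>lborel) = (\<integral>\<xi>. shell j \<xi> * (ft f \<xi> * cnj (ft g \<xi>)) \<partial>lborel)"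
    "integrable lborel (\<lambda>x. conv (shell_kernel j) f x * cnj (conv (shell_kernel j) g x))"
proof -
  let ?F = "\<lambda>x. ft (cutft j f) x * cnj (ft (cutft j g) x)"
  have u: "bsupp (cutft j f)" "bsupp (cutft j g)" by (intro bsupp_cutft f g)+
  have "integrable lborel (\<lambda>x. ?F (0 - x))" unfolding lborel_integrable_shift[of ?F 0] by (rule ft_pair_integrable(2)[OF u])
  then show "integrable lborel (\<lambda>x. conv (shell_kernel j) f x * cnj (conv (shell_kernel j) g x))"
    by (simp add: conv_shell_kernel_cutft f g)
  have "(\<integral>x. conv (shell_kernel j) f x * cnj (conv (shell_kernel j) g x) \<partial>lborel) = (\<integral>x. ?F (0 - x) \<partial>lborel)" by (simp add: conv_shell_kernel_cutft f g)
  also have "\<dots> = (\<integral>x. ?F x \<partial>lborel)" by (rule lborel_integral_shift)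
  also have "\<dots> = (\<integral>\<xi>. cutft j f \<xi> * cnj (cutft j g \<xi>) \<partial>lborel)"
  proof (rule plancherel[OF u, symmetric])
    show "AE \<xi> in lborel. isCont (cutft j f) \<xi>"
      using isCont_shell[of j]
      by eventually_elim (simp add: cutft_def[abs_def] continuous_mult continuous_ft[OF bsupp_integrable[OF f]])
  qed
  also have "\<dots> = (\<integral>\<xi>. shell j \<xi> * (ft f \<xi> * cnj (ft g \<xi>)) \<partial>lborel)"
  proof (rule Bochner_Integration.integral_cong[OF refl])
    fix \<xi>
    have "shell j \<xi> * cnj (shell j \<xi>) = shell j \<xi>" using shell_cases[of j \<xi>] by auto
    then show "cutft j f \<xi> * cnj (cutft j g \<xi>) = shell j \<xi> * (ft f \<xi> * cnj (ft g \<xi>))"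
      unfolding cutft_def complex_cnj_mult by (metis (no_types, opaque_lifting) mult.assoc mult.commute)
  qed
  finally show "(\<integral>x. conv (shell_kernel j) f x * cnj (conv (shell_kernel j) g x) \<partial>lborel) = (\<integral>\<xi>. shell j \<xi> * (ft f \<xi> * cnj (ft g \<xi>)) \<partial>lborel)" .
qed

lemma indicator_shells:
  fixes c d \<xi> :: real
  assumes "0 < c" "2 * c \<le> d"
  shows "(indicator {c..<2 * c} \<xi> + indicator {- (2 * c)..<- c} \<xi>) + ((indicator {2 * d..<2 * (2 * d)} \<xi> + indicator {- (2 * (2 * d))..<- (2 * d)} \<xi>)
     + (indicator {2 * c..<2 * d} \<xi> + indicator {- (2 * d)..<- (2 * c)} \<xi>)) = (indicator {c..<2 * (2 * d)} \<xi> + indicator {- (2 * (2 * d))..<- c} \<xi> :: complex)"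
  using assms by (auto simp: indicator_def)

text \<open>Adjacent shells merge, so a symmetric partial sum is the indicator of a two-sided
  annulus and is bounded by 1 uniformly in n.\<close>

lemma sum_shell:
  "(\<Sum>j\<in>{-int n..int n}. shell j \<xi>) = indicator {2 powi (- int n)..<2 * 2 powi (int n)} \<xi> + indicator {- (2 * 2 powi (int n))..<- (2 powi (- int n))} \<xi>"
proof (induction n)
  case 0
  then show ?case by (simp add: shell_def)
next
  case (Suc n)
  define c d :: real where "c = 2 powi (- int (Suc n))" and "d = 2 powi int n"
  have s: "{- int (Suc n)..int (Suc n)} = insert (- int (Suc n)) (insert (int (Suc n)) {- int n..int n})" by auto
  have a: "2 powi int (Suc n) = 2 * d" unfolding d_def power_int_of_nat by simp
  have b: "2 powi (- int n) = 2 * c" unfolding c_def power_int_minus power_int_of_nat by simp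
  have cd: "0 < c" "2 * c \<le> d"
    unfolding b[symmetric] unfolding c_def d_def power_int_minus power_int_of_nat
    by (simp_all add: inverse_le_1_iff order_trans[of _ 1])
  have "(\<Sum>j\<in>{- int (Suc n)..int (Suc n)}. shell j \<xi>) = shell (- int (Suc n)) \<xi> + (shell (int (Suc n)) \<xi> + (\<Sum>j\<in>{-int n..int n}. shell j \<xi>))"
    unfolding s by simp
  also have "\<dots> = indicator {c..<2 * (2 * d)} \<xi> + indicator {- (2 * (2 * d))..<- c} \<xi>"
    unfolding Suc.IH unfolding shell_def a b c_def[symmetric] d_def[symmetric] by (rule indicator_shells[OF cd])
  finally show ?case unfolding a c_def[symmetric] .
qed

text \<open>Completeness of the decomposition: the annuli exhaust all frequencies except 0, and
  dominated convergence applies on the Fourier side.\<close>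

lemma sum_blocks_tendsto:
  assumes f: "bsupp f" and g: "bsupp g" and c: "AE x in lborel. isCont f x"
  shows "(\<lambda>n. \<Sum>j\<in>{-int n..int n}. \<integral>x. conv (shell_kernel j) f x * cnj (conv (shell_kernel j) g x) \<partial>lborel) \<longlonglongrightarrow> (\<integral>x. f x * cnj (g x) \<partial>lborel)"
proof -
  have [measurable]: "f \<in> borel_measurable borel" "g \<in> borel_measurable borel" using f g by (auto dest: bsupp_measurable)
  have [measurable]: "shell j \<in> borel_measurable borel" for j by (rule bsupp_measurable[OF shell_bsupp])
  have i: "integrable lborel (\<lambda>\<xi>. shell j \<xi> * (ft f \<xi> * cnj (ft g \<xi>)))" for j
  proof (rule Bochner_Integration.integrable_bound[OF ft_pair_integrable(1)[OF f g]])
    have "cmod (shell j \<xi>) \<le> 1" for \<xi> using shell_cases[of j \<xi>] by auto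
    then show "AE \<xi> in lborel. norm (shell j \<xi> * (ft f \<xi> * cnj (ft g \<xi>))) \<le> norm (cmod (ft f \<xi>) * cmod (ft g \<xi>))"
      by (auto simp: norm_mult abs_mult intro!: mult_left_le_one_le)
  qed measurable
  have eq: "(\<Sum>j\<in>{-int n..int n}. \<integral>x. conv (shell_kernel j) f x * cnj (conv (shell_kernel j) g x) \<partial>lborel) = (\<integral>\<xi>. (\<Sum>j\<in>{-int n..int n}. shell j \<xi>) * (ft f \<xi> * cnj (ft g \<xi>)) \<partial>lborel)" for n
    unfolding block_pairing(1)[OF f g] sum_distrib_right by (rule Bochner_Integration.integral_sum[symmetric, OF i])
  show ?thesis unfolding plancherel[OF f g c] eq
  proof (rule integral_dominated_convergence)
    show "integrable lborel (\<lambda>\<xi>. cmod (ft f \<xi>) * cmod (ft g \<xi>))" by (rule ft_pair_integrable(1)[OF f g])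
    have le1: "cmod (\<Sum>j\<in>{-int n..int n}. shell j \<xi>) \<le> 1" for n \<xi>
    proof -
      define c where "c = (2::real) powi (- int n)"
      have "c > 0" by (simp add: c_def)
      then show ?thesis unfolding sum_shell c_def[symmetric] by (auto simp: indicator_def)
    qed
    show "AE \<xi> in lborel. norm ((\<Sum>j\<in>{-int n..int n}. shell j \<xi>) * (ft f \<xi> * cnj (ft g \<xi>))) \<le> cmod (ft f \<xi>) * cmod (ft g \<xi>)" for n
      unfolding norm_mult complex_mod_cnj by (intro AE_I2 mult_left_le_one_le le1) auto
    have "AE \<xi> in lborel. \<xi> \<noteq> (0::real)" by (rule AE_lborel_singleton)
    then show "AE \<xi> in lborel. (\<lambda>n. (\<Sum>j\<in>{-int n..int n}. shell j \<xi>) * (ft f \<xi> * cnj (ft g \<xi>))) \<longlonglongrightarrow> ft f \<xi> * cnj (ft g \<xi>)"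
    proof eventually_elim
      case (elim \<xi>)
      have "\<forall>\<^sub>F n in sequentially. 2 powi (- int n) < \<bar>\<xi>\<bar>"
      proof -
        have "(\<lambda>n. (1/2::real) ^ n) \<longlonglongrightarrow> 0" by (intro LIMSEQ_power_zero) auto
        then have "\<forall>\<^sub>F n in sequentially. (1/2::real) ^ n < \<bar>\<xi>\<bar>" using elim by (intro order_tendstoD) auto
        then show ?thesis by eventually_elim (simp add: power_int_minus power_one_over inverse_eq_divide)
      qed
      moreover have "\<forall>\<^sub>F n in sequentially. \<bar>\<xi>\<bar> < 2 * 2 powi (int n)"
      proof -
        obtain N where N: "\<bar>\<xi>\<bar> < 2 ^ N" using real_arch_pow[of 2 "\<bar>\<xi>\<bar>"] by auto
        show ?thesis using eventually_ge_at_top[of N]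
        proof eventually_elim
          case (elim n)
          then have "(2::real) ^ N \<le> 2 ^ n" by (intro power_increasing) auto
          moreover have "(0::real) < 2 ^ n" by simp
          ultimately have "\<bar>\<xi>\<bar> < 2 * 2 ^ n" using N by linarith
          then show ?case by simp
        qed
      qed
      ultimately have "\<forall>\<^sub>F n in sequentially. (\<Sum>j\<in>{-int n..int n}. shell j \<xi>) * (ft f \<xi> * cnj (ft g \<xi>)) = ft f \<xi> * cnj (ft g \<xi>)"
      proof eventually_elim
        case (elim n)
        define c where "c = (2::real) powi (- int n)"
        have "c > 0" by (simp add: c_def)
        moreover have "c < \<bar>\<xi>\<bar>" using elim(1) by (simp add: c_def)
        ultimately have "(\<Sum>j\<in>{-int n..int n}. shell j \<xi>) = 1" unfolding sum_shell c_def[symmetric] using elim(2) by (cases "\<xi> > 0") (auto simp: indicator_def)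
        then show ?case by simp
      qed
      then show ?case by (rule tendsto_eventually)
    qed
  qed measurable
qed

section \<open>The lower bound\<close>

text \<open>Convergence almost everywhere alone would not pass to masses. The radial truncation
  \<open>tr\<close> and the cut-off \<open>ch\<close> make the approximants uniformly bounded with
  common support, and both leave g unchanged.\<close>

lemma bsupp_continuous_approx:
  fixes g :: "real \<Rightarrow> complex"
  assumes g: "bsupp g"
  obtains h R M where "\<And>n. continuous_on UNIV (h n)" "\<And>n x. cmod (h n x) \<le> M" "\<And>n x. R < \<bar>x\<bar> \<Longrightarrow> h n x = 0"
    "AE x in lborel. (\<lambda>n. h n x) \<longlonglongrightarrow> g x"
proof -
  obtain M0 R where MR0: "M0 \<ge> 0" "R \<ge> 0" "\<And>x. cmod (g x) \<le> M0" "\<And>x. R < \<bar>x\<bar> \<Longrightarrow> g x = 0"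
    using bsuppE[OF g] by blast
  \<comment> \<open>One more than the bound of g, so that division by \<open>M\<close> is legitimate
    even when g is zero.\<close>
  define M where "M = M0 + 1"
  have M: "M > 0" "\<And>x. cmod (g x) \<le> M" using MR0(1,3) by (auto simp: M_def add_increasing2)
  have "g \<in> borel_measurable lebesgue" using bsupp_measurable[OF g] by (simp add: measurable_completion)
  then have "g measurable_on UNIV" by (rule lebesgue_measurable_imp_measurable_on) simp
  then obtain N u where u: "negligible N" "\<And>n. continuous_on UNIV (u n)" "\<And>x. x \<notin> N \<Longrightarrow> (\<lambda>n. u n x) \<longlonglongrightarrow> g x"
    unfolding measurable_on_def by (simp) metis
  define tr :: "complex \<Rightarrow> complex" where "tr z = z / of_real (max 1 (cmod z / M))" for z
  define ch :: "real \<Rightarrow> real" where "ch x = max 0 (min 1 (R + 1 - \<bar>x\<bar>))" for x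
  define h where "h n x = of_real (ch x) * tr (u n x)" for n x
  have trc: "continuous_on UNIV tr" unfolding tr_def using M
    by (intro continuous_intros) auto
  have trM: "cmod (tr z) \<le> M" for z
  proof -
    have "cmod z \<le> M * max 1 (cmod z / M)" using M by (auto simp: max_def field_simps)
    then show ?thesis unfolding tr_def using M by (simp add: norm_divide divide_le_eq)
  qed
  have trg: "tr (g x) = g x" for x using M(2)[of x] M(1) by (simp add: tr_def max_def divide_le_eq)
  show ?thesis
  proof (rule that[of h M "R + 1"])
    show "continuous_on UNIV (h n)" for n
      unfolding h_def ch_def by (intro continuous_intros continuous_on_compose2[OF trc u(2)]) auto
    show "cmod (h n x) \<le> M" for n x
    proof -
      have "cmod (h n x) = ch x * cmod (tr (u n x))" by (simp add: h_def norm_mult ch_def)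
      also have "\<dots> \<le> 1 * M" by (intro mult_mono trM) (auto simp: ch_def)
      finally show ?thesis by simp
    qed
    show "h n x = 0" if "R + 1 < \<bar>x\<bar>" for n x using that by (simp add: h_def ch_def)
    have "AE x in lebesgue. x \<notin> N" using u(1) by (intro AE_not_in) (simp add: negligible_iff_null_sets)
    then have "AE x in lborel. x \<notin> N" by (simp add: AE_completion_iff)
    then show "AE x in lborel. (\<lambda>n. h n x) \<longlonglongrightarrow> g x"
    proof eventually_elim
      case (elim x)
      have "isCont tr (g x)" using trc by (simp add: continuous_on_eq_continuous_at)
      then have "(\<lambda>n. tr (u n x)) \<longlonglongrightarrow> tr (g x)" using u(3)[OF elim] by (rule isCont_tendsto_compose)
      then have "(\<lambda>n. h n x) \<longlonglongrightarrow> of_real (ch x) * g x" unfolding h_def trg by (intro tendsto_intros)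
      moreover have "of_real (ch x) * g x = g x" using MR0(4)[of x] by (cases "\<bar>x\<bar> \<le> R") (auto simp: ch_def)
      ultimately show ?case by simp
    qed
  qed
qed

text \<open>The pairing of f with g is a limit of sums of block pairings, each estimated by the
  assumed square-function bound for f and the upper bound for g with exponent q. The dual constant
  is the same because \<kappa> is.\<close>

lemma block_lower_bsupp:
  assumes f: "bsupp f" and p: "p > 1" and a: "a \<ge> 0"
    and S: "\<And>n::nat. pmass p (\<lambda>x. L2_set (\<lambda>j. cmod (conv (shell_kernel j) f x)) {- int n..int n}) \<le> ennreal a"
  shows "pmass p (\<lambda>x. cmod (f x)) \<le> ennreal ((base_const * (p + 1 / (p - 1))\<^sup>2) powr p * a)"
proof -
  define q where "q = p / (p - 1)"
  have q: "q > 1" "1/p + 1/q = 1" using p by (auto simp: q_def field_simps)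
  define L where "L = base_const * (p + 1 / (p - 1))\<^sup>2"
  have L: "L > 0" using p inv_symbol_var_pos by (auto simp: L_def base_const_def intro!: mult_pos_pos add_pos_pos zero_less_power)
  have fm [measurable]: "f \<in> borel_measurable borel" using f by (rule bsupp_measurable)
  have fi: "integrable lborel f" by (rule bsupp_integrable[OF f])
  \<comment> \<open>Continuous g come first, since completeness asks for one almost everywhere
    continuous factor and f is arbitrary.\<close>
  have c: "Re (\<integral>x. f x * cnj (g x) \<partial>lborel) \<le> L powr p * a / p + pmass_real q (\<lambda>x. cmod (g x)) / q"
    if g: "bsupp g" and gc: "continuous_on UNIV g" for g
  proof -
    have [measurable]: "g \<in> borel_measurable borel" using g by (rule bsupp_measurable)
    have "Re (\<Sum>j\<in>{-int n..int n}. \<integral>x. conv (shell_kernel j) f x * cnj (conv (shell_kernel j) g x) \<partial>lborel) \<le> L powr p * a / p + (L powr q * pmass_real q (\<lambda>x. cmod (g x))) / (L powr q * q)" for n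
    proof (rule re_pair_young[OF _ p q L])
      show "integrable lborel (\<lambda>x. conv (shell_kernel j) f x * cnj (conv (shell_kernel j) g x))" for j by (rule block_pairing(2)[OF f g])
      show "pmass q (\<lambda>x. L2_set (\<lambda>j. cmod (conv (shell_kernel j) g x)) {-int n..int n}) \<le> ennreal (L powr q * pmass_real q (\<lambda>x. cmod (g x)))"
        using block_upper_bsupp[OF _ g q(1), of "{-int n..int n}"] unfolding kappa_dual[OF p q(2,1)] L_def by simp
    qed (use a S pmass_real_nonneg in auto)
    then have le: "Re (\<Sum>j\<in>{-int n..int n}. \<integral>x. conv (shell_kernel j) f x * cnj (conv (shell_kernel j) g x) \<partial>lborel) \<le> L powr p * a / p + pmass_real q (\<lambda>x. cmod (g x)) / q" for n
      using L by simp
    have "AE x in lborel. isCont g x" using gc by (simp add: continuous_on_eq_continuous_at)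
    \<comment> \<open>The continuous function has to be the first argument, so the limit is taken
      for the pair (g, f) and then conjugated.\<close>
    from sum_blocks_tendsto[OF g f this] have "(\<lambda>n. cnj (\<Sum>j\<in>{-int n..int n}. \<integral>x. conv (shell_kernel j) g x * cnj (conv (shell_kernel j) f x) \<partial>lborel)) \<longlonglongrightarrow> cnj (\<integral>x. g x * cnj (f x) \<partial>lborel)"
      by (rule tendsto_cnj)
    then have "(\<lambda>n. \<Sum>j\<in>{-int n..int n}. \<integral>x. conv (shell_kernel j) f x * cnj (conv (shell_kernel j) g x) \<partial>lborel) \<longlonglongrightarrow> (\<integral>x. f x * cnj (g x) \<partial>lborel)"
      unfolding cnj_sum Bochner_Integration.integral_cnj[symmetric] complex_cnj_mult complex_cnj_cnj by (simp add: mult.commute)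
    from tendsto_Re[OF this] show ?thesis by (rule LIMSEQ_le_const2) (use le in auto)
  qed
  have "pmass p (\<lambda>x. L2_set (\<lambda>j. cmod (f x)) {()}) \<le> ennreal (L powr p * a)"
  proof (rule norming[OF _ p q])
    fix g' :: "unit \<Rightarrow> real \<Rightarrow> complex" assume "\<And>j. j \<in> {()} \<Longrightarrow> bsupp (g' j)"
    then have g: "bsupp (g' ())" by simp
    define g where "g = g' ()"
    have gb: "bsupp g" using g by (simp add: g_def)
    have [measurable]: "g \<in> borel_measurable borel" using gb by (rule bsupp_measurable)
    obtain h M R where h: "\<And>n. continuous_on UNIV (h n)" "\<And>n x. cmod (h n x) \<le> M" "\<And>n x. R < \<bar>x\<bar> \<Longrightarrow> h n x = 0"
      "AE x in lborel. (\<lambda>n. h n x) \<longlonglongrightarrow> g x" by (rule bsupp_continuous_approx[OF gb]) (rule that; assumption)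
    have hm [measurable]: "h n \<in> borel_measurable borel" for n by (rule borel_measurable_continuous_onI[OF h(1)])
    have hb: "bsupp (h n)" for n by (rule bsuppI[OF hm h(2,3)])
    \<comment> \<open>General test functions are reached by dominated convergence on both sides of
      the inequality.\<close>
    have "(\<lambda>n. \<integral>x. f x * cnj (h n x) \<partial>lborel) \<longlonglongrightarrow> (\<integral>x. f x * cnj (g x) \<partial>lborel)"
    proof (rule integral_dominated_convergence)
      show "integrable lborel (\<lambda>x. cmod (f x) * M)" using fi by simp
      show "AE x in lborel. (\<lambda>n. f x * cnj (h n x)) \<longlonglongrightarrow> f x * cnj (g x)"
        using h(4) by eventually_elim (intro tendsto_intros)
      show "AE x in lborel. norm (f x * cnj (h n x)) \<le> cmod (f x) * M" for n
        unfolding norm_mult complex_mod_cnj by (intro AE_I2 mult_left_mono h(2)) auto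
    qed measurable
    from tendsto_Re[OF this] have l1: "(\<lambda>n. Re (\<integral>x. f x * cnj (h n x) \<partial>lborel)) \<longlonglongrightarrow> Re (\<integral>x. f x * cnj (g x) \<partial>lborel)" .
    have "(\<lambda>n. pmass_real q (\<lambda>x. cmod (h n x))) \<longlonglongrightarrow> pmass_real q (\<lambda>x. cmod (g x))"
      unfolding pmass_real_def
    proof (rule integral_dominated_convergence)
      have "bsupp (\<lambda>x. M powr q * indicator {-R..<R + 1} x)"
        by (rule bsupp_mult(2)[OF bsupp_indicator_Ico _ order_refl]) simp
      then show "integrable lborel (\<lambda>x. M powr q * indicator {-R..<R + 1} x)" by (rule bsupp_integrable)
      show "AE x in lborel. (\<lambda>n. \<bar>cmod (h n x)\<bar> powr q) \<longlonglongrightarrow> \<bar>cmod (g x)\<bar> powr q"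
        using h(4)
      proof eventually_elim
        case (elim x)
        then show ?case by (intro tendsto_powr2 tendsto_rabs tendsto_norm tendsto_const) (use q in auto)
      qed
      show "AE x in lborel. norm (\<bar>cmod (h n x)\<bar> powr q) \<le> M powr q * indicator {-R..<R + 1} x" for n
      proof (rule AE_I2)
        fix x show "norm (\<bar>cmod (h n x)\<bar> powr q) \<le> M powr q * indicator {-R..<R + 1} x"
          using h(2)[of n x] h(3)[of x n] q by (cases "R < \<bar>x\<bar>") (auto simp: indicator_def intro!: powr_mono2)
      qed
    qed measurable
    then have l2: "(\<lambda>n. L powr p * a / p + pmass_real q (\<lambda>x. cmod (h n x)) / q) \<longlonglongrightarrow> L powr p * a / p + pmass_real q (\<lambda>x. cmod (g x)) / q"
      by (intro tendsto_intros) (use q in auto)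
    have "Re (\<integral>x. f x * cnj (g x) \<partial>lborel) \<le> L powr p * a / p + pmass_real q (\<lambda>x. cmod (g x)) / q"
      by (rule LIMSEQ_le[OF l1 l2]) (use c[OF hb h(1)] in auto)
    then show "Re (\<Sum>j\<in>{()}. \<integral>x. f x * cnj (g' j x) \<partial>lborel) \<le> L powr p * a / p + pmass_real q (\<lambda>x. L2_set (\<lambda>j. cmod (g' j x)) {()}) / q"
      by (simp add: g_def)
  qed auto
  then show ?thesis by (simp add: L_def)
qed

section \<open>Truncation of functions of finite mass\<close>

definition trunc :: "(real \<Rightarrow> complex) \<Rightarrow> nat \<Rightarrow> real \<Rightarrow> complex" where
  "trunc f n x = (if \<bar>x\<bar> \<le> real n \<and> cmod (f x) \<le> real n then f x else 0)"

lemma trunc_bsupp: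
  assumes [measurable]: "f \<in> borel_measurable borel"
  shows "bsupp (trunc f n)"
  by (rule bsuppI[of _ "real n" "real n"]) (auto simp: trunc_def[abs_def])

lemma trunc_eventually: "\<forall>\<^sub>F n in sequentially. trunc f n x = f x"
proof -
  obtain N :: nat where "max \<bar>x\<bar> (cmod (f x)) \<le> real N" using real_arch_simple by blast
  then show ?thesis by (intro eventually_sequentiallyI[of N]) (auto simp: trunc_def)
qed

lemma trunc_le: "cmod (trunc f n x) \<le> cmod (f x)" "cmod (f x - trunc f n x) \<le> cmod (f x)"
  by (auto simp: trunc_def)

lemma pmass_trunc_diff:
  assumes [measurable]: "f \<in> borel_measurable borel" and p: "p > 0" and fin: "pmass p (\<lambda>x. cmod (f x)) < top"
  shows "(\<lambda>n. pmass p (\<lambda>x. cmod (f x - trunc f n x))) \<longlonglongrightarrow> 0"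
proof -
  have [measurable]: "trunc f n \<in> borel_measurable borel" for n by (rule bsupp_measurable[OF trunc_bsupp]) measurable
  have "(\<lambda>n. \<integral>\<^sup>+x. ennreal (\<bar>cmod (f x - trunc f n x)\<bar> powr p) \<partial>lborel) \<longlonglongrightarrow> (\<integral>\<^sup>+(x::real). 0 \<partial>lborel)"
  proof (rule nn_integral_dominated_convergence[where w = "\<lambda>x. ennreal (\<bar>cmod (f x)\<bar> powr p)"])
    show "AE x in lborel. ennreal (\<bar>cmod (f x - trunc f n x)\<bar> powr p) \<le> ennreal (\<bar>cmod (f x)\<bar> powr p)" for n
      using p trunc_le(2)[of f _ n] by (intro AE_I2 ennreal_leI powr_mono2) auto
    show "(\<integral>\<^sup>+x. ennreal (\<bar>cmod (f x)\<bar> powr p) \<partial>lborel) < \<infinity>" using fin by (simp add: pmass_def)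
    show "AE x in lborel. (\<lambda>n. ennreal (\<bar>cmod (f x - trunc f n x)\<bar> powr p)) \<longlonglongrightarrow> 0"
    proof (intro AE_I2 tendsto_eventually)
      fix x show "\<forall>\<^sub>F n in sequentially. ennreal (\<bar>cmod (f x - trunc f n x)\<bar> powr p) = 0"
        using trunc_eventually[of f x] by eventually_elim simp
    qed
  qed measurable
  then show ?thesis by (simp add: pmass_def)
qed

section \<open>Functions in Lp\<close>

text \<open>Combines the bound b - a with |x| times the kernel being at most 1. The resulting rate
  1/|x| lies in L^q at infinity for every q > 1, so the convolution with an L^p function
  converges.\<close>

lemma band_decay:
  assumes "a \<le> b"
  shows "cmod (band a b x) \<le> (b - a + 1) * (1 / (1 + \<bar>x\<bar>))"
proof -
  have 1: "\<bar>x\<bar> * cmod (band a b x) \<le> 1"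
  proof (cases "x = 0")
    case False
    have "cmod (uchar (b * x) - uchar (a * x)) \<le> 2" using norm_triangle_ineq4[of "uchar (b * x)" "uchar (a * x)"] by simp
    then have "cmod (band a b x) \<le> 2 / (2 * pi * \<bar>x\<bar>)"
      unfolding band_explicit[OF assms False] using divide_right_mono[of _ 2 "2 * pi * \<bar>x\<bar>"] by (simp add: norm_divide norm_mult del: divide_le_cancel mult_divide_mult_cancel_left_if)
    then have "\<bar>x\<bar> * cmod (band a b x) \<le> \<bar>x\<bar> * (2 / (2 * pi * \<bar>x\<bar>))" by (intro mult_left_mono) auto
    also have "\<dots> = 1 / pi" using False by simp
    also have "\<dots> \<le> 1" using pi_gt3 by simp
    finally show ?thesis .
  qed simp
  have "(1 + \<bar>x\<bar>) * cmod (band a b x) \<le> b - a + 1" using 1 band_bound[of a b x] assms by (simp add: distrib_right)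
  then show ?thesis by (simp add: field_simps)
qed

lemma shell_kernel_decay: "cmod (shell_kernel j x) \<le> (2 * 2 powi j + 2) * (1 / (1 + \<bar>x\<bar>))"
proof -
  have "0 < (2::real) powi j" by simp
  then have "cmod (shell_kernel j x) \<le> (2 * 2 powi j - 2 powi j + 1) * (1 / (1 + \<bar>x\<bar>)) + (- (2 powi j) - - (2 * 2 powi j) + 1) * (1 / (1 + \<bar>x\<bar>))"
    unfolding shell_kernel_def by (intro norm_triangle_mono band_decay) auto
  then show ?thesis by (simp add: distrib_right[symmetric] add_divide_distrib[symmetric])
qed

lemma integrable_decay_powr:
  fixes q :: real
  assumes q: "q > 1"
  shows "integrable lborel (\<lambda>x::real. (1 / (1 + \<bar>x\<bar>)) powr q)"
proof (rule integrableI_bounded)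
  define F where "F x = - ((1 + x) powr (1 - q)) / (q - 1)" for x :: real
  let ?h = "\<lambda>x::real. ennreal ((1 / (1 + \<bar>x\<bar>)) powr q)"
  have "(\<integral>\<^sup>+x. ennreal ((1 / (1 + \<bar>x\<bar>)) powr q) * indicator {0..} x \<partial>lborel) = 0 - F 0"
  proof (rule nn_integral_FTC_atLeast)
    show "(\<lambda>x::real. (1 / (1 + \<bar>x\<bar>)) powr q) \<in> borel_measurable borel" by measurable
    show "DERIV F x :> (1 / (1 + \<bar>x\<bar>)) powr q" if "0 \<le> x" for x
    proof -
      have "(F has_real_derivative - ((1 - q) * (1 + x) powr (- q)) / (q - 1)) (at x)"
        unfolding F_def using q that by (auto intro!: derivative_eq_intros)
      moreover have "- ((1 - q) * (1 + x) powr (- q)) / (q - 1) = (1 + x) powr (- q)" using q by (simp add: divide_eq_eq algebra_simps)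
      ultimately have "(F has_real_derivative (1 + x) powr (- q)) (at x)" by simp
      moreover have "(1 + x) powr (- q) = (1 / (1 + \<bar>x\<bar>)) powr q" using that by (simp add: powr_minus powr_divide inverse_eq_divide)
      ultimately show ?thesis by simp
    qed
    have "((\<lambda>x::real. (1 + x) powr (1 - q)) \<longlongrightarrow> 0) at_top"
      using q by (intro tendsto_neg_powr filterlim_tendsto_add_at_top[OF tendsto_const filterlim_ident]) auto
    then have "((\<lambda>x. - ((1 + x) powr (1 - q)) / (q - 1)) \<longlongrightarrow> - 0 / (q - 1)) at_top"
      using q by (intro tendsto_divide tendsto_minus tendsto_const) auto
    then show "(F \<longlongrightarrow> 0) at_top" unfolding F_def by simp
  qed auto
  then have fin: "(\<integral>\<^sup>+x. ?h x * indicator {0..} x \<partial>lborel) < \<infinity>" by simp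
  have "(\<integral>\<^sup>+x. ?h x * indicator {..0} x \<partial>lborel) = (\<integral>\<^sup>+x. ?h (0 - x) * indicator {..0} (0 - x) \<partial>lborel)"
    by (rule lborel_nn_integral_shift[symmetric]) measurable
  also have "\<dots> = (\<integral>\<^sup>+x. ?h x * indicator {0..} x \<partial>lborel)"
    by (intro nn_integral_cong) (auto simp: indicator_def)
  finally have "(\<integral>\<^sup>+x. ?h x * indicator {..0} x + ?h x * indicator {0..} x \<partial>lborel) < \<infinity>"
    using fin by (subst nn_integral_add) auto
  moreover have "(\<integral>\<^sup>+x. ennreal (norm ((1 / (1 + \<bar>x\<bar>)) powr q)) \<partial>lborel) \<le> (\<integral>\<^sup>+x. ?h x * indicator {..0} x + ?h x * indicator {0..} x \<partial>lborel)"
    by (intro nn_integral_mono) (auto simp: indicator_def add_increasing2)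
  ultimately show "(\<integral>\<^sup>+x. ennreal (norm ((1 / (1 + \<bar>x\<bar>)) powr q)) \<partial>lborel) < \<infinity>" by (rule le_less_trans[rotated])
qed measurable

lemma pmass_finite_integrable:
  assumes [measurable]: "f \<in> borel_measurable borel" and fin: "pmass p (\<lambda>x. cmod (f x)) < top"
  shows "integrable lborel (\<lambda>x. cmod (f x) powr p)"
  using fin unfolding pmass_def by (intro integrableI_bounded) auto

text \<open>Young's inequality dominates the integrand by the q-th power of the kernel bound plus
  the p-th power of |f|.\<close>

lemma conv_shell_kernel_integrable_Lp:
  assumes fm [measurable]: "f \<in> borel_measurable borel" and p: "p > 1" and fin: "pmass p (\<lambda>x. cmod (f x)) < top"
  shows "integrable lborel (\<lambda>y. shell_kernel j (x - y) * f y)"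
proof -
  define q where "q = p / (p - 1)"
  have q: "q > 1" "1/p + 1/q = 1" using p by (auto simp: q_def field_simps)
  define C where "C = 2 * 2 powi j + (2::real)"
  have C: "C > 0" unfolding C_def by (intro add_pos_pos) auto
  have fi: "integrable lborel (\<lambda>y. cmod (f y) powr p)" by (rule pmass_finite_integrable[OF fm fin])
  have ki: "integrable lborel (\<lambda>y. (C * (1 / (1 + \<bar>x - y\<bar>))) powr q)"
    using integrable_decay_powr[OF q(1)] unfolding powr_mult
    using lborel_integrable_shift[of "\<lambda>x. (1 / (1 + \<bar>x\<bar>)) powr q" x] by simp
  show ?thesis
  proof (rule Bochner_Integration.integrable_bound)
    show "integrable lborel (\<lambda>y. (C * (1 / (1 + \<bar>x - y\<bar>))) powr q / q + cmod (f y) powr p / p)" using fi ki by simp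
    show "AE y in lborel. norm (shell_kernel j (x - y) * f y) \<le> norm ((C * (1 / (1 + \<bar>x - y\<bar>))) powr q / q + cmod (f y) powr p / p)"
    proof (rule AE_I2)
      fix y
      have "norm (shell_kernel j (x - y) * f y) \<le> (C * (1 / (1 + \<bar>x - y\<bar>))) * cmod (f y)"
        unfolding norm_mult C_def by (intro mult_right_mono shell_kernel_decay) auto
      also have "\<dots> \<le> (C * (1 / (1 + \<bar>x - y\<bar>))) powr q / q + cmod (f y) powr p / p"
        using p q C by (intro Youngs_inequality) auto
      finally show "norm (shell_kernel j (x - y) * f y) \<le> norm ((C * (1 / (1 + \<bar>x - y\<bar>))) powr q / q + cmod (f y) powr p / p)" by simp
    qed
  qed measurable
qed

lemma conv_trunc_tendsto:
  assumes fm [measurable]: "f \<in> borel_measurable borel" and p: "p > 1" and fin: "pmass p (\<lambda>x. cmod (f x)) < top"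
  shows "(\<lambda>n. conv (shell_kernel j) (trunc f n) x) \<longlonglongrightarrow> conv (shell_kernel j) f x"
  unfolding conv_def
proof (rule integral_dominated_convergence)
  have [measurable]: "trunc f n \<in> borel_measurable borel" for n by (rule bsupp_measurable[OF trunc_bsupp[OF fm]])
  show "integrable lborel (\<lambda>y. norm (shell_kernel j (x - y) * f y))" by (intro integrable_norm conv_shell_kernel_integrable_Lp[OF fm p fin])
  show "(\<lambda>y. shell_kernel j (x - y) * trunc f n y) \<in> borel_measurable lborel" for n by measurable
  show "AE y in lborel. (\<lambda>n. shell_kernel j (x - y) * trunc f n y) \<longlonglongrightarrow> shell_kernel j (x - y) * f y"
    by (intro AE_I2 tendsto_mult tendsto_const tendsto_eventually trunc_eventually)
  show "AE y in lborel. norm (shell_kernel j (x - y) * trunc f n y) \<le> norm (shell_kernel j (x - y) * f y)" for n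
    unfolding norm_mult by (intro AE_I2 mult_left_mono trunc_le) auto
qed measurable

text \<open>The blocks of the truncations converge pointwise and the truncations have no larger mass
  than f, so Fatou's lemma carries the bound over.\<close>

lemma block_upper_Lp:
  assumes J: "finite J" and fm [measurable]: "f \<in> borel_measurable borel" and p: "p > 1" and fin: "pmass p (\<lambda>x. cmod (f x)) < top"
  shows "pmass p (\<lambda>x. L2_set (\<lambda>j. cmod (conv (shell_kernel j) f x)) J) \<le> ennreal ((base_const * (p + 1 / (p - 1))\<^sup>2) powr p) * pmass p (\<lambda>x. cmod (f x))"
proof (rule pmass_Fatou)
  have tb: "bsupp (trunc f n)" for n by (rule trunc_bsupp[OF fm])
  have [measurable]: "trunc f n \<in> borel_measurable borel" for n by (rule bsupp_measurable[OF tb])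
  show "(\<lambda>x. L2_set (\<lambda>j. cmod (conv (shell_kernel j) (trunc f n) x)) J) \<in> borel_measurable borel" for n by measurable
  show "(\<lambda>n. L2_set (\<lambda>j. cmod (conv (shell_kernel j) (trunc f n) x)) J) \<longlonglongrightarrow> L2_set (\<lambda>j. cmod (conv (shell_kernel j) f x)) J" for x
    unfolding L2_set_def by (intro tendsto_real_sqrt tendsto_sum tendsto_power tendsto_norm conv_trunc_tendsto[OF fm p fin])
  fix n
  have "pmass p (\<lambda>x. L2_set (\<lambda>j. cmod (conv (shell_kernel j) (trunc f n) x)) J) \<le> ennreal ((base_const * (p + 1 / (p - 1))\<^sup>2) powr p * pmass_real p (\<lambda>x. cmod (trunc f n x)))"
    by (rule block_upper_bsupp[OF J tb p])
  also have "\<dots> = ennreal ((base_const * (p + 1 / (p - 1))\<^sup>2) powr p) * pmass p (\<lambda>x. cmod (trunc f n x))"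
    using p by (subst pmass_pmass_real[OF bsupp_cmod[OF tb]]) (auto simp: ennreal_mult pmass_real_nonneg)
  also have "\<dots> \<le> ennreal ((base_const * (p + 1 / (p - 1))\<^sup>2) powr p) * pmass p (\<lambda>x. cmod (f x))"
    using p trunc_le(1) by (intro mult_left_mono pmass_mono) auto
  finally show "pmass p (\<lambda>x. L2_set (\<lambda>j. cmod (conv (shell_kernel j) (trunc f n) x)) J) \<le> ennreal ((base_const * (p + 1 / (p - 1))\<^sup>2) powr p) * pmass p (\<lambda>x. cmod (f x))" .
qed (use p in simp)

lemma conv_shell_kernel_diff:
  assumes f: "f \<in> borel_measurable borel" "pmass p (\<lambda>x. cmod (f x)) < top" and g: "g \<in> borel_measurable borel" "pmass p (\<lambda>x. cmod (g x)) < top" and p: "p > 1"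
  shows "conv (shell_kernel j) (\<lambda>y. f y - g y) x = conv (shell_kernel j) f x - conv (shell_kernel j) g x"
  unfolding conv_def right_diff_distrib
  by (rule Bochner_Integration.integral_diff; rule conv_shell_kernel_integrable_Lp) (use assms in auto)

text \<open>For the square function Fatou's lemma points the wrong way here. Instead, the square
  function of a truncation is at most that of f plus that of the remainder, and the latter is small
  by the upper bound. The extra factor 2 comes from \<open>pmass_add\<close>.\<close>

lemma block_lower_Lp:
  assumes fm [measurable]: "f \<in> borel_measurable borel" and p: "p > 1" and fin: "pmass p (\<lambda>x. cmod (f x)) < top"
    and c: "c < top" and S: "\<And>n::nat. pmass p (\<lambda>x. L2_set (\<lambda>j. cmod (conv (shell_kernel j) f x)) {- int n..int n}) \<le> c"
  shows "pmass p (\<lambda>x. cmod (f x)) \<le> ennreal ((2 * base_const * (p + 1 / (p - 1))\<^sup>2) powr p) * c"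
proof -
  define L where "L = base_const * (p + 1 / (p - 1))\<^sup>2"
  have tb: "bsupp (trunc f n)" for n by (rule trunc_bsupp[OF fm])
  have tm [measurable]: "trunc f n \<in> borel_measurable borel" for n by (rule bsupp_measurable[OF tb])
  define \<delta> where "\<delta> n = pmass p (\<lambda>x. cmod (f x - trunc f n x))" for n
  have \<delta>0: "\<delta> \<longlonglongrightarrow> 0" unfolding \<delta>_def using p by (intro pmass_trunc_diff[OF fm _ fin]) simp
  have \<delta>fin: "\<delta> n < top" for n
  proof -
    have "\<delta> n \<le> pmass p (\<lambda>x. cmod (f x))" unfolding \<delta>_def using p trunc_le(2) by (intro pmass_mono) auto
    then show ?thesis using fin by (rule le_less_trans)
  qed
  have tfin: "pmass p (\<lambda>x. cmod (trunc f n x)) < top" for n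
    using p by (subst pmass_pmass_real[OF bsupp_cmod[OF tb]]) auto
  have main: "pmass p (\<lambda>x. cmod (trunc f m x)) \<le> ennreal (L powr p) * (ennreal (2 powr p) * (c + ennreal (L powr p) * \<delta> m))" for m
  proof -
    define A where "A = ennreal (2 powr p) * (c + ennreal (L powr p) * \<delta> m)"
    have A: "A < top" unfolding A_def using c \<delta>fin[of m] by (simp add: ennreal_mult_less_top)
    have "pmass p (\<lambda>x. L2_set (\<lambda>j. cmod (conv (shell_kernel j) (trunc f m) x)) {- int n..int n}) \<le> A" for n
    proof -
      let ?J = "{- int n..int n}"
      have "pmass p (\<lambda>x. L2_set (\<lambda>j. cmod (conv (shell_kernel j) (trunc f m) x)) ?J) 
         \<le> pmass p (\<lambda>x. L2_set (\<lambda>j. cmod (conv (shell_kernel j) f x)) ?J + L2_set (\<lambda>j. cmod (conv (shell_kernel j) (\<lambda>y. f y - trunc f m y) x)) ?J)"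
      proof (rule pmass_mono)
        fix x
        have "L2_set (\<lambda>j. cmod (conv (shell_kernel j) (trunc f m) x)) ?J \<le> L2_set (\<lambda>j. cmod (conv (shell_kernel j) f x) + cmod (conv (shell_kernel j) (\<lambda>y. f y - trunc f m y) x)) ?J"
        proof (intro L2_set_mono)
          fix j
          have "conv (shell_kernel j) (trunc f m) x = conv (shell_kernel j) f x - conv (shell_kernel j) (\<lambda>y. f y - trunc f m y) x"
            using conv_shell_kernel_diff[OF fm fin tm tfin p, of j m x] by simp
          then show "cmod (conv (shell_kernel j) (trunc f m) x) \<le> cmod (conv (shell_kernel j) f x) + cmod (conv (shell_kernel j) (\<lambda>y. f y - trunc f m y) x)"
            by (simp only: norm_triangle_ineq4)
        qed simp
        also have "\<dots> \<le> L2_set (\<lambda>j. cmod (conv (shell_kernel j) f x)) ?J + L2_set (\<lambda>j. cmod (conv (shell_kernel j) (\<lambda>y. f y - trunc f m y) x)) ?J"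
          by (rule L2_set_triangle_ineq)
        finally show "\<bar>L2_set (\<lambda>j. cmod (conv (shell_kernel j) (trunc f m) x)) ?J\<bar> \<le> \<bar>L2_set (\<lambda>j. cmod (conv (shell_kernel j) f x)) ?J + L2_set (\<lambda>j. cmod (conv (shell_kernel j) (\<lambda>y. f y - trunc f m y) x)) ?J\<bar>"
          by (simp add: add_nonneg_nonneg)
      qed (use p in simp)
      also have "\<dots> \<le> ennreal (2 powr p) * (pmass p (\<lambda>x. L2_set (\<lambda>j. cmod (conv (shell_kernel j) f x)) ?J) + pmass p (\<lambda>x. L2_set (\<lambda>j. cmod (conv (shell_kernel j) (\<lambda>y. f y - trunc f m y) x)) ?J))"
        using p by (intro pmass_add) auto
      also have "\<dots> \<le> A" unfolding A_def
      proof (intro mult_left_mono add_mono S)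
        show "pmass p (\<lambda>x. L2_set (\<lambda>j. cmod (conv (shell_kernel j) (\<lambda>y. f y - trunc f m y) x)) ?J) \<le> ennreal (L powr p) * \<delta> m"
          unfolding L_def \<delta>_def using \<delta>fin[of m] by (intro block_upper_Lp p) (auto simp: \<delta>_def)
      qed auto
      finally show ?thesis .
    qed
    then have "pmass p (\<lambda>x. cmod (trunc f m x)) \<le> ennreal (L powr p * enn2real A)"
      unfolding L_def using A by (intro block_lower_bsupp[OF tb p]) auto
    also have "\<dots> = ennreal (L powr p) * A" using A by (simp add: ennreal_mult)
    finally show ?thesis unfolding A_def .
  qed
  have "pmass p (\<lambda>x. cmod (f x)) = (\<integral>\<^sup>+x. liminf (\<lambda>n. ennreal (\<bar>cmod (trunc f n x)\<bar> powr p)) \<partial>lborel)"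
    unfolding pmass_def
  proof (intro nn_integral_cong lim_imp_Liminf[symmetric] tendsto_eventually)
    fix x show "\<forall>\<^sub>F n in sequentially. ennreal (\<bar>cmod (trunc f n x)\<bar> powr p) = ennreal (\<bar>cmod (f x)\<bar> powr p)"
      using trunc_eventually[of f x] by eventually_elim simp
  qed simp
  also have "\<dots> \<le> liminf (\<lambda>n. pmass p (\<lambda>x. cmod (trunc f n x)))" unfolding pmass_def by (intro nn_integral_liminf) measurable
  also have "\<dots> \<le> liminf (\<lambda>m. ennreal (L powr p) * (ennreal (2 powr p) * (c + ennreal (L powr p) * \<delta> m)))"
    by (intro Liminf_mono always_eventually allI main)
  \<comment> \<open>As m grows, the mass \<delta> m of the remainder disappears and only the factor
    2^p survives.\<close>
  also have "\<dots> = ennreal (L powr p) * (ennreal (2 powr p) * (c + ennreal (L powr p) * 0))"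
    by (intro lim_imp_Liminf tendsto_intros ennreal_tendsto_cmult \<delta>0) auto
  also have "\<dots> = ennreal ((2 * L) powr p) * c" by (simp add: powr_mult ennreal_mult mult_ac)
  finally show ?thesis by (simp add: L_def mult.assoc)
qed

section \<open>The operators of the statement\<close>

lemma ennpowr_ennreal: "t \<ge> 0 \<Longrightarrow> ennpowr (ennreal t) r = ennreal (t powr r)"
  by (simp add: ennpowr_def)

lemma ennpowr_top [simp]: "ennpowr top r = top"
  by (simp add: ennpowr_def)

lemma ennpowr_mono:
  assumes "x \<le> y" "r > 0" shows "ennpowr x r \<le> ennpowr y r"
  using assms by (cases x rule: ennreal_cases; cases y rule: ennreal_cases)
    (auto simp: ennpowr_ennreal top_unique intro!: ennreal_leI powr_mono2)

lemma ennpowr_ennpowr: "r > 0 \<Longrightarrow> s > 0 \<Longrightarrow> ennpowr (ennpowr x r) s = ennpowr x (r * s)"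
  by (cases x rule: ennreal_cases) (auto simp: ennpowr_ennreal powr_powr)

lemma ennpowr_1: "ennpowr x 1 = x"
  by (cases x rule: ennreal_cases) (auto simp: ennpowr_ennreal)

lemma ennpowr_lt_top: "ennpowr x r < top \<longleftrightarrow> x < top"
  by (cases x rule: ennreal_cases) (auto simp: ennpowr_ennreal)

lemma ennpowr_cmult:
  assumes "c \<ge> 0" "r > 0" shows "ennpowr (ennreal c * x) r = ennreal (c powr r) * ennpowr x r"
proof (cases x rule: ennreal_cases)
  case (real t)
  then have "ennpowr (ennreal c * x) r = ennreal ((c * t) powr r)" using assms by (simp add: ennpowr_ennreal flip: ennreal_mult)
  then show ?thesis using real assms by (simp add: ennpowr_ennreal powr_mult ennreal_mult)
next
  case top
  show ?thesis
  proof (cases "c = 0")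
    case True
    then show ?thesis using top assms ennpowr_ennreal[of 0 r] by simp
  next
    case False
    then show ?thesis using top assms by (simp add: ennreal_mult_top)
  qed
qed

text \<open>The power map is an increasing bijection with inverse the power 1/r, hence it commutes
  with suprema.\<close>

lemma ennpowr_SUP:
  assumes r: "r > 0" and I: "I \<noteq> {}"
  shows "ennpowr (SUP i\<in>I. X i) r = (SUP i\<in>I. ennpowr (X i) r)"
proof (rule antisym)
  have inv: "ennpowr (ennpowr x r) (1/r) = x" "ennpowr (ennpowr x (1/r)) r = x" for x
    using r ennpowr_ennpowr[of r "1/r" x] ennpowr_ennpowr[of "1/r" r x] by (auto simp: ennpowr_1)
  have "X i \<le> ennpowr (SUP i\<in>I. ennpowr (X i) r) (1/r)" if "i \<in> I" for i
    using ennpowr_mono[OF SUP_upper[OF that, of "\<lambda>i. ennpowr (X i) r"], of "1/r"] r inv by simp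
  then have "(SUP i\<in>I. X i) \<le> ennpowr (SUP i\<in>I. ennpowr (X i) r) (1/r)" by (rule SUP_least)
  from ennpowr_mono[OF this r] show "ennpowr (SUP i\<in>I. X i) r \<le> (SUP i\<in>I. ennpowr (X i) r)" unfolding inv .
  show "(SUP i\<in>I. ennpowr (X i) r) \<le> ennpowr (SUP i\<in>I. X i) r"
    by (intro SUP_least ennpowr_mono r SUP_upper)
qed

text \<open>The statement concerns Lebesgue measurable functions and \<open>lebesgue\<close>,
  whereas the estimates are proved for Borel functions and \<open>lborel\<close>, where Fubini's
  theorem is at hand. Here \<open>h\<close> is a Borel version of \<open>f\<close>.\<close>

definition borel_rep :: "(real \<Rightarrow> complex) \<Rightarrow> (real \<Rightarrow> complex) \<Rightarrow> bool" where
  "borel_rep f h \<longleftrightarrow> f \<in> borel_measurable lebesgue \<and> h \<in> borel_measurable borel \<and> (AE x in lebesgue. f x = h x)"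

lemma borel_rep_ex:
  assumes f: "f \<in> borel_measurable lebesgue"
  obtains h where "borel_rep f h"
proof -
  have [measurable]: "f \<in> borel_measurable lebesgue" by fact
  have "(\<lambda>x. Re (f x)) \<in> borel_measurable lebesgue" "(\<lambda>x. Im (f x)) \<in> borel_measurable lebesgue" by measurable
  then obtain u v where uv: "u \<in> borel_measurable lborel" "AE x in lborel. Re (f x) = u x" "v \<in> borel_measurable lborel" "AE x in lborel. Im (f x) = v x"
    using completion_ex_borel_measurable_real by metis
  have [measurable]: "u \<in> borel_measurable borel" "v \<in> borel_measurable borel" using uv by simp_all
  have "(\<lambda>x. of_real (u x) + \<i> * of_real (v x)) \<in> borel_measurable borel" by measurable
  moreover have "AE x in lborel. f x = of_real (u x) + \<i> * of_real (v x)"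
    using uv(2,4) by eventually_elim (simp add: complex_eq_iff)
  ultimately have "borel_rep f (\<lambda>x. of_real (u x) + \<i> * of_real (v x))" unfolding borel_rep_def using f by (simp add: AE_completion)
  then show ?thesis by (rule that)
qed

lemma borel_rep_self: "h \<in> borel_measurable borel \<Longrightarrow> borel_rep h h"
  by (simp add: borel_rep_def measurable_completion)

lemma cLp_norm_rep:
  assumes "borel_rep f h"
  shows "cLp_norm p f = ennpowr (pmass p (\<lambda>x. cmod (h x))) (1 / p)"
proof -
  have [measurable]: "h \<in> borel_measurable borel" using assms by (simp add: borel_rep_def)
  have "(\<integral>\<^sup>+x. ennpowr (ennreal (cmod (f x))) p \<partial>lebesgue) = (\<integral>\<^sup>+x. ennreal (\<bar>cmod (h x)\<bar> powr p) \<partial>lebesgue)"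
    using assms unfolding borel_rep_def by (intro nn_integral_cong_AE) (auto simp: ennpowr_ennreal elim: eventually_mono)
  also have "\<dots> = pmass p (\<lambda>x. cmod (h x))" unfolding pmass_def by (rule nn_integral_completion)
  finally show ?thesis by (simp add: Lp_norm_def)
qed

lemma Lp_rep:
  assumes "borel_rep f h"
  shows "f \<in> Lp p \<longleftrightarrow> pmass p (\<lambda>x. cmod (h x)) < top"
proof -
  have "cLp_norm p f < top \<longleftrightarrow> pmass p (\<lambda>x. cmod (h x)) < top"
    by (simp only: cLp_norm_rep[OF assms] ennpowr_lt_top)
  then show ?thesis using assms by (simp add: Lp_def borel_rep_def)
qed

lemma LpE:
  assumes "f \<in> Lp p"
  obtains h where "borel_rep f h" "h \<in> borel_measurable borel" "pmass p (\<lambda>x. cmod (h x)) < top"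
proof -
  from assms have "f \<in> borel_measurable lebesgue" by (simp add: Lp_def)
  then obtain h where "borel_rep f h" by (rule borel_rep_ex)
  then show ?thesis using that Lp_rep[of f h p] assms by (auto simp: borel_rep_def)
qed

lemma borel_rep_lift2:
  assumes "borel_rep f h" "borel_rep g k" and [measurable]: "case_prod w \<in> borel_measurable (borel \<Otimes>\<^sub>M borel)"
  shows "borel_rep (\<lambda>x. w (f x) (g x)) (\<lambda>x. w (h x) (k x))"
proof -
  have [measurable]: "f \<in> borel_measurable lebesgue" "g \<in> borel_measurable lebesgue" "h \<in> borel_measurable borel" "k \<in> borel_measurable borel"
    using assms by (auto simp: borel_rep_def)
  have "AE x in lebesgue. f x = h x" "AE x in lebesgue. g x = k x" using assms by (auto simp: borel_rep_def)
  then have "AE x in lebesgue. w (f x) (g x) = w (h x) (k x)" by eventually_elim simp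
  then show ?thesis unfolding borel_rep_def by auto
qed

lemma borel_rep_add: "borel_rep f h \<Longrightarrow> borel_rep g k \<Longrightarrow> borel_rep (\<lambda>x. f x + g x) (\<lambda>x. h x + k x)"
  by (rule borel_rep_lift2) measurable

lemma borel_rep_diff: "borel_rep f h \<Longrightarrow> borel_rep g k \<Longrightarrow> borel_rep (\<lambda>x. f x - g x) (\<lambda>x. h x - k x)"
  by (rule borel_rep_lift2) measurable

lemma borel_rep_trunc: 
  assumes "borel_rep f h" shows "borel_rep (trunc f n) (trunc h n)"
proof -
  have [measurable]: "f \<in> borel_measurable lebesgue" "h \<in> borel_measurable borel" and ae: "AE x in lebesgue. f x = h x"
    using assms by (auto simp: borel_rep_def)
  have "{x. \<bar>x\<bar> \<le> real n} \<in> sets borel" by measurable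
  then have [measurable]: "{x. \<bar>x\<bar> \<le> real n} \<in> sets lebesgue" by simp
  have "(\<lambda>x. indicator {x. \<bar>x\<bar> \<le> real n} x * (if cmod (f x) \<le> real n then f x else 0)) \<in> borel_measurable lebesgue" by measurable
  also have "(\<lambda>x. indicator {x. \<bar>x\<bar> \<le> real n} x * (if cmod (f x) \<le> real n then f x else 0)) = trunc f n"
    by (auto simp: trunc_def indicator_def fun_eq_iff)
  finally have 1: "trunc f n \<in> borel_measurable lebesgue" .
  have 2: "trunc h n \<in> borel_measurable borel" by (rule bsupp_measurable[OF trunc_bsupp]) measurable
  have "AE x in lebesgue. trunc f n x = trunc h n x" using ae by eventually_elim (simp add: trunc_def)
  then show ?thesis using 1 2 by (simp add: borel_rep_def)
qed

lemma cLp_norm_mono_rep: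
  assumes fh: "borel_rep f h" and gk: "borel_rep g k" and p: "p > 0" and B: "B \<ge> 0"
  shows "cLp_norm p g \<le> ennreal B * cLp_norm p f \<longleftrightarrow> pmass p (\<lambda>x. cmod (k x)) \<le> ennreal (B powr p) * pmass p (\<lambda>x. cmod (h x))"
proof
  have e: "ennpowr (ennpowr x (1/p)) p = x" for x using p ennpowr_ennpowr[of "1/p" p x] by (simp add: ennpowr_1)
  assume "cLp_norm p g \<le> ennreal B * cLp_norm p f"
  from ennpowr_mono[OF this p] show "pmass p (\<lambda>x. cmod (k x)) \<le> ennreal (B powr p) * pmass p (\<lambda>x. cmod (h x))"
    unfolding cLp_norm_rep[OF fh] cLp_norm_rep[OF gk] ennpowr_cmult[OF B p] e .
next
  assume "pmass p (\<lambda>x. cmod (k x)) \<le> ennreal (B powr p) * pmass p (\<lambda>x. cmod (h x))"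
  from ennpowr_mono[OF this, of "1/p"] show "cLp_norm p g \<le> ennreal B * cLp_norm p f"
    unfolding cLp_norm_rep[OF fh] cLp_norm_rep[OF gk] using p B by (simp add: ennpowr_cmult powr_powr)
qed

text \<open>Integrating against \<open>lebesgue\<close> allows this operator to act on any f without
  choosing a Borel version; on measurable functions it depends only on the almost everywhere
  class.\<close>

definition block_conv :: "int \<Rightarrow> (real \<Rightarrow> complex) \<Rightarrow> real \<Rightarrow> complex" where
  "block_conv j f x = (\<integral>y. shell_kernel j (x - y) * f y \<partial>lebesgue)"

lemma block_conv_rep:
  assumes "borel_rep f h"
  shows "block_conv j f = conv (shell_kernel j) h"
proof
  fix x
  have f: "f \<in> borel_measurable lebesgue" and h [measurable]: "h \<in> borel_measurable borel" and ae: "AE x in lebesgue. f x = h x"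
    using assms by (auto simp: borel_rep_def)
  have [measurable]: "f \<in> borel_measurable lebesgue" by fact
  have "(\<lambda>y. shell_kernel j (x - y)) \<in> borel_measurable lborel" by measurable
  then have [measurable]: "(\<lambda>y. shell_kernel j (x - y)) \<in> borel_measurable lebesgue" by (rule measurable_completion)
  have hb: "(\<lambda>y. shell_kernel j (x - y) * h y) \<in> borel_measurable lborel" by measurable
  have "block_conv j f x = (\<integral>y. shell_kernel j (x - y) * h y \<partial>lebesgue)"
    unfolding block_conv_def
  proof (rule integral_cong_AE)
    show "(\<lambda>y. shell_kernel j (x - y) * h y) \<in> borel_measurable lebesgue" using hb by (rule measurable_completion)
    show "AE y in lebesgue. shell_kernel j (x - y) * f y = shell_kernel j (x - y) * h y" using ae by eventually_elim simp
  qed measurable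
  also have "\<dots> = conv (shell_kernel j) h x" unfolding conv_def by (rule integral_completion[OF hb])
  finally show "block_conv j f x = conv (shell_kernel j) h x" .
qed

definition block_const :: "real \<Rightarrow> real" where "block_const p = base_const * (p + 1 / (p - 1))\<^sup>2"

lemma block_const_pos: "p > 1 \<Longrightarrow> block_const p > 0"
  using inv_symbol_var_pos by (auto simp: block_const_def base_const_def intro!: mult_pos_pos add_pos_pos zero_less_power)

lemma pmass_conv_shell_kernel:
  assumes "h \<in> borel_measurable borel" "p > 1" "pmass p (\<lambda>x. cmod (h x)) < top"
  shows "pmass p (\<lambda>x. cmod (conv (shell_kernel j) h x)) \<le> ennreal (block_const p powr p) * pmass p (\<lambda>x. cmod (h x))"
  using block_upper_Lp[of "{j}" h p] assms by (simp add: block_const_def)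

lemma exp_uchar: "exp (- 2 * of_real pi * \<i> * of_real t) = uchar (- t)" "exp (2 * of_real pi * \<i> * of_real t) = uchar t"
  by (simp_all add: uchar_def cis_conv_exp mult_ac)

lemma fourier_rep:
  assumes "borel_rep f h"
  shows "fourier f \<xi> = ft h \<xi>"
proof -
  have f: "f \<in> borel_measurable lebesgue" and h [measurable]: "h \<in> borel_measurable borel" and ae: "AE x in lebesgue. f x = h x"
    using assms by (auto simp: borel_rep_def)
  have [measurable]: "f \<in> borel_measurable lebesgue" by fact
  have "(\<lambda>x. uchar (- (x * \<xi>))) \<in> borel_measurable lborel" by measurable
  then have [measurable]: "(\<lambda>x. uchar (- (x * \<xi>))) \<in> borel_measurable lebesgue" by (rule measurable_completion)
  have hb: "(\<lambda>x. uchar (- (x * \<xi>)) * h x) \<in> borel_measurable lborel" by measurable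
  have "fourier f \<xi> = (\<integral>x. uchar (- (x * \<xi>)) * h x \<partial>lebesgue)"
    unfolding fourier_def exp_uchar
  proof (rule integral_cong_AE)
    show "(\<lambda>x. uchar (- (x * \<xi>)) * h x) \<in> borel_measurable lebesgue" using hb by (rule measurable_completion)
    show "AE x in lebesgue. uchar (- (x * \<xi>)) * f x = uchar (- (x * \<xi>)) * h x" using ae by eventually_elim simp
  qed measurable
  also have "\<dots> = ft h \<xi>" unfolding ft_def by (rule integral_completion[OF hb])
  finally show ?thesis .
qed

lemma sharp_block_L1_rep:
  assumes fh: "borel_rep f h" and hi: "integrable lborel h"
  shows "sharp_block_L1 j f = conv (shell_kernel j) h"
proof
  fix x
  have [measurable]: "h \<in> borel_measurable borel" using fh by (simp add: borel_rep_def)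
  have [measurable]: "shell j \<in> borel_measurable borel" by (rule bsupp_measurable[OF shell_bsupp])
  have [measurable]: "dyadic_shell j \<in> sets borel" unfolding dyadic_shell_def by measurable
  let ?g = "\<lambda>\<xi>. uchar (x * \<xi>) * (ft h \<xi> * indicator (dyadic_shell j) \<xi>)"
  have m: "?g \<in> borel_measurable lborel" by measurable
  have "sharp_block_L1 j f x = (\<integral>\<xi>. ?g \<xi> \<partial>lebesgue)"
    unfolding sharp_block_L1_def inv_fourier_def exp_uchar fourier_rep[OF fh] ..
  also have "\<dots> = (\<integral>\<xi>. ?g \<xi> \<partial>lborel)" by (rule integral_completion[OF m])
  \<comment> \<open>The two symbols differ only at the end points of the negative half-shell, a null
    set.\<close>
  also have "\<dots> = (\<integral>\<xi>. shell j \<xi> * (uchar (x * \<xi>) * ft h \<xi>) \<partial>lborel)"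
  proof (rule integral_cong_AE)
    have pw: "(2::real) powi (j + 1) = 2 * 2 powi j" by (simp add: power_int_add)
    have pos: "(0::real) < 2 powi j" by simp
    have "AE \<xi> in lborel. \<xi> \<noteq> a" for a :: real by (rule AE_lborel_singleton)
    then have "AE \<xi> in lborel. \<xi> \<noteq> - (2 * 2 powi j) \<and> \<xi> \<noteq> - (2 powi j :: real)" by (simp add: AE_conj_iff)
    then show "AE \<xi> in lborel. ?g \<xi> = shell j \<xi> * (uchar (x * \<xi>) * ft h \<xi>)"
    proof eventually_elim
      case (elim \<xi>)
      define t where "t = (2::real) powi j"
      have t: "t > 0" by (simp add: t_def)
      show ?case using elim unfolding shell_def dyadic_shell_def pw t_def[symmetric] using t by (auto simp: indicator_def)
    qed
  qed measurable
  also have "\<dots> = conv (shell_kernel j) h x"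
    unfolding shell_kernel_fourier_kernel conv_fourier_kernel[OF bsupp_integrable[OF shell_bsupp] hi] ..
  finally show "sharp_block_L1 j f x = conv (shell_kernel j) h x" .
qed

lemma Lp1_integrable:
  assumes [measurable]: "h \<in> borel_measurable borel" and fin: "pmass 1 (\<lambda>x. cmod (h x)) < top"
  shows "integrable lborel h"
  using fin unfolding pmass_def by (intro integrableI_bounded) auto

lemma conv_shell_kernel_linear:
  assumes p: "p > 1" and h: "h \<in> borel_measurable borel" "pmass p (\<lambda>x. cmod (h x)) < top" and k: "k \<in> borel_measurable borel" "pmass p (\<lambda>x. cmod (k x)) < top"
  shows "conv (shell_kernel j) (\<lambda>y. h y + k y) x = conv (shell_kernel j) h x + conv (shell_kernel j) k x"
  unfolding conv_def distrib_left
  by (rule Bochner_Integration.integral_add; rule conv_shell_kernel_integrable_Lp) (use assms in auto)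

text \<open>Existence of an extension, so that the \<open>SOME\<close> in \<open>sharp_block\<close>
  does select an operator with the required properties.\<close>

lemma block_conv_extension:
  assumes p: "p > 1"
  shows "is_Lp_extension p (sharp_block_L1 j) (block_conv j)"
  unfolding is_Lp_extension_def
proof (intro conjI ballI allI)
  have bound: "block_conv j f \<in> Lp p" "cLp_norm p (block_conv j f) \<le> ennreal (block_const p) * cLp_norm p f" if f: "f \<in> Lp p" for f
  proof -
    obtain h where h: "borel_rep f h" and hm [measurable]: "h \<in> borel_measurable borel" and fin: "pmass p (\<lambda>x. cmod (h x)) < top" using LpE[OF f] by metis
    have r: "borel_rep (block_conv j f) (conv (shell_kernel j) h)" unfolding block_conv_rep[OF h] by (rule borel_rep_self) measurable
    note b = pmass_conv_shell_kernel[OF hm p fin, of j]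
    show "cLp_norm p (block_conv j f) \<le> ennreal (block_const p) * cLp_norm p f"
      using p block_const_pos[OF p] b by (subst cLp_norm_mono_rep[OF h r]) auto
    have "pmass p (\<lambda>x. cmod (conv (shell_kernel j) h x)) < top"
      using fin by (intro le_less_trans[OF b]) (simp add: ennreal_mult_less_top)
    then show "block_conv j f \<in> Lp p" by (simp add: Lp_rep[OF r])
  qed
  show "block_conv j f \<in> Lp p" if "f \<in> Lp p" for f by (rule bound(1)[OF that])
  show "\<exists>B\<ge>0. \<forall>f\<in>Lp p. cLp_norm p (block_conv j f) \<le> ennreal B * cLp_norm p f"
    using bound(2) block_const_pos[OF p] by (intro exI[of _ "block_const p"]) auto
  show "AE x in lebesgue. block_conv j (\<lambda>y. f y + g y) x = block_conv j f x + block_conv j g x" if fg: "f \<in> Lp p" "g \<in> Lp p" for f g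
  proof -
    obtain h where h: "borel_rep f h" "h \<in> borel_measurable borel" "pmass p (\<lambda>x. cmod (h x)) < top" using LpE[OF fg(1)] by metis
    obtain k where k: "borel_rep g k" "k \<in> borel_measurable borel" "pmass p (\<lambda>x. cmod (k x)) < top" using LpE[OF fg(2)] by metis
    show ?thesis unfolding block_conv_rep[OF borel_rep_add[OF h(1) k(1)]] block_conv_rep[OF h(1)] block_conv_rep[OF k(1)]
      by (intro AE_I2 conv_shell_kernel_linear[OF p h(2,3) k(2,3)])
  qed
  show "AE x in lebesgue. block_conv j (\<lambda>y. c * f y) x = c * block_conv j f x" if "f \<in> Lp p" for c f
    unfolding block_conv_def by (simp add: mult.left_commute)
  show "AE x in lebesgue. block_conv j f x = sharp_block_L1 j f x" if "f \<in> Lp 1 \<inter> Lp p" for f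
  proof -
    have "f \<in> Lp 1" using that by simp
    then obtain h where h: "borel_rep f h" "h \<in> borel_measurable borel" "pmass 1 (\<lambda>x. cmod (h x)) < top" by (rule LpE)
    show ?thesis unfolding block_conv_rep[OF h(1)] sharp_block_L1_rep[OF h(1) Lp1_integrable[OF h(2,3)]] by simp
  qed
qed

text \<open>Truncations lie in both L^1 and L^p, so T is known on them. The remainder tends to zero
  in L^p, where T and the convolution are both bounded, so the mass of their difference is
  zero.\<close>

lemma Lp_extension_unique:
  assumes p: "p > 1" and T: "is_Lp_extension p (sharp_block_L1 j) T" and f: "f \<in> Lp p"
  shows "AE x in lebesgue. T f x = block_conv j f x"
proof -
  from T obtain B where T1: "\<And>f. f \<in> Lp p \<Longrightarrow> T f \<in> Lp p"
    and Tadd: "\<And>f g. f \<in> Lp p \<Longrightarrow> g \<in> Lp p \<Longrightarrow> AE x in lebesgue. T (\<lambda>y. f y + g y) x = T f x + T g x"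
    and B: "B \<ge> 0" "\<And>f. f \<in> Lp p \<Longrightarrow> cLp_norm p (T f) \<le> ennreal B * cLp_norm p f"
    and Teq: "\<And>f. f \<in> Lp 1 \<inter> Lp p \<Longrightarrow> AE x in lebesgue. T f x = sharp_block_L1 j f x"
    unfolding is_Lp_extension_def by blast
  obtain h where h: "borel_rep f h" and hm [measurable]: "h \<in> borel_measurable borel" and hfin: "pmass p (\<lambda>x. cmod (h x)) < top" using LpE[OF f] by metis
  obtain a where a: "borel_rep (T f) a" and am [measurable]: "a \<in> borel_measurable borel" using LpE[OF T1[OF f]] by metis
  let ?D = "\<lambda>x. cmod (a x - conv (shell_kernel j) h x)"
  define K where "K = ennreal (2 powr p) * (ennreal (B powr p) + ennreal (block_const p powr p))"
  have key: "pmass p ?D \<le> K * pmass p (\<lambda>x. cmod (h x - trunc h n x))" for n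
  proof -
    define r where "r y = f y - trunc f n y" for y
    define s where "s y = h y - trunc h n y" for y
    have tb: "bsupp (trunc h n)" by (rule trunc_bsupp[OF hm])
    have tm [measurable]: "trunc h n \<in> borel_measurable borel" by (rule bsupp_measurable[OF tb])
    have tr: "borel_rep (trunc f n) (trunc h n)" by (rule borel_rep_trunc[OF h])
    have rs: "borel_rep r s" unfolding r_def[abs_def] s_def[abs_def] by (rule borel_rep_diff[OF h tr])
    have sm [measurable]: "s \<in> borel_measurable borel" unfolding s_def by measurable
    have tfin: "pmass q (\<lambda>x. cmod (trunc h n x)) < top" if "q > 0" for q
      by (subst pmass_pmass_real[OF bsupp_cmod[OF tb] that]) simp
    have sfin: "pmass p (\<lambda>x. cmod (s x)) < top"
      using p by (intro le_less_trans[OF pmass_mono hfin]) (auto simp: s_def trunc_le)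
    have rL: "r \<in> Lp p" and tL: "trunc f n \<in> Lp p" "trunc f n \<in> Lp 1"
      using sfin tfin p by (auto simp: Lp_rep[OF rs] Lp_rep[OF tr])
    obtain b where b: "borel_rep (T r) b" and bm [measurable]: "b \<in> borel_measurable borel" using LpE[OF T1[OF rL]] by metis
    \<comment> \<open>Splitting f into truncation and remainder lets additivity of T reach the value
      at f.\<close>
    have "(\<lambda>y. trunc f n y + r y) = f" by (auto simp: r_def)
    with Tadd[OF tL(1) rL] have 1: "AE x in lebesgue. T f x = T (trunc f n) x + T r x" by simp
    have "AE x in lebesgue. T (trunc f n) x = sharp_block_L1 j (trunc f n) x" using tL by (intro Teq) auto
    then have 2: "AE x in lebesgue. T (trunc f n) x = conv (shell_kernel j) (trunc h n) x"
      unfolding sharp_block_L1_rep[OF tr bsupp_integrable[OF tb]] .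
    have 3: "AE x in lebesgue. T f x = a x" "AE x in lebesgue. T r x = b x" using a b by (auto simp: borel_rep_def)
    have "conv (shell_kernel j) s x = conv (shell_kernel j) h x - conv (shell_kernel j) (trunc h n) x" for x
      unfolding s_def[abs_def] by (rule conv_shell_kernel_diff[OF hm hfin tm _ p]) (use tfin p in simp)
    with 1 2 3 have "AE x in lebesgue. a x - conv (shell_kernel j) h x = b x - conv (shell_kernel j) s x"
      by (auto elim!: eventually_elim2)
    then have "AE x in lborel. a x - conv (shell_kernel j) h x = b x - conv (shell_kernel j) s x" by (simp add: AE_completion_iff)
    then have "pmass p ?D = pmass p (\<lambda>x. cmod (b x - conv (shell_kernel j) s x))"
      unfolding pmass_def by (intro nn_integral_cong_AE) (auto elim: eventually_mono)
    also have "\<dots> \<le> pmass p (\<lambda>x. cmod (b x) + cmod (conv (shell_kernel j) s x))"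
      using p by (intro pmass_mono) (auto intro: norm_triangle_ineq4)
    also have "\<dots> \<le> ennreal (2 powr p) * (pmass p (\<lambda>x. cmod (b x)) + pmass p (\<lambda>x. cmod (conv (shell_kernel j) s x)))"
      using p by (intro pmass_add) auto
    also have "\<dots> \<le> ennreal (2 powr p) * (ennreal (B powr p) * pmass p (\<lambda>x. cmod (s x)) + ennreal (block_const p powr p) * pmass p (\<lambda>x. cmod (s x)))"
    proof (intro mult_left_mono add_mono)
      show "pmass p (\<lambda>x. cmod (b x)) \<le> ennreal (B powr p) * pmass p (\<lambda>x. cmod (s x))"
        using B(2)[OF rL] p B(1) by (subst (asm) cLp_norm_mono_rep[OF rs b]) auto
      show "pmass p (\<lambda>x. cmod (conv (shell_kernel j) s x)) \<le> ennreal (block_const p powr p) * pmass p (\<lambda>x. cmod (s x))"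
        by (rule pmass_conv_shell_kernel[OF sm p sfin])
    qed auto
    also have "\<dots> = K * pmass p (\<lambda>x. cmod (s x))" unfolding K_def by (simp add: distrib_right mult.assoc)
    finally show ?thesis by (simp add: s_def)
  qed
  have "(\<lambda>n. K * pmass p (\<lambda>x. cmod (h x - trunc h n x))) \<longlonglongrightarrow> K * 0"
    using p by (intro ennreal_tendsto_cmult pmass_trunc_diff hm hfin) (auto simp: K_def ennreal_mult_less_top)
  then have "pmass p ?D \<le> 0" by (intro LIMSEQ_le_const[of _ _ "pmass p ?D"]) (use key in auto)
  then have "AE x in lborel. ennreal (\<bar>?D x\<bar> powr p) = 0"
    unfolding pmass_def by (subst (asm) le_zero_eq, subst (asm) nn_integral_0_iff_AE) auto
  then have "AE x in lborel. a x = conv (shell_kernel j) h x" by eventually_elim simp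
  then have "AE x in lebesgue. a x = conv (shell_kernel j) h x" by (rule AE_completion)
  moreover have "AE x in lebesgue. T f x = a x" using a by (simp add: borel_rep_def)
  ultimately show ?thesis unfolding block_conv_rep[OF h] by eventually_elim simp
qed

lemma sharp_block_rep:
  assumes p: "p > 1" and f: "f \<in> Lp p" and h: "borel_rep f h"
  shows "AE x in lebesgue. sharp_block p j f x = conv (shell_kernel j) h x"
proof -
  have "is_Lp_extension p (sharp_block_L1 j) (sharp_block p j)"
    unfolding sharp_block_def by (rule someI[of _ "block_conv j"]) (rule block_conv_extension[OF p])
  from Lp_extension_unique[OF p this f] show ?thesis unfolding block_conv_rep[OF h] .
qed

section \<open>From finite square functions to the full one\<close>

lemma infsum_int_SUP:
  fixes X :: "int \<Rightarrow> ennreal"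
  shows "(\<Sum>\<^sub>\<infinity>j\<in>UNIV. X j) = (SUP n::nat. \<Sum>j\<in>{- int n..int n}. X j)"
proof -
  have "(\<Sum>\<^sub>\<infinity>j\<in>UNIV. X j) = (SUP F\<in>{F. finite F \<and> F \<subseteq> UNIV}. sum X F)"
    by (rule nonneg_infsum_complete) simp
  also have "\<dots> = (SUP n::nat. \<Sum>j\<in>{- int n..int n}. X j)"
  proof (rule antisym)
    show "(SUP F\<in>{F. finite F \<and> F \<subseteq> UNIV}. sum X F) \<le> (SUP n::nat. \<Sum>j\<in>{- int n..int n}. X j)"
    proof (rule SUP_least)
      fix F :: "int set" assume "F \<in> {F. finite F \<and> F \<subseteq> UNIV}"
      then have F: "finite F" by simp
      then have "bdd_above ((\<lambda>j. nat \<bar>j\<bar>) ` F)" by simp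
      then obtain n where "\<And>j. j \<in> F \<Longrightarrow> nat \<bar>j\<bar> \<le> n" unfolding bdd_above_def by auto
      then have "F \<subseteq> {- int n..int n}" by force
      then have "sum X F \<le> (\<Sum>j\<in>{- int n..int n}. X j)" by (intro sum_mono2) auto
      also have "\<dots> \<le> (SUP n::nat. \<Sum>j\<in>{- int n..int n}. X j)" by (rule SUP_upper) simp
      finally show "sum X F \<le> (SUP n::nat. \<Sum>j\<in>{- int n..int n}. X j)" .
    qed
    show "(SUP n::nat. \<Sum>j\<in>{- int n..int n}. X j) \<le> (SUP F\<in>{F. finite F \<and> F \<subseteq> UNIV}. sum X F)"
      by (intro SUP_least SUP_upper) auto
  qed
  finally show ?thesis .
qed

text \<open>Monotone convergence along symmetric windows of indices, with the root and the p-th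
  power moved through the supremum.\<close>

lemma square_norm:
  assumes p: "p > 1" and u [measurable]: "\<And>j::int. u j \<in> borel_measurable borel"
  shows "Lp_norm p (\<lambda>x. ennpowr (\<Sum>\<^sub>\<infinity>j\<in>UNIV. ennreal ((cmod (u j x))\<^sup>2)) (1/2))
    = ennpowr (SUP n::nat. pmass p (\<lambda>x. L2_set (\<lambda>j. cmod (u j x)) {- int n..int n})) (1 / p)"
proof -
  let ?N = "\<lambda>n x. L2_set (\<lambda>j. cmod (u j x)) {- int n..int n}"
  have 1: "ennpowr (ennpowr (\<Sum>\<^sub>\<infinity>j\<in>UNIV. ennreal ((cmod (u j x))\<^sup>2)) (1/2)) p = (SUP n::nat. ennreal (\<bar>?N n x\<bar> powr p))" for x
  proof -
    have e: "ennpowr (\<Sum>j\<in>{- int n..int n}. ennreal ((cmod (u j x))\<^sup>2)) (1/2) = ennreal (?N n x)" for n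
      by (simp add: ennpowr_ennreal sum_nonneg L2_set_def powr_half_sqrt)
    have "(1 / 2 :: real) > 0" "p > 0" using p by auto
    note SUP = this[THEN ennpowr_SUP, OF UNIV_not_empty]
    show ?thesis unfolding infsum_int_SUP SUP e by (simp add: ennpowr_ennreal)
  qed
  have "(\<integral>\<^sup>+x. ennpowr (ennpowr (\<Sum>\<^sub>\<infinity>j\<in>UNIV. ennreal ((cmod (u j x))\<^sup>2)) (1/2)) p \<partial>lebesgue) = (\<integral>\<^sup>+x. (SUP n::nat. ennreal (\<bar>?N n x\<bar> powr p)) \<partial>lborel)"
    unfolding 1 by (rule nn_integral_completion)
  also have "\<dots> = (SUP n::nat. pmass p (?N n))"
    unfolding pmass_def
  proof (rule nn_integral_monotone_convergence_SUP)
    show "incseq (\<lambda>n x. ennreal (\<bar>?N n x\<bar> powr p))"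
    proof (intro incseq_SucI le_funI ennreal_leI)
      fix n x
      have "?N n x \<le> ?N (Suc n) x" unfolding L2_set_def by (intro real_sqrt_le_mono sum_mono2) auto
      then show "\<bar>?N n x\<bar> powr p \<le> \<bar>?N (Suc n) x\<bar> powr p" using p by (intro powr_mono2) auto
    qed
  qed measurable
  finally show ?thesis unfolding Lp_norm_def by simp
qed

theorem theorem4p4:
  fixes \<alpha> :: real
  assumes "\<And>k::int. \<alpha> \<noteq> of_int k * pi"
  shows "\<exists>C>0. \<forall>p>1. \<forall>f\<in>Lp p.
           ennreal (1 / (C * (p + 1 / (p - 1))\<^sup>2)) * cLp_norm p f
             \<le> Lp_norm p (frac_square_function p \<alpha> f) \<and>
           Lp_norm p (frac_square_function p \<alpha> f)
             \<le> ennreal (C * (p + 1 / (p - 1))\<^sup>2) * cLp_norm p f"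
proof (intro exI[of _ "2 * base_const"] conjI allI impI ballI)
  \<comment> \<open>The factor 2 serves the lower bound; it is the one lost there in passing from
    truncations to f.\<close>
  show "2 * base_const > 0" using inv_symbol_var_pos by (simp add: base_const_def)
  fix p :: real and f assume p: "p > 1" and f: "f \<in> Lp p"
  define L where "L = 2 * base_const * (p + 1 / (p - 1))\<^sup>2"
  have LC: "L = 2 * block_const p" by (simp add: L_def block_const_def)
  have L: "L > 0" using block_const_pos[OF p] by (simp add: LC)
  have "(\<lambda>x. exp (\<i> * of_real (pi * x\<^sup>2 * cot \<alpha>))) \<in> borel_measurable lborel" by measurable
  then have m [measurable]: "(\<lambda>x. exp (\<i> * of_real (pi * x\<^sup>2 * cot \<alpha>))) \<in> borel_measurable lebesgue" by (rule measurable_completion)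
  have [measurable]: "f \<in> borel_measurable lebesgue" using f by (simp add: Lp_def)
  have cm: "chirp_mult \<alpha> f \<in> borel_measurable lebesgue" unfolding chirp_mult_def[abs_def] by measurable
  have eqn: "cLp_norm p (chirp_mult \<alpha> f) = cLp_norm p f" by (simp add: chirp_mult_def norm_mult)
  have F: "chirp_mult \<alpha> f \<in> Lp p" using f cm eqn by (simp add: Lp_def)
  obtain h where h: "borel_rep (chirp_mult \<alpha> f) h" and hm [measurable]: "h \<in> borel_measurable borel" and fin: "pmass p (\<lambda>x. cmod (h x)) < top" using LpE[OF F] by metis
  define c where "c = (SUP n::nat. pmass p (\<lambda>x. L2_set (\<lambda>j. cmod (conv (shell_kernel j) h x)) {- int n..int n}))"
  \<comment> \<open>The countably many exceptional sets, one for each j, are merged before the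
    square function is formed.\<close>
  have "AE x in lebesgue. \<forall>j. sharp_block p j (chirp_mult \<alpha> f) x = conv (shell_kernel j) h x"
    unfolding AE_all_countable using sharp_block_rep[OF p F h] by blast
  then have ae: "AE x in lebesgue. frac_square_function p \<alpha> f x = ennpowr (\<Sum>\<^sub>\<infinity>j\<in>UNIV. ennreal ((cmod (conv (shell_kernel j) h x))\<^sup>2)) (1/2)"
  proof eventually_elim
    case (elim x)
    \<comment> \<open>The outer chirp is unimodular too, so it disappears in the moduli inside the
      square function.\<close>
    have "cmod (exp (- \<i> * of_real t)) = 1" for t by (simp add: norm_exp_eq_Re)
    then have "cmod (frac_sharp_block p \<alpha> j f x) = cmod (conv (shell_kernel j) h x)" for j
      unfolding frac_sharp_block_def chirp_mult_inv_def using elim by (simp add: norm_mult)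
    then show ?case unfolding frac_square_function_def by simp
  qed
  have "Lp_norm p (frac_square_function p \<alpha> f) = Lp_norm p (\<lambda>x. ennpowr (\<Sum>\<^sub>\<infinity>j\<in>UNIV. ennreal ((cmod (conv (shell_kernel j) h x))\<^sup>2)) (1/2))"
    unfolding Lp_norm_def using ae by (intro arg_cong2[of _ _ _ _ ennpowr] nn_integral_cong_AE) (auto elim: eventually_mono)
  also have "\<dots> = ennpowr c (1 / p)" unfolding c_def by (rule square_norm[OF p]) measurable
  finally have S: "Lp_norm p (frac_square_function p \<alpha> f) = ennpowr c (1 / p)" .
  have N: "cLp_norm p f = ennpowr (pmass p (\<lambda>x. cmod (h x))) (1 / p)" unfolding eqn[symmetric] by (rule cLp_norm_rep[OF h])
  have each: "pmass p (\<lambda>x. L2_set (\<lambda>j. cmod (conv (shell_kernel j) h x)) {- int n..int n}) \<le> ennreal (block_const p powr p) * pmass p (\<lambda>x. cmod (h x))" for n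
    unfolding block_const_def by (rule block_upper_Lp[OF _ hm p fin]) simp
  then have up: "c \<le> ennreal (block_const p powr p) * pmass p (\<lambda>x. cmod (h x))" unfolding c_def by (rule SUP_least)
  have root: "ennpowr (ennreal (A powr p) * x) (1 / p) = ennreal A * ennpowr x (1 / p)" if "A > 0" for A x
    using p that by (simp add: ennpowr_cmult powr_powr)
  have "ennpowr c (1 / p) \<le> ennreal (block_const p) * cLp_norm p f"
    using ennpowr_mono[OF up, of "1/p"] p unfolding root[OF block_const_pos[OF p]] N by simp
  also have "\<dots> \<le> ennreal L * cLp_norm p f"
    using block_const_pos[OF p] unfolding LC by (intro mult_right_mono ennreal_leI) auto
  finally show "Lp_norm p (frac_square_function p \<alpha> f) \<le> ennreal (2 * base_const * (p + 1 / (p - 1))\<^sup>2) * cLp_norm p f"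
    unfolding S L_def .
  \<comment> \<open>The upper bound supplies the finiteness that the lower one presupposes.\<close>
  have "c < top" using fin by (intro le_less_trans[OF up]) (simp add: ennreal_mult_less_top)
  then have "pmass p (\<lambda>x. cmod (h x)) \<le> ennreal (L powr p) * c"
    unfolding L_def by (intro block_lower_Lp[OF hm p fin]) (auto simp: c_def intro: SUP_upper)
  from ennpowr_mono[OF this, of "1/p"] have lo: "cLp_norm p f \<le> ennreal L * ennpowr c (1 / p)"
    using p unfolding root[OF L] N by simp
  have "ennreal (1 / L) * cLp_norm p f \<le> ennreal (1 / L) * (ennreal L * ennpowr c (1 / p))"
    by (intro mult_left_mono lo) simp
  also have "\<dots> = ennpowr c (1 / p)"
    using L by (simp add: mult.assoc[symmetric] flip: ennreal_mult)
  finally show "ennreal (1 / (2 * base_const * (p + 1 / (p - 1))\<^sup>2)) * cLp_norm p f \<le> Lp_norm p (frac_square_function p \<alpha> f)"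
    unfolding S L_def .
qed

end
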